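(* Let $n\ge 2$ be an integer, $\mu>0$, $\beta>2$ and $p=p_S(n)$. Let $f\in H^1(\mathbf{R}^n)$ and $g\in L^2(\mathbf{R}^n)$ both be non-negative and not vanish identically, with $\mathrm{supp}\, f,\ \mathrm{supp}\, g\subset\{x:|x|\le 1\}$. Then there exist a constant $\varepsilon_0=\varepsilon_0(f,g,n,p,\mu,\beta)>0$ and a constant $C>0$ independent of $\varepsilon$ such that the following holds. For every $0<\varepsilon\le\varepsilon_0$, if $u$ is an energy solution on $[0,T)$ of $$u_{tt}-\Delta u+\frac{\mu}{(1+|x|)^\beta}u_t=|u|^p,\qquad u(0,x)=\varepsilon f(x),\quad u_t(0,x)=\varepsilon g(x),$$ satisfying $$\mathrm{supp}\, u\subset\{(x,t)\in\mathbf{R}^n\times[0,T):|x|\le t+1\},$$ then $$T\le\exp\left(C\varepsilon^{-p(p-1)}\right).$$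
   Context: For $n\ge2$, the Strauss exponent $p_S(n)$ is the positive root $p$ of $\gamma(p,n):=2+(n+1)p-(n-1)p^2=0$, i.e. $p_S(n)=\frac{n+1+\sqrt{n^2+10n-7}}{2(n-1)}$. Energy solution: $u$ is an energy solution on $[0,T)$ of the Cauchy problem $u_{tt}-\Delta u+\frac{\mu}{(1+|x|)^\beta}u_t=|u|^p$ in $[0,T)\times\mathbf{R}^n$, $u(0,x)=\varepsilon f(x)$, $u_t(0,x)=\varepsilon g(x)$, if $$u\in C([0,T),H^1(\mathbf{R}^n))\cap C^1([0,T),L^2(\mathbf{R}^n))\cap L^p_{\rm loc}(\mathbf{R}^n\times(0,T))$$ satisfies $u(0,x)=\varepsilon f(x)$, $u_t(0,x)=\varepsilon g(x)$ and $$\varepsilon\int_{\mathbf{R}^n}g(x)\Psi(0,x)\,dx+\varepsilon\int_{\mathbf{R}^n}\frac{\mu}{(1+|x|)^\beta}f(x)\Psi(0,x)\,dx+\int_0^T\!\int_{\mathbf{R}^n}|u|^p\Psi\,dx\,dt$$ $$=-\int_0^T\!\int_{\mathbf{R}^n}u_t\Psi_t\,dx\,dt+\int_0^T\!\int_{\mathbf{R}^n}\nabla u\cdot\nabla\Psi\,dx\,dt-\int_0^T\!\int_{\mathbf{R}^n}\frac{\mu}{(1+|x|)^\beta}u\,\Psi_t\,dx\,dt$$ for every $\Psi\in C_0^\infty([0,T)\times\mathbf{R}^n)$ (all integrals being understood as convergent). *)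

theory Defs
  imports "HOL-Analysis.Analysis"
begin

section \<open>The Strauss exponent\<close>

definition strauss_gamma :: "real \<Rightarrow> nat \<Rightarrow> real" where
  "strauss_gamma p n = 2 + (real n + 1) * p - (real n - 1) * p\<^sup>2"

definition strauss_exponent :: "nat \<Rightarrow> real" where
  "strauss_exponent n = (THE p. 0 < p \<and> strauss_gamma p n = 0)"

lemma strauss_exponent_eq:
  assumes "2 \<le> n"
  shows "strauss_exponent n =
    (real n + 1 + sqrt ((real n)\<^sup>2 + 10 * real n - 7)) / (2 * (real n - 1))"
proof -
  define m where "m = real n"
  define D where "D = m\<^sup>2 + 10 * m - 7"
  define s where "s = sqrt D"
  have m: "2 \<le> m" using assms by (simp add: m_def)
  have Dgt: "(m + 1)\<^sup>2 < D"
    using m by (simp add: D_def power2_eq_square algebra_simps)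
  then have "0 \<le> D" by (smt (verit) zero_le_power2)
  then have s2: "s\<^sup>2 = D" by (simp add: s_def)
  have sgt: "m + 1 < s"
    unfolding s_def using Dgt by (rule real_less_rsqrt)
  have root: "strauss_gamma p n = 0 \<longleftrightarrow> (2 * (m - 1) * p - (m + 1))\<^sup>2 = s\<^sup>2" for p
  proof -
    have "(2 * (m - 1) * p - (m + 1))\<^sup>2 - s\<^sup>2 = - 4 * (m - 1) * strauss_gamma p n"
      unfolding s2 D_def strauss_gamma_def m_def[symmetric]
      by (simp add: power2_eq_square algebra_simps)
    then show ?thesis using m by auto
  qed
  have "0 < p \<and> strauss_gamma p n = 0 \<longleftrightarrow> p = (m + 1 + s) / (2 * (m - 1))" for p
  proof
    assume p: "0 < p \<and> strauss_gamma p n = 0"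
    then have "2 * (m - 1) * p - (m + 1) = s \<or> 2 * (m - 1) * p - (m + 1) = - s"
      using root power2_eq_iff by blast
    moreover have "0 < 2 * (m - 1) * p" using p m by simp
    ultimately have "2 * (m - 1) * p = m + 1 + s" using sgt by linarith
    then show "p = (m + 1 + s) / (2 * (m - 1))" using m by (simp add: field_simps)
  next
    assume p: "p = (m + 1 + s) / (2 * (m - 1))"
    then have "2 * (m - 1) * p - (m + 1) = s" using m by (simp add: field_simps)
    moreover have "0 < p" using p m sgt by simp
    ultimately show "0 < p \<and> strauss_gamma p n = 0" using root by simp
  qed
  then show ?thesis
    unfolding strauss_exponent_def by (simp add: s_def D_def m_def)
qed

section \<open>Test functions\<close>

primrec Ck :: "nat \<Rightarrow> ('a::euclidean_space \<Rightarrow> real) \<Rightarrow> bool" where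
  "Ck 0 \<phi> \<longleftrightarrow> continuous_on UNIV \<phi>"
| "Ck (Suc k) \<phi> \<longleftrightarrow>
     (\<forall>x. \<phi> differentiable (at x)) \<and>
     (\<forall>b\<in>Basis. Ck k (\<lambda>x. frechet_derivative \<phi> (at x) b))"

text \<open>
  Smooth functions on the whole space whose compact support lies in \<open>\<Omega>\<close>.
  With \<open>\<Omega> = {..<T} \<times> UNIV\<close>, their restrictions to times \<open>t \<ge> 0\<close> are the test functions in
  $C_0^\infty([0,T)\times\mathbf{R}^n)$, which need not vanish at \<open>t = 0\<close>.
\<close>

definition test_function :: "'a::euclidean_space set \<Rightarrow> ('a \<Rightarrow> real) \<Rightarrow> bool" where
  "test_function \<Omega> \<phi> \<longleftrightarrow>
     (\<forall>k. Ck k \<phi>) \<and> compact (closure {x. \<phi> x \<noteq> 0}) \<and> closure {x. \<phi> x \<noteq> 0} \<subseteq> \<Omega>"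

definition grad :: "(real^'n \<Rightarrow> real) \<Rightarrow> real^'n \<Rightarrow> real^'n" where
  "grad \<phi> x = (\<chi> i. frechet_derivative \<phi> (at x) (axis i 1))"

section \<open>Function spaces\<close>

text \<open>
  Elements of Lebesgue and Sobolev spaces are represented by Borel functions; all notions below
  are invariant under changes on null sets.
\<close>

definition L2 :: "('a::euclidean_space \<Rightarrow> 'b::euclidean_space) \<Rightarrow> bool" where
  "L2 f \<longleftrightarrow> f \<in> borel_measurable borel \<and> integrable lborel (\<lambda>x. (norm (f x))\<^sup>2)"

definition L2norm :: "('a::euclidean_space \<Rightarrow> 'b::euclidean_space) \<Rightarrow> real" where
  "L2norm f = sqrt (LINT x|lborel. (norm (f x))\<^sup>2)"

definition Lp_loc :: "real \<Rightarrow> 'a::euclidean_space set \<Rightarrow> ('a \<Rightarrow> real) \<Rightarrow> bool" where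
  "Lp_loc p \<Omega> f \<longleftrightarrow>
     set_borel_measurable lborel \<Omega> f \<and>
     (\<forall>K. compact K \<and> K \<subseteq> \<Omega> \<longrightarrow> set_integrable lborel K (\<lambda>x. \<bar>f x\<bar> powr p))"

definition is_weak_grad :: "(real^'n \<Rightarrow> real) \<Rightarrow> (real^'n \<Rightarrow> real^'n) \<Rightarrow> bool" where
  "is_weak_grad f G \<longleftrightarrow>
     (\<forall>\<phi> i. test_function UNIV \<phi> \<longrightarrow>
        (LINT x|lborel. f x * grad \<phi> x $ i) = - (LINT x|lborel. G x $ i * \<phi> x))"

definition H1 :: "(real^'n \<Rightarrow> real) \<Rightarrow> bool" where
  "H1 f \<longleftrightarrow> L2 f \<and> (\<exists>G. L2 G \<and> is_weak_grad f G)"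

text \<open>For \<open>f\<close> in \<open>H1\<close> the weak gradient is unique up to null sets, so that any choice will do.\<close>

definition weak_grad :: "(real^'n \<Rightarrow> real) \<Rightarrow> real^'n \<Rightarrow> real^'n" where
  "weak_grad f = (SOME G. L2 G \<and> is_weak_grad f G)"

definition H1norm :: "(real^'n \<Rightarrow> real) \<Rightarrow> real" where
  "H1norm f = sqrt ((L2norm f)\<^sup>2 + (L2norm (weak_grad f))\<^sup>2)"

definition ess_supp :: "'a::euclidean_space set \<Rightarrow> ('a \<Rightarrow> real) \<Rightarrow> 'a set" where
  "ess_supp S f =
     {x\<in>S. \<forall>U. open U \<and> x \<in> U \<longrightarrow> \<not> (AE y in lborel. y \<in> U \<inter> S \<longrightarrow> f y = 0)}"

section \<open>Curves in function spaces on \<open>[0,T)\<close>\<close>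

definition C_H1 :: "real \<Rightarrow> (real \<Rightarrow> real^'n \<Rightarrow> real) \<Rightarrow> bool" where
  "C_H1 T u \<longleftrightarrow>
     (\<forall>t\<in>{0..<T}. H1 (u t) \<and>
        ((\<lambda>s. H1norm (\<lambda>x. u s x - u t x)) \<longlongrightarrow> 0) (at t within {0..<T}))"

definition C_L2 :: "real \<Rightarrow> (real \<Rightarrow> real^'n \<Rightarrow> real) \<Rightarrow> bool" where
  "C_L2 T u \<longleftrightarrow>
     (\<forall>t\<in>{0..<T}. L2 (u t) \<and>
        ((\<lambda>s. L2norm (\<lambda>x. u s x - u t x)) \<longlongrightarrow> 0) (at t within {0..<T}))"

text \<open>\<open>u\<close> is continuously differentiable with values in \<open>L2\<close>, with derivative \<open>v\<close>.\<close>

definition C1_L2 :: "real \<Rightarrow> (real \<Rightarrow> real^'n \<Rightarrow> real) \<Rightarrow> (real \<Rightarrow> real^'n \<Rightarrow> real) \<Rightarrow> bool" where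
  "C1_L2 T u v \<longleftrightarrow>
     C_L2 T u \<and> C_L2 T v \<and>
     (\<forall>t\<in>{0..<T}.
        ((\<lambda>s. L2norm (\<lambda>x. (u s x - u t x) / (s - t) - v t x)) \<longlongrightarrow> 0) (at t within {0..<T}))"

section \<open>Energy solutions\<close>

definition st_integral :: "real \<Rightarrow> (real \<Rightarrow> real^'n \<Rightarrow> real) \<Rightarrow> real" where
  "st_integral T h = (LINT t:{0..<T}|lborel. LINT x|lborel. h t x)"

definition st_convergent :: "real \<Rightarrow> (real \<Rightarrow> real^'n \<Rightarrow> real) \<Rightarrow> bool" where
  "st_convergent T h \<longleftrightarrow>
     (AE t in lborel. t \<in> {0..<T} \<longrightarrow> integrable lborel (h t)) \<and>
     set_integrable lborel {0..<T} (\<lambda>t. LINT x|lborel. h t x)"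

definition damping :: "real \<Rightarrow> real \<Rightarrow> real^'n \<Rightarrow> real" where
  "damping \<mu> \<beta> x = \<mu> / (1 + norm x) powr \<beta>"

definition energy_solution ::
  "real \<Rightarrow> real \<Rightarrow> real \<Rightarrow> real \<Rightarrow> (real^'n \<Rightarrow> real) \<Rightarrow> (real^'n \<Rightarrow> real) \<Rightarrow> real
    \<Rightarrow> (real \<Rightarrow> real^'n \<Rightarrow> real) \<Rightarrow> bool" where
  "energy_solution \<mu> \<beta> p \<epsilon> f g T u \<longleftrightarrow>
     0 < T \<and>
     C_H1 T u \<and>
     Lp_loc p ({0<..<T} \<times> UNIV) (\<lambda>(t, x). u t x) \<and>
     (\<exists>u'. C1_L2 T u u' \<and>
        (AE x in lborel. u 0 x = \<epsilon> * f x) \<and>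
        (AE x in lborel. u' 0 x = \<epsilon> * g x) \<and>
        (\<forall>\<Psi>. test_function ({..<T} \<times> UNIV) \<Psi> \<longrightarrow>
           integrable lborel (\<lambda>x. g x * \<Psi> (0, x)) \<and>
           integrable lborel (\<lambda>x. damping \<mu> \<beta> x * f x * \<Psi> (0, x)) \<and>
           st_convergent T (\<lambda>t x. \<bar>u t x\<bar> powr p * \<Psi> (t, x)) \<and>
           st_convergent T (\<lambda>t x. u' t x * deriv (\<lambda>s. \<Psi> (s, x)) t) \<and>
           st_convergent T (\<lambda>t x. weak_grad (u t) x \<bullet> grad (\<lambda>y. \<Psi> (t, y)) x) \<and>
           st_convergent T (\<lambda>t x. damping \<mu> \<beta> x * u t x * deriv (\<lambda>s. \<Psi> (s, x)) t) \<and>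
           \<epsilon> * (LINT x|lborel. g x * \<Psi> (0, x))
             + \<epsilon> * (LINT x|lborel. damping \<mu> \<beta> x * f x * \<Psi> (0, x))
             + st_integral T (\<lambda>t x. \<bar>u t x\<bar> powr p * \<Psi> (t, x))
           = - st_integral T (\<lambda>t x. u' t x * deriv (\<lambda>s. \<Psi> (s, x)) t)
             + st_integral T (\<lambda>t x. weak_grad (u t) x \<bullet> grad (\<lambda>y. \<Psi> (t, y)) x)
             - st_integral T (\<lambda>t x. damping \<mu> \<beta> x * u t x * deriv (\<lambda>s. \<Psi> (s, x)) t)))"

end

theory Submission
  imports Defs "HOL-Real_Asymp.Real_Asymp"
begin

text \<open>
  Put $k = (n-1)/2$, $b = k - 1/p$, $p' = p/(p-1)$ and let $\eta_R(t) = \eta(t/R)$ be a temporal cutoff. Testing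
  with $\eta_R e^{-t}\phi$, where $\Delta\phi = (1+a)\phi$ and $a$ is the damping coefficient, gives
  $\int |u|^p \eta_R \ge c\,\varepsilon^p R^{n-kp}$ over $R/2 \le t \le R$; at the Strauss exponent $n - kp = b$.
  Testing with $\eta_R\Phi$, where $\Phi \sim (t+t_0)^{-b}$ is a self-similar solution of the free wave equation,
  bounds $X_R = \int |u|^p (t+t_0)^{-b}\eta_R$ by $C (\ln R)^{1/p'} B_R^{1/p}$, where $B_R$ is the part of $X_R$
  over $R/2 \le t \le R$, plus an error due to the damping. The error is absorbed by choosing $t_0$ a large
  negative power of $\varepsilon$. This costs nothing, since it only affects times polynomial in $1/\varepsilon$.
  As $\int^\tau B_{e^\sigma}\,d\sigma \le (\ln 2) X_{e^\tau}$, the function $y(\tau) = \int^\tau B_{e^\sigma}\,d\sigma$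
  satisfies $y' \ge c\,\tau^{1-p} y^p$ and $y' \ge c\,\varepsilon^p$, which forces blow-up by
  $\tau \sim \varepsilon^{-p(p-1)}$.
\<close>

section \<open>Smooth functions and mollifiers\<close>

text \<open>With \<psi> = e^(-t) \<phi>, the relation for \<phi> says exactly that \<psi>_tt -
  Laplacian \<psi> - a \<psi>_t = 0: the adjoint equation, damping included, so only cutoff
  derivatives survive. For \<Phi> no damped analogue is used, which leaves the error a \<Phi>_t. The
  exponent b is tuned so that, with s = t + t0 and r = |x|, s^b \<Phi> stays bounded up to r = s,
  while \<Phi>_t is bounded by a multiple of s^(-k) (s - r)^(-1/p'). The p'-th power of this is of
  order 1/(s - r), borderline non-integrable, and that is the source of the logarithm; the Strauss
  relation cancels all powers of R around it. Admissible test functions are smooth with compact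
  support; the ones wanted are only twice differentiable along coordinate lines, unbounded in space,
  and \<Phi> is an infinite series. Hence mollification, a spatial cutoff hidden by the cone support
  of u, and partial sums of \<Phi> whose limit is taken only in the final inequality. The local L^p
  condition says nothing near t = 0; integrability of |u|^p up to the initial time comes from the
  weak equation itself.\<close>

lemma Ck_SucI:
  assumes "\<And>x. (f has_derivative D x) (at x)" "\<And>b. b \<in> Basis \<Longrightarrow> Ck k (\<lambda>x. D x b)"
  shows "Ck (Suc k) f"
proof -
  have "frechet_derivative f (at x) = D x" for x
    using frechet_derivative_at[OF assms(1)] by metis
  then show ?thesis using assms by (auto simp: differentiable_def)
qed

lemma Ck_SucD:
  assumes "Ck (Suc k) f"
  shows "(f has_derivative frechet_derivative f (at x)) (at x)"
    "b \<in> Basis \<Longrightarrow> Ck k (\<lambda>x. frechet_derivative f (at x) b)"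
  using assms by (auto simp: frechet_derivative_works)

lemma Ck_lower: "Ck (Suc k) f \<Longrightarrow> Ck k f"
proof (induction k arbitrary: f)
  case 0
  then show ?case
    by (auto intro!: continuous_at_imp_continuous_on differentiable_imp_continuous_within)
next
  case (Suc k)
  then show ?case by auto
qed

lemma Ck_le: "Ck k f \<Longrightarrow> j \<le> k \<Longrightarrow> Ck j f"
  by (induction k) (auto simp: le_Suc_eq intro: Ck_lower simp del: Ck.simps)

lemma Ck_continuous: "Ck k f \<Longrightarrow> continuous_on UNIV f"
  using Ck_le[of k f 0] by simp

lemma Ck_const: "Ck k (\<lambda>x. c)"
  by (induction k arbitrary: c) (auto simp: frechet_derivative_const)

lemma Ck_bounded_linear: "bounded_linear f \<Longrightarrow> Ck k f"
  by (cases k) (auto intro!: Ck_SucI[where D="\<lambda>_. f"] bounded_linear_imp_has_derivative Ck_const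
      linear_continuous_on simp del: Ck.simps(2))

lemma Ck_add: "Ck k f \<Longrightarrow> Ck k g \<Longrightarrow> Ck k (\<lambda>x. f x + g x)"
proof (induction k arbitrary: f g)
  case 0
  then show ?case by (auto intro: continuous_intros)
next
  case (Suc k)
  show ?case
    by (rule Ck_SucI[OF has_derivative_add[OF Ck_SucD(1)[OF Suc.prems(1)] Ck_SucD(1)[OF Suc.prems(2)]]])
      (intro Suc.IH Ck_SucD(2)[OF Suc.prems(1)] Ck_SucD(2)[OF Suc.prems(2)])
qed

lemma Ck_mult:
  "Ck k f \<Longrightarrow> Ck k g \<Longrightarrow> Ck k (\<lambda>x. f x * g x)"
proof (induction k arbitrary: f g)
  case 0
  then show ?case by (auto intro: continuous_intros)
next
  case (Suc k)
  show ?case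
    by (rule Ck_SucI[OF has_derivative_mult[OF Ck_SucD(1)[OF Suc.prems(1)] Ck_SucD(1)[OF Suc.prems(2)]]])
      (intro Ck_add Suc.IH Ck_SucD(2)[OF Suc.prems(1)] Ck_SucD(2)[OF Suc.prems(2)] Ck_lower[OF Suc.prems(1)]
        Ck_lower[OF Suc.prems(2)])
qed

lemma Ck_norm2:
  fixes a :: "'a::euclidean_space"
  shows "Ck k (\<lambda>x. c + d * ((x - a) \<bullet> (x - a)))"
proof (cases k)
  case 0
  then show ?thesis by (auto intro!: continuous_intros)
next
  case (Suc j)
  have "Ck j (\<lambda>x. 2 * d * (x \<bullet> b) + - 2 * d * (a \<bullet> b))" for b
    by (intro Ck_add Ck_const Ck_bounded_linear bounded_linear_const_mult bounded_linear_inner_left)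
  then show ?thesis unfolding Suc
    by (intro Ck_SucI[where D="\<lambda>x h. 2 * d * (x \<bullet> h) + - 2 * d * (a \<bullet> h)"])
      (auto intro!: derivative_eq_intros simp: algebra_simps inner_commute)
qed

text \<open>The chain rule turns a claim about \<open>H m\<close> into one about
  \<open>H (Suc m)\<close>, so the induction runs over a whole tower of successive derivatives, with
  \<open>m\<close> arbitrary.\<close>

lemma Ck_comp:
  fixes H :: "nat \<Rightarrow> real \<Rightarrow> real"
  assumes H: "\<And>m s. (H m has_real_derivative H (Suc m) s) (at s)" and q: "\<And>k. Ck k q"
  shows "Ck k (\<lambda>x. H m (q x))"
proof (induction k arbitrary: m)
  case 0
  have "continuous_on UNIV (H m)" for m
    by (meson H DERIV_continuous continuous_at_imp_continuous_on)
  then show ?case using Ck_continuous[OF q[of 0]]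
    by (auto intro: continuous_on_compose2)
next
  case (Suc k)
  have "((\<lambda>x. H m (q x)) has_derivative (\<lambda>h. H (Suc m) (q x) * frechet_derivative q (at x) h)) (at x)" for x
    using has_derivative_compose[OF Ck_SucD(1)[OF q[of 1, simplified One_nat_def]] H[unfolded has_field_derivative_def]] by simp
  then show ?case
    by (rule Ck_SucI) (intro Ck_mult Suc.IH Ck_SucD(2)[OF q])
qed

text \<open>The $m$-th derivative of $e^{-1/s}$ is $P_m(1/s)e^{-1/s}$ with $P_{m+1} = X^2(P_m - P_m')$.\<close>

primrec flat_poly :: "nat \<Rightarrow> real poly" where
  "flat_poly 0 = 1"
| "flat_poly (Suc m) = [:0, 0, 1:] * (flat_poly m - pderiv (flat_poly m))"

definition flat :: "nat \<Rightarrow> real \<Rightarrow> real" where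
  "flat m s = (if s \<le> 0 then 0 else poly (flat_poly m) (1 / s) * exp (- 1 / s))"

lemma poly_times_exp_neg_tendsto_0:
  fixes P :: "real poly"
  shows "((\<lambda>y. poly P y * exp (- y)) \<longlongrightarrow> 0) at_top"
proof (induction P)
  case 0
  then show ?case by simp
next
  case (pCons a P)
  have 1: "((\<lambda>y::real. y ^ k / exp y) \<longlongrightarrow> 0) at_top" for k
    by (rule tendsto_power_div_exp_0)
  have "((\<lambda>y. poly (pCons 0 P) y * exp (- y)) \<longlongrightarrow> 0) at_top"
  proof -
    have "((\<lambda>y. \<Sum>i\<le>degree (pCons 0 P). coeff (pCons 0 P) i * (y ^ i / exp y)) \<longlongrightarrow> (\<Sum>i\<le>degree (pCons 0 P). coeff (pCons 0 P) i * 0)) at_top"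
      by (intro tendsto_sum tendsto_mult_left 1)
    moreover have "(\<Sum>i\<le>degree (pCons 0 P). coeff (pCons 0 P) i * (y ^ i / exp y)) = poly (pCons 0 P) y * exp (- y)" for y
      by (simp only: poly_altdef sum_distrib_right exp_minus divide_inverse mult.assoc)
    ultimately show ?thesis by simp
  qed
  moreover have "((\<lambda>y. a * (y ^ 0 / exp y)) \<longlongrightarrow> a * 0) at_top"
    by (intro tendsto_mult_left 1)
  ultimately have "((\<lambda>y. poly (pCons 0 P) y * exp (- y) + a * (y ^ 0 / exp y)) \<longlongrightarrow> 0 + a * 0) at_top"
    by (rule tendsto_add)
  then show ?case by (simp add: algebra_simps exp_minus divide_inverse)
qed

lemma flat_deriv: "(flat m has_real_derivative flat (Suc m) s) (at s)"
proof -
  consider "s < 0" | "s > 0" | "s = 0" by linarith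
  then show ?thesis
  proof cases
    case 1
    have "((\<lambda>s. 0) has_real_derivative flat (Suc m) s) (at s)" using 1 by (simp add: flat_def)
    then show ?thesis
      by (rule has_field_derivative_transform_within_open[where S="{..<0}"]) (use 1 in \<open>auto simp: flat_def\<close>)
  next
    case 2
    have "((\<lambda>s. poly (flat_poly m) (1 / s) * exp (- 1 / s)) has_real_derivative flat (Suc m) s) (at s)"
      using 2 by (auto intro!: derivative_eq_intros DERIV_chain2[OF poly_DERIV] simp: flat_def field_simps power2_eq_square)
    then show ?thesis
      by (rule has_field_derivative_transform_within_open[where S="{0<..}"]) (use 2 in \<open>auto simp: flat_def\<close>)
  next
    case 3
    have r: "((\<lambda>h. (flat m (0 + h) - flat m 0) / h) \<longlongrightarrow> 0) (at_right 0)"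
    proof (rule Lim_transform_eventually)
      \<comment> \<open>With y = 1/h the difference quotient at 0 is a polynomial in y times
        exp(-y); the factor \<open>[:0,1:]\<close> accounts for the division by h.\<close>
      show "((\<lambda>h. poly ([:0,1:] * flat_poly m) (inverse h) * exp (- inverse h)) \<longlongrightarrow> 0) (at_right 0)"
        using filterlim_compose[OF poly_times_exp_neg_tendsto_0 filterlim_inverse_at_top_right] .
      show "\<forall>\<^sub>F h in at_right 0. poly ([:0,1:] * flat_poly m) (inverse h) * exp (- inverse h) = (flat m (0 + h) - flat m 0) / h"
        by (auto simp: eventually_at_filter flat_def divide_inverse)
    qed
    have l: "((\<lambda>h. (flat m (0 + h) - flat m 0) / h) \<longlongrightarrow> 0) (at_left 0)"
      by (rule Lim_transform_eventually[OF tendsto_const]) (auto simp: eventually_at_filter flat_def)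
    show ?thesis unfolding 3 DERIV_def using filterlim_split_at[OF l r] by (simp add: flat_def)
  qed
qed

lemma flat_pos: "0 < s \<Longrightarrow> 0 < flat 0 s" and flat_0: "s \<le> 0 \<Longrightarrow> flat m s = 0" and flat_nonneg: "0 \<le> flat 0 s"
  by (auto simp: flat_def)

section \<open>Convolution with a smooth kernel\<close>

definition conv :: "('a::euclidean_space \<Rightarrow> real) \<Rightarrow> ('a \<Rightarrow> real) \<Rightarrow> 'a \<Rightarrow> real" where
  "conv f \<rho> x = (LINT y|lborel. f y * \<rho> (x - y))"

lemma lborel_integral_reflect:
  fixes f :: "'a::euclidean_space \<Rightarrow> real"
  assumes [measurable]: "f \<in> borel_measurable borel"
  shows "(LINT y|lborel. f (x - y)) = (LINT y|lborel. f y)"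
proof -
  have "(LINT y|lborel. f (x - y)) = (LINT y|distr lborel borel ((+) x). f (x - y))"
    by (simp add: lborel_distr_plus)
  also have "\<dots> = (LINT y|lborel. f (- y))" by (subst integral_distr) auto
  also have "\<dots> = (LINT y|density (distr lborel borel (\<lambda>x. 0 + (-1) *\<^sub>R x)) (\<lambda>_. ennreal (\<bar>-1\<bar>^DIM('a))). f (- y))"
    by (subst lborel_affine[of "-1" 0, symmetric]) auto
  also have "\<dots> = (LINT y|lborel. f y)"
    by (simp add: density_1 integral_distr)
  finally show ?thesis .
qed

lemma conv_commute:
  assumes "continuous_on UNIV f" "continuous_on UNIV \<rho>"
  shows "conv f \<rho> x = (LINT y|lborel. f (x - y) * \<rho> y)"
proof -
  have [measurable]: "f \<in> borel_measurable borel" "\<rho> \<in> borel_measurable borel"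
    using assms by (auto intro: borel_measurable_continuous_onI)
  have "conv f \<rho> x = (LINT y|lborel. (\<lambda>y. f (x - y) * \<rho> y) (x - y))"
    by (simp add: conv_def)
  also have "\<dots> = (LINT y|lborel. f (x - y) * \<rho> y)"
    by (rule lborel_integral_reflect) measurable
  finally show ?thesis .
qed

lemma integral_cbox_of_supp:
  fixes f :: "'a::euclidean_space \<Rightarrow> real"
  assumes "continuous_on UNIV f" "\<And>y. y \<notin> cbox a b \<Longrightarrow> f y = 0"
  shows "(LINT y|lborel. f y) = integral (cbox a b) f"
proof -
  have "(LINT y|lborel. f y) = (LINT y:cbox a b|lborel. f y)"
    unfolding set_lebesgue_integral_def
    using assms(2) by (intro Bochner_Integration.integral_cong) (auto simp: indicator_def)
  also have "\<dots> = integral (cbox a b) f"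
    using borel_integrable_compact[OF compact_cbox continuous_on_subset[OF assms(1)]]
    by (intro set_borel_integral_eq_integral(2)) (auto simp: set_integrable_def)
  finally show ?thesis .
qed

text \<open>The derivative falls on the kernel, so \<open>f\<close> needs no smoothness; iterating
  this gives \<open>conv_Ck\<close>.\<close>

lemma conv_has_derivative:
  fixes f :: "'a::euclidean_space \<Rightarrow> real"
  assumes f: "continuous_on UNIV f" and supp: "\<And>y. y \<notin> cbox a b \<Longrightarrow> f y = 0"
    and \<rho>: "Ck (Suc 0) \<rho>"
  shows "(conv f \<rho> has_derivative (\<lambda>h. conv f (\<lambda>z. frechet_derivative \<rho> (at z) h) x)) (at x)"
proof -
  \<comment> \<open>The Leibniz rule asks for a jointly continuous derivative with values in the
    bounded linear maps. Its continuity reduces to that of the partial derivatives, which is what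
    \<open>Ck\<close> provides.\<close>
  define D where "D z = Blinfun (frechet_derivative \<rho> (at z))" for z
  have lin: "bounded_linear (frechet_derivative \<rho> (at z))" for z
    using Ck_SucD(1)[OF \<rho>] has_derivative_bounded_linear by blast
  have D: "blinfun_apply (D z) = frechet_derivative \<rho> (at z)" for z
    unfolding D_def by (rule bounded_linear_Blinfun_apply[OF lin])
  have contD: "continuous_on UNIV D"
    by (rule continuous_on_blinfun_componentwise) (use Ck_SucD(2)[OF \<rho>] in \<open>simp add: D\<close>)
  have c\<rho>: "continuous_on UNIV \<rho>" by (rule Ck_continuous[OF \<rho>])
  have cD: "continuous_on UNIV (\<lambda>z. frechet_derivative \<rho> (at z) h)" for h
    unfolding D[symmetric] by (intro continuous_intros contD)
  have e: "conv f k = (\<lambda>x. integral (cbox a b) (\<lambda>y. f y * k (x - y)))" if "continuous_on UNIV k" for k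
  proof
    fix x
    show "conv f k x = integral (cbox a b) (\<lambda>y. f y * k (x - y))"
      unfolding conv_def
      by (rule integral_cbox_of_supp) (auto simp: supp intro!: continuous_intros f continuous_on_compose2[OF that])
  qed
  have "((\<lambda>x. integral (cbox a b) (\<lambda>y. f y * \<rho> (x - y))) has_derivative
      blinfun_apply (integral (cbox a b) (\<lambda>y. f y *\<^sub>R D (x - y)))) (at x within UNIV)"
  proof (rule leibniz_rule)
    show "((\<lambda>x. f t * \<rho> (x - t)) has_derivative blinfun_apply (f t *\<^sub>R D (x - t))) (at x within UNIV)" for x t
    proof -
      have "((\<lambda>x. \<rho> (x - t)) has_derivative (\<lambda>h. frechet_derivative \<rho> (at (x - t)) h)) (at x)"
        by (rule has_derivative_compose[OF _ Ck_SucD(1)[OF \<rho>], of "\<lambda>x. x - t" "\<lambda>h. h"])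
           (auto intro!: derivative_eq_intros)
      then show ?thesis
        by (auto simp: D scaleR_blinfun.rep_eq intro!: derivative_eq_intros)
    qed
    show "(\<lambda>y. f y * \<rho> (x - y)) integrable_on cbox a b" for x
      by (intro integrable_continuous continuous_intros continuous_on_subset[OF f] continuous_on_compose2[OF c\<rho>]) auto
    show "continuous_on (UNIV \<times> cbox a b) (\<lambda>(x, t). f t *\<^sub>R D (x - t))"
      unfolding split_beta
      by (intro continuous_intros continuous_on_compose2[OF f] continuous_on_compose2[OF contD]) auto
  qed auto
  moreover have "blinfun_apply (integral (cbox a b) (\<lambda>y. f y *\<^sub>R D (x - y))) h =
      conv f (\<lambda>z. frechet_derivative \<rho> (at z) h) x" for h
  proof -
    have "(\<lambda>y. f y *\<^sub>R D (x - y)) integrable_on cbox a b"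
      by (intro integrable_continuous continuous_intros continuous_on_subset[OF f] continuous_on_compose2[OF contD]) auto
    then have "blinfun_apply (integral (cbox a b) (\<lambda>y. f y *\<^sub>R D (x - y))) h
      = integral (cbox a b) (\<lambda>y. blinfun_apply (f y *\<^sub>R D (x - y)) h)"
      using integral_linear[of "\<lambda>y. f y *\<^sub>R D (x - y)" "cbox a b" "\<lambda>F. blinfun_apply F h"]
        by (simp add: o_def blinfun.bounded_linear_left)
    then show ?thesis by (simp add: e[OF cD] D scaleR_blinfun.rep_eq)
  qed
  ultimately have "((\<lambda>x. integral (cbox a b) (\<lambda>y. f y * \<rho> (x - y))) has_derivative
      (\<lambda>h. conv f (\<lambda>z. frechet_derivative \<rho> (at z) h) x)) (at x)"
    by (metis (no_types, lifting) ext)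
  then show ?thesis by (simp add: e[OF c\<rho>])
qed

lemma conv_Ck:
  fixes f :: "'a::euclidean_space \<Rightarrow> real"
  assumes f: "continuous_on UNIV f" and supp: "\<And>y. y \<notin> cbox a b \<Longrightarrow> f y = 0"
  shows "(\<And>j. Ck j \<rho>) \<Longrightarrow> Ck k (conv f \<rho>)"
proof (induction k arbitrary: \<rho>)
  case 0
  show ?case
    using conv_has_derivative[OF f supp 0]
    by (auto intro!: continuous_at_imp_continuous_on has_derivative_continuous)
next
  case (Suc k)
  show ?case
    by (rule Ck_SucI[OF conv_has_derivative[OF f supp Suc.prems]]) (auto intro!: Suc.IH Ck_SucD(2)[OF Suc.prems])
qed

text \<open>Counterpart of \<open>conv_has_derivative\<close> with the derivative falling on
  \<open>f\<close>, which needs one only along the direction \<open>b\<close>. This carries the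
  derivatives of a test function of limited smoothness through mollification. The compact support
  now belongs to the kernel, so the variables are exchanged first.\<close>

lemma conv_directional_derivative:
  fixes f :: "'a::euclidean_space \<Rightarrow> real"
  assumes f: "continuous_on UNIV f" and D: "continuous_on UNIV D"
    and der: "\<And>z. ((\<lambda>s. f (z + s *\<^sub>R b)) has_real_derivative D z) (at 0)"
    and \<rho>: "continuous_on UNIV \<rho>" "\<And>y. y \<notin> cbox u v \<Longrightarrow> \<rho> y = 0"
  shows "((\<lambda>s. conv f \<rho> (x + s *\<^sub>R b)) has_real_derivative conv D \<rho> x) (at 0)"
proof -
  have e: "conv g \<rho> z = integral (cbox u v) (\<lambda>y. g (z - y) * \<rho> y)" if "continuous_on UNIV g" for g z
    unfolding conv_commute[OF that \<rho>(1)]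
    by (rule integral_cbox_of_supp) (auto simp: \<rho> intro!: continuous_intros \<rho>(1) continuous_on_compose2[OF that])
  have der': "((\<lambda>s. f (z + s *\<^sub>R b)) has_real_derivative D (z + s0 *\<^sub>R b)) (at s0)" for z s0
    using der[of "z + s0 *\<^sub>R b"] DERIV_shift[of "\<lambda>s. f (z + s *\<^sub>R b)" "D (z + s0 *\<^sub>R b)" 0 s0]
    by (simp add: algebra_simps)
  have "((\<lambda>s. integral (cbox u v) (\<lambda>y. f (x + s *\<^sub>R b - y) * \<rho> y)) has_real_derivative
      integral (cbox u v) (\<lambda>y. D (x + 0 *\<^sub>R b - y) * \<rho> y)) (at 0 within UNIV)"
  proof (rule leibniz_rule_field_derivative)
    show "((\<lambda>s. f (x + s *\<^sub>R b - t) * \<rho> t) has_real_derivative D (x + s *\<^sub>R b - t) * \<rho> t) (at s within UNIV)" for s t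
      using DERIV_cmult_right[OF der'[of "x - t" s], of "\<rho> t"] by (simp add: algebra_simps)
    show "(\<lambda>y. f (x + s *\<^sub>R b - y) * \<rho> y) integrable_on cbox u v" for s
      by (intro integrable_continuous continuous_intros continuous_on_subset[OF \<rho>(1)] continuous_on_compose2[OF f]) auto
    show "continuous_on (UNIV \<times> cbox u v) (\<lambda>(s, t). D (x + s *\<^sub>R b - t) * \<rho> t)"
      unfolding split_beta
      by (intro continuous_intros continuous_on_compose2[OF D] continuous_on_compose2[OF \<rho>(1)]) auto
  qed auto
  then show ?thesis by (simp add: e[OF f] e[OF D])
qed

lemma integral_pos_of_open_pos:
  fixes f :: "'a::euclidean_space \<Rightarrow> real"
  assumes "integrable lborel f" "\<And>x. 0 \<le> f x" "open S" "S \<noteq> {}" "\<And>x. x \<in> S \<Longrightarrow> 0 < f x"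
  shows "0 < (LINT x|lborel. f x)"
proof (rule ccontr)
  assume "\<not> 0 < (LINT x|lborel. f x)"
  then have "(LINT x|lborel. f x) = 0" using assms(2) by (simp add: Bochner_Integration.integral_nonneg order.antisym)
  then have "AE x in lborel. f x = 0" using assms(1,2) by (simp add: integral_nonneg_eq_0_iff_AE)
  then have "AE x in lborel. x \<notin> S" by eventually_elim (use assms(5) in force)
  then have "S \<in> null_sets lborel" using \<open>open S\<close> by (subst AE_iff_null_sets) auto
  then have "negligible S" using negligible_iff_null_sets null_sets_completionI by blast
  then show False using open_not_negligible assms(3,4) by blast
qed

lemma continuous_supp_integrable:
  fixes f :: "'a::euclidean_space \<Rightarrow> real"
  assumes "continuous_on UNIV f" "\<And>y. y \<notin> K \<Longrightarrow> f y = 0" "compact K"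
  shows "integrable lborel f"
proof -
  have "integrable lborel (\<lambda>x. indicator K x *\<^sub>R f x)"
    by (rule borel_integrable_compact[OF assms(3) continuous_on_subset[OF assms(1)]]) simp
  moreover have "(\<lambda>x. indicator K x *\<^sub>R f x) = f"
    by (rule ext) (use assms(2) in \<open>auto simp: indicator_def\<close>)
  ultimately show ?thesis by simp
qed

lemma mollifier:
  obtains \<rho> :: "nat \<Rightarrow> 'a::euclidean_space \<Rightarrow> real" where
    "\<And>m k. Ck k (\<rho> m)" "\<And>m y. 0 \<le> \<rho> m y" "\<And>m y. 1 / real (Suc m) \<le> norm y \<Longrightarrow> \<rho> m y = 0"
    "\<And>m. integrable lborel (\<rho> m)" "\<And>m. (LINT y|lborel. \<rho> m y) = 1"
proof -
  \<comment> \<open>A radial bump supported in the ball of radius 1/(m+1), not yet normalised. The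
    subtracted zeros give the expression the shape of \<open>Ck_norm2\<close>.\<close>
  define h where "h m y = flat 0 ((1 / real (Suc m))\<^sup>2 + (-1) * ((y - 0) \<bullet> (y - (0::'a))))" for m y
  have C: "Ck k (h m)" for k m
    unfolding h_def by (rule Ck_comp[where H=flat, OF flat_deriv]) (rule Ck_norm2)
  have z: "h m y = 0" if "1 / real (Suc m) \<le> norm y" for m y
    using power_mono[OF that, of 2] by (auto simp: h_def dot_square_norm intro!: flat_0)
  have p: "0 < h m y" if "norm y < 1 / real (Suc m)" for m y
    using power_strict_mono[OF that, of 2] by (auto simp: h_def dot_square_norm intro!: flat_pos)
  have nn: "0 \<le> h m y" for m y unfolding h_def by (rule flat_nonneg)
  have i: "integrable lborel (h m)" for m
    by (rule continuous_supp_integrable[OF Ck_continuous[OF C], where K="cball 0 (1 / real (Suc m))"]) (auto intro!: z)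
  have pos: "0 < (LINT y|lborel. h m y)" for m
    by (rule integral_pos_of_open_pos[where S="ball 0 (1 / real (Suc m))"]) (use p nn i in auto)
  show thesis
  proof (rule that[of "\<lambda>m y. inverse (LINT y|lborel. h m y) * h m y"])
    show "Ck k (\<lambda>y. inverse (LINT y|lborel. h m y) * h m y)" for k m by (intro Ck_mult Ck_const C)
  qed (use pos z nn i in \<open>auto simp: less_imp_le less_imp_neq[symmetric]\<close>)
qed

lemma conv_bounded:
  assumes f: "continuous_on UNIV f" and "\<And>z. \<bar>f z\<bar> \<le> M"
    and \<rho>: "continuous_on UNIV \<rho>" "\<And>y. 0 \<le> \<rho> y" "integrable lborel \<rho>" "(LINT y|lborel. \<rho> y) = 1"
  shows "\<bar>conv f \<rho> x\<bar> \<le> M"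
proof -
  have [measurable]: "f \<in> borel_measurable borel" "\<rho> \<in> borel_measurable borel"
    using f \<rho> by (auto intro: borel_measurable_continuous_onI)
  have i: "integrable lborel (\<lambda>y. M * \<rho> y)" using \<rho> by simp
  have j: "integrable lborel (\<lambda>y. f (x - y) * \<rho> y)"
    by (rule Bochner_Integration.integrable_bound[OF i]) (use assms in \<open>auto simp: abs_mult intro!: mult_mono AE_I2 order_trans[OF assms(2) abs_ge_self]\<close>)
  have "\<bar>conv f \<rho> x\<bar> \<le> (LINT y|lborel. \<bar>f (x - y) * \<rho> y\<bar>)"
    unfolding conv_commute[OF f \<rho>(1)] by (rule integral_abs_bound)
  also have "\<dots> \<le> (LINT y|lborel. M * \<rho> y)"
    by (rule integral_mono[OF integrable_abs[OF j] i]) (use assms in \<open>auto simp: abs_mult intro!: mult_right_mono\<close>)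
  finally show ?thesis using \<rho> by simp
qed

lemma conv_supp:
  assumes f: "continuous_on UNIV f" and \<rho>: "continuous_on UNIV \<rho>" "\<And>y. r \<le> norm y \<Longrightarrow> \<rho> y = 0"
    and "\<And>z. dist z x < r \<Longrightarrow> f z = 0"
  shows "conv f \<rho> x = 0"
proof -
  have "(\<lambda>y. f (x - y) * \<rho> y) = (\<lambda>y. 0)"
  proof
    fix y show "f (x - y) * \<rho> y = 0"
      using \<rho>(2)[of y] assms(4)[of "x - y"] by (cases "r \<le> norm y") (auto simp: dist_norm norm_minus_commute)
  qed
  then show ?thesis unfolding conv_commute[OF f \<rho>(1)] by simp
qed

lemma conv_mollifier_tendsto:
  fixes f :: "'a::euclidean_space \<Rightarrow> real"
  assumes f: "continuous_on UNIV f" 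
    and \<rho>: "\<And>m. continuous_on UNIV (\<rho> m)" "\<And>m y. 0 \<le> \<rho> m y" "\<And>m y. 1 / real (Suc m) \<le> norm y \<Longrightarrow> \<rho> m y = 0"
     "\<And>m. integrable lborel (\<rho> m)" "\<And>m. (LINT y|lborel. \<rho> m y) = 1"
  shows "(\<lambda>m. conv f (\<rho> m) x) \<longlonglongrightarrow> f x"
proof (rule LIMSEQ_I)
  fix e :: real assume "0 < e"
  then obtain d where d: "0 < d" "\<And>z. dist z x < d \<Longrightarrow> \<bar>f z - f x\<bar> < e / 2"
    using f[unfolded continuous_on_iff, rule_format, of x "e/2"] by (auto simp: dist_real_def)
  obtain N where N: "1 / real (Suc N) < d" using nat_approx_posE[OF d(1)] by metis
  show "\<exists>N. \<forall>m\<ge>N. norm (conv f (\<rho> m) x - f x) < e"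
  proof (intro exI allI impI)
    fix m assume "N \<le> m"
    then have md: "1 / real (Suc m) < d" using N by (smt (verit) frac_le of_nat_0_less_iff of_nat_mono Suc_le_mono zero_less_Suc)
    have [measurable]: "f \<in> borel_measurable borel" "\<rho> m \<in> borel_measurable borel"
      using f \<rho> by (auto intro: borel_measurable_continuous_onI)
    have b: "\<bar>(f (x - y) - f x) * \<rho> m y\<bar> \<le> e / 2 * \<rho> m y" for y
    proof (cases "1 / real (Suc m) \<le> norm y")
      case False
      then have "dist (x - y) x < d" using md by (simp add: dist_norm)
      then show ?thesis using mult_right_mono[OF less_imp_le[OF d(2)[of "x - y"]] \<rho>(2)[of m y]] \<rho>(2)[of m y] by (simp add: abs_mult)
    qed (simp add: \<rho>(3))
    have i: "integrable lborel (\<lambda>y. e / 2 * \<rho> m y)" using \<rho> by simp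
    have j: "integrable lborel (\<lambda>y. (f (x - y) - f x) * \<rho> m y)"
      by (rule Bochner_Integration.integrable_bound[OF i]) (measurable, rule AE_I2, unfold real_norm_def, rule order_trans[OF b abs_ge_self])
    have k: "integrable lborel (\<lambda>y. f (x - y) * \<rho> m y)"
    proof -
      have "integrable lborel (\<lambda>y. (f (x - y) - f x) * \<rho> m y + f x * \<rho> m y)"
        by (intro Bochner_Integration.integrable_add j) (use \<rho> in auto)
      then show ?thesis by (simp add: algebra_simps)
    qed
    have "conv f (\<rho> m) x - f x = (LINT y|lborel. f (x - y) * \<rho> m y) - (LINT y|lborel. f x * \<rho> m y)"
      unfolding conv_commute[OF f \<rho>(1)] using \<rho> by simp
    also have "\<dots> = (LINT y|lborel. (f (x - y) - f x) * \<rho> m y)"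
      by (subst Bochner_Integration.integral_diff[symmetric]) (use k \<rho> in \<open>auto simp: algebra_simps\<close>)
    finally have "\<bar>conv f (\<rho> m) x - f x\<bar> \<le> (LINT y|lborel. \<bar>(f (x - y) - f x) * \<rho> m y\<bar>)"
      using integral_abs_bound by metis
    also have "\<dots> \<le> (LINT y|lborel. e / 2 * \<rho> m y)"
      by (rule integral_mono[OF integrable_abs[OF j] i b])
    also have "\<dots> < e" using \<rho> \<open>0 < e\<close> by simp
    finally show "norm (conv f (\<rho> m) x - f x) < e" by simp
  qed
qed

section \<open>Test functions in space-time\<close>

definition pd :: "'a::euclidean_space \<Rightarrow> ('a \<Rightarrow> real) \<Rightarrow> 'a \<Rightarrow> real" where
  "pd b f z = frechet_derivative f (at z) b"

lemma test_function_Ck: "test_function \<Omega> f \<Longrightarrow> Ck k f"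
  by (simp add: test_function_def)

lemma test_function_intro:
  assumes "\<And>k. Ck k f" "compact K" "K \<subseteq> \<Omega>" "\<And>z. z \<notin> K \<Longrightarrow> f z = 0"
  shows "test_function \<Omega> f"
proof -
  have "closure {x. f x \<noteq> 0} \<subseteq> K" using assms
    by (intro closure_minimal) (auto intro: compact_imp_closed)
  then show ?thesis
    unfolding test_function_def using assms
    by (meson bounded_subset closed_closure compact_eq_bounded_closed order_trans)
qed

lemma test_function_pd:
  assumes "test_function \<Omega> f" "b \<in> Basis"
  shows "test_function \<Omega> (pd b f)"
proof (rule test_function_intro[where K="closure {x. f x \<noteq> 0}"])
  show "Ck k (pd b f)" for k
    unfolding pd_def by (rule Ck_SucD(2)[OF test_function_Ck[OF assms(1)] assms(2)])
  show "pd b f z = 0" if "z \<notin> closure {x. f x \<noteq> 0}" for z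
  proof -
    have "((\<lambda>x. 0) has_derivative (\<lambda>h. 0)) (at z)" by simp
    then have "(f has_derivative (\<lambda>h. 0)) (at z)"
      by (rule has_derivative_transform_within_open[of _ _ _ _ "- closure {x. f x \<noteq> 0}"])
         (use that closure_subset[of "{x. f x \<noteq> 0}"] in auto)
    then show ?thesis unfolding pd_def using frechet_derivative_at by metis
  qed
qed (use assms in \<open>auto simp: test_function_def\<close>)

lemma Basis_pair: "(1::real, 0::real^'n) \<in> Basis" "(0::real, axis i (1::real) :: real^'n) \<in> Basis"
  by (auto simp: Basis_prod_def axis_in_Basis_iff)

lemma Ck_slice:
  fixes f :: "real \<times> (real^'n) \<Rightarrow> real"
  shows "Ck k f \<Longrightarrow> Ck k (\<lambda>x. f (t, x))"
proof (induction k arbitrary: f)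
  case 0
  then show ?case by (auto intro!: continuous_on_compose2[of UNIV f] continuous_intros)
next
  case (Suc k)
  have "((\<lambda>x. f (t, x)) has_derivative (\<lambda>h. frechet_derivative f (at (t, x)) (0, h))) (at x)" for x
    by (rule has_derivative_compose[OF _ Ck_SucD(1)[OF Suc.prems], of "\<lambda>x. (t, x)"])
       (auto intro!: derivative_eq_intros)
  then show ?case
    by (rule Ck_SucI) (rule Suc.IH, rule Ck_SucD(2)[OF Suc.prems], auto simp: Basis_prod_def)
qed

lemma test_function_slice:
  fixes f :: "real \<times> (real^'n) \<Rightarrow> real"
  assumes "test_function \<Omega> f"
  shows "test_function UNIV (\<lambda>x. f (t, x))"
proof (rule test_function_intro[where K="snd ` closure {x. f x \<noteq> 0}"])
  show "compact (snd ` closure {x. f x \<noteq> 0})"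
    using assms by (intro compact_continuous_image continuous_intros) (auto simp: test_function_def)
  show "f (t, z) = 0" if "z \<notin> snd ` closure {x. f x \<noteq> 0}" for z
    using that closure_subset[of "{x. f x \<noteq> 0}"] by force
qed (auto intro: Ck_slice test_function_Ck[OF assms])

lemma grad_slice:
  fixes f :: "real \<times> (real^'n) \<Rightarrow> real"
  assumes "Ck (Suc 0) f"
  shows "grad (\<lambda>y. f (t, y)) x $ i = pd (0, axis i 1) f (t, x)"
proof -
  have "((\<lambda>x. f (t, x)) has_derivative (\<lambda>h. frechet_derivative f (at (t, x)) (0, h))) (at x)"
    by (rule has_derivative_compose[OF _ Ck_SucD(1)[OF assms], of "\<lambda>x. (t, x)"])
       (auto intro!: derivative_eq_intros)
  from frechet_derivative_at[OF this] show ?thesis unfolding grad_def pd_def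
    by (auto dest: fun_cong[of _ _ "axis i 1"])
qed

lemma pd_time:
  fixes f :: "real \<times> (real^'n) \<Rightarrow> real"
  assumes "Ck (Suc 0) f"
  shows "((\<lambda>s. f (s, x)) has_real_derivative pd (1, 0) f (t, x)) (at t)"
proof -
  interpret bounded_linear "frechet_derivative f (at (t, x))"
    using Ck_SucD(1)[OF assms] has_derivative_bounded_linear by blast
  have "((\<lambda>s. f (s, x)) has_derivative (\<lambda>h. frechet_derivative f (at (t, x)) (h, 0))) (at t)"
    by (rule has_derivative_compose[OF _ Ck_SucD(1)[OF assms], of "\<lambda>s. (s, x)"])
       (auto intro!: derivative_eq_intros)
  moreover have "frechet_derivative f (at (t, x)) (h, 0) = pd (1, 0) f (t, x) * h" for h
    using scale[of h "(1,0)"] by (simp add: pd_def mult.commute)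
  ultimately show ?thesis by (simp add: has_field_derivative_def)
qed

lemma test_function_support:
  fixes f :: "real \<times> (real^'n) \<Rightarrow> real"
  assumes "test_function ({..<T} \<times> UNIV) f" "0 < T"
  obtains T1 M where "0 \<le> T1" "T1 < T" "0 < M" "\<And>t x. f (t, x) \<noteq> 0 \<Longrightarrow> t < T1 \<and> norm x \<le> M"
proof -
  let ?K = "closure {x. f x \<noteq> 0}"
  have K: "compact ?K" "?K \<subseteq> {..<T} \<times> UNIV"
    using assms by (auto simp: test_function_def)
  have K3: "{x. f x \<noteq> 0} \<subseteq> ?K" by (rule closure_subset)
  obtain M where M: "0 < M" "\<And>z. z \<in> ?K \<Longrightarrow> norm z \<le> M"
    using compact_imp_bounded[OF K(1)] by (meson bounded_pos)
  have "\<exists>t0<T. \<forall>z\<in>?K. fst z \<le> t0"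
  proof (cases "?K = {}")
    case True
    then show ?thesis using assms(2) by (metis empty_iff)
  next
    case False
    have "continuous_on ?K (fst :: real \<times> (real^'n) \<Rightarrow> real)" by (intro continuous_intros)
    from continuous_attains_sup[OF K(1) False this] show ?thesis using K(2) by fastforce
  qed
  then obtain t0 where t0: "t0 < T" "\<And>z. z \<in> ?K \<Longrightarrow> fst z \<le> t0" by auto
  show thesis
  \<comment> \<open>The midpoint lies strictly above every time in the support and strictly below
    \<open>T\<close>, so the test function already vanishes at time \<open>T1\<close>
    itself.\<close>
  proof (rule that[of "(max 0 t0 + T) / 2" M])
    show "t < (max 0 t0 + T) / 2 \<and> norm x \<le> M" if "f (t, x) \<noteq> 0" for t x
    proof -
      have "(t, x) \<in> ?K" using that K3 by auto
      then have "t \<le> t0" "norm (t, x) \<le> M" using t0(2) M(2) by force+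
      then show ?thesis using norm_snd_le[where x=t and y=x] t0 assms(2) by (auto simp: max_def)
    qed
  qed (use t0 M assms in auto)
qed

lemma continuous_compact_bounded:
  fixes f :: "'a::euclidean_space \<Rightarrow> real"
  assumes "continuous_on UNIV f" "compact K" "\<And>z. z \<notin> K \<Longrightarrow> f z = 0"
  obtains B where "0 < B" "\<And>z. \<bar>f z\<bar> \<le> B"
proof -
  have "bounded (f ` K)"
    using assms by (intro compact_imp_bounded compact_continuous_image) (auto intro: continuous_on_subset)
  then obtain B where "0 < B" "\<And>z. z \<in> K \<Longrightarrow> \<bar>f z\<bar> \<le> B" by (auto simp: bounded_pos)
  then show thesis using assms(3) by (intro that[of B]) (metis abs_zero less_imp_le)+
qed

lemma test_function_bounded:
  assumes "test_function \<Omega> f"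
  obtains B where "0 < B" "\<And>z. \<bar>f z\<bar> \<le> B"
proof (rule continuous_compact_bounded[of f "closure {x. f x \<noteq> 0}"])
  show "continuous_on UNIV f" using test_function_Ck[OF assms] by (rule Ck_continuous)
  show "f z = 0" if "z \<notin> closure {x. f x \<noteq> 0}" for z
    using that closure_subset[of "{x. f x \<noteq> 0}"] by auto
qed (use assms in \<open>auto simp: test_function_def intro: that\<close>)

text \<open>The open time interval matches \<open>Lp_loc\<close>, whose measurability statement
  covers only \<open>{0<..<T} \<times> UNIV\<close>. The slice t = 0 that is lost is a null
  set.\<close>

definition spacetime :: "real \<Rightarrow> (real \<Rightarrow> (real^'n) \<Rightarrow> real) \<Rightarrow> real \<times> (real^'n) \<Rightarrow> real" where
  "spacetime T u z = indicator ({0<..<T} \<times> UNIV) z * u (fst z) (snd z)"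

lemma AE_not_0: "AE t in lborel. t \<noteq> (0::real)"
  by (rule AE_I[of _ _ "{0}"]) auto

lemma st_integral_eq:
  fixes h :: "real \<Rightarrow> (real^'n) \<Rightarrow> real"
  assumes "integrable lborel (spacetime T h)"
  shows "st_integral T h = (LINT z|lborel. spacetime T h z)"
    "set_integrable lborel {0..<T} (\<lambda>t. LINT x|lborel. h t x)"
    "AE t in lborel. t \<in> {0..<T} \<longrightarrow> integrable lborel (h t)"
proof -
  have i: "integrable (lborel \<Otimes>\<^sub>M lborel) (spacetime T h)" using assms by (simp add: lborel_prod)
  have e: "(LINT x|lborel. spacetime T h (t, x)) = indicator {0..<T} t * (LINT x|lborel. h t x)" if "t \<noteq> 0" for t
    using that by (auto simp: spacetime_def indicator_def)
  have m: "integrable lborel (\<lambda>t. LINT x|lborel. spacetime T h (t, x))"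
    by (rule lborel_pair.integrable_fst'[OF i])
  have ae: "AE t in lborel. indicator {0..<T} t * (LINT x|lborel. h t x) = (LINT x|lborel. spacetime T h (t, x))"
    using AE_not_0 by eventually_elim (simp add: e)
  have [measurable]: "(\<lambda>t. LINT x|lborel. spacetime T h (t, x)) \<in> borel_measurable borel"
    using borel_measurable_integrable[OF m] by simp
  \<comment> \<open>The slice at t = 0 is not controlled by \<open>spacetime\<close>, so
    measurability is obtained by giving that single point its own value.\<close>
  have mm: "(\<lambda>t. indicator {0..<T} t * (LINT x|lborel. h t x)) = (\<lambda>t. if t = 0 then indicator {0..<T} 0 * (LINT x|lborel. h 0 x) else (LINT x|lborel. spacetime T h (t, x)))"
    by (auto simp: e)
  have [measurable]: "(\<lambda>t. indicator {0..<T} t * (LINT x|lborel. h t x)) \<in> borel_measurable borel"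
    unfolding mm by measurable
  show "st_integral T h = (LINT z|lborel. spacetime T h z)"
    unfolding st_integral_def set_lebesgue_integral_def lborel_prod[symmetric] 
      lborel_pair.integral_fst'[OF i, symmetric] real_scaleR_def
    by (rule integral_cong_AE) (use ae in auto)
  show "set_integrable lborel {0..<T} (\<lambda>t. LINT x|lborel. h t x)"
    unfolding set_integrable_def real_scaleR_def using m
    by (subst integrable_cong_AE[OF _ _ ae]) auto
  show "AE t in lborel. t \<in> {0..<T} \<longrightarrow> integrable lborel (h t)"
    using lborel_pair.AE_integrable_fst'[OF i] AE_not_0
    by eventually_elim (auto simp: spacetime_def indicator_def split: if_splits)
qed

text \<open>The weak equation speaks of iterated integrals only. For a nonnegative integrand Tonelli
  upgrades them to joint integrability; this is the entrance through which |u|^p becomes integrable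
  on space-time.\<close>

lemma spacetime_integrable_nonneg:
  fixes h :: "real \<Rightarrow> (real^'n) \<Rightarrow> real"
  assumes "st_convergent T h" "\<And>t x. 0 \<le> h t x" "spacetime T h \<in> borel_measurable borel"
  shows "integrable lborel (spacetime T h)"
proof -
  have [measurable]: "spacetime T h \<in> borel_measurable (lborel \<Otimes>\<^sub>M lborel)"
    using assms(3) by (simp add: lborel_prod)
  have e: "(LINT x|lborel. norm (spacetime T h (t, x))) = indicator {0..<T} t * (LINT x|lborel. h t x)" if "t \<noteq> 0" for t
    using that assms(2) by (auto simp: spacetime_def indicator_def)
  have [measurable]: "(\<lambda>t. LINT x|lborel. norm (spacetime T h (t, x))) \<in> borel_measurable borel"
    using lborel.borel_measurable_lebesgue_integral[of "\<lambda>t x. norm (spacetime T h (t, x))" lborel] by simp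
  have "integrable lborel (\<lambda>t. indicator {0..<T} t * (LINT x|lborel. h t x))"
    using assms(1) by (simp add: st_convergent_def set_integrable_def)
  then have "integrable lborel (\<lambda>t. LINT x|lborel. norm (spacetime T h (t, x)))"
    by (rule Bochner_Integration.integrable_cong_AE_imp) (auto intro!: eventually_mono[OF AE_not_0] simp: e simp del: real_norm_def)
  moreover have "AE t in lborel. integrable lborel (\<lambda>x. spacetime T h (t, x))"
    using conjunct1[OF assms(1)[unfolded st_convergent_def]]
    by eventually_elim (auto simp: spacetime_def indicator_def)
  ultimately have "integrable (lborel \<Otimes>\<^sub>M lborel) (spacetime T h)"
    by (intro lborel_pair.Fubini_integrable) auto
  then show ?thesis by (simp add: lborel_prod)
qed

section \<open>Pairings of curves in L2 with test functions\<close>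

lemma L2_diff:
  assumes "L2 f" "L2 g"
  shows "L2 (\<lambda>x. f x - g x :: real)"
proof -
  have [measurable]: "f \<in> borel_measurable borel" "g \<in> borel_measurable borel"
    and i: "integrable lborel (\<lambda>x. 2 * (f x)\<^sup>2 + 2 * (g x)\<^sup>2)" using assms by (auto simp: L2_def)
  have "(f x - g x)\<^sup>2 \<le> 2 * (f x)\<^sup>2 + 2 * (g x)\<^sup>2" for x
    using sum_squares_bound[of "f x" "- g x"] by (simp add: power2_eq_square algebra_simps)
  then show ?thesis unfolding L2_def
    by (auto intro!: Bochner_Integration.integrable_bound[OF i])
qed

lemma L2_cmult: "L2 f \<Longrightarrow> L2 (\<lambda>x. c * f x :: real)"
  by (auto simp: L2_def power_mult_distrib)

text \<open>Pointwise 2|w|d <= w^2 + d^2, and the choice d = \<open>L2norm w\<close> makes the bound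
  linear in the norm. If the norm vanishes, only the term in d remains and d may be taken
  arbitrarily small.\<close>

lemma L2_local:
  fixes w :: "'a::euclidean_space \<Rightarrow> real"
  assumes "L2 w" and [measurable]: "\<omega> \<in> borel_measurable borel"
    and \<omega>: "\<And>x. \<bar>\<omega> x\<bar> \<le> B * indicator (cball 0 M) x" and "0 \<le> B"
  shows "integrable lborel (\<lambda>x. w x * \<omega> x)"
    "\<bar>LINT x|lborel. w x * \<omega> x\<bar> \<le> B * (1 + measure lborel (cball (0::'a) M)) / 2 * L2norm w"
proof -
  have [measurable]: "w \<in> borel_measurable borel" and w2: "integrable lborel (\<lambda>x. (w x)\<^sup>2)"
    using assms(1) by (auto simp: L2_def)
  have ib: "integrable lborel (indicator (cball (0::'a) M) :: 'a \<Rightarrow> real)"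
    using emeasure_bounded_finite[OF bounded_cball, of "0::'a" M] by (intro integrable_real_indicator) auto
  have bound: "\<bar>w x * \<omega> x\<bar> \<le> B * ((w x)\<^sup>2 / d + d * indicator (cball 0 M) x) / 2" if "0 < d" for d x
  proof (cases "x \<in> cball 0 M")
    case True
    have "2 * \<bar>w x\<bar> * d \<le> (w x)\<^sup>2 + d\<^sup>2"
      using sum_squares_bound[of "\<bar>w x\<bar>" d] by (simp add: mult_ac)
    then have "\<bar>w x\<bar> \<le> ((w x)\<^sup>2 / d + d) / 2" using that by (simp add: field_simps power2_eq_square)
    moreover have "\<bar>w x * \<omega> x\<bar> \<le> \<bar>w x\<bar> * B" using \<omega>[of x] True by (auto simp: abs_mult intro!: mult_left_mono)
    moreover have "\<bar>w x\<bar> * B \<le> ((w x)\<^sup>2 / d + d) / 2 * B" using calculation assms(4) by (intro mult_right_mono) auto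
    ultimately show ?thesis using True by (simp add: mult_ac)
  next
    case False
    then have "\<omega> x = 0" using \<omega>[of x] by simp
    then show ?thesis using False that assms(4) by simp
  qed
  have ii: "integrable lborel (\<lambda>x. B * ((w x)\<^sup>2 / d + d * indicator (cball 0 M) x) / 2)" for d
    using w2 ib by auto
  show int: "integrable lborel (\<lambda>x. w x * \<omega> x)"
    by (rule Bochner_Integration.integrable_bound[OF ii[of 1]])
      (measurable, rule AE_I2, unfold real_norm_def, rule order_trans[OF bound abs_ge_self], simp)
  let ?m = "measure lborel (cball (0::'a) M)"
  have N: "0 \<le> L2norm w" "(L2norm w)\<^sup>2 = (LINT x|lborel. (w x)\<^sup>2)"
    by (auto simp: L2norm_def)
  have main: "\<bar>LINT x|lborel. w x * \<omega> x\<bar> \<le> B * ((L2norm w)\<^sup>2 / d + d * ?m) / 2" if "0 < d" for d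
  proof -
    have "\<bar>LINT x|lborel. w x * \<omega> x\<bar> \<le> (LINT x|lborel. \<bar>w x * \<omega> x\<bar>)" by (rule integral_abs_bound)
    also have "\<dots> \<le> (LINT x|lborel. B * ((w x)\<^sup>2 / d + d * indicator (cball 0 M) x) / 2)"
      by (rule integral_mono[OF integrable_abs[OF int] ii bound[OF that]])
    also have "\<dots> = B * ((L2norm w)\<^sup>2 / d + d * ?m) / 2"
      using w2 ib by (simp add: N)
    finally show ?thesis .
  qed
  show "\<bar>LINT x|lborel. w x * \<omega> x\<bar> \<le> B * (1 + ?m) / 2 * L2norm w"
  proof (cases "L2norm w = 0")
    case False
    then show ?thesis using main[of "L2norm w"] N(1) by (simp add: power2_eq_square algebra_simps)
  next
    case True
    have "\<bar>LINT x|lborel. w x * \<omega> x\<bar> \<le> 0 + e" if "0 < e" for e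
    proof -
      have "0 \<le> B * ?m" using assms(4) by simp
      have "\<bar>LINT x|lborel. w x * \<omega> x\<bar> \<le> B * (0 / (e / (1 + B * ?m)) + e / (1 + B * ?m) * ?m) / 2"
        using main[of "e / (1 + B * ?m)"] that True \<open>0 \<le> B * ?m\<close> by simp
      also have "\<dots> = e * (B * ?m / (1 + B * ?m)) / 2" by simp
      also have "\<dots> \<le> e * 1 / 2" using that \<open>0 \<le> B * ?m\<close> by (intro divide_right_mono mult_left_mono) (auto simp: field_simps)
      finally show ?thesis using that by simp
    qed
    from field_le_epsilon[OF this] show ?thesis by (simp add: True)
  qed
qed

lemma L2_local_tendsto:
  fixes w :: "'a::euclidean_space \<Rightarrow> real"
  assumes "L2 w" "\<And>s. \<kappa> s \<in> borel_measurable borel"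
    and ev: "\<And>e. 0 < e \<Longrightarrow> \<forall>\<^sub>F s in F. \<forall>x. \<bar>\<kappa> s x\<bar> \<le> e * indicator (cball 0 M) x"
  shows "((\<lambda>s. LINT x|lborel. w x * \<kappa> s x) \<longlongrightarrow> 0) F"
proof (rule tendstoI)
  fix e :: real assume "0 < e"
  define A where "A = (1 + measure lborel (cball (0::'a) M)) / 2 * L2norm w"
  have A: "0 \<le> A" by (auto simp: A_def L2norm_def intro!: mult_nonneg_nonneg)
  have "0 < e / (1 + A)" using \<open>0 < e\<close> A by simp
  from ev[OF this] show "\<forall>\<^sub>F s in F. dist (LINT x|lborel. w x * \<kappa> s x) 0 < e"
  proof eventually_elim
    case (elim s)
    have "\<bar>LINT x|lborel. w x * \<kappa> s x\<bar> \<le> e / (1 + A) * A"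
      using L2_local(2)[OF assms(1,2), of s "e / (1 + A)" M] elim \<open>0 < e / (1 + A)\<close> by (simp add: A_def mult_ac)
    also have "\<dots> < e" using A \<open>0 < e\<close> by (simp add: field_simps)
    finally show ?case by simp
  qed
qed

lemma uniform_slice:
  fixes f :: "real \<times> (real^'n) \<Rightarrow> real"
  assumes f: "continuous_on UNIV f" and supp: "\<And>t x. f (t, x) \<noteq> 0 \<Longrightarrow> norm x \<le> M" and "0 < e"
  obtains d where "0 < d" "\<And>s x. \<bar>s - t\<bar> < d \<Longrightarrow> \<bar>f (s, x) - f (t, x)\<bar> \<le> e * indicator (cball 0 M) x"
proof -
  have "uniformly_continuous_on ({t-1..t+1} \<times> cball 0 M) f"
    by (intro compact_uniformly_continuous continuous_on_subset[OF f] compact_Times) auto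
  then obtain d where d: "0 < d" "\<And>z z'. z \<in> {t-1..t+1} \<times> cball 0 M \<Longrightarrow> z' \<in> {t-1..t+1} \<times> cball 0 M \<Longrightarrow> dist z' z < d \<Longrightarrow> dist (f z') (f z) < e"
    unfolding uniformly_continuous_on_def using \<open>0 < e\<close> by metis
  show thesis
  proof (rule that[of "min d 1"])
    fix s x assume s: "\<bar>s - t\<bar> < min d 1"
    show "\<bar>f (s, x) - f (t, x)\<bar> \<le> e * indicator (cball 0 M) x"
    proof (cases "norm x \<le> M")
      case True
      have "dist (s, x) (t, x) < d" using s by (simp add: dist_Pair_Pair dist_real_def)
      moreover have "t - 1 \<le> s" "s \<le> t + 1" using s by linarith+
      ultimately show ?thesis using d(2)[of "(t, x)" "(s, x)"] True by (auto simp: dist_real_def)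
    next
      case False
      then have "f (s, x) = 0" "f (t, x) = 0" using supp by blast+
      then show ?thesis using \<open>0 < e\<close> by simp
    qed
  qed (use d in auto)
qed

lemma pd_supp:
  fixes f :: "real \<times> (real^'n) \<Rightarrow> real"
  assumes "f z = 0" "open S" "z \<in> S" "\<And>y. y \<in> S \<Longrightarrow> f y = 0"
  shows "pd b f z = 0"
proof -
  have "((\<lambda>x. 0) has_derivative (\<lambda>h. 0)) (at z)" by simp
  then have "(f has_derivative (\<lambda>h. 0)) (at z)"
    by (rule has_derivative_transform_within_open[of _ _ _ _ S]) (use assms in auto)
  then show ?thesis unfolding pd_def using frechet_derivative_at by metis
qed

lemma continuous_slice: "continuous_on UNIV f \<Longrightarrow> continuous_on UNIV (\<lambda>x. f (t, x))"
  by (auto intro!: continuous_on_compose2[of UNIV f] continuous_intros)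

text \<open>Product rule for the pairing of u(s) with \<theta>(s). The difference quotient minus the
  claimed derivative is a sum of three errors, each of which tends to 0; the derivative is one-sided
  at t = 0.\<close>

lemma pairing_has_derivative:
  fixes u v :: "real \<Rightarrow> real^'n \<Rightarrow> real"
  assumes C1: "C1_L2 T u v" and \<theta>: "test_function \<Omega> \<theta>" and t: "t \<in> {0..<T}"
  shows "((\<lambda>s. LINT x|lborel. u s x * \<theta> (s, x)) has_real_derivative
    (LINT x|lborel. v t x * \<theta> (t, x)) + (LINT x|lborel. u t x * pd (1, 0) \<theta> (t, x))) (at t within {0..<T})"
proof -
  let ?F = "at t within {0..<T}"
  let ?p = "pd (1, 0) \<theta>"
  have \<theta>': "test_function \<Omega> ?p" by (rule test_function_pd[OF \<theta> Basis_pair(1)])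
  have c: "continuous_on UNIV \<theta>" "continuous_on UNIV ?p"
    using Ck_continuous[OF test_function_Ck] \<theta> \<theta>' by blast+
  have cs: "(\<lambda>x. \<theta> (s, x)) \<in> borel_measurable borel" "(\<lambda>x. ?p (s, x)) \<in> borel_measurable borel" for s
    using continuous_slice[OF c(1)] continuous_slice[OF c(2)] by (auto intro!: borel_measurable_continuous_onI)
  note [measurable] = cs
  have "compact (closure {x. \<theta> x \<noteq> 0})" using \<theta> by (simp add: test_function_def)
  then obtain M where M0: "\<And>z. z \<in> closure {x. \<theta> x \<noteq> 0} \<Longrightarrow> norm z \<le> M" "0 < M"
    by (meson bounded_pos compact_imp_bounded)
  have M1: "\<theta> (s, x) = 0" if "M < norm x" for s x
    using M0(1)[of "(s, x)"] that closure_subset[of "{x. \<theta> x \<noteq> 0}"] norm_snd_le[where x=s and y=x] by fastforce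
  have M2: "?p (s, x) = 0" if "M < norm x" for s x
    by (rule pd_supp[where S="UNIV \<times> (- cball 0 M)"]) (use that M1 in \<open>auto intro!: open_Times\<close>)
  obtain B where B: "0 < B" "\<And>z. \<bar>\<theta> z\<bar> \<le> B" by (rule test_function_bounded[OF \<theta>]) auto
  obtain B' where B': "0 < B'" "\<And>z. \<bar>?p z\<bar> \<le> B'" by (rule test_function_bounded[OF \<theta>']) auto
  have b1: "\<bar>\<theta> (s, x)\<bar> \<le> B * indicator (cball 0 M) x" for s x
    using B(2)[of "(s, x)"] M1[of x s] by (auto simp: indicator_def)
  have b2: "\<bar>?p (s, x)\<bar> \<le> B' * indicator (cball 0 M) x" for s x
    using B'(2)[of "(s, x)"] M2[of x s] by (auto simp: indicator_def)
  have L2u: "L2 (u s)" "L2 (v s)" if "s \<in> {0..<T}" for s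
    using C1 that by (auto simp: C1_L2_def C_L2_def)
  have L2q: "L2 (\<lambda>x. (u s x - u t x) / (s - t) - v t x)" if "s \<in> {0..<T}" for s
  proof -
    have "L2 (\<lambda>x. inverse (s - t) * (u s x - u t x) - v t x)"
      by (intro L2_diff L2_cmult L2u that t)
    then show ?thesis by (simp add: divide_inverse mult.commute)
  qed
  \<comment> \<open>\<open>q1\<close> is the differentiation error of \<open>u\<close> in L2,
    \<open>q2\<close> comes from replacing \<theta>(s) by \<theta>(t) next to \<open>v\<close>, and
    \<open>q3\<close> is the differentiation error of \<theta> next to u(t).\<close>
  define q1 where "q1 s = (LINT x|lborel. ((u s x - u t x) / (s - t) - v t x) * \<theta> (s, x))" for s
  define q2 where "q2 s = (LINT x|lborel. v t x * (\<theta> (s, x) - \<theta> (t, x)))" for s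
  define q3 where "q3 s = (LINT x|lborel. u t x * ((\<theta> (s, x) - \<theta> (t, x)) / (s - t) - ?p (t, x)))" for s
  have evS: "\<forall>\<^sub>F s in ?F. s \<in> {0..<T} \<and> s \<noteq> t" by (auto simp: eventually_at_filter)
  have near: "\<forall>\<^sub>F s in ?F. \<bar>s - t\<bar> < d" if "0 < d" for d :: real
    using that by (auto simp: eventually_at dist_real_def intro!: exI[of _ d])
  have 1: "(q1 \<longlongrightarrow> 0) ?F"
  proof (rule Lim_null_comparison)
    show "\<forall>\<^sub>F s in ?F. norm (q1 s) \<le> B * (1 + measure lborel (cball (0::real^'n) M)) / 2 * L2norm (\<lambda>x. (u s x - u t x) / (s - t) - v t x)"
      using evS by eventually_elim (unfold q1_def real_norm_def, rule L2_local(2), use L2q b1 B in auto)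
    show "((\<lambda>s. B * (1 + measure lborel (cball (0::real^'n) M)) / 2 * L2norm (\<lambda>x. (u s x - u t x) / (s - t) - v t x)) \<longlongrightarrow> 0) ?F"
      using C1 t by (intro tendsto_mult_right_zero) (auto simp: C1_L2_def)
  qed
  have 2: "(q2 \<longlongrightarrow> 0) ?F" unfolding q2_def
  proof (rule L2_local_tendsto[where M=M])
    fix e :: real assume "0 < e"
    obtain d where d: "0 < d" "\<And>s x. \<bar>s - t\<bar> < d \<Longrightarrow> \<bar>\<theta> (s, x) - \<theta> (t, x)\<bar> \<le> e * indicator (cball 0 M) x"
      using uniform_slice[OF c(1) _ \<open>0 < e\<close>, of M t] M1 not_less by metis
    show "\<forall>\<^sub>F s in ?F. \<forall>x. \<bar>\<theta> (s, x) - \<theta> (t, x)\<bar> \<le> e * indicator (cball 0 M) x"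
      using near[OF d(1)] by eventually_elim (use d(2) in auto)
  qed (use t L2u in auto)
  have 3: "(q3 \<longlongrightarrow> 0) ?F" unfolding q3_def
  proof (rule L2_local_tendsto[where M=M])
    fix e :: real assume "0 < e"
    obtain d where d: "0 < d" "\<And>s x. \<bar>s - t\<bar> < d \<Longrightarrow> \<bar>?p (s, x) - ?p (t, x)\<bar> \<le> e * indicator (cball 0 M) x"
      using uniform_slice[OF c(2) _ \<open>0 < e\<close>, of M t] M2 not_less by metis
    have "\<bar>(\<theta> (s, x) - \<theta> (t, x)) / (s - t) - ?p (t, x)\<bar> \<le> e * indicator (cball 0 M) x"
      if s: "\<bar>s - t\<bar> < d" "s \<noteq> t" for s x
    proof -
      \<comment> \<open>Subtracting the linear part from \<theta> lets the mean value inequality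
        turn uniform continuity of the time derivative into a bound that is uniform in x.\<close>
      let ?g = "\<lambda>r. \<theta> (r, x) - r * ?p (t, x)"
      have "norm (?g s - ?g t) \<le> e * indicator (cball 0 M) x * norm (s - t)"
      proof (rule field_differentiable_bound[where S="ball t d" and f'="\<lambda>r. ?p (r, x) - ?p (t, x)"])
        show "(?g has_field_derivative ?p (r, x) - ?p (t, x)) (at r within ball t d)" for r
          by (rule has_field_derivative_at_within)
            (auto intro!: derivative_eq_intros pd_time test_function_Ck[OF \<theta>])
      qed (use d s in \<open>auto simp: dist_real_def abs_minus_commute\<close>)
      then have "\<bar>?g s - ?g t\<bar> / \<bar>s - t\<bar> \<le> e * indicator (cball 0 M) x"
        using s by (simp add: field_simps)
      moreover have "(\<theta> (s, x) - \<theta> (t, x)) / (s - t) - ?p (t, x) = (?g s - ?g t) / (s - t)"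
        using s by (simp add: field_simps)
      ultimately show ?thesis by simp
    qed
    then show "\<forall>\<^sub>F s in ?F. \<forall>x. \<bar>(\<theta> (s, x) - \<theta> (t, x)) / (s - t) - ?p (t, x)\<bar> \<le> e * indicator (cball 0 M) x"
      using near[OF d(1)] evS by (intro eventually_mono[OF eventually_conj[OF near[OF d(1)] evS]]) blast
  qed (use t L2u in auto)
  let ?h = "\<lambda>s. LINT x|lborel. u s x * \<theta> (s, x)"
  let ?D = "(LINT x|lborel. v t x * \<theta> (t, x)) + (LINT x|lborel. u t x * ?p (t, x))"
  have i: "integrable lborel (\<lambda>x. w x * \<theta> (s, x))" "integrable lborel (\<lambda>x. w x * ?p (s, x))" if "L2 w" for w s
    by (rule L2_local(1)[OF that _ b1] L2_local(1)[OF that _ b2]; use B B' in simp)+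
  have eq: "q1 s + q2 s + q3 s = (?h s - ?h t) / (s - t) - ?D" if s: "s \<in> {0..<T}" "s \<noteq> t" for s
  proof -
    have "(?h s - ?h t) / (s - t) - ?D = (LINT x|lborel. (u s x * \<theta> (s, x) - u t x * \<theta> (t, x)) / (s - t) - (v t x * \<theta> (t, x) + u t x * ?p (t, x)))"
      using i L2u s t by simp
    also have "\<dots> = (LINT x|lborel. ((u s x - u t x) / (s - t) - v t x) * \<theta> (s, x) + v t x * (\<theta> (s, x) - \<theta> (t, x))
        + u t x * ((\<theta> (s, x) - \<theta> (t, x)) / (s - t) - ?p (t, x)))"
      by (intro Bochner_Integration.integral_cong) (auto simp: divide_inverse algebra_simps)
    also have "\<dots> = q1 s + q2 s + q3 s"
    proof -
      have j1: "integrable lborel (\<lambda>x. ((u s x - u t x) / (s - t) - v t x) * \<theta> (s, x))" by (intro i L2q s)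
      have j2: "integrable lborel (\<lambda>x. v t x * (\<theta> (s, x) - \<theta> (t, x)))"
        using i(1)[OF L2u(2)[OF t], of s] i(1)[OF L2u(2)[OF t], of t] by (simp add: right_diff_distrib)
      have "integrable lborel (\<lambda>x. (u t x * \<theta> (s, x) - u t x * \<theta> (t, x)) / (s - t) - u t x * ?p (t, x))"
        using i[OF L2u(1)[OF t]] by simp
      then have j3: "integrable lborel (\<lambda>x. u t x * ((\<theta> (s, x) - \<theta> (t, x)) / (s - t) - ?p (t, x)))"
        by (simp add: algebra_simps diff_divide_distrib)
      show ?thesis unfolding q1_def q2_def q3_def using j1 j2 j3 by simp
    qed
    finally show ?thesis by simp
  qed
  have "((\<lambda>s. q1 s + q2 s + q3 s) \<longlongrightarrow> 0 + 0 + 0) ?F" by (intro tendsto_add 1 2 3)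
  then have "((\<lambda>s. (?h s - ?h t) / (s - t) - ?D) \<longlongrightarrow> 0) ?F"
    by (rule_tac Lim_transform_eventually[of "\<lambda>s. q1 s + q2 s + q3 s"]) (use evS eq in \<open>auto elim!: eventually_mono\<close>)
  then show ?thesis unfolding has_field_derivative_iff by (rule LIM_zero_cancel)
qed

section \<open>The space-time form of the weak equation\<close>

lemma Ck_fst: "Ck k (\<lambda>z::real \<times> (real^'n). fst z)"
  by (rule Ck_bounded_linear) (rule bounded_linear_fst)

text \<open>Write |x|^2 as |z|^2 - t^2 for z = (t, x), since \<open>Ck_norm2\<close> concerns the
  norm of the whole space.\<close>

lemma Ck_snd_norm2: "Ck k (\<lambda>z::real \<times> (real^'n). c + d * (snd z \<bullet> snd z))"
proof -
  have "Ck k (\<lambda>z::real \<times> (real^'n). (c + d * ((z - 0) \<bullet> (z - 0))) + (- d) * (fst z * fst z))"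
    by (intro Ck_add Ck_mult Ck_norm2 Ck_fst Ck_const)
  moreover have "(c + d * ((z - 0) \<bullet> (z - 0))) + (- d) * (fst z * fst z) = c + d * (snd z \<bullet> snd z)"
    for z :: "real \<times> (real^'n)"
    by (simp add: inner_prod_def algebra_simps)
  ultimately show ?thesis by (simp only:)
qed

text \<open>The lower bound holds on a compact set that reaches down to t = 0. Testing with such a
  function therefore controls |u|^p up to the initial time, where the local condition on the open
  strip is silent.\<close>

lemma positive_test_function:
  fixes T1 T M :: real
  assumes "0 \<le> T1" "T1 < T" "0 \<le> M"
  obtains \<Psi> :: "real \<times> (real^'n) \<Rightarrow> real" and c where "test_function ({..<T} \<times> UNIV) \<Psi>" "\<And>z. 0 \<le> \<Psi> z" "0 < c"
    "\<And>t x. 0 \<le> t \<Longrightarrow> t \<le> T1 \<Longrightarrow> norm x \<le> M \<Longrightarrow> c \<le> \<Psi> (t, x)"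
proof -
  define T2 where "T2 = (T1 + T) / 2"
  define \<Psi> :: "real \<times> (real^'n) \<Rightarrow> real" where
    "\<Psi> z = flat 0 (T2 + (-1) * fst z) * (flat 0 (1 + fst z) * flat 0 ((M+1)\<^sup>2 + (-1) * (snd z \<bullet> snd z)))" for z
  have C: "Ck k \<Psi>" for k
    unfolding \<Psi>_def
    by (intro Ck_mult Ck_comp[where H=flat, OF flat_deriv] Ck_add Ck_const Ck_fst Ck_snd_norm2)
  have z: "\<Psi> z = 0" if "z \<notin> {-1..T2} \<times> cball 0 (M + 1)" for z
  proof -
    obtain t x where zz: "z = (t, x)" by (cases z)
    have "T2 < t \<or> t < -1 \<or> M + 1 < norm x" using that by (auto simp: zz not_le)
    then consider "T2 \<le> t" | "t \<le> -1" | "(M+1)\<^sup>2 \<le> x \<bullet> x"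
      using assms(3) power_mono[of "M+1" "norm x" 2] unfolding dot_square_norm by linarith
    then show ?thesis by cases (auto simp: \<Psi>_def zz flat_0)
  qed
  have pos: "0 < \<Psi> z" if z: "z \<in> {0..T1} \<times> cball 0 M" for z
  proof -
    have "snd z \<bullet> snd z \<le> M\<^sup>2" using power_mono[of "norm (snd z)" M 2] z by (auto simp: dot_square_norm)
    also have "\<dots> < (M+1)\<^sup>2" using assms(3) by (simp add: power2_eq_square algebra_simps)
    finally show ?thesis using assms z unfolding \<Psi>_def by (intro mult_pos_pos flat_pos) (auto simp: T2_def)
  qed
  have "\<exists>c>0. \<forall>z\<in>{0..T1} \<times> cball 0 M. c \<le> \<Psi> z"
  proof -
    have "compact ({0..T1} \<times> cball (0::real^'n) M)" by (intro compact_Times) auto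
    moreover have "(0, 0) \<in> {0..T1} \<times> cball (0::real^'n) M" using assms by auto
    moreover have "continuous_on ({0..T1} \<times> cball (0::real^'n) M) \<Psi>"
      by (rule continuous_on_subset[OF Ck_continuous[OF C[of 0]]]) simp
    ultimately show ?thesis using continuous_attains_inf[of "{0..T1} \<times> cball (0::real^'n) M" \<Psi>] pos by blast
  qed
  then obtain c where "0 < c" "\<And>z. z \<in> {0..T1} \<times> cball 0 M \<Longrightarrow> c \<le> \<Psi> z" by auto
  moreover have "test_function ({..<T} \<times> UNIV) \<Psi>"
    by (rule test_function_intro[OF C _ _ z]) (use assms in \<open>auto intro!: compact_Times simp: T2_def\<close>)
  ultimately show thesis by (intro that[of \<Psi> c]) (auto simp: \<Psi>_def flat_nonneg)
qed

lemma damping_bounds: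
  assumes "0 \<le> \<mu>" "0 \<le> \<beta>"
  shows "0 \<le> damping \<mu> \<beta> x" "damping \<mu> \<beta> x \<le> \<mu>" "damping \<mu> \<beta> \<in> borel_measurable borel"
proof -
  have "1 \<le> (1 + norm x) powr \<beta>" using assms by (intro ge_one_powr_ge_zero) auto
  then show "damping \<mu> \<beta> x \<le> \<mu>" using assms(1) mult_left_mono[of 1 "(1 + norm x) powr \<beta>" \<mu>] by (simp add: damping_def divide_le_eq)
  show "damping \<mu> \<beta> \<in> borel_measurable borel" unfolding damping_def[abs_def] by measurable
qed (use assms in \<open>auto simp: damping_def\<close>)

lemma borel_measurable_fst_snd [measurable]:
  "(fst :: real \<times> (real^'n) \<Rightarrow> real) \<in> borel_measurable borel"
  "(snd :: real \<times> (real^'n) \<Rightarrow> real^'n) \<in> borel_measurable borel"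
  by (auto intro!: borel_measurable_continuous_onI continuous_intros)

text \<open>One solution together with a witness \<open>v\<close> for its time derivative, so that
  the weak equation is at hand as a rule for every test function.\<close>

locale energy =
  fixes \<mu> \<beta> p \<epsilon> T :: real and f g :: "real^'n \<Rightarrow> real" and u v :: "real \<Rightarrow> real^'n \<Rightarrow> real"
  assumes T: "0 < T" and p: "1 \<le> p" and \<mu>: "0 \<le> \<mu>" and \<beta>: "0 \<le> \<beta>"
    and CH: "C_H1 T u" and LP: "Lp_loc p ({0<..<T} \<times> UNIV) (\<lambda>(t, x). u t x)" and C1: "C1_L2 T u v"
    and init: "AE x in lborel. u 0 x = \<epsilon> * f x"
    and L2f: "L2 f" and L2g: "L2 g"
    and weak: "test_function ({..<T} \<times> UNIV) \<Psi> \<Longrightarrow>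
      st_convergent T (\<lambda>t x. \<bar>u t x\<bar> powr p * \<Psi> (t, x)) \<and>
      st_convergent T (\<lambda>t x. v t x * deriv (\<lambda>s. \<Psi> (s, x)) t) \<and>
      \<epsilon> * (LINT x|lborel. g x * \<Psi> (0, x))
        + \<epsilon> * (LINT x|lborel. damping \<mu> \<beta> x * f x * \<Psi> (0, x))
        + st_integral T (\<lambda>t x. \<bar>u t x\<bar> powr p * \<Psi> (t, x))
      = - st_integral T (\<lambda>t x. v t x * deriv (\<lambda>s. \<Psi> (s, x)) t)
        + st_integral T (\<lambda>t x. weak_grad (u t) x \<bullet> grad (\<lambda>y. \<Psi> (t, y)) x)
        - st_integral T (\<lambda>t x. damping \<mu> \<beta> x * u t x * deriv (\<lambda>s. \<Psi> (s, x)) t)"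
begin

abbreviation U where "U \<equiv> spacetime T u"
abbreviation a where "a \<equiv> (damping \<mu> \<beta> :: real^'n \<Rightarrow> real)"

lemma U_measurable[measurable]: "U \<in> borel_measurable borel"
  using LP by (simp add: Lp_loc_def set_borel_measurable_def spacetime_def[abs_def] split_beta)

lemma a_measurable[measurable]: "a \<in> borel_measurable borel"
  by (rule damping_bounds[OF \<mu> \<beta>])

lemma spacetime_mult: "spacetime T (\<lambda>t x. u t x * \<omega> (t, x)) = (\<lambda>z. U z * \<omega> z)"
  by (auto simp: spacetime_def)

lemma spacetime_powr_mult: "spacetime T (\<lambda>t x. \<bar>u t x\<bar> powr p * \<omega> (t, x)) = (\<lambda>z. \<bar>U z\<bar> powr p * \<omega> z)"
  using p by (auto simp: spacetime_def indicator_def)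

text \<open>The weak equation contains the convergence of the integral of |u|^p against any test
  function. A nonnegative one that is bounded below on the set in question gives the claim.\<close>

lemma U_powr_local:
  assumes "0 \<le> T1" "T1 < T" "0 \<le> M"
  shows "integrable lborel (\<lambda>z. indicator ({..T1} \<times> cball 0 M) z * \<bar>U z\<bar> powr p)"
proof -
  obtain \<Psi> :: "real \<times> (real^'n) \<Rightarrow> real" and c where \<Psi>: "test_function ({..<T} \<times> UNIV) \<Psi>" "\<And>z. 0 \<le> \<Psi> z" "0 < c"
    "\<And>t x. 0 \<le> t \<Longrightarrow> t \<le> T1 \<Longrightarrow> norm x \<le> M \<Longrightarrow> c \<le> \<Psi> (t, x)"
    by (rule positive_test_function[OF assms]) blast
  have [measurable]: "{..T1} \<times> cball (0::real^'n) M \<in> sets borel" by (intro borel_closed closed_Times) auto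
  have [measurable]: "\<Psi> \<in> borel_measurable borel"
    using Ck_continuous[OF test_function_Ck[OF \<Psi>(1)]] by (rule borel_measurable_continuous_onI)
  have "integrable lborel (spacetime T (\<lambda>t x. \<bar>u t x\<bar> powr p * \<Psi> (t, x)))"
  proof (rule spacetime_integrable_nonneg)
    show "st_convergent T (\<lambda>t x. \<bar>u t x\<bar> powr p * \<Psi> (t, x))" using weak[OF \<Psi>(1)] by blast
    show "spacetime T (\<lambda>t x. \<bar>u t x\<bar> powr p * \<Psi> (t, x)) \<in> borel_measurable borel"
      unfolding spacetime_powr_mult by measurable
  qed (use \<Psi>(2) in auto)
  then have i: "integrable lborel (\<lambda>z. inverse c * (\<bar>U z\<bar> powr p * \<Psi> z))" unfolding spacetime_powr_mult by simp
  show ?thesis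
  proof (rule Bochner_Integration.integrable_bound[OF i])
    show "AE z in lborel. norm (indicator ({..T1} \<times> cball 0 M) z * \<bar>U z\<bar> powr p) \<le> norm (inverse c * (\<bar>U z\<bar> powr p * \<Psi> z))"
    proof (rule AE_I2)
      fix z
      show "norm (indicator ({..T1} \<times> cball 0 M) z * \<bar>U z\<bar> powr p) \<le> norm (inverse c * (\<bar>U z\<bar> powr p * \<Psi> z))"
      proof (cases "z \<in> {0..T1} \<times> cball 0 M")
        case True
        then have "1 \<le> inverse c * \<Psi> z" using \<Psi>(3) \<Psi>(4)[of "fst z" "snd z"] by (auto simp: field_simps)
        then have "\<bar>U z\<bar> powr p * 1 \<le> \<bar>U z\<bar> powr p * (inverse c * \<Psi> z)" by (intro mult_left_mono) auto
        then show ?thesis using \<Psi>(2)[of z] \<Psi>(3) True by (auto simp: abs_mult indicator_def mult_ac)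
      next
        case False
        then have "z \<notin> {..T1} \<times> cball 0 M \<or> U z = 0" by (auto simp: spacetime_def indicator_def mem_Times_iff)
        then show ?thesis using p by auto
      qed
    qed
  qed (intro borel_measurable_times borel_measurable_indicator, measurable)
qed

text \<open>The linear term is reduced to the nonlinear one by |U| <= |U|^p + 1 on a bounded set.
  Conditions on the weight are imposed for positive times only, because \<open>U\<close> vanishes
  elsewhere.\<close>

lemma U_integrable:
  assumes [measurable]: "\<omega> \<in> borel_measurable borel" and T1: "T1 < T"
    and \<omega>: "\<And>z. 0 < fst z \<Longrightarrow> \<bar>\<omega> z\<bar> \<le> B" "\<And>z. 0 < fst z \<Longrightarrow> T1 < fst z \<or> M < norm (snd z) \<Longrightarrow> \<omega> z = 0"
  shows "integrable lborel (\<lambda>z. U z * \<omega> z)" "integrable lborel (\<lambda>z. \<bar>U z\<bar> powr p * \<omega> z)"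
proof -
  define T2 M2 where "T2 = max 0 T1" and "M2 = max 0 M"
  have T2: "0 \<le> T2" "T2 < T" "0 \<le> M2" using T T1 by (auto simp: T2_def M2_def)
  let ?I = "indicator ({..T2} \<times> cball 0 M2) :: real \<times> (real^'n) \<Rightarrow> real"
  let ?J = "indicator ({0..T2} \<times> cball 0 M2) :: real \<times> (real^'n) \<Rightarrow> real"
  have i1: "integrable lborel (\<lambda>z. ?I z * \<bar>U z\<bar> powr p)" by (rule U_powr_local[OF T2])
  have i2: "integrable lborel ?J"
    using emeasure_bounded_finite[OF bounded_Times[OF bounded_closed_interval bounded_cball], of 0 T2 "0::real^'n" M2]
    by (intro integrable_real_indicator) (auto intro!: bounded_Times borel_closed closed_Times)
  have i3: "integrable lborel (\<lambda>z. B * (?I z * \<bar>U z\<bar> powr p))" "integrable lborel (\<lambda>z. B * (?I z * \<bar>U z\<bar> powr p + ?J z))"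
    using i1 i2 by auto
  have b1: "\<bar>\<omega> z\<bar> * \<bar>U z\<bar> powr p \<le> B * (?I z * \<bar>U z\<bar> powr p)"
    "\<bar>\<omega> z\<bar> * \<bar>U z\<bar> \<le> B * (?I z * \<bar>U z\<bar> powr p + ?J z)" for z
  proof -
    consider "fst z \<le> 0" | "0 < fst z" "T1 < fst z \<or> M < norm (snd z)" | "0 < fst z" "fst z \<le> T1" "norm (snd z) \<le> M" by linarith
    then have "\<bar>\<omega> z\<bar> * \<bar>U z\<bar> powr p \<le> B * (?I z * \<bar>U z\<bar> powr p) \<and> \<bar>\<omega> z\<bar> * \<bar>U z\<bar> \<le> B * (?I z * \<bar>U z\<bar> powr p + ?J z)"
    proof cases
      case 1
      then have "U z = 0" by (auto simp: spacetime_def indicator_def mem_Times_iff)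
      moreover have "0 \<le> B" using \<omega>(1)[of "(1, 0)"] by auto
      ultimately show ?thesis using p by auto
    next
      case 2
      moreover have "0 \<le> B" using \<omega>(1)[of "(1, 0)"] by auto
      ultimately show ?thesis using \<omega>(2)[OF 2] by auto
    next
      case 3
      then have z: "z \<in> {0..T2} \<times> cball 0 M2" by (auto simp: T2_def M2_def mem_Times_iff)
      have "\<bar>U z\<bar> \<le> \<bar>U z\<bar> powr p + 1"
      proof (cases "\<bar>U z\<bar> \<le> 1")
        case False
        then show ?thesis using powr_mono[of 1 p "\<bar>U z\<bar>"] p by simp
      qed (simp add: add_increasing)
      then have "\<bar>\<omega> z\<bar> * \<bar>U z\<bar> \<le> B * (\<bar>U z\<bar> powr p + 1)" "\<bar>\<omega> z\<bar> * \<bar>U z\<bar> powr p \<le> B * \<bar>U z\<bar> powr p"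
        using \<omega>(1)[OF 3(1)] by (auto intro!: mult_mono)
      then show ?thesis using z by (auto simp: indicator_def mem_Times_iff)
    qed
    then show "\<bar>\<omega> z\<bar> * \<bar>U z\<bar> powr p \<le> B * (?I z * \<bar>U z\<bar> powr p)"
      "\<bar>\<omega> z\<bar> * \<bar>U z\<bar> \<le> B * (?I z * \<bar>U z\<bar> powr p + ?J z)" by blast+
  qed
  show "integrable lborel (\<lambda>z. U z * \<omega> z)"
  proof (rule Bochner_Integration.integrable_bound[OF i3(2)])
    show "AE z in lborel. norm (U z * \<omega> z) \<le> norm (B * (?I z * \<bar>U z\<bar> powr p + ?J z))"
      using order_trans[OF b1(2) abs_ge_self] by (auto simp: abs_mult mult.commute simp del: abs_mult_self_eq)
  qed measurable
  show "integrable lborel (\<lambda>z. \<bar>U z\<bar> powr p * \<omega> z)"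
  proof (rule Bochner_Integration.integrable_bound[OF i3(1)])
    show "AE z in lborel. norm (\<bar>U z\<bar> powr p * \<omega> z) \<le> norm (B * (?I z * \<bar>U z\<bar> powr p))"
      using order_trans[OF b1(1) abs_ge_self] by (auto simp: abs_mult mult.commute)
  qed measurable
qed

lemma U_integrable_test:
  assumes "test_function ({..<T} \<times> UNIV) \<omega>" "bounded (range k)" and [measurable]: "k \<in> borel_measurable borel"
  shows "integrable lborel (\<lambda>z. U z * (k z * \<omega> z))" "integrable lborel (\<lambda>z. \<bar>U z\<bar> powr p * (k z * \<omega> z))"
proof -
  obtain T1 M where TM: "0 \<le> T1" "T1 < T" "0 < M" "\<And>t x. \<omega> (t, x) \<noteq> 0 \<Longrightarrow> t < T1 \<and> norm x \<le> M"
    by (rule test_function_support[OF assms(1) T]) blast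
  obtain B where B: "0 < B" "\<And>z. \<bar>\<omega> z\<bar> \<le> B" by (rule test_function_bounded[OF assms(1)]) auto
  obtain K where K: "0 < K" "\<And>z. \<bar>k z\<bar> \<le> K" using assms(2) by (auto simp: bounded_pos)
  have [measurable]: "\<omega> \<in> borel_measurable borel"
    using Ck_continuous[OF test_function_Ck[OF assms(1)]] by (rule borel_measurable_continuous_onI)
  have b: "\<bar>k z * \<omega> z\<bar> \<le> K * B" for z unfolding abs_mult by (rule mult_mono) (use B K in \<open>auto intro: less_imp_le\<close>)
  have c: "k z * \<omega> z = 0" if "T1 < fst z \<or> M < norm (snd z)" for z
    using TM(4)[of "fst z" "snd z"] that by auto
  show "integrable lborel (\<lambda>z. U z * (k z * \<omega> z))" "integrable lborel (\<lambda>z. \<bar>U z\<bar> powr p * (k z * \<omega> z))"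
    by (rule U_integrable[OF _ TM(2) b c]; (measurable | simp))+
qed

text \<open>Integrate the derivative of the pairing of u(t) with \<theta>(t) over [0, T1], where
  \<theta> vanishes at T1. The boundary value at 0 is the initial datum \<epsilon> f.\<close>

lemma time_by_parts:
  assumes \<theta>: "test_function ({..<T} \<times> UNIV) \<theta>"
    and conv: "st_convergent T (\<lambda>t x. v t x * \<theta> (t, x))"
  shows "st_integral T (\<lambda>t x. v t x * \<theta> (t, x)) = - (\<epsilon> * (LINT x|lborel. f x * \<theta> (0, x))) - (LINT z|lborel. U z * pd (1, 0) \<theta> z)"
proof -
  let ?p = "pd (1, 0) \<theta>"
  have p: "test_function ({..<T} \<times> UNIV) ?p" by (rule test_function_pd[OF \<theta> Basis_pair(1)])
  obtain T1 M where TM: "0 \<le> T1" "T1 < T" "0 < M" "\<And>t x. \<theta> (t, x) \<noteq> 0 \<Longrightarrow> t < T1 \<and> norm x \<le> M"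
    by (rule test_function_support[OF \<theta> T]) blast
  have z: "\<theta> (t, x) = 0" if "T1 \<le> t" for t x using TM(4)[of t x] that by force
  have zp: "?p (t, x) = 0" if "T1 < t" for t x
    by (rule pd_supp[where S="{T1<..} \<times> UNIV"]) (use that z in \<open>auto intro!: open_Times\<close>)
  define A where "A t = (LINT x|lborel. v t x * \<theta> (t, x))" for t
  define B where "B t = (LINT x|lborel. u t x * ?p (t, x))" for t
  define h where "h t = (LINT x|lborel. u t x * \<theta> (t, x))" for t
  have "(A has_integral X) {0..T1}" if "X = st_integral T (\<lambda>t x. v t x * \<theta> (t, x))" for X
  proof -
    have s: "set_integrable lborel {0..<T} A" using conv by (simp add: st_convergent_def A_def[abs_def])
    have s': "set_integrable lborel {0..T1} A" by (rule set_integrable_subset[OF s]) (use TM in auto)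
    have "(LINT t:{0..<T}|lborel. A t) = (LINT t:{0..T1}|lborel. A t)"
      unfolding set_lebesgue_integral_def
      by (rule Bochner_Integration.integral_cong) (use TM in \<open>auto simp: indicator_def A_def z\<close>)
    then show ?thesis using set_borel_integral_eq_integral[OF s'] that
      by (simp add: st_integral_def A_def[abs_def] has_integral_iff)
  qed
  moreover have "(B has_integral (LINT z|lborel. U z * ?p z)) {0..T1}"
  proof -
    have i: "integrable lborel (spacetime T (\<lambda>t x. u t x * ?p (t, x)))"
      unfolding spacetime_mult using U_integrable_test(1)[OF p, of "\<lambda>_. 1"] by simp
    have s: "set_integrable lborel {0..<T} B" unfolding B_def[abs_def] by (rule st_integral_eq(2)[OF i])
    have s': "set_integrable lborel {0..T1} B" by (rule set_integrable_subset[OF s]) (use TM in auto)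
    have "(LINT t:{0..<T}|lborel. B t) = (LINT t:{0..T1}|lborel. B t)"
      unfolding set_lebesgue_integral_def
      by (rule Bochner_Integration.integral_cong) (use TM in \<open>auto simp: indicator_def B_def zp\<close>)
    then show ?thesis using set_borel_integral_eq_integral[OF s'] st_integral_eq(1)[OF i]
      by (simp add: st_integral_def B_def[abs_def] spacetime_mult has_integral_iff)
  qed
  ultimately have "((\<lambda>t. A t + B t) has_integral (st_integral T (\<lambda>t x. v t x * \<theta> (t, x)) + (LINT z|lborel. U z * ?p z))) {0..T1}"
    by (intro has_integral_add) auto
  moreover have "((\<lambda>t. A t + B t) has_integral (h T1 - h 0)) {0..T1}"
  proof (rule fundamental_theorem_of_calculus[OF TM(1)])
    fix t assume t: "t \<in> {0..T1}"
    then have "t \<in> {0..<T}" using TM by auto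
    from pairing_has_derivative[OF C1 \<theta> this]
    have "(h has_vector_derivative (A t + B t)) (at t within {0..<T})"
      by (simp add: h_def[abs_def] A_def B_def has_real_derivative_iff_has_vector_derivative)
    then show "(h has_vector_derivative (A t + B t)) (at t within {0..T1})"
      by (rule has_vector_derivative_within_subset) (use TM in auto)
  qed
  ultimately have "st_integral T (\<lambda>t x. v t x * \<theta> (t, x)) + (LINT z|lborel. U z * ?p z) = h T1 - h 0"
    by (rule has_integral_unique)
  moreover have "h T1 = 0" by (simp add: h_def z)
  moreover have "h 0 = \<epsilon> * (LINT x|lborel. f x * \<theta> (0, x))"
  proof -
    have [measurable]: "u 0 \<in> borel_measurable borel" "f \<in> borel_measurable borel" "(\<lambda>x. \<theta> (0, x)) \<in> borel_measurable borel"
      using C1 T L2f continuous_slice[OF Ck_continuous[OF test_function_Ck[OF \<theta>]]]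
      by (auto simp: C1_L2_def C_L2_def L2_def intro: borel_measurable_continuous_onI)
    have "h 0 = (LINT x|lborel. \<epsilon> * (f x * \<theta> (0, x)))"
      unfolding h_def by (rule integral_cong_AE, measurable) (use init in \<open>eventually_elim, simp\<close>)
    then show ?thesis by simp
  qed
  ultimately show ?thesis by simp
qed

text \<open>On each time slice this is the definition of the weak gradient, applied to the first
  spatial derivatives of \<Psi>; the slices are then assembled by Fubini.\<close>

lemma grad_by_parts:
  assumes \<Psi>: "test_function ({..<T} \<times> UNIV) \<Psi>"
  shows "st_integral T (\<lambda>t x. weak_grad (u t) x \<bullet> grad (\<lambda>y. \<Psi> (t, y)) x) = - (LINT z|lborel. U z * (\<Sum>i\<in>UNIV. pd (0, axis i 1) (pd (0, axis i 1) \<Psi>) z))"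
proof -
  let ?d = "\<lambda>i. pd (0, axis i 1) \<Psi>" and ?dd = "\<lambda>i. pd (0, axis i 1) (pd (0, axis i 1) \<Psi>)"
  have d: "test_function ({..<T} \<times> UNIV) (?d i)" for i by (rule test_function_pd[OF \<Psi> Basis_pair(2)])
  have dd: "test_function ({..<T} \<times> UNIV) (?dd i)" for i by (rule test_function_pd[OF d Basis_pair(2)])
  have ck: "Ck (Suc 0) \<Psi>" "Ck (Suc 0) (?d i)" for i using test_function_Ck \<Psi> d by blast+
  have slice: "(LINT x|lborel. weak_grad (u t) x \<bullet> grad (\<lambda>y. \<Psi> (t, y)) x) = - (LINT x|lborel. u t x * (\<Sum>i\<in>UNIV. ?dd i (t, x)))"
    if t: "t \<in> {0..<T}" for t
  proof -
    have H: "H1 (u t)" using CH t by (auto simp: C_H1_def)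
    then have G: "L2 (weak_grad (u t)) \<and> is_weak_grad (u t) (weak_grad (u t))"
      unfolding weak_grad_def H1_def by (metis (mono_tags, lifting) someI_ex)
    have tf: "test_function UNIV (\<lambda>x. ?d i (t, x))" "test_function UNIV (\<lambda>x. ?dd i (t, x))" for i
      by (rule test_function_slice[OF d] test_function_slice[OF dd])+
    have L2G: "L2 (\<lambda>x. weak_grad (u t) x $ i)" for i
    proof -
      have [measurable]: "weak_grad (u t) \<in> borel_measurable borel" and i: "integrable lborel (\<lambda>x. (norm (weak_grad (u t) x))\<^sup>2)"
        using G by (auto simp: L2_def)
      have [measurable]: "(\<lambda>x. weak_grad (u t) x $ i) \<in> borel_measurable borel"
        by (rule measurable_compose[OF \<open>weak_grad (u t) \<in> borel_measurable borel\<close>]) (intro borel_measurable_continuous_onI continuous_intros)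
      have le: "(weak_grad (u t) x $ i)\<^sup>2 \<le> (norm (weak_grad (u t) x))\<^sup>2" for x
        using power_mono[OF component_le_norm_cart[of "weak_grad (u t) x" i], of 2] by simp
      show ?thesis unfolding L2_def
        by (auto intro!: Bochner_Integration.integrable_bound[OF i] le)
    qed
    have loc: "integrable lborel (\<lambda>x. w x * \<theta> x)" if w: "L2 w" and \<theta>: "test_function UNIV \<theta>" for w \<theta> :: "real^'n \<Rightarrow> real"
    proof -
      obtain B where B: "0 < B" "\<And>z. \<bar>\<theta> z\<bar> \<le> B" by (rule test_function_bounded[OF \<theta>]) auto
      have "bounded (closure {x. \<theta> x \<noteq> 0})" using \<theta> by (auto simp: test_function_def intro: compact_imp_bounded)
      then obtain M where M: "\<And>x. x \<in> closure {x. \<theta> x \<noteq> 0} \<Longrightarrow> norm x \<le> M" by (meson bounded_pos)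
      have "\<bar>\<theta> x\<bar> \<le> B * indicator (cball 0 M) x" for x
        using M[of x] B closure_subset[of "{x. \<theta> x \<noteq> 0}"] by (auto simp: indicator_def)
      then show ?thesis using w \<theta> B
        by (intro L2_local(1)[where B=B and M=M])
          (auto intro!: borel_measurable_continuous_onI Ck_continuous[OF test_function_Ck[OF \<theta>]])
    qed
    have "(LINT x|lborel. weak_grad (u t) x \<bullet> grad (\<lambda>y. \<Psi> (t, y)) x) = (LINT x|lborel. (\<Sum>i\<in>UNIV. weak_grad (u t) x $ i * ?d i (t, x)))"
      by (simp add: inner_vec_def grad_slice[OF ck(1)])
    also have "\<dots> = (\<Sum>i\<in>UNIV. LINT x|lborel. weak_grad (u t) x $ i * ?d i (t, x))"
      by (intro Bochner_Integration.integral_sum loc L2G tf)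
    also have "\<dots> = (\<Sum>i\<in>UNIV. - (LINT x|lborel. u t x * ?dd i (t, x)))"
    proof (rule sum.cong[OF refl])
      fix i
      have "(LINT x|lborel. u t x * grad (\<lambda>x. ?d i (t, x)) x $ i) = - (LINT x|lborel. weak_grad (u t) x $ i * ?d i (t, x))"
        using G tf(1)[of i] unfolding is_weak_grad_def by blast
      then show "(LINT x|lborel. weak_grad (u t) x $ i * ?d i (t, x)) = - (LINT x|lborel. u t x * ?dd i (t, x))"
        by (simp add: grad_slice[OF ck(2)])
    qed
    also have "\<dots> = - (LINT x|lborel. (\<Sum>i\<in>UNIV. u t x * ?dd i (t, x)))"
    proof -
      have "L2 (u t)" using C1 t by (auto simp: C1_L2_def C_L2_def)
      then have "(LINT x|lborel. (\<Sum>i\<in>UNIV. u t x * ?dd i (t, x))) = (\<Sum>i\<in>UNIV. (LINT x|lborel. u t x * ?dd i (t, x)))"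
        by (intro Bochner_Integration.integral_sum loc tf)
      then show ?thesis by (simp add: sum_negf)
    qed
    finally show ?thesis by (simp add: sum_distrib_left)
  qed
  have "integrable lborel (\<lambda>z. (\<Sum>i\<in>UNIV. U z * ?dd i z))"
    using U_integrable_test(1)[OF dd, of "\<lambda>_. 1"] by (intro Bochner_Integration.integrable_sum) simp
  then have i: "integrable lborel (spacetime T (\<lambda>t x. u t x * (\<Sum>i\<in>UNIV. ?dd i (t, x))))"
    unfolding spacetime_mult[of "\<lambda>z. (\<Sum>i\<in>UNIV. ?dd i z)"] by (simp add: sum_distrib_left)
  have "st_integral T (\<lambda>t x. weak_grad (u t) x \<bullet> grad (\<lambda>y. \<Psi> (t, y)) x) = - st_integral T (\<lambda>t x. u t x * (\<Sum>i\<in>UNIV. ?dd i (t, x)))"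
    unfolding st_integral_def set_lebesgue_integral_def Bochner_Integration.integral_minus[symmetric]
    by (rule Bochner_Integration.integral_cong) (auto simp: indicator_def slice)
  also have "\<dots> = - (LINT z|lborel. U z * (\<Sum>i\<in>UNIV. ?dd i z))"
    by (subst st_integral_eq(1)[OF i]) (simp only: spacetime_mult[of "\<lambda>z. (\<Sum>i\<in>UNIV. ?dd i z)"])
  finally show ?thesis .
qed

text \<open>Applying \<open>time_by_parts\<close> to the time derivative of \<Psi> produces the
  boundary term in \<open>f\<close>. Afterwards neither \<open>v\<close> nor the weak gradient
  occurs on the space-time side, so limits of test functions can be taken by dominated
  convergence.\<close>

lemma weak_test:
  assumes \<Psi>: "test_function ({..<T} \<times> UNIV) \<Psi>"
  shows "\<epsilon> * (LINT x|lborel. g x * \<Psi> (0, x)) + \<epsilon> * (LINT x|lborel. a x * f x * \<Psi> (0, x))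
      - \<epsilon> * (LINT x|lborel. f x * pd (1, 0) \<Psi> (0, x)) + (LINT z|lborel. \<bar>U z\<bar> powr p * \<Psi> z)
    = (LINT z|lborel. U z * (pd (1, 0) (pd (1, 0) \<Psi>) z - (\<Sum>i\<in>UNIV. pd (0, axis i 1) (pd (0, axis i 1) \<Psi>) z) - a (snd z) * pd (1, 0) \<Psi> z))"
proof -
  let ?p = "pd (1, 0) \<Psi>"
  let ?dd = "\<lambda>i. pd (0, axis i 1) (pd (0, axis i 1) \<Psi>)"
  have ck: "Ck (Suc 0) \<Psi>" by (rule test_function_Ck[OF \<Psi>])
  have der: "deriv (\<lambda>s. \<Psi> (s, x)) t = ?p (t, x)" for t x
    by (rule DERIV_imp_deriv[OF pd_time[OF ck]])
  have p': "test_function ({..<T} \<times> UNIV) ?p" by (rule test_function_pd[OF \<Psi> Basis_pair(1)])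
  have pp: "test_function ({..<T} \<times> UNIV) (pd (1, 0) ?p)" by (rule test_function_pd[OF p' Basis_pair(1)])
  have dd: "test_function ({..<T} \<times> UNIV) (?dd i)" for i by (intro test_function_pd \<Psi> Basis_pair(2))
  note w = weak[OF \<Psi>, unfolded der]
  have bd: "bounded (range (\<lambda>z::real \<times> (real^'n). a (snd z)))"
  proof -
    have "\<bar>a x\<bar> \<le> \<mu>" for x using damping_bounds(1,2)[OF \<mu> \<beta>, of x] by simp
    then show ?thesis unfolding bounded_iff by (intro exI[of _ \<mu>]) auto
  qed
  have i0: "integrable lborel (spacetime T (\<lambda>t x. \<bar>u t x\<bar> powr p * \<Psi> (t, x)))"
    unfolding spacetime_powr_mult using U_integrable_test(2)[OF \<Psi>, of "\<lambda>_. 1"] by simp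
  have i3: "integrable lborel (\<lambda>z. U z * (a (snd z) * ?p z))"
    by (rule U_integrable_test(1)[OF p' bd]) (rule measurable_compose[OF borel_measurable_fst_snd(2) a_measurable])
  have i3': "spacetime T (\<lambda>t x. a x * u t x * ?p (t, x)) = (\<lambda>z. U z * (a (snd z) * ?p z))"
    by (auto simp: spacetime_def)
  have e3: "st_integral T (\<lambda>t x. a x * u t x * ?p (t, x)) = (LINT z|lborel. U z * (a (snd z) * ?p z))"
    by (subst st_integral_eq(1)) (simp_all add: i3' i3)
  have e0: "st_integral T (\<lambda>t x. \<bar>u t x\<bar> powr p * \<Psi> (t, x)) = (LINT z|lborel. \<bar>U z\<bar> powr p * \<Psi> z)"
    using st_integral_eq(1)[OF i0] by (simp add: spacetime_powr_mult)
  have e1: "st_integral T (\<lambda>t x. v t x * ?p (t, x)) = - (\<epsilon> * (LINT x|lborel. f x * ?p (0, x))) - (LINT z|lborel. U z * pd (1, 0) ?p z)"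
    by (rule time_by_parts[OF p']) (use w in blast)
  have i1: "integrable lborel (\<lambda>z. U z * pd (1, 0) ?p z)"
    using U_integrable_test(1)[OF pp, of "\<lambda>_. 1"] by simp
  have i2: "integrable lborel (\<lambda>z. U z * (\<Sum>i\<in>UNIV. ?dd i z))"
    unfolding sum_distrib_left using U_integrable_test(1)[OF dd, of "\<lambda>_. 1"] by (intro Bochner_Integration.integrable_sum) simp
  have "(LINT z|lborel. U z * (pd (1, 0) ?p z - (\<Sum>i\<in>UNIV. ?dd i z) - a (snd z) * ?p z))
    = (LINT z|lborel. U z * pd (1, 0) ?p z) - (LINT z|lborel. U z * (\<Sum>i\<in>UNIV. ?dd i z)) - (LINT z|lborel. U z * (a (snd z) * ?p z))"
    unfolding right_diff_distrib using i1 i2 i3 by simp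
  then show ?thesis using w by (simp add: e0 e1 e3 grad_by_parts[OF \<Psi>])
qed

end

section \<open>Twice differentiable test functions\<close>

text \<open>The convolution is smooth, so its partial derivative can be read off along a line, where
  \<open>conv_directional_derivative\<close> moves it onto \<open>F\<close>. The support of
  \<open>F\<close> gives the smoothness, that of the kernel the line derivative.\<close>

lemma pd_conv:
  fixes F :: "'a::euclidean_space \<Rightarrow> real"
  assumes F: "continuous_on UNIV F" "continuous_on UNIV D" "compact K" "\<And>z. z \<notin> K \<Longrightarrow> F z = 0"
    and der: "\<And>z. ((\<lambda>s. F (z + s *\<^sub>R b)) has_real_derivative D z) (at 0)"
    and \<rho>: "\<And>k. Ck k \<rho>" "\<And>y. r \<le> norm y \<Longrightarrow> \<rho> y = 0"
  shows "Ck k (conv F \<rho>)" "pd b (conv F \<rho>) = conv D \<rho>"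
proof -
  obtain a where a: "K \<subseteq> cbox (- a) a" using bounded_subset_cbox_symmetric[OF compact_imp_bounded[OF F(3)]] by blast
  obtain u where u: "cball (0::'a) r \<subseteq> cbox (- u) u" using bounded_subset_cbox_symmetric[OF bounded_cball] by blast
  have ck: "Ck k (conv F \<rho>)" for k
    by (rule conv_Ck[OF F(1)]) (use a F(4) \<rho>(1) in blast)+
  then show "Ck k (conv F \<rho>)" .
  show "pd b (conv F \<rho>) = conv D \<rho>"
  proof
    fix z
    have 1: "((\<lambda>s. conv F \<rho> (z + s *\<^sub>R b)) has_real_derivative conv D \<rho> z) (at 0)"
    proof (rule conv_directional_derivative[OF F(1,2) der])
      show "continuous_on UNIV \<rho>" by (rule Ck_continuous[OF \<rho>(1)])
      show "\<rho> y = 0" if "y \<notin> cbox (- u) u" for y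
      proof -
        have "y \<notin> cball 0 r" using u that by blast
        then show ?thesis using \<rho>(2)[of y] by simp
      qed
    qed
    interpret bounded_linear "frechet_derivative (conv F \<rho>) (at z)"
      using Ck_SucD(1)[OF ck] has_derivative_bounded_linear by blast
    have "((\<lambda>s. conv F \<rho> (z + s *\<^sub>R b)) has_derivative (\<lambda>h. frechet_derivative (conv F \<rho>) (at z) (h *\<^sub>R b))) (at 0)"
      by (rule has_derivative_compose[of "\<lambda>s. z + s *\<^sub>R b"]) (use Ck_SucD(1)[OF ck] in \<open>auto intro!: derivative_eq_intros\<close>)
    moreover have "(\<lambda>h. frechet_derivative (conv F \<rho>) (at z) (h *\<^sub>R b)) = (*) (pd b (conv F \<rho>) z)"
      by (auto simp: scale pd_def)
    ultimately have "((\<lambda>s. conv F \<rho> (z + s *\<^sub>R b)) has_real_derivative pd b (conv F \<rho>) z) (at 0)"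
      by (simp add: has_field_derivative_def)
    then show "pd b (conv F \<rho>) z = conv D \<rho> z" using 1 DERIV_unique by blast
  qed
qed

lemma directional_derivative_supp:
  fixes F :: "'a::euclidean_space \<Rightarrow> real"
  assumes der: "((\<lambda>s. F (z + s *\<^sub>R b)) has_real_derivative D) (at 0)"
    and "closed K" "\<And>z. z \<notin> K \<Longrightarrow> F z = 0" "z \<notin> K"
  shows "D = 0"
proof -
  have o: "open ((\<lambda>s. z + s *\<^sub>R b) -` (- K))"
    by (intro open_vimage continuous_intros) (use assms in auto)
  have "((\<lambda>s. 0) has_real_derivative D) (at 0)"
    by (rule has_field_derivative_transform_within_open[OF der o]) (use assms in auto)
  then show ?thesis using DERIV_unique[OF _ DERIV_const] by blast
qed

section \<open>Limits of mollified test functions\<close>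

context energy
begin

lemma L2_lim:
  fixes \<omega> :: "nat \<Rightarrow> real^'n \<Rightarrow> real"
  assumes w: "L2 w" and \<omega>: "\<And>m. \<omega> m \<in> borel_measurable borel" "\<And>m x. \<bar>\<omega> m x\<bar> \<le> B * indicator (cball 0 M) x" "0 \<le> B"
    and lim: "\<And>x. (\<lambda>m. \<omega> m x) \<longlonglongrightarrow> \<omega>' x"
  shows "(\<lambda>m. LINT x|lborel. w x * \<omega> m x) \<longlonglongrightarrow> (LINT x|lborel. w x * \<omega>' x)"
proof -
  note [measurable] = \<omega>(1)
  have [measurable]: "w \<in> borel_measurable borel" using w by (simp add: L2_def)
  have [measurable]: "\<omega>' \<in> borel_measurable borel"
    by (rule borel_measurable_LIMSEQ_real[OF lim]) measurable
  have i: "integrable lborel (\<lambda>x. \<bar>w x * (B * indicator (cball 0 M) x)\<bar>)"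
  proof (intro integrable_abs L2_local(1)[OF w, where B=B and M=M])
    show "(\<lambda>x::real^'n. B * indicator (cball 0 M) x) \<in> borel_measurable borel"
      by (intro borel_measurable_times borel_measurable_indicator) auto
  qed (use \<omega>(3) in auto)
  show ?thesis
  proof (rule integral_dominated_convergence[OF _ _ i])
    show "AE x in lborel. (\<lambda>m. w x * \<omega> m x) \<longlonglongrightarrow> w x * \<omega>' x" by (intro AE_I2 tendsto_mult_left lim)
    show "AE x in lborel. norm (w x * \<omega> m x) \<le> \<bar>w x * (B * indicator (cball 0 M) x)\<bar>" for m
      using \<omega>(2)[of m] \<omega>(3) by (intro AE_I2) (auto simp: abs_mult intro!: mult_left_mono order_trans[OF \<omega>(2)] )
  qed measurable
qed

lemma U_lim:
  fixes \<omega> :: "nat \<Rightarrow> real \<times> (real^'n) \<Rightarrow> real"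
  assumes \<omega>: "\<And>m. \<omega> m \<in> borel_measurable borel" "T1 < T" "\<And>m z. \<bar>\<omega> m z\<bar> \<le> B"
    "\<And>m z. T1 < fst z \<or> M < norm (snd z) \<Longrightarrow> \<omega> m z = 0"
    and lim: "\<And>x. (\<lambda>m. \<omega> m x) \<longlonglongrightarrow> \<omega>' x"
  shows "(\<lambda>m. LINT z|lborel. U z * \<omega> m z) \<longlonglongrightarrow> (LINT z|lborel. U z * \<omega>' z)"
    "(\<lambda>m. LINT z|lborel. \<bar>U z\<bar> powr p * \<omega> m z) \<longlonglongrightarrow> (LINT z|lborel. \<bar>U z\<bar> powr p * \<omega>' z)"
proof -
  note [measurable] = \<omega>(1)
  have [measurable]: "\<omega>' \<in> borel_measurable borel"
    by (rule borel_measurable_LIMSEQ_real[OF lim]) measurable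
  have B: "0 \<le> B" using \<omega>(3)[of 0 undefined] by linarith
  let ?S = "{..T1} \<times> cball (0::real^'n) M"
  have [measurable]: "?S \<in> sets borel" by (intro borel_closed closed_Times) auto
  have b: "\<bar>\<omega> m z\<bar> \<le> B * indicator ?S z" for m z
    using \<omega>(3)[of m z] \<omega>(4)[of z m] B by (cases "z \<in> ?S") (auto simp: mem_Times_iff not_le)
  have [measurable]: "(\<lambda>z. B * indicator ?S z) \<in> borel_measurable borel" 
    by (intro borel_measurable_times borel_measurable_indicator) auto
  have i: "integrable lborel (\<lambda>z. U z * (B * indicator ?S z))" "integrable lborel (\<lambda>z. \<bar>U z\<bar> powr p * (B * indicator ?S z))"
    by (rule U_integrable[OF _ \<omega>(2), where B=B and M=M]; use B in \<open>auto simp: indicator_def\<close>)+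
  show "(\<lambda>m. LINT z|lborel. U z * \<omega> m z) \<longlonglongrightarrow> (LINT z|lborel. U z * \<omega>' z)"
  proof (rule integral_dominated_convergence[OF _ _ integrable_abs[OF i(1)]])
    show "AE x in lborel. (\<lambda>m. U x * \<omega> m x) \<longlonglongrightarrow> U x * \<omega>' x" by (intro AE_I2 tendsto_mult_left lim)
    show "AE x in lborel. norm (U x * \<omega> m x) \<le> \<bar>U x * (B * indicator ?S x)\<bar>" for m
      using b[of m] by (intro AE_I2) (simp only: real_norm_def abs_mult, intro mult_left_mono, use B in \<open>auto simp: abs_mult[symmetric] intro: order_trans\<close>)
  qed measurable
  show "(\<lambda>m. LINT z|lborel. \<bar>U z\<bar> powr p * \<omega> m z) \<longlonglongrightarrow> (LINT z|lborel. \<bar>U z\<bar> powr p * \<omega>' z)"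
  proof (rule integral_dominated_convergence[OF _ _ integrable_abs[OF i(2)]])
    show "AE x in lborel. (\<lambda>m. \<bar>U x\<bar> powr p * \<omega> m x) \<longlonglongrightarrow> \<bar>U x\<bar> powr p * \<omega>' x" by (intro AE_I2 tendsto_mult_left lim)
    show "AE x in lborel. norm (\<bar>U x\<bar> powr p * \<omega> m x) \<le> \<bar>\<bar>U x\<bar> powr p * (B * indicator ?S x)\<bar>" for m
      using b[of m] by (intro AE_I2) (simp only: real_norm_def abs_mult, intro mult_left_mono, use B in \<open>auto simp: abs_mult[symmetric] intro: order_trans\<close>)
  qed measurable
qed

text \<open>The mollifications of \<Psi> are admissible, and their derivatives are the
  mollifications of the given ones. All of them are bounded uniformly, with supports in one compact
  set, so every term of \<open>weak_test\<close> converges. Only pure second derivatives enter, and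
  these only along coordinate lines.\<close>

lemma weak_identity_compact_support:
  fixes \<Psi> Pt Ptt :: "real \<times> (real^'n) \<Rightarrow> real" and P Q :: "'n \<Rightarrow> real \<times> (real^'n) \<Rightarrow> real"
  assumes cont: "continuous_on UNIV \<Psi>" "continuous_on UNIV Pt" "continuous_on UNIV Ptt"
      "\<And>i. continuous_on UNIV (P i)" "\<And>i. continuous_on UNIV (Q i)"
    and dt: "\<And>z. ((\<lambda>s. \<Psi> (z + s *\<^sub>R (1, 0))) has_real_derivative Pt z) (at 0)"
      "\<And>z. ((\<lambda>s. Pt (z + s *\<^sub>R (1, 0))) has_real_derivative Ptt z) (at 0)"
    and dx: "\<And>i z. ((\<lambda>s. \<Psi> (z + s *\<^sub>R (0, axis i 1))) has_real_derivative P i z) (at 0)"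
      "\<And>i z. ((\<lambda>s. P i (z + s *\<^sub>R (0, axis i 1))) has_real_derivative Q i z) (at 0)"
    and K: "compact K" "K \<subseteq> {..<T} \<times> UNIV" "\<And>z. z \<notin> K \<Longrightarrow> \<Psi> z = 0"
  shows "\<epsilon> * (LINT x|lborel. g x * \<Psi> (0, x)) + \<epsilon> * (LINT x|lborel. a x * f x * \<Psi> (0, x))
      - \<epsilon> * (LINT x|lborel. f x * Pt (0, x)) + (LINT z|lborel. \<bar>U z\<bar> powr p * \<Psi> z)
    = (LINT z|lborel. U z * (Ptt z - (\<Sum>i\<in>UNIV. Q i z) - a (snd z) * Pt z))"
proof -
  have cK: "closed K" using K(1) compact_imp_closed by blast
  have Z: "Pt z = 0" "Ptt z = 0" "P i z = 0" "Q i z = 0" if "z \<notin> K" for z i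
  proof -
    have 1: "Pt z = 0" if "z \<notin> K" for z by (rule directional_derivative_supp[OF dt(1) cK K(3) that])
    have 2: "P i z = 0" if "z \<notin> K" for z by (rule directional_derivative_supp[OF dx(1) cK K(3) that])
    show "Pt z = 0" "P i z = 0" using 1 2 that by auto
    show "Ptt z = 0" by (rule directional_derivative_supp[OF dt(2) cK 1 that])
    show "Q i z = 0" by (rule directional_derivative_supp[OF dx(2) cK 2 that])
  qed
  obtain \<rho> :: "nat \<Rightarrow> real \<times> (real^'n) \<Rightarrow> real" where
    \<rho>0: "\<And>m k. Ck k (\<rho> m)" "\<And>m y. 0 \<le> \<rho> m y" "\<And>m y. 1 / real (Suc m) \<le> norm y \<Longrightarrow> \<rho> m y = 0"
    "\<And>m. integrable lborel (\<rho> m)" "\<And>m. (LINT y|lborel. \<rho> m y) = 1"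
    by (rule mollifier) blast
  have c\<rho>: "continuous_on UNIV (\<rho> m)" for m by (rule Ck_continuous[OF \<rho>0(1)])
  have "open ({..<T} \<times> (UNIV :: (real^'n) set))" by (intro open_Times) auto
  from compact_subset_open_imp_ball_epsilon_subset[OF K(1) this K(2)]
  obtain e where e: "0 < e" "(\<Union>x\<in>K. ball x e) \<subseteq> {..<T} \<times> UNIV" by auto
  \<comment> \<open>The kernel radius stays below the distance \<open>e\<close> from
    \<open>K\<close> to the times >= \<open>T\<close>, so that the enlarged support
    \<open>K'\<close> still avoids them.\<close>
  obtain N where N: "1 / real (Suc N) < e" using nat_approx_posE[OF e(1)] by metis
  define r where "r = 1 / real (Suc N)"
  \<comment> \<open>Discarding the first \<open>N\<close> kernels makes \<open>r\<close> a common
    support radius for all that remain.\<close>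
  define \<rho>' where "\<rho>' m = \<rho> (N + m)" for m
  have r': "\<rho>' m y = 0" if "r \<le> norm y" for m y
  proof -
    have "1 / real (Suc (N + m)) \<le> r" unfolding r_def by (rule divide_left_mono) auto
    then show ?thesis using that \<rho>0(3) unfolding \<rho>'_def by (meson order_trans)
  qed
  define K' where "K' = {x + y |x y. x \<in> K \<and> y \<in> cball (0 :: real \<times> (real^'n)) r}"
  have K': "compact K'" unfolding K'_def by (intro compact_sums K(1)) auto
  have "K' \<subseteq> {..<T} \<times> UNIV"
  proof
    fix z assume "z \<in> K'"
    then obtain x y where "x \<in> K" "norm y \<le> r" "z = x + y" by (auto simp: K'_def)
    then have "z \<in> ball x e" using N by (auto simp: r_def dist_norm)
    then show "z \<in> {..<T} \<times> UNIV" using \<open>x \<in> K\<close> e(2) by blast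
  qed
  have cz: "conv F (\<rho>' m) z = 0" if "continuous_on UNIV F" "\<And>z. z \<notin> K \<Longrightarrow> F z = 0" "z \<notin> K'" for F m z
  proof (rule conv_supp[OF that(1)])
    show "continuous_on UNIV (\<rho>' m)" unfolding \<rho>'_def by (rule c\<rho>)
    show "\<rho>' m y = 0" if "r \<le> norm y" for y by (rule r'[OF that])
    show "F w = 0" if "dist w z < r" for w
    proof (rule ccontr)
      assume "F w \<noteq> 0"
      then have "w \<in> K" using \<open>\<And>z. z \<notin> K \<Longrightarrow> F z = 0\<close> by blast
      moreover have "z - w \<in> cball 0 r" using that by (simp add: dist_norm norm_minus_commute)
      ultimately have "w + (z - w) \<in> K'" unfolding K'_def by blast
      then show False using \<open>z \<notin> K'\<close> by simp
    qed
  qed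
  have \<rho>'k: "Ck k (\<rho>' m)" for k m unfolding \<rho>'_def by (rule \<rho>0)
  define \<Psi>' where "\<Psi>' m = conv \<Psi> (\<rho>' m)" for m
  have ck: "Ck k (\<Psi>' m)" for k m unfolding \<Psi>'_def by (rule pd_conv(1)[OF cont(1,2) K(1,3) dt(1) \<rho>'k r'])
  have tf: "test_function ({..<T} \<times> UNIV) (\<Psi>' m)" for m
    by (rule test_function_intro[OF ck K' \<open>K' \<subseteq> _\<close>]) (auto simp: \<Psi>'_def intro!: cz cont K)
  have p1: "pd (1, 0) (\<Psi>' m) = conv Pt (\<rho>' m)" for m unfolding \<Psi>'_def by (rule pd_conv(2)[OF cont(1,2) K(1,3) dt(1) \<rho>'k r'])
  have p2: "pd (1, 0) (conv Pt (\<rho>' m)) = conv Ptt (\<rho>' m)" for m by (rule pd_conv(2)[OF cont(2,3) K(1) Z(1) dt(2) \<rho>'k r'])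
  have p3: "pd (0, axis i 1) (\<Psi>' m) = conv (P i) (\<rho>' m)" for m i unfolding \<Psi>'_def by (rule pd_conv(2)[OF cont(1,4) K(1,3) dx(1) \<rho>'k r'])
  have p4: "pd (0, axis i 1) (conv (P i) (\<rho>' m)) = conv (Q i) (\<rho>' m)" for m i by (rule pd_conv(2)[OF cont(4,5) K(1) Z(3) dx(2) \<rho>'k r'])
  note W = weak_test[OF tf, unfolded p1 p3 p2 p4]
  have "bounded K'" using K' by (rule compact_imp_bounded)
  then obtain M0 where M0: "\<And>z. z \<in> K' \<Longrightarrow> norm z \<le> M0" by (auto simp: bounded_iff)
  obtain T1 where T1: "T1 < T" "\<And>z. z \<in> K' \<Longrightarrow> fst z \<le> T1"
  proof (cases "K' = {}")
    case True
    then show ?thesis using that[of 0] T by auto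
  next
    case False
    have "continuous_on K' (fst :: real \<times> (real^'n) \<Rightarrow> real)" by (intro continuous_intros)
    from continuous_attains_sup[OF K' False this] show ?thesis using \<open>K' \<subseteq> _\<close> that by fastforce
  qed
  have out: "z \<notin> K'" if "T1 < fst z \<or> M0 < norm (snd z)" for z
    using that T1(2)[of z] M0[of z] norm_snd_le[of "snd z" "fst z"] norm_snd_le[of "fst z" "snd z"] by (cases z) force
  have bd: "\<exists>B\<ge>0. \<forall>m z. \<bar>conv F (\<rho>' m) z\<bar> \<le> B" if F: "continuous_on UNIV F" "\<And>z. z \<notin> K \<Longrightarrow> F z = 0" for F
  proof -
    obtain B where B: "0 < B" "\<And>z. \<bar>F z\<bar> \<le> B" using continuous_compact_bounded[OF F(1) K(1) F(2)] by metis
    then show ?thesis using conv_bounded[OF F(1) B(2) c\<rho> \<rho>0(2) \<rho>0(4) \<rho>0(5)] unfolding \<rho>'_def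
      by (intro exI[of _ B]) auto
  qed
  have lim: "(\<lambda>m. conv F (\<rho>' m) z) \<longlonglongrightarrow> F z" if F: "continuous_on UNIV F" for F z
  proof -
    have "(\<lambda>m. conv F (\<rho> (m + N)) z) \<longlonglongrightarrow> F z"
      by (rule LIMSEQ_ignore_initial_segment[OF conv_mollifier_tendsto[OF F c\<rho> \<rho>0(2-5)]])
    then show ?thesis unfolding \<rho>'_def by (simp add: add.commute)
  qed
  have cc: "continuous_on UNIV (conv F (\<rho>' m))" if F: "continuous_on UNIV F" "\<And>z. z \<notin> K \<Longrightarrow> F z = 0" for F m
  proof -
    obtain b where b: "K \<subseteq> cbox (- b) b" using bounded_subset_cbox_symmetric[OF compact_imp_bounded[OF K(1)]] by blast
    have "Ck 0 (conv F (\<rho>' m))" by (rule conv_Ck[OF F(1) _ \<rho>'k]) (use b F(2) in blast)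
    then show ?thesis by (rule Ck_continuous)
  qed
  have limL: "(\<lambda>m. LINT x|lborel. w x * conv F (\<rho>' m) (0, x)) \<longlonglongrightarrow> (LINT x|lborel. w x * F (0, x))"
    if F: "continuous_on UNIV F" "\<And>z. z \<notin> K \<Longrightarrow> F z = 0" and w: "L2 w" for F and w :: "real^'n \<Rightarrow> real"
  proof -
    obtain B where B: "B \<ge> 0" "\<And>m z. \<bar>conv F (\<rho>' m) z\<bar> \<le> B" using bd[OF F] by blast
    show ?thesis
    proof (rule L2_lim[OF w _ _ B(1) lim[OF F(1)], where M=M0])
      show "\<bar>conv F (\<rho>' m) (0, x)\<bar> \<le> B * indicator (cball 0 M0) x" for m x
        using B(2)[of m "(0, x)"] cz[OF F out[of "(0, x)"], of m] by (auto simp: indicator_def)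
      show "(\<lambda>x. conv F (\<rho>' m) (0, x)) \<in> borel_measurable borel" for m
        by (intro borel_measurable_continuous_onI continuous_slice cc F)
    qed
  qed
  have limU: "(\<lambda>m. LINT z|lborel. U z * (k z * conv F (\<rho>' m) z)) \<longlonglongrightarrow> (LINT z|lborel. U z * (k z * F z))"
      "(\<lambda>m. LINT z|lborel. \<bar>U z\<bar> powr p * (k z * conv F (\<rho>' m) z)) \<longlonglongrightarrow> (LINT z|lborel. \<bar>U z\<bar> powr p * (k z * F z))"
      "\<And>m. integrable lborel (\<lambda>z. U z * (k z * conv F (\<rho>' m) z))" "integrable lborel (\<lambda>z. U z * (k z * F z))"
    if F: "continuous_on UNIV F" "\<And>z. z \<notin> K \<Longrightarrow> F z = 0" and k[measurable]: "k \<in> borel_measurable borel" "\<And>z. \<bar>k z\<bar> \<le> C" for F k C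
  proof -
    obtain B where B: "B \<ge> 0" "\<And>m z. \<bar>conv F (\<rho>' m) z\<bar> \<le> B" using bd[OF F] by blast
    have B': "\<bar>F z\<bar> \<le> B" for z
      by (rule LIMSEQ_le_const2[OF tendsto_rabs[OF lim[OF F(1)]]]) (use B in auto)
    have C: "0 \<le> C" using k(2)[of undefined] by linarith
    have [measurable]: "conv F (\<rho>' m) \<in> borel_measurable borel" "F \<in> borel_measurable borel" for m
      using cc[OF F] F(1) by (auto intro: borel_measurable_continuous_onI)
    have 1: "\<bar>k z * conv F (\<rho>' m) z\<bar> \<le> C * B" "\<bar>k z * F z\<bar> \<le> C * B" for m z
      unfolding abs_mult by (intro mult_mono B B' k C abs_ge_zero)+
    have "K \<subseteq> K'"
    proof
      fix x assume "x \<in> K"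
      then have "x + 0 \<in> K'" unfolding K'_def using r_def by (intro CollectI exI[of _ x] exI[of _ 0]) auto
      then show "x \<in> K'" by simp
    qed
    then have 2: "k z * conv F (\<rho>' m) z = 0" "k z * F z = 0" if "T1 < fst z \<or> M0 < norm (snd z)" for m z
      using cz[OF F out[OF that]] out[OF that] F(2)[of z] by auto
    have m: "(\<lambda>z. k z * conv F (\<rho>' m) z) \<in> borel_measurable borel" "(\<lambda>z. k z * F z) \<in> borel_measurable borel" for m by measurable
    show "(\<lambda>m. LINT z|lborel. U z * (k z * conv F (\<rho>' m) z)) \<longlonglongrightarrow> (LINT z|lborel. U z * (k z * F z))"
      "(\<lambda>m. LINT z|lborel. \<bar>U z\<bar> powr p * (k z * conv F (\<rho>' m) z)) \<longlonglongrightarrow> (LINT z|lborel. \<bar>U z\<bar> powr p * (k z * F z))"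
      using U_lim[where \<omega>="\<lambda>m z. k z * conv F (\<rho>' m) z" and \<omega>'="\<lambda>z. k z * F z" and M=M0 and B="C * B", OF _ T1(1)]
        m(1) 1(1) 2(1) tendsto_mult_left[OF lim[OF F(1)]] by blast+
    show "integrable lborel (\<lambda>z. U z * (k z * conv F (\<rho>' m) z))" for m
      by (rule U_integrable(1)[OF m(1) T1(1) 1(1) 2(1)])
    show "integrable lborel (\<lambda>z. U z * (k z * F z))"
      by (rule U_integrable(1)[OF m(2) T1(1) 1(2) 2(2)])
  qed
  have ab: "\<bar>a x\<bar> \<le> \<mu>" for x using damping_bounds(1,2)[OF \<mu> \<beta>, of x] by simp
  have am: "(\<lambda>z::real \<times> (real^'n). a (snd z)) \<in> borel_measurable borel" by (rule measurable_compose[OF borel_measurable_fst_snd(2) a_measurable])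
  have L2af: "L2 (\<lambda>x. a x * f x)"
  proof -
    have [measurable]: "f \<in> borel_measurable borel" and i: "integrable lborel (\<lambda>x. \<mu>\<^sup>2 * (f x)\<^sup>2)" using L2f by (auto simp: L2_def)
    have "(a x * f x)\<^sup>2 \<le> \<mu>\<^sup>2 * (f x)\<^sup>2" for x
      using power_mono[OF ab[of x], of 2] by (auto simp: power_mult_distrib intro!: mult_right_mono)
    then show ?thesis unfolding L2_def by (auto intro!: Bochner_Integration.integrable_bound[OF i])
  qed
  note one = limU[of _ "\<lambda>_. 1" 1, simplified]
  let ?R = "\<lambda>A B C. (LINT z|lborel. U z * A z) - (\<Sum>i\<in>UNIV. LINT z|lborel. U z * B i z) - (LINT z|lborel. U z * (a (snd z) * C z))"
  have split: "(LINT z|lborel. U z * (A z - (\<Sum>i\<in>UNIV. B i z) - a (snd z) * C z)) = ?R A B C"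
    if "integrable lborel (\<lambda>z. U z * A z)" "\<And>i. integrable lborel (\<lambda>z. U z * B i z)" "integrable lborel (\<lambda>z. U z * (a (snd z) * C z))" for A C and B :: "'n \<Rightarrow> _"
    using that unfolding right_diff_distrib sum_distrib_left by simp
  have Wm: "\<epsilon> * (LINT x|lborel. g x * \<Psi>' m (0, x)) + \<epsilon> * (LINT x|lborel. a x * f x * \<Psi>' m (0, x))
      - \<epsilon> * (LINT x|lborel. f x * conv Pt (\<rho>' m) (0, x)) + (LINT z|lborel. \<bar>U z\<bar> powr p * \<Psi>' m z)
      = ?R (conv Ptt (\<rho>' m)) (\<lambda>i. conv (Q i) (\<rho>' m)) (conv Pt (\<rho>' m))" for m
    by (rule trans[OF W split[OF one(3)[OF cont(3) Z(2)] one(3)[OF cont(5) Z(4)] limU(3)[OF cont(2) Z(1) am ab]]])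
  have R: "(\<lambda>m. ?R (conv Ptt (\<rho>' m)) (\<lambda>i. conv (Q i) (\<rho>' m)) (conv Pt (\<rho>' m))) \<longlonglongrightarrow> ?R Ptt Q Pt"
    by (intro tendsto_diff tendsto_sum one(1) limU(1)[OF _ _ am ab] cont Z)
  have L: "(\<lambda>m. \<epsilon> * (LINT x|lborel. g x * \<Psi>' m (0, x)) + \<epsilon> * (LINT x|lborel. a x * f x * \<Psi>' m (0, x))
      - \<epsilon> * (LINT x|lborel. f x * conv Pt (\<rho>' m) (0, x)) + (LINT z|lborel. \<bar>U z\<bar> powr p * \<Psi>' m z)) \<longlonglongrightarrow>
      \<epsilon> * (LINT x|lborel. g x * \<Psi> (0, x)) + \<epsilon> * (LINT x|lborel. a x * f x * \<Psi> (0, x))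
      - \<epsilon> * (LINT x|lborel. f x * Pt (0, x)) + (LINT z|lborel. \<bar>U z\<bar> powr p * \<Psi> z)"
    unfolding \<Psi>'_def by (intro tendsto_diff tendsto_add tendsto_mult_left limL one(2) cont Z K(3) L2f L2g L2af)
  have "\<epsilon> * (LINT x|lborel. g x * \<Psi> (0, x)) + \<epsilon> * (LINT x|lborel. a x * f x * \<Psi> (0, x))
      - \<epsilon> * (LINT x|lborel. f x * Pt (0, x)) + (LINT z|lborel. \<bar>U z\<bar> powr p * \<Psi> z) = ?R Ptt Q Pt"
  proof (rule LIMSEQ_unique[OF L])
    show "(\<lambda>m. \<epsilon> * (LINT x|lborel. g x * \<Psi>' m (0, x)) + \<epsilon> * (LINT x|lborel. a x * f x * \<Psi>' m (0, x))
      - \<epsilon> * (LINT x|lborel. f x * conv Pt (\<rho>' m) (0, x)) + (LINT z|lborel. \<bar>U z\<bar> powr p * \<Psi>' m z)) \<longlonglongrightarrow> ?R Ptt Q Pt"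
      using R unfolding Wm .
  qed
  also have "\<dots> = (LINT z|lborel. U z * (Ptt z - (\<Sum>i\<in>UNIV. Q i z) - a (snd z) * Pt z))"
    by (rule split[OF one(4)[OF cont(3) Z(2)] one(4)[OF cont(5) Z(4)] limU(4)[OF cont(2) Z(1) am ab], symmetric])
  finally show ?thesis .
qed

end

section \<open>Solutions supported in the light cone\<close>

text \<open>The points off the essential support are covered by open sets on which the function
  vanishes almost everywhere. By Lindelof countably many of these suffice, and the exceptional null
  sets add up to a null set.\<close>

lemma ess_supp_AE:
  assumes "ess_supp S h \<subseteq> C"
  shows "AE y in lborel. y \<in> S \<longrightarrow> y \<notin> C \<longrightarrow> h y = 0"
proof -
  define \<F> where "\<F> = {V. open V \<and> (AE y in lborel. y \<in> V \<inter> S \<longrightarrow> h y = 0)}"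
  obtain \<F>' where F': "\<F>' \<subseteq> \<F>" "countable \<F>'" "\<Union>\<F>' = \<Union>\<F>"
    using Lindelof[of \<F>] by (auto simp: \<F>_def)
  have "AE y in lborel. \<forall>V\<in>\<F>'. y \<in> V \<inter> S \<longrightarrow> h y = 0"
    using F'(1) by (subst AE_ball_countable[OF F'(2)]) (auto simp: \<F>_def)
  then show ?thesis
  proof eventually_elim
    case (elim y)
    show ?case
    proof (intro impI)
      assume "y \<in> S" "y \<notin> C"
      then have "y \<notin> ess_supp S h" using assms by blast
      then have "y \<in> \<Union>\<F>" using \<open>y \<in> S\<close> by (auto simp: ess_supp_def \<F>_def)
      then show "h y = 0" using elim F'(3) \<open>y \<in> S\<close> by blast
    qed
  qed
qed

section \<open>A cutoff in time with two continuous derivatives\<close>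

lemma DERIV_max0_power:
  "((\<lambda>y. (max 0 y) ^ Suc (Suc k)) has_real_derivative real (Suc (Suc k)) * (max 0 y) ^ Suc k) (at y)"
proof -
  consider "y < 0" | "y > 0" | "y = 0" by linarith
  then show ?thesis
  proof cases
    case 1
    have "((\<lambda>y. 0) has_real_derivative real (Suc (Suc k)) * (max 0 y) ^ Suc k) (at y)" using 1 by (simp add: max_def)
    then show ?thesis
      by (rule has_field_derivative_transform_within_open[where S="{..<0}"]) (use 1 in auto)
  next
    case 2
    have "((\<lambda>y. y ^ Suc (Suc k)) has_real_derivative real (Suc (Suc k)) * (max 0 y) ^ Suc k) (at y)"
      using DERIV_pow[of "Suc (Suc k)" y] 2 by (simp add: max_def)
    then show ?thesis
      by (rule has_field_derivative_transform_within_open[where S="{0<..}"]) (use 2 in auto)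
  next
    case 3
    have "((\<lambda>h. ((max 0 (0 + h)) ^ Suc (Suc k) - (max 0 0) ^ Suc (Suc k)) / h) \<longlongrightarrow> (0::real)) (at 0)"
    proof (rule Lim_null_comparison)
      show "\<forall>\<^sub>F h in at (0::real). norm (((max 0 (0 + h)) ^ Suc (Suc k) - (max 0 0) ^ Suc (Suc k)) / h) \<le> \<bar>h\<bar> ^ Suc k"
      proof (intro always_eventually allI)
        fix h :: real
        show "norm (((max 0 (0 + h)) ^ Suc (Suc k) - (max 0 0) ^ Suc (Suc k)) / h) \<le> \<bar>h\<bar> ^ Suc k"
          by (cases "0 < h") (auto simp: max_absorb1 intro!: mult_nonpos_nonneg)
      qed
      have "((\<lambda>h::real. \<bar>h\<bar> ^ Suc k) \<longlongrightarrow> \<bar>0\<bar> ^ Suc k) (at 0)" by (intro tendsto_intros)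
      then show "((\<lambda>h::real. \<bar>h\<bar> ^ Suc k) \<longlongrightarrow> 0) (at 0)" by simp
    qed
    then show ?thesis unfolding 3 DERIV_def by simp
  qed
qed

text \<open>
  The outer power keeps \<open>cutoff'\<close> and \<open>cutoff''\<close> below a multiple of \<open>cutoff powr (1 / p)\<close> once
  \<open>m\<close> is at least twice the conjugate exponent of \<open>p\<close>.
\<close>

definition cutoff :: "nat \<Rightarrow> real \<Rightarrow> real" where
  "cutoff m s = (max 0 (1 - (max 0 (2 * s - 1)) ^ 3)) ^ m"

definition cutoff' :: "nat \<Rightarrow> real \<Rightarrow> real" where
  "cutoff' m s = - (6 * real m) * (max 0 (1 - (max 0 (2 * s - 1)) ^ 3)) ^ (m - 1) * (max 0 (2 * s - 1)) ^ 2"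

definition cutoff'' :: "nat \<Rightarrow> real \<Rightarrow> real" where
  "cutoff'' m s = 36 * real m * real (m - 1) * (max 0 (1 - (max 0 (2 * s - 1)) ^ 3)) ^ (m - 2) * (max 0 (2 * s - 1)) ^ 4
     - 24 * real m * (max 0 (1 - (max 0 (2 * s - 1)) ^ 3)) ^ (m - 1) * max 0 (2 * s - 1)"

lemma DERIV_max0_power_chain:
  assumes "2 \<le> n" "(h has_real_derivative h') (at s)"
  shows "((\<lambda>s. (max 0 (h s)) ^ n) has_real_derivative real n * (max 0 (h s)) ^ (n - 1) * h') (at s)"
proof -
  obtain k where "n = 2 + k" using assms(1) le_Suc_ex by blast
  then have k: "n = Suc (Suc k)" by simp
  show ?thesis unfolding k diff_Suc_1
    by (rule DERIV_chain2[where f="\<lambda>y. (max 0 y) ^ Suc (Suc k)", OF DERIV_max0_power assms(2)])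
qed

lemma cutoff_arg_deriv:
  "((\<lambda>s. 2 * s - 1) has_real_derivative 2) (at (s::real))"
  "((\<lambda>s. 1 - (max 0 (2 * s - 1)) ^ 3) has_real_derivative - (6 * (max 0 (2 * s - 1)) ^ 2)) (at s)"
proof -
  show d: "((\<lambda>s. 2 * s - 1) has_real_derivative 2) (at s)" by (auto intro!: derivative_eq_intros)
  have "((\<lambda>s. (max 0 (2 * s - 1)) ^ 3) has_real_derivative real 3 * (max 0 (2 * s - 1)) ^ (3 - 1) * 2) (at s)"
    by (rule DERIV_max0_power_chain[OF _ d]) simp
  from DERIV_diff[OF DERIV_const this, of 1]
  show "((\<lambda>s. 1 - (max 0 (2 * s - 1)) ^ 3) has_real_derivative - (6 * (max 0 (2 * s - 1)) ^ 2)) (at s)"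
    by (rule DERIV_cong) simp
qed

lemma cutoff_deriv:
  assumes "3 \<le> m"
  shows "(cutoff m has_real_derivative cutoff' m s) (at s)"
proof -
  have "2 \<le> m" using assms by simp
  show ?thesis unfolding cutoff_def[abs_def] cutoff'_def
    by (rule DERIV_cong[OF DERIV_max0_power_chain[OF \<open>2 \<le> m\<close> cutoff_arg_deriv(2)]]) simp
qed

lemma cutoff'_deriv:
  assumes "3 \<le> m"
  shows "(cutoff' m has_real_derivative cutoff'' m s) (at s)"
proof -
  let ?A = "\<lambda>s::real. max 0 (1 - (max 0 (2 * s - 1)) ^ 3)" and ?c = "\<lambda>s::real. max 0 (2 * s - 1)"
  have m: "2 \<le> m - 1" "m - 1 - 1 = m - 2" using assms by auto
  have 1: "((\<lambda>s. ?A s ^ (m - 1)) has_real_derivative real (m - 1) * ?A s ^ (m - 2) * - (6 * ?c s ^ 2)) (at s)"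
    using DERIV_max0_power_chain[OF m(1) cutoff_arg_deriv(2)] unfolding m(2) .
  have 2: "((\<lambda>s. ?c s ^ 2) has_real_derivative real 2 * ?c s ^ (2 - 1) * 2) (at s)"
    by (rule DERIV_max0_power_chain[OF _ cutoff_arg_deriv(1)]) simp
  have e: "C * D * B * - (6 * c ^ 2) * c ^ 2 = - 6 * (C * D * B * c ^ 4)" for C D B c :: real
    by (simp add: power2_eq_square power4_eq_xxxx)
  show ?thesis unfolding cutoff'_def[abs_def] cutoff''_def
    by (rule DERIV_cong[OF DERIV_mult[OF DERIV_cmult[OF 1] 2]])
      (simp add: power2_eq_square power4_eq_xxxx)
qed

lemma cutoff_continuous: "continuous_on S (cutoff m)" "continuous_on S (cutoff' m)" "continuous_on S (cutoff'' m)"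
  unfolding cutoff_def cutoff'_def cutoff''_def by (intro continuous_intros)+

lemma cutoff_le_half:
  assumes "s \<le> 1 / 2"
  shows "cutoff m s = 1" "cutoff' m s = 0" "cutoff'' m s = 0"
proof -
  have "max 0 (2 * s - 1) = 0" using assms by simp
  then show "cutoff m s = 1" "cutoff' m s = 0" "cutoff'' m s = 0"
    by (simp_all add: cutoff_def cutoff'_def cutoff''_def)
qed

lemma cutoff_ge_1:
  assumes "3 \<le> m" "1 \<le> s"
  shows "cutoff m s = 0" "cutoff' m s = 0" "cutoff'' m s = 0"
proof -
  have "1 \<le> (max 0 (2 * s - 1)) ^ 3" using assms(2) by (intro one_le_power) auto
  then have "max 0 (1 - (max 0 (2 * s - 1)) ^ 3) = (0::real)" by simp
  moreover have "m \<noteq> 0" "m - 1 \<noteq> 0" "m - 2 \<noteq> 0" using assms(1) by auto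
  ultimately show "cutoff m s = 0" "cutoff' m s = 0" "cutoff'' m s = 0"
    by (simp_all add: cutoff_def cutoff'_def cutoff''_def power_0_left)
qed

lemma DERIV_chain_line:
  fixes h :: "'a::euclidean_space \<Rightarrow> real"
  assumes "(c has_real_derivative c') (at (h z))" "((\<lambda>s. h (z + s *\<^sub>R b)) has_real_derivative h') (at 0)"
  shows "((\<lambda>s. c (h (z + s *\<^sub>R b))) has_real_derivative c' * h') (at 0)"
  by (rule DERIV_chain2[where f=c and g="\<lambda>s. h (z + s *\<^sub>R b)"]) (use assms in simp_all)

lemma DERIV_mult_line:
  fixes F G :: "'a::euclidean_space \<Rightarrow> real"
  assumes "((\<lambda>s. F (z + s *\<^sub>R b)) has_real_derivative DF) (at 0)" "((\<lambda>s. G (z + s *\<^sub>R b)) has_real_derivative DG) (at 0)"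
  shows "((\<lambda>s. F (z + s *\<^sub>R b) * G (z + s *\<^sub>R b)) has_real_derivative DF * G z + F z * DG) (at 0)"
  by (rule DERIV_cong[OF DERIV_mult[OF assms]]) simp

locale energy_supp = energy \<mu> \<beta> p \<epsilon> T f g u v
  for \<mu> \<beta> p \<epsilon> T :: real and f g :: "real^'n \<Rightarrow> real" and u v :: "real \<Rightarrow> real^'n \<Rightarrow> real" +
  assumes suppU: "AE z in lborel. spacetime T u z \<noteq> 0 \<longrightarrow> norm (snd z) \<le> fst z + 1"
    and suppf: "AE x in lborel. 1 < norm x \<longrightarrow> f x = 0" and suppg: "AE x in lborel. 1 < norm x \<longrightarrow> g x = 0"
begin

text \<open>A representative of \<open>U\<close> for which the support condition holds at every
  point. Weights that are controlled only inside the cone can then be compared pointwise.\<close>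

definition W :: "real \<times> (real^'n) \<Rightarrow> real" where
  "W z = indicator {z. norm (snd z) \<le> fst z + 1} z * U z"

lemma W_measurable[measurable]: "W \<in> borel_measurable borel"
proof -
  have "closed {z::real \<times> (real^'n). norm (snd z) \<le> fst z + 1}" by (intro closed_Collect_le continuous_intros)
  then have [measurable]: "{z::real \<times> (real^'n). norm (snd z) \<le> fst z + 1} \<in> sets borel" by (rule borel_closed)
  show ?thesis unfolding W_def[abs_def] by measurable
qed

lemma W_eq_AE: "AE z in lborel. W z = U z"
  using suppU by eventually_elim (auto simp: W_def indicator_def)

lemma W_nonzeroD: "W z \<noteq> 0 \<Longrightarrow> 0 < fst z \<and> fst z < T \<and> norm (snd z) \<le> fst z + 1"
  by (auto simp: W_def spacetime_def indicator_def mem_Times_iff split: if_splits)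

text \<open>The cone has bounded slices, so a weight that is cut off in time needs neither decay nor
  compact support in space.\<close>

lemma W_integrable:
  assumes [measurable]: "\<omega> \<in> borel_measurable borel" and T1: "0 \<le> T1" "T1 < T"
    and b: "\<And>z. 0 < fst z \<Longrightarrow> fst z \<le> T1 \<Longrightarrow> norm (snd z) \<le> fst z + 1 \<Longrightarrow> \<bar>\<omega> z\<bar> \<le> B"
    and z: "\<And>z. T1 < fst z \<Longrightarrow> \<omega> z = 0"
  shows "integrable lborel (\<lambda>z. W z * \<omega> z)" "integrable lborel (\<lambda>z. \<bar>W z\<bar> powr p * \<omega> z)"
proof -
  let ?S = "{z::real \<times> (real^'n). norm (snd z) \<le> fst z + 1 \<and> fst z \<le> T1}"
  have "closed ?S" by (intro closed_Collect_conj closed_Collect_le continuous_intros)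
  then have [measurable]: "?S \<in> sets borel" by (rule borel_closed)
  have [measurable]: "(\<lambda>z. indicator ?S z * \<omega> z) \<in> borel_measurable borel" by measurable
  have i: "integrable lborel (\<lambda>z. U z * (indicator ?S z * \<omega> z))" "integrable lborel (\<lambda>z. \<bar>U z\<bar> powr p * (indicator ?S z * \<omega> z))"
  proof -
    have 1: "\<bar>indicator ?S z * \<omega> z\<bar> \<le> \<bar>B\<bar>" if "0 < fst z" for z
      using b[OF that] by (auto simp: indicator_def)
    have 2: "indicator ?S z * \<omega> z = 0" if "T1 < fst z \<or> T1 + 1 < norm (snd z)" for z
      using that by (auto simp: indicator_def)
    show "integrable lborel (\<lambda>z. U z * (indicator ?S z * \<omega> z))" "integrable lborel (\<lambda>z. \<bar>U z\<bar> powr p * (indicator ?S z * \<omega> z))"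
      by (rule U_integrable[OF _ T1(2) 1 2]; simp)+
  qed
  have e: "U z * (indicator ?S z * \<omega> z) = W z * \<omega> z" "\<bar>U z\<bar> powr p * (indicator ?S z * \<omega> z) = \<bar>W z\<bar> powr p * \<omega> z" for z
    using z[of z] p by (auto simp: W_def indicator_def)
  show "integrable lborel (\<lambda>z. W z * \<omega> z)" "integrable lborel (\<lambda>z. \<bar>W z\<bar> powr p * \<omega> z)"
    using i by (simp_all only: e)
qed

text \<open>Multiply \<Psi> by a cutoff \<open>K\<close> that restricts it to bounded x and to t >
  -1/2. \<open>K\<close> equals 1 on the part of the cone with t >= 0 and t <= T1, so it leaves no
  trace in the identity.\<close>

lemma weak_identity:
  fixes \<Psi> Pt Ptt :: "real \<times> (real^'n) \<Rightarrow> real" and P Q :: "'n \<Rightarrow> real \<times> (real^'n) \<Rightarrow> real"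
  assumes cont: "continuous_on UNIV \<Psi>" "continuous_on UNIV Pt" "continuous_on UNIV Ptt"
      "\<And>i. continuous_on UNIV (P i)" "\<And>i. continuous_on UNIV (Q i)"
    and dt: "\<And>z. ((\<lambda>s. \<Psi> (z + s *\<^sub>R (1, 0))) has_real_derivative Pt z) (at 0)"
      "\<And>z. ((\<lambda>s. Pt (z + s *\<^sub>R (1, 0))) has_real_derivative Ptt z) (at 0)"
    and dx: "\<And>i z. ((\<lambda>s. \<Psi> (z + s *\<^sub>R (0, axis i 1))) has_real_derivative P i z) (at 0)"
      "\<And>i z. ((\<lambda>s. P i (z + s *\<^sub>R (0, axis i 1))) has_real_derivative Q i z) (at 0)"
    and T1: "0 \<le> T1" "T1 < T" "\<And>z. T1 \<le> fst z \<Longrightarrow> \<Psi> z = 0"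
  shows "\<epsilon> * (LINT x|lborel. g x * \<Psi> (0, x)) + \<epsilon> * (LINT x|lborel. a x * f x * \<Psi> (0, x))
      - \<epsilon> * (LINT x|lborel. f x * Pt (0, x)) + (LINT z|lborel. \<bar>W z\<bar> powr p * \<Psi> z)
    = (LINT z|lborel. W z * (Ptt z - (\<Sum>i\<in>UNIV. Q i z) - a (snd z) * Pt z))"
proof -
  \<comment> \<open>Larger than T1 + 1, the radius of the cone at the last time that
    matters.\<close>
  define R where "R = T1 + 2"
  have R: "0 < R" using T1 by (simp add: R_def)
  \<comment> \<open>\<open>cutoff\<close> is 1 up to 1/2 and 0 from 1 on. Hence
    \<open>cutoff 3 (q z)\<close> is 1 for |x| <= R and 0 for |x| >= 2R, and with \<open>l z\<close>
    = -2t the time factor is 1 for t >= -1/4 and 0 for t <= -1/2. The exponent 3 suffices for two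
    continuous derivatives.\<close>
  define q where "q z = (snd z \<bullet> snd z) / (2 * R\<^sup>2)" for z :: "real \<times> (real^'n)"
  define l where "l z = - 2 * fst z" for z :: "real \<times> (real^'n)"
  define K where "K z = cutoff 3 (l z) * cutoff 3 (q z)" for z
  define Kt where "Kt z = - 2 * cutoff' 3 (l z) * cutoff 3 (q z)" for z
  define Ktt where "Ktt z = 4 * cutoff'' 3 (l z) * cutoff 3 (q z)" for z
  define Ki where "Ki i z = cutoff 3 (l z) * (cutoff' 3 (q z) * (snd z $ i / R\<^sup>2))" for i z
  define Kii where "Kii i z = cutoff 3 (l z) * (cutoff'' 3 (q z) * (snd z $ i / R\<^sup>2)\<^sup>2 + cutoff' 3 (q z) / R\<^sup>2)" for i z
  have cq: "continuous_on UNIV q" "continuous_on UNIV l"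
    unfolding q_def[abs_def] l_def[abs_def] using R by (auto intro!: continuous_intros)
  have cc: "continuous_on UNIV (\<lambda>z. cutoff 3 (q z))" "continuous_on UNIV (\<lambda>z. cutoff' 3 (q z))" "continuous_on UNIV (\<lambda>z. cutoff'' 3 (q z))"
     "continuous_on UNIV (\<lambda>z. cutoff 3 (l z))" "continuous_on UNIV (\<lambda>z. cutoff' 3 (l z))" "continuous_on UNIV (\<lambda>z. cutoff'' 3 (l z))"
    using cq by (auto intro!: continuous_on_compose2[OF cutoff_continuous(1)[of UNIV]] continuous_on_compose2[OF cutoff_continuous(2)[of UNIV]]
       continuous_on_compose2[OF cutoff_continuous(3)[of UNIV]])
  have cK: "continuous_on UNIV K" "continuous_on UNIV Kt" "continuous_on UNIV Ktt" "continuous_on UNIV (Ki i)" "continuous_on UNIV (Kii i)" for i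
    unfolding K_def[abs_def] Kt_def[abs_def] Ktt_def[abs_def] Ki_def[abs_def] Kii_def[abs_def]
    using R by (auto intro!: cc continuous_intros)
  have l1: "((\<lambda>s. l (z + s *\<^sub>R (1, 0))) has_real_derivative -2) (at 0)" for z
    by (auto simp: l_def intro!: derivative_eq_intros)
  have lc: "((\<lambda>s. cutoff 3 (l (z + s *\<^sub>R (1, 0)))) has_real_derivative cutoff' 3 (l z) * -2) (at 0)"
    "((\<lambda>s. cutoff' 3 (l (z + s *\<^sub>R (1, 0)))) has_real_derivative cutoff'' 3 (l z) * -2) (at 0)" for z
    by (rule DERIV_chain_line[OF cutoff_deriv l1], simp, rule DERIV_chain_line[OF cutoff'_deriv l1], simp)
  have q0: "q (z + s *\<^sub>R (1, 0)) = q z" "l (z + s *\<^sub>R (0, x)) = l z" for z s x by (simp_all add: q_def l_def)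
  have q1: "((\<lambda>s. q (z + s *\<^sub>R (0, axis i 1))) has_real_derivative snd z $ i / R\<^sup>2) (at 0)" for z i
  proof -
    have e: "q (z + s *\<^sub>R (0, axis i 1)) = (snd z \<bullet> snd z + 2 * s * (snd z $ i) + s * s) / (2 * R\<^sup>2)" for s
      by (simp add: q_def inner_add inner_axis inner_axis' algebra_simps)
    have "((\<lambda>s. (A + 2 * s * c + s * s) * k) has_real_derivative 2 * c * k) (at 0)" for A c k :: real
      by (auto intro!: derivative_eq_intros)
    from this[of "snd z \<bullet> snd z" "snd z $ i" "1 / (2 * R\<^sup>2)"] show ?thesis unfolding e by simp
  qed
  have qc: "((\<lambda>s. cutoff 3 (q (z + s *\<^sub>R (0, axis i 1)))) has_real_derivative cutoff' 3 (q z) * (snd z $ i / R\<^sup>2)) (at 0)"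
    "((\<lambda>s. cutoff' 3 (q (z + s *\<^sub>R (0, axis i 1)))) has_real_derivative cutoff'' 3 (q z) * (snd z $ i / R\<^sup>2)) (at 0)" for z i
    by (rule DERIV_chain_line[OF cutoff_deriv q1], simp, rule DERIV_chain_line[OF cutoff'_deriv q1], simp)
  have dK: "((\<lambda>s. K (z + s *\<^sub>R (1, 0))) has_real_derivative Kt z) (at 0)"
      "((\<lambda>s. Kt (z + s *\<^sub>R (1, 0))) has_real_derivative Ktt z) (at 0)"
      "((\<lambda>s. K (z + s *\<^sub>R (0, axis i 1))) has_real_derivative Ki i z) (at 0)"
      "((\<lambda>s. Ki i (z + s *\<^sub>R (0, axis i 1))) has_real_derivative Kii i z) (at 0)" for z i
  proof -
    show "((\<lambda>s. K (z + s *\<^sub>R (1, 0))) has_real_derivative Kt z) (at 0)"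
      unfolding K_def Kt_def q0 by (rule DERIV_cong[OF DERIV_cmult_right[OF lc(1)]]) auto
    show "((\<lambda>s. Kt (z + s *\<^sub>R (1, 0))) has_real_derivative Ktt z) (at 0)"
      unfolding Ktt_def Kt_def q0 by (rule DERIV_cong[OF DERIV_cmult_right[OF DERIV_cmult[OF lc(2)]]]) auto
    show "((\<lambda>s. K (z + s *\<^sub>R (0, axis i 1))) has_real_derivative Ki i z) (at 0)"
      unfolding K_def Ki_def q0 by (rule DERIV_cong[OF DERIV_cmult[OF qc(1)]]) auto
    have "((\<lambda>s. (c + s) * k) has_real_derivative k) (at 0)" for c k :: real
      by (auto intro!: derivative_eq_intros)
    from this[of "snd z $ i" "1 / R\<^sup>2"]
    have s: "((\<lambda>s. snd (z + s *\<^sub>R (0, axis i 1)) $ i / R\<^sup>2) has_real_derivative 1 / R\<^sup>2) (at 0)"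
      by simp
    show "((\<lambda>s. Ki i (z + s *\<^sub>R (0, axis i 1))) has_real_derivative Kii i z) (at 0)"
      unfolding Ki_def Kii_def q0
      by (rule DERIV_cong[OF DERIV_cmult[OF DERIV_mult_line[where F="\<lambda>z. cutoff' 3 (q z)" and G="\<lambda>z. snd z $ i / R\<^sup>2", OF qc(2) s]]])
        (simp add: power2_eq_square[of "snd z $ i / R\<^sup>2"])
  qed
  have Kone: "K z = 1" "Kt z = 0" "Ktt z = 0" "Ki i z = 0" "Kii i z = 0" if "- 1 / 4 \<le> fst z" "norm (snd z) \<le> R" for z i
  proof -
    have "(norm (snd z))\<^sup>2 \<le> R\<^sup>2" using that(2) by (intro power_mono) auto
    then have "q z \<le> R\<^sup>2 / (2 * R\<^sup>2)" unfolding q_def dot_square_norm by (intro divide_right_mono) auto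
    then have "q z \<le> 1 / 2" using R by simp
    moreover have "l z \<le> 1 / 2" using that(1) by (simp add: l_def)
    ultimately show "K z = 1" "Kt z = 0" "Ktt z = 0" "Ki i z = 0" "Kii i z = 0"
      by (simp_all add: K_def Kt_def Ktt_def Ki_def Kii_def cutoff_le_half)
  qed
  have Kzero: "K z = 0" if "fst z < - 1 / 2 \<or> 2 * R < norm (snd z)" for z
    using that
  proof
    assume "2 * R < norm (snd z)"
    then have "(2 * R)\<^sup>2 \<le> (norm (snd z))\<^sup>2" using R by (intro power_mono) auto
    moreover have "2 * R\<^sup>2 \<le> (2 * R)\<^sup>2" by (simp add: power_mult_distrib)
    ultimately have "2 * R\<^sup>2 \<le> (norm (snd z))\<^sup>2" by linarith
    then have "2 * R\<^sup>2 / (2 * R\<^sup>2) \<le> q z" unfolding q_def dot_square_norm by (intro divide_right_mono) auto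
    then have "1 \<le> q z" using R by simp
    then show "K z = 0" by (simp add: K_def cutoff_ge_1)
  qed (simp add: K_def l_def cutoff_ge_1)
  let ?\<Psi> = "\<lambda>z. K z * \<Psi> z"
  let ?Pt = "\<lambda>z. Kt z * \<Psi> z + K z * Pt z"
  let ?Ptt = "\<lambda>z. (Ktt z * \<Psi> z + Kt z * Pt z) + (Kt z * Pt z + K z * Ptt z)"
  let ?P = "\<lambda>i z. Ki i z * \<Psi> z + K z * P i z"
  let ?Q = "\<lambda>i z. (Kii i z * \<Psi> z + Ki i z * P i z) + (Ki i z * P i z + K z * Q i z)"
  have main: "\<epsilon> * (LINT x|lborel. g x * ?\<Psi> (0, x)) + \<epsilon> * (LINT x|lborel. a x * f x * ?\<Psi> (0, x))
      - \<epsilon> * (LINT x|lborel. f x * ?Pt (0, x)) + (LINT z|lborel. \<bar>U z\<bar> powr p * ?\<Psi> z)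
    = (LINT z|lborel. U z * (?Ptt z - (\<Sum>i\<in>UNIV. ?Q i z) - a (snd z) * ?Pt z))"
  proof (rule weak_identity_compact_support[where P="?P"])
    show "continuous_on UNIV ?\<Psi>" "continuous_on UNIV ?Pt" "continuous_on UNIV ?Ptt" "continuous_on UNIV (?P i)" "continuous_on UNIV (?Q i)" for i
      by (intro continuous_intros cK cont)+
    show "((\<lambda>s. ?\<Psi> (z + s *\<^sub>R (1, 0))) has_real_derivative ?Pt z) (at 0)"
      "((\<lambda>s. ?Pt (z + s *\<^sub>R (1, 0))) has_real_derivative ?Ptt z) (at 0)"
      "((\<lambda>s. ?\<Psi> (z + s *\<^sub>R (0, axis i 1))) has_real_derivative ?P i z) (at 0)"
      "((\<lambda>s. ?P i (z + s *\<^sub>R (0, axis i 1))) has_real_derivative ?Q i z) (at 0)" for z i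
      by (intro DERIV_add DERIV_mult_line dK dt dx)+
    show "compact ({- 1 / 2..T1} \<times> cball (0::real^'n) (2 * R))" by (intro compact_Times) auto
    show "{- 1 / 2..T1} \<times> cball (0::real^'n) (2 * R) \<subseteq> {..<T} \<times> UNIV" using T1 by auto
    show "?\<Psi> z = 0" if "z \<notin> {- 1 / 2..T1} \<times> cball (0::real^'n) (2 * R)" for z
    proof -
      have "fst z < - 1 / 2 \<or> 2 * R < norm (snd z) \<or> T1 \<le> fst z" using that by (auto simp: mem_Times_iff not_le)
      then show ?thesis using Kzero[of z] T1(3)[of z] by auto
    qed
  qed
  have late: "Pt z = 0" "Ptt z = 0" "Q i z = 0" if "T1 < fst z" for z i
  proof -
    have cl: "closed ({..T1} \<times> (UNIV :: (real^'n) set))" by (intro closed_Times) auto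
    have n: "z \<notin> {..T1} \<times> (UNIV :: (real^'n) set) \<longleftrightarrow> T1 < fst z" for z by (auto simp: mem_Times_iff)
    have 0: "\<Psi> z = 0" if "z \<notin> {..T1} \<times> (UNIV :: (real^'n) set)" for z using that T1(3)[of z] by (auto simp: mem_Times_iff)
    have 1: "Pt z = 0" if "z \<notin> {..T1} \<times> (UNIV :: (real^'n) set)" for z by (rule directional_derivative_supp[OF dt(1) cl 0 that])
    have 2: "P i z = 0" if "z \<notin> {..T1} \<times> (UNIV :: (real^'n) set)" for z by (rule directional_derivative_supp[OF dx(1) cl 0 that])
    show "Pt z = 0" using 1 n that by blast
    show "Ptt z = 0" by (rule directional_derivative_supp[OF dt(2) cl 1]) (use n that in auto)
    show "Q i z = 0" by (rule directional_derivative_supp[OF dx(2) cl 2]) (use n that in auto)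
  qed
  have [measurable]: "K \<in> borel_measurable borel" "Kt \<in> borel_measurable borel" "Ktt \<in> borel_measurable borel"
    "Ki i \<in> borel_measurable borel" "Kii i \<in> borel_measurable borel" "\<Psi> \<in> borel_measurable borel"
    "Pt \<in> borel_measurable borel" "Ptt \<in> borel_measurable borel" "P i \<in> borel_measurable borel" "Q i \<in> borel_measurable borel" for i
    using cK cont by (auto intro: borel_measurable_continuous_onI)
  have am[measurable]: "(\<lambda>z::real \<times> (real^'n). a (snd z)) \<in> borel_measurable borel" by (rule measurable_compose[OF borel_measurable_fst_snd(2) a_measurable])
  have cases: "U z = 0 \<and> W z = 0 \<or> W z = U z \<and> (T1 < fst z \<or> - 1 / 4 \<le> fst z \<and> norm (snd z) \<le> R)"
    if "W z = U z" for z
    using that W_nonzeroD[of z] by (auto simp: R_def)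
  have eU: "(LINT z|lborel. U z * (?Ptt z - (\<Sum>i\<in>UNIV. ?Q i z) - a (snd z) * ?Pt z)) =
      (LINT z|lborel. W z * (Ptt z - (\<Sum>i\<in>UNIV. Q i z) - a (snd z) * Pt z))"
  proof (rule integral_cong_AE)
    show "AE z in lborel. U z * (?Ptt z - (\<Sum>i\<in>UNIV. ?Q i z) - a (snd z) * ?Pt z) = W z * (Ptt z - (\<Sum>i\<in>UNIV. Q i z) - a (snd z) * Pt z)"
      using W_eq_AE
    proof eventually_elim
      case (elim z)
      from cases[OF elim] consider "U z = 0" "W z = 0" | "W z = U z" "T1 < fst z" | "W z = U z" "- 1 / 4 \<le> fst z" "norm (snd z) \<le> R" by blast
      then show ?case
      proof cases
        case 2
        have "\<Psi> z = 0" using T1(3)[of z] 2 by simp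
        moreover have "P i z = 0" for i
          by (rule directional_derivative_supp[OF dx(1), where K="{..T1} \<times> UNIV"]) (use 2 T1(3) in \<open>auto intro!: closed_Times simp: mem_Times_iff\<close>)
        ultimately show ?thesis using 2 late[OF 2(2)] by simp
      qed (use Kone in simp_all)
    qed
  qed measurable
  have eP: "(LINT z|lborel. \<bar>U z\<bar> powr p * ?\<Psi> z) = (LINT z|lborel. \<bar>W z\<bar> powr p * \<Psi> z)"
  proof (rule integral_cong_AE)
    show "AE z in lborel. \<bar>U z\<bar> powr p * ?\<Psi> z = \<bar>W z\<bar> powr p * \<Psi> z"
      using W_eq_AE
    proof eventually_elim
      case (elim z)
      from cases[OF elim] show ?case using Kone(1)[of z] T1(3)[of z] by auto
    qed
  qed measurable
  have one: "K (0, x) = 1" "Kt (0, x) = 0" if "\<not> 1 < norm x" for x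
    using Kone(1,2)[of "(0, x)"] that T1 by (auto simp: R_def)
  have mf[measurable]: "f \<in> borel_measurable borel" "g \<in> borel_measurable borel" using L2f L2g by (auto simp: L2_def)
  have [measurable]: "(\<lambda>x. K (0, x)) \<in> borel_measurable borel" "(\<lambda>x. Kt (0, x)) \<in> borel_measurable borel" "(\<lambda>x. \<Psi> (0, x)) \<in> borel_measurable borel" "(\<lambda>x. Pt (0, x)) \<in> borel_measurable borel"
    by (intro borel_measurable_continuous_onI continuous_slice cK cont)+
  have e1: "(LINT x|lborel. g x * ?\<Psi> (0, x)) = (LINT x|lborel. g x * \<Psi> (0, x))"
    by (rule integral_cong_AE, measurable, use suppg in eventually_elim, use one in auto)
  have e2: "(LINT x|lborel. a x * f x * ?\<Psi> (0, x)) = (LINT x|lborel. a x * f x * \<Psi> (0, x))"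
    by (rule integral_cong_AE, measurable, use suppf in eventually_elim, use one in auto)
  have e3: "(LINT x|lborel. f x * ?Pt (0, x)) = (LINT x|lborel. f x * Pt (0, x))"
    by (rule integral_cong_AE, measurable, use suppf in eventually_elim, use one in auto)
  show ?thesis using main unfolding eU eP e1 e2 e3 .
qed

end

section \<open>A radial elliptic equation\<close>

lemma continuous_on_halfline:
  fixes h :: "real \<Rightarrow> real"
  assumes "\<And>b. 0 < b \<Longrightarrow> continuous_on {0..b} h"
  shows "continuous_on {0..} h"
  unfolding continuous_on_eq_continuous_within
proof
  fix x :: real assume "x \<in> {0..}"
  then have "continuous (at x within {0..x+1}) h"
    using assms[of "x+1"] by (auto simp: continuous_on_eq_continuous_within)
  moreover have "at x within {0..} = at x within {0..x+1}"
    by (rule at_within_nhd[of x "{x-1<..<x+1}"]) auto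
  ultimately show "continuous (at x within {0..}) h" by (simp add: continuous_within)
qed

locale radial =
  fixes d :: nat and q :: "real \<Rightarrow> real" and B :: real
  assumes q: "continuous_on {0..} q" "\<And>r. 0 \<le> r \<Longrightarrow> 0 \<le> q r" "\<And>r. 0 \<le> r \<Longrightarrow> q r \<le> B"
begin

text \<open>The equation \<phi>'' + (d/r) \<phi>' = q \<phi> times r^d reads (r^d \<phi>')' = r^d q
  \<phi>. Thus \<open>I \<phi>\<close> stands for r^d \<phi>', \<open>J \<phi>\<close> for \<phi>',
  and a regular solution with value 1 at 0 is a fixed point of 1 + integral of
  \<open>J \<phi>\<close>. In this form the singular point r = 0 is harmless.\<close>

definition I :: "(real \<Rightarrow> real) \<Rightarrow> real \<Rightarrow> real" where
  "I F s = integral {0..s} (\<lambda>\<sigma>. \<sigma> ^ d * q \<sigma> * F \<sigma>)"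

definition J :: "(real \<Rightarrow> real) \<Rightarrow> real \<Rightarrow> real" where
  "J F s = I F s / s ^ d"

lemma B: "0 \<le> B" using q(2,3)[of 0] by simp

lemma integrand_cont: "continuous_on {0..} F \<Longrightarrow> continuous_on {0..} (\<lambda>\<sigma>. \<sigma> ^ d * q \<sigma> * F \<sigma>)"
  by (intro continuous_intros q)

lemma integrand_integrable: "continuous_on {0..} F \<Longrightarrow> (\<lambda>\<sigma>. \<sigma> ^ d * q \<sigma> * F \<sigma>) integrable_on {0..s}"
  by (rule integrable_continuous_real) (rule continuous_on_subset[OF integrand_cont], auto)

lemma I_deriv:
  assumes "continuous_on {0..} F" "0 < s"
  shows "(I F has_real_derivative s ^ d * q s * F s) (at s)"
proof -
  have "((\<lambda>u. integral {0..u} (\<lambda>\<sigma>. \<sigma> ^ d * q \<sigma> * F \<sigma>)) has_real_derivative s ^ d * q s * F s) (at s within {0..s+1})"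
    by (rule integral_has_real_derivative) (use assms in \<open>auto intro: continuous_on_subset[OF integrand_cont]\<close>)
  moreover have "at s within {0..s+1} = at s"
    using assms by (intro at_within_interior) auto
  ultimately show ?thesis by (simp add: I_def[abs_def])
qed

lemma J_bounds:
  assumes F: "continuous_on {0..} F" "\<And>\<sigma>. 0 \<le> \<sigma> \<Longrightarrow> \<sigma> \<le> s \<Longrightarrow> 0 \<le> F \<sigma>" "\<And>\<sigma>. 0 \<le> \<sigma> \<Longrightarrow> \<sigma> \<le> s \<Longrightarrow> F \<sigma> \<le> M" and s: "0 \<le> s"
  shows "0 \<le> I F s" "0 \<le> J F s" "J F s \<le> B * M * s"
proof -
  have M: "0 \<le> M" using F(2,3)[of 0] s by linarith
  show "0 \<le> I F s" unfolding I_def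
    by (rule integral_nonneg[OF integrand_integrable[OF F(1)]]) (use q F in auto)
  then show "0 \<le> J F s" using s by (simp add: J_def)
  have "I F s \<le> integral {0..s} (\<lambda>\<sigma>. s ^ d * (B * M))"
    unfolding I_def mult.assoc
    using integrand_integrable[OF F(1)]
    by (intro integral_le) (use q F B M in \<open>auto simp: mult.assoc intro!: mult_mono power_mono\<close>)
  also have "\<dots> = s ^ d * (B * M * s)" using s by simp
  finally show "J F s \<le> B * M * s" unfolding J_def using s B M by (cases "s = 0") (auto simp: field_simps I_def)
qed

lemma J_mono:
  assumes "continuous_on {0..} F" "continuous_on {0..} G" "\<And>\<sigma>. 0 \<le> \<sigma> \<Longrightarrow> F \<sigma> \<le> G \<sigma>" "0 \<le> s"
  shows "J F s \<le> J G s"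
  unfolding J_def I_def using assms q
  by (intro divide_right_mono integral_le integrand_integrable) (auto intro!: mult_left_mono)

lemma J_cont:
  assumes F: "continuous_on {0..} F" "\<And>\<sigma>. 0 \<le> \<sigma> \<Longrightarrow> 0 \<le> F \<sigma>"
  shows "continuous_on {0..} (J F)"
  unfolding continuous_on_eq_continuous_within
proof
  fix s :: real assume s: "s \<in> {0..}"
  show "continuous (at s within {0..}) (J F)"
  proof (cases "s = 0")
    case False
    then have "isCont (I F) s" using DERIV_isCont[OF I_deriv[OF F(1)]] s by auto
    then have "isCont (J F) s" unfolding J_def[abs_def] using False by (intro continuous_intros) auto
    then show ?thesis by (rule continuous_at_imp_continuous_at_within)
  next
    case True
    have "compact (F ` {0..1})" by (intro compact_continuous_image continuous_on_subset[OF F(1)]) auto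
    then obtain M where M: "\<And>\<sigma>. \<sigma> \<in> {0..1} \<Longrightarrow> F \<sigma> \<le> M"
      using compact_imp_bounded[of "F ` {0..1}"] by (metis abs_le_D1 bounded_real image_eqI)
    have "((J F) \<longlongrightarrow> 0) (at 0 within {0..})"
    proof (rule Lim_null_comparison)
      have "\<forall>\<^sub>F s in at 0 within {0..}. s \<in> {0..1::real}"
        by (auto simp: eventually_at_filter eventually_nhds intro!: exI[of _ "{-1<..<1}"])
      then show "\<forall>\<^sub>F s in at 0 within {0..}. norm (J F s) \<le> B * M * s"
      proof eventually_elim
        case (elim s)
        then show ?case using J_bounds(2,3)[of F s M] F M by auto
      qed
      have "((\<lambda>s. B * M * s) \<longlongrightarrow> B * M * 0) (at 0 within {0..})" by (intro tendsto_intros)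
      then show "((\<lambda>s. B * M * s) \<longlongrightarrow> 0) (at 0 within {0..})" by simp
    qed
    then show ?thesis unfolding True continuous_within by (simp add: J_def I_def)
  qed
qed

text \<open>Picard iterates, starting from the constant 1.\<close>

primrec ph :: "nat \<Rightarrow> real \<Rightarrow> real" where
  "ph 0 = (\<lambda>r. 1)"
| "ph (Suc k) = (\<lambda>r. 1 + integral {0..r} (J (ph k)))"

lemma J_integrable:
  assumes "continuous_on {0..} F" "\<And>\<sigma>. 0 \<le> \<sigma> \<Longrightarrow> 0 \<le> F \<sigma>"
  shows "J F integrable_on {0..r}"
  by (rule integrable_continuous_real) (rule continuous_on_subset[OF J_cont[OF assms]], auto)

lemma exp_integral:
  assumes "0 \<le> r"
  shows "((\<lambda>s. B * exp (B * s\<^sup>2 / 2) * s) has_integral (exp (B * r\<^sup>2 / 2) - exp (B * 0\<^sup>2 / 2))) {0..r}"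
  by (rule fundamental_theorem_of_calculus[OF assms])
    (auto intro!: derivative_eq_intros simp: has_real_derivative_iff_has_vector_derivative[symmetric])

text \<open>The bound exp(B r^2 / 2) reproduces itself: it gives \<open>J (ph k) s\<close> <= B s
  exp(B s^2 / 2), which is exactly its derivative. Positivity of \<open>q\<close> makes the
  iteration monotone.\<close>

lemma ph_props:
  "continuous_on {0..} (ph k) \<and> (\<forall>r\<ge>0. 1 \<le> ph k r \<and> ph k r \<le> exp (B * r\<^sup>2 / 2) \<and> ph k r \<le> ph (Suc k) r)"
proof (induction k)
  case 0
  have "0 \<le> integral {0..r} (J (\<lambda>r. 1))" if "0 \<le> r" for r
    by (rule integral_nonneg[OF J_integrable]) (auto intro!: J_bounds(2)[where M=1])
  then show ?case using B by (auto intro!: continuous_intros)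
next
  case (Suc k)
  then have c: "continuous_on {0..} (ph k)" and b: "\<And>r. 0 \<le> r \<Longrightarrow> 1 \<le> ph k r" "\<And>r. 0 \<le> r \<Longrightarrow> ph k r \<le> exp (B * r\<^sup>2 / 2)"
    "\<And>r. 0 \<le> r \<Longrightarrow> ph k r \<le> ph (Suc k) r" by blast+
  have nn: "\<And>r. 0 \<le> r \<Longrightarrow> 0 \<le> ph k r" using b(1) by (meson order_trans zero_le_one)
  have nn': "\<And>r. 0 \<le> r \<Longrightarrow> 0 \<le> ph (Suc k) r" using b(3) nn by (meson order_trans)
  have c': "continuous_on {0..} (ph (Suc k))"
    unfolding ph.simps
    by (intro continuous_intros continuous_on_halfline indefinite_integral_continuous_1 J_integrable c nn)
  have J0: "0 \<le> integral {0..r} (J (ph k))" if "0 \<le> r" for r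
  proof (rule integral_nonneg[OF J_integrable[OF c nn]])
    fix s assume "s \<in> {0..r}"
    then show "0 \<le> J (ph k) s" by (intro J_bounds(2)[OF c nn, where M="exp (B * s\<^sup>2 / 2)"])
       (use B in \<open>auto intro!: order_trans[OF b(2)] mult_left_mono power_mono\<close>)
  qed
  have up: "integral {0..r} (J (ph k)) \<le> exp (B * r\<^sup>2 / 2) - 1" if "0 \<le> r" for r
  proof -
    have "integral {0..r} (J (ph k)) \<le> integral {0..r} (\<lambda>s. B * exp (B * s\<^sup>2 / 2) * s)"
    proof (rule integral_le[OF J_integrable[OF c nn]])
      show "(\<lambda>s. B * exp (B * s\<^sup>2 / 2) * s) integrable_on {0..r}" using exp_integral[OF that] by blast
      fix s assume "s \<in> {0..r}"
      then show "J (ph k) s \<le> B * exp (B * s\<^sup>2 / 2) * s"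
        by (intro J_bounds(3)[OF c nn]) (use B in \<open>auto intro!: order_trans[OF b(2)] mult_left_mono power_mono\<close>)
    qed auto
    also have "\<dots> = exp (B * r\<^sup>2 / 2) - 1" using integral_unique[OF exp_integral[OF that]] by simp
    finally show ?thesis .
  qed
  have mono: "integral {0..r} (J (ph k)) \<le> integral {0..r} (J (ph (Suc k)))" if "0 \<le> r" for r
    by (rule integral_le[OF J_integrable[OF c nn] J_integrable[OF c' nn']]) (use b(3) in \<open>auto intro!: J_mono c c' simp del: ph.simps\<close>)
  have e1: "ph (Suc k) r = 1 + integral {0..r} (J (ph k))" "ph (Suc (Suc k)) r = 1 + integral {0..r} (J (ph (Suc k)))" for r by simp_all
  show ?case
  proof (intro conjI allI impI c')
    fix r :: real assume r: "0 \<le> r"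
    show "1 \<le> ph (Suc k) r" "ph (Suc k) r \<le> exp (B * r\<^sup>2 / 2)" using J0[OF r] up[OF r] unfolding e1(1) by linarith+
    show "ph (Suc k) r \<le> ph (Suc (Suc k)) r" using mono[OF r] by (subst e1(2), subst e1(1)) linarith
  qed
qed

text \<open>The iterates increase and are bounded on bounded intervals, so they converge pointwise.
  Dominated convergence, once inside \<open>I\<close> and once for the outer integral, passes to the
  limit in the fixed point equation.\<close>

lemma solution:
  obtains \<phi> where "continuous_on {0..} \<phi>" "\<And>r. 0 \<le> r \<Longrightarrow> 1 \<le> \<phi> r"
    "\<And>r. 0 \<le> r \<Longrightarrow> \<phi> r = 1 + integral {0..r} (J \<phi>)"
proof -
  have c: "continuous_on {0..} (ph k)" and b: "\<And>r. 0 \<le> r \<Longrightarrow> 1 \<le> ph k r" "\<And>r. 0 \<le> r \<Longrightarrow> ph k r \<le> exp (B * r\<^sup>2 / 2)"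
    "\<And>r. 0 \<le> r \<Longrightarrow> ph k r \<le> ph (Suc k) r" for k using ph_props[of k] by blast+
  have nn: "\<And>r k. 0 \<le> r \<Longrightarrow> 0 \<le> ph k r" using b(1) by (meson order_trans zero_le_one)
  define \<phi> where "\<phi> r = lim (\<lambda>k. ph k r)" for r
  have lim: "(\<lambda>k. ph k r) \<longlonglongrightarrow> \<phi> r" if "0 \<le> r" for r
  proof -
    have "incseq (\<lambda>k. ph k r)" by (rule incseq_SucI) (rule b(3)[OF that])
    then have "convergent (\<lambda>k. ph k r)"
      using b(2)[OF that] incseq_convergent[of "\<lambda>k. ph k r" "exp (B * r\<^sup>2 / 2)"] by (metis convergent_def)
    then show ?thesis unfolding \<phi>_def by (simp add: convergent_LIMSEQ_iff)
  qed
  have limI: "(\<lambda>k. I (ph k) s) \<longlonglongrightarrow> I \<phi> s" if "0 \<le> s" for s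
    unfolding I_def
  proof (rule dominated_convergence(2)[where h="\<lambda>_. s ^ d * (B * exp (B * s\<^sup>2 / 2))"])
    show "(\<lambda>\<sigma>. \<sigma> ^ d * q \<sigma> * ph k \<sigma>) integrable_on {0..s}" for k by (rule integrand_integrable[OF c])
    show "norm (x ^ d * q x * ph k x) \<le> s ^ d * (B * exp (B * s\<^sup>2 / 2))" if "x \<in> {0..s}" for k x
    proof -
      have "ph k x \<le> exp (B * s\<^sup>2 / 2)" using that B by (auto intro!: order_trans[OF b(2)] mult_left_mono power_mono)
      then have "x ^ d * (q x * ph k x) \<le> s ^ d * (B * exp (B * s\<^sup>2 / 2))"
        using that q B nn by (intro mult_mono power_mono) auto
      moreover have "0 \<le> x ^ d * q x * ph k x" using that q nn by auto
      ultimately show ?thesis by (simp add: mult.assoc)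
    qed
    show "(\<lambda>k. x ^ d * q x * ph k x) \<longlonglongrightarrow> x ^ d * q x * \<phi> x" if "x \<in> {0..s}" for x
      using that by (intro tendsto_mult_left lim) auto
  qed auto
  have limJ: "(\<lambda>k. J (ph k) s) \<longlonglongrightarrow> J \<phi> s" if "0 \<le> s" for s
    unfolding J_def divide_inverse by (intro tendsto_mult_right limI that)
  have Jb: "norm (J (ph k) s) \<le> B * exp (B * r\<^sup>2 / 2) * r" if "s \<in> {0..r}" for k s r
  proof -
    have bb: "ph k \<sigma> \<le> exp (B * r\<^sup>2 / 2)" if "0 \<le> \<sigma>" "\<sigma> \<le> s" for \<sigma>
      using that \<open>s \<in> {0..r}\<close> B by (auto intro!: order_trans[OF b(2)] mult_left_mono power_mono)
    have "0 \<le> J (ph k) s" "J (ph k) s \<le> B * exp (B * r\<^sup>2 / 2) * s"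
      using that by (intro J_bounds[OF c nn bb]; simp)+
    moreover have "B * exp (B * r\<^sup>2 / 2) * s \<le> B * exp (B * r\<^sup>2 / 2) * r" using that B by (intro mult_left_mono) auto
    ultimately show ?thesis by simp
  qed
  have DC: "J \<phi> integrable_on {0..r}" "(\<lambda>k. integral {0..r} (J (ph k))) \<longlonglongrightarrow> integral {0..r} (J \<phi>)" for r
    by (rule dominated_convergence[where f="\<lambda>k. J (ph k)" and h="\<lambda>_. B * exp (B * r\<^sup>2 / 2) * r"];
      use J_integrable[OF c nn] Jb limJ in auto)+
  have eq: "\<phi> r = 1 + integral {0..r} (J \<phi>)" if "0 \<le> r" for r
  proof (rule LIMSEQ_unique)
    show "(\<lambda>k. ph (Suc k) r) \<longlonglongrightarrow> \<phi> r" using lim[OF that] by (rule LIMSEQ_Suc)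
    show "(\<lambda>k. ph (Suc k) r) \<longlonglongrightarrow> 1 + integral {0..r} (J \<phi>)" unfolding ph.simps by (intro tendsto_intros DC)
  qed
  have "continuous_on {0..} (\<lambda>r. 1 + integral {0..r} (J \<phi>))"
    by (intro continuous_intros continuous_on_halfline indefinite_integral_continuous_1 DC)
  then have "continuous_on {0..} \<phi>" by (rule continuous_on_eq) (simp add: eq)
  moreover have "1 \<le> \<phi> r" if "0 \<le> r" for r
    by (rule LIMSEQ_le_const[OF lim[OF that]]) (use b(1)[OF that] in auto)
  ultimately show thesis using eq that by blast
qed

end

lemma DERIV_norm_line:
  fixes x :: "real^'n"
  assumes "x \<noteq> 0"
  shows "((\<lambda>s. norm (x + s *\<^sub>R axis i 1)) has_real_derivative x $ i / norm x) (at 0)"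
proof -
  have e: "norm (x + s *\<^sub>R axis i 1) = sqrt (x \<bullet> x + 2 * s * (x $ i) + s * s)" for s
    by (simp add: norm_eq_sqrt_inner inner_add inner_axis inner_axis' algebra_simps)
  have pos: "0 < x \<bullet> x" using assms by simp
  have "((\<lambda>s. x \<bullet> x + 2 * s * (x $ i) + s * s) has_real_derivative 2 * x $ i) (at 0)"
    by (auto intro!: derivative_eq_intros)
  then have "((\<lambda>s. sqrt (x \<bullet> x + 2 * s * (x $ i) + s * s)) has_real_derivative (inverse (sqrt (x \<bullet> x + 2 * 0 * (x $ i) + 0 * 0)) / 2) * (2 * x $ i)) (at 0)"
    by (rule DERIV_chain2[where f=sqrt, OF DERIV_real_sqrt, rotated]) (use pos in simp)
  moreover have "x \<bullet> x + 2 * 0 * (x $ i) + 0 * 0 = x \<bullet> x" by simp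
  moreover have "inverse (norm x) / 2 * (2 * x $ i) = x $ i / norm x" by (simp add: inverse_eq_divide)
  ultimately show ?thesis by (simp only: e norm_eq_sqrt_inner[of x, symmetric])
qed

section \<open>Growth of the radial solution and its extension to space\<close>

context radial
begin

context
  fixes \<phi> :: "real \<Rightarrow> real"
  assumes \<phi>: "continuous_on {0..} \<phi>" "\<And>r. 0 \<le> r \<Longrightarrow> 1 \<le> \<phi> r"
    "\<And>r. 0 \<le> r \<Longrightarrow> \<phi> r = 1 + integral {0..r} (J \<phi>)"
begin

lemma \<phi>_nonneg: "0 \<le> r \<Longrightarrow> 0 \<le> \<phi> r"
  using \<phi>(2) by (meson order_trans zero_le_one)

lemma \<phi>_deriv:
  assumes "0 < r"
  shows "(\<phi> has_real_derivative J \<phi> r) (at r)"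
proof -
  have "((\<lambda>u. integral {0..u} (J \<phi>)) has_real_derivative J \<phi> r) (at r within {0..r+1})"
    by (rule integral_has_real_derivative) (use assms in \<open>auto intro: continuous_on_subset[OF J_cont[OF \<phi>(1) \<phi>_nonneg]]\<close>)
  moreover have "at r within {0..r+1} = at r"
    using assms by (intro at_within_interior) auto
  ultimately have "((\<lambda>u. 1 + integral {0..u} (J \<phi>)) has_real_derivative J \<phi> r) (at r)"
    by (auto intro!: derivative_eq_intros)
  then show ?thesis
    by (rule has_field_derivative_transform_within_open[where S="{0<..}"]) (use assms \<phi>(3) in auto)
qed

lemma \<phi>_mono:
  assumes "0 \<le> r" "r \<le> s"
  shows "\<phi> r \<le> \<phi> s"
proof -
  have Jn: "0 \<le> J \<phi> t" if t: "0 \<le> t" for t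
  proof -
    have "compact (\<phi> ` {0..t})" by (intro compact_continuous_image continuous_on_subset[OF \<phi>(1)]) auto
    then obtain M where "\<And>\<sigma>. \<sigma> \<in> {0..t} \<Longrightarrow> \<phi> \<sigma> \<le> M"
      using compact_imp_bounded[of "\<phi> ` {0..t}"] by (metis abs_le_D1 bounded_real image_eqI)
    then show ?thesis using t by (intro J_bounds(2)[OF \<phi>(1) \<phi>_nonneg]) auto
  qed
  have "integral {0..r} (J \<phi>) \<le> integral {0..s} (J \<phi>)"
    by (rule integral_subset_le) (use assms Jn J_integrable[OF \<phi>(1) \<phi>_nonneg] in auto)
  then show ?thesis using \<phi>(3)[of r] \<phi>(3)[of s] assms by simp
qed

text \<open>
  The Wronskian of \<open>\<phi>\<close> and the supersolution \<open>S r = exp (r - k * ln r - D / r)\<close> of $h'' + (d/r)h' = qh$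
  stays of one sign, so \<open>\<phi> / S\<close> is non-increasing.
\<close>

lemma growth:
  fixes A :: real
  assumes A: "0 \<le> A" "\<And>r. 1 \<le> r \<Longrightarrow> q r \<le> 1 + A / r\<^sup>2"
  obtains C where "0 < C" "\<And>r. 0 \<le> r \<Longrightarrow> \<phi> r \<le> C * exp r * (1 + r) powr - (real d / 2)"
proof -
  define k where "k = real d / 2"
  \<comment> \<open>The quotient is \<phi>'(2)/\<phi>(2). With l(2) = 1 - k/2 + D/4, the condition E
    <= D/4 puts the logarithmic derivative of \<open>S\<close> at 2 above that of \<phi>.\<close>
  define E where "E = I \<phi> 2 / (2 ^ d * \<phi> 2) + k / 2"
  obtain F :: real where F: "E \<le> F" "0 \<le> F" by (meson abs_ge_self abs_ge_zero)
  \<comment> \<open>A + k^2 makes \<open>S\<close> a supersolution for r >= 2; the term 4F, with F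
    above E, starts the comparison at r = 2.\<close>
  define D where "D = A + k\<^sup>2 + 4 * F"
  have k: "0 \<le> k" by (simp add: k_def)
  have k2: "0 \<le> k\<^sup>2" by simp
  have D1: "A + k\<^sup>2 \<le> D" using F by (simp add: D_def)
  have "4 * E \<le> D" using F A(1) k2 unfolding D_def by linarith
  then have D2: "E \<le> D / 4" by simp
  have D3: "0 \<le> D" using F A(1) k2 unfolding D_def by linarith
  note D = D1 D2 D3
  define S where "S r = exp (r - k * ln r - D / r)" for r
  \<comment> \<open>The logarithmic derivative S'/S. The inequality \<open>ineq\<close> below is
    S''/S + (d/r) S'/S >= q, with d = 2k.\<close>
  define l where "l r = 1 - k / r + D / r\<^sup>2" for r
  have S0: "0 < S r" for r by (simp add: S_def)
  have dS: "(S has_real_derivative l r * S r) (at r)" if "0 < r" for r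
    unfolding S_def[abs_def] l_def using that
    by (auto intro!: derivative_eq_intros simp: power2_eq_square)
  have dl: "(l has_real_derivative k / r\<^sup>2 - 2 * D / r ^ 3) (at r)" if "0 < r" for r
    unfolding l_def[abs_def] using that
    by (auto intro!: derivative_eq_intros simp: power2_eq_square power3_eq_cube field_simps)
  have ineq: "q r \<le> (k / r\<^sup>2 - 2 * D / r ^ 3) + (l r)\<^sup>2 + 2 * k / r * l r" if r: "2 \<le> r" for r
  proof -
    have "(k / r\<^sup>2 - 2 * D / r ^ 3) + (l r)\<^sup>2 + 2 * k / r * l r = k / r\<^sup>2 - 2 * D / r ^ 3 + (l r + k / r)\<^sup>2 - k\<^sup>2 / r\<^sup>2"
      by (simp add: power2_sum power_divide)
    also have "l r + k / r = 1 + D / r\<^sup>2" by (simp add: l_def)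
    finally have e: "(k / r\<^sup>2 - 2 * D / r ^ 3) + (l r)\<^sup>2 + 2 * k / r * l r = k / r\<^sup>2 - 2 * D / r ^ 3 + (1 + D / r\<^sup>2)\<^sup>2 - k\<^sup>2 / r\<^sup>2" .
    have "(1 + D / r\<^sup>2)\<^sup>2 \<ge> 1 + 2 * (D / r\<^sup>2)" by (simp add: power2_sum)
    moreover have "2 * D / r ^ 3 \<le> D / r\<^sup>2"
    proof -
      have "2 * D / r ^ 3 = (D / r\<^sup>2) * (2 / r)" by (simp add: power2_eq_square power3_eq_cube)
      also have "\<dots> \<le> (D / r\<^sup>2) * 1" using r D by (intro mult_left_mono) auto
      finally show ?thesis by simp
    qed
    moreover have "A / r\<^sup>2 + k\<^sup>2 / r\<^sup>2 \<le> D / r\<^sup>2" using D(1) by (simp add: add_divide_distrib[symmetric] divide_right_mono)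
    moreover have "0 \<le> k / r\<^sup>2" using k by simp
    ultimately show ?thesis unfolding e using A(2)[of r] r by linarith
  qed
  \<comment> \<open>Since \<open>I \<phi>\<close> is r^d \<phi>' and l S = S', this is r^d (S
    \<phi>' - \<phi> S').\<close>
  define w where "w r = S r * (I \<phi> r - r ^ d * \<phi> r * l r)" for r
  have dw: "(w has_real_derivative S r * (r ^ d * \<phi> r) * (q r - ((k / r\<^sup>2 - 2 * D / r ^ 3) + (l r)\<^sup>2 + 2 * k / r * l r))) (at r)" if r: "2 \<le> r" for r
  proof -
    have r0: "0 < r" using r by simp
    have Jr: "r ^ d * J \<phi> r = I \<phi> r" using r0 by (simp add: J_def)
    have pd: "((\<lambda>r. r ^ d) has_real_derivative 2 * k / r * r ^ d) (at r)"
    proof (rule DERIV_cong[OF DERIV_pow])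
      show "real d * r ^ (d - Suc 0) = 2 * k / r * r ^ d" using r0 by (cases d) (simp_all add: k_def)
    qed
    have "(w has_real_derivative (l r * S r) * (I \<phi> r - r ^ d * \<phi> r * l r) +
       (r ^ d * q r * \<phi> r - ((2 * k / r * r ^ d * \<phi> r + J \<phi> r * r ^ d) * l r + (k / r\<^sup>2 - 2 * D / r ^ 3) * (r ^ d * \<phi> r))) * S r) (at r)"
      unfolding w_def[abs_def]
      by (rule DERIV_mult[OF dS[OF r0] DERIV_diff[OF I_deriv[OF \<phi>(1) r0] DERIV_mult[OF DERIV_mult[OF pd \<phi>_deriv[OF r0]] dl[OF r0]]]])
    moreover have "(l r * S r) * (I \<phi> r - r ^ d * \<phi> r * l r) +
       (r ^ d * q r * \<phi> r - ((2 * k / r * r ^ d * \<phi> r + J \<phi> r * r ^ d) * l r + (k / r\<^sup>2 - 2 * D / r ^ 3) * (r ^ d * \<phi> r))) * S r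
      = S r * (r ^ d * \<phi> r) * (q r - ((k / r\<^sup>2 - 2 * D / r ^ 3) + (l r)\<^sup>2 + 2 * k / r * l r))"
      unfolding Jr[symmetric] by (simp add: algebra_simps power2_eq_square)
    ultimately show ?thesis by simp
  qed
  have w2: "w 2 \<le> 0"
  proof -
    have p2: "0 < 2 ^ d * \<phi> 2" using \<phi>(2)[of 2] by simp
    have "l 2 = 1 - k / 2 + D / 4" by (simp add: l_def)
    then have "I \<phi> 2 / (2 ^ d * \<phi> 2) \<le> l 2" using D(2) unfolding E_def by linarith
    then have "I \<phi> 2 \<le> 2 ^ d * \<phi> 2 * l 2" using p2 by (simp add: pos_divide_le_eq mult.commute)
    then show ?thesis unfolding w_def using S0[of 2] by (simp add: mult_le_0_iff)
  qed
  have w: "w r \<le> 0" if r: "2 \<le> r" for r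
  proof -
    have "w r \<le> w 2"
    proof (rule DERIV_nonpos_imp_nonincreasing[OF r])
      fix x :: real assume x: "2 \<le> x" "x \<le> r"
      show "\<exists>y. (w has_real_derivative y) (at x) \<and> y \<le> 0"
        using dw[OF x(1)] ineq[OF x(1)] S0[of x] x \<phi>_nonneg[of x]
        by (intro exI conjI) (assumption, auto intro!: mult_nonneg_nonpos)
    qed
    then show ?thesis using w2 by simp
  qed
  have quot: "\<phi> r / S r \<le> \<phi> 2 / S 2" if r: "2 \<le> r" for r
  proof (rule DERIV_nonpos_imp_nonincreasing[OF r])
    fix x :: real assume x: "2 \<le> x" "x \<le> r"
    then have x0: "0 < x" by simp
    have "I \<phi> x \<le> x ^ d * \<phi> x * l x" using w[OF x(1)] S0[of x] by (simp add: w_def mult_le_0_iff)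
    then have J: "J \<phi> x \<le> \<phi> x * l x" using x0 by (simp add: J_def pos_divide_le_eq mult_ac)
    have "((\<lambda>x. \<phi> x / S x) has_real_derivative (J \<phi> x * S x - \<phi> x * (l x * S x)) / (S x * S x)) (at x)"
      using S0[of x] by (intro DERIV_divide \<phi>_deriv dS x0) auto
    moreover have "(J \<phi> x * S x - \<phi> x * (l x * S x)) / (S x * S x) \<le> 0"
    proof -
      have "J \<phi> x * S x - \<phi> x * (l x * S x) = (J \<phi> x - \<phi> x * l x) * S x" by (simp add: algebra_simps)
      also have "\<dots> \<le> 0" using J S0[of x] by (intro mult_nonpos_nonneg) auto
      finally show ?thesis by (simp add: divide_nonpos_nonneg)
    qed
    ultimately show "\<exists>y. ((\<lambda>x. \<phi> x / S x) has_real_derivative y) (at x) \<and> y \<le> 0" by blast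
  qed
  \<comment> \<open>The first summand serves r <= 2, where \<phi> <= \<phi>(2) and 1 + r <= 3. The
    second serves r > 2, where 2^k pays for replacing r^(-k) by (1 + r)^(-k).\<close>
  define C where "C = \<phi> 2 * 3 powr k + \<phi> 2 / S 2 * 2 powr k"
  have p: "0 < \<phi> 2" using \<phi>(2)[of 2] by simp
  have C12: "0 < \<phi> 2 * 3 powr k" "0 < \<phi> 2 / S 2 * 2 powr k" using p S0[of 2] by simp_all
  then have C: "0 < C" "\<phi> 2 * 3 powr k \<le> C" "\<phi> 2 / S 2 * 2 powr k \<le> C" unfolding C_def by auto
  show thesis
  proof (rule that[of C])
    show "0 < C" by (rule C)
    fix r :: real assume r: "0 \<le> r"
    show "\<phi> r \<le> C * exp r * (1 + r) powr - (real d / 2)"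
    proof (cases "r \<le> 2")
      case True
      have a: "3 powr - k \<le> (1 + r) powr - k" using True r k by (intro powr_mono2') auto
      have b: "1 \<le> exp r" using r by simp
      have "\<phi> r \<le> \<phi> 2" using \<phi>_mono[OF r True] .
      also have "\<dots> = (\<phi> 2 * 3 powr k) * 1 * 3 powr - k" by (simp add: powr_minus)
      also have "\<dots> \<le> C * exp r * (1 + r) powr - k"
        using a b p C by (intro mult_mono) auto
      finally show ?thesis by (simp add: k_def)
    next
      case False
      have a: "S r \<le> exp r * r powr - k"
      proof -
        have "S r \<le> exp (r + - k * ln r)" unfolding S_def using False D(3) by simp
        also have "\<dots> = exp r * r powr - k" using False by (simp add: powr_def exp_add[symmetric])
        finally show ?thesis .
      qed
      have b: "r powr - k \<le> 2 powr k * (1 + r) powr - k"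
      proof -
        have "((1 + r) / 2) powr - k \<ge> r powr - k" using False k by (intro powr_mono2') auto
        moreover have "((1 + r) / 2) powr - k = 2 powr k * (1 + r) powr - k" using False
          by (simp add: powr_divide powr_minus_divide)
        ultimately show ?thesis by simp
      qed
      have "\<phi> r \<le> \<phi> 2 / S 2 * S r" using quot[of r] False S0[of r] by (simp add: pos_divide_le_eq)
      also have "\<dots> \<le> \<phi> 2 / S 2 * (exp r * (2 powr k * (1 + r) powr - k))"
      proof (rule mult_left_mono)
        have "S r \<le> exp r * r powr - k" by (rule a)
        also have "\<dots> \<le> exp r * (2 powr k * (1 + r) powr - k)" by (intro mult_left_mono b) simp
        finally show "S r \<le> exp r * (2 powr k * (1 + r) powr - k)" .
      qed (use p S0[of 2] in simp)
      also have "\<dots> = (\<phi> 2 / S 2 * 2 powr k) * (exp r * (1 + r) powr - k)" by simp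
      also have "\<dots> \<le> C * (exp r * (1 + r) powr - k)" by (intro mult_right_mono C) auto
      finally show ?thesis by (simp add: k_def mult.assoc)
    qed
  qed
qed

text \<open>\<phi>'(s)/s, extended by its limit at 0, which is q(0)/(d+1) because \<phi>(0) = 1. The
  gradient of \<phi>(|x|) is then x m(|x|), without a singularity.\<close>

definition m :: "real \<Rightarrow> real" where
  "m s = (if s = 0 then q 0 / real (Suc d) else I \<phi> s / s ^ Suc d)"

text \<open>This is s m'(s) = \<phi>'' - \<phi>'/s, the coefficient of (x_i/|x|)^2 in the i-th pure
  second derivative of \<phi>(|x|).\<close>

definition hess :: "real \<Rightarrow> real" where
  "hess s = q s * \<phi> s - real (Suc d) * m s"

lemma phi0: "\<phi> 0 = 1" using \<phi>(3)[of 0] by simp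

lemma m_deriv:
  assumes "0 < s"
  shows "(m has_real_derivative hess s / s) (at s)"
proof -
  have "((\<lambda>s. I \<phi> s / s ^ Suc d) has_real_derivative (s ^ d * q s * \<phi> s * s ^ Suc d - I \<phi> s * (real (Suc d) * s ^ (Suc d - Suc 0))) / (s ^ Suc d * s ^ Suc d)) (at s)"
    by (intro DERIV_divide I_deriv \<phi> DERIV_pow assms) (use assms in auto)
  moreover have "(s ^ d * q s * \<phi> s * s ^ Suc d - I \<phi> s * (real (Suc d) * s ^ (Suc d - Suc 0))) / (s ^ Suc d * s ^ Suc d) = hess s / s"
    using assms unfolding hess_def m_def by (simp add: field_simps)
  ultimately have "((\<lambda>s. I \<phi> s / s ^ Suc d) has_real_derivative hess s / s) (at s)" by simp
  then show ?thesis
    by (rule has_field_derivative_transform_within_open[where S="{0<..}"]) (use assms in \<open>auto simp: m_def\<close>)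
qed

lemma m_cont: "continuous_on {0..} m"
  unfolding continuous_on_eq_continuous_within
proof
  fix s :: real assume s: "s \<in> {0..}"
  show "continuous (at s within {0..}) m"
  proof (cases "s = 0")
    case False
    then show ?thesis using DERIV_isCont[OF m_deriv] s by (auto intro: continuous_at_imp_continuous_at_within)
  next
    case True
    have "((\<lambda>s. I \<phi> s / s ^ Suc d) \<longlongrightarrow> q 0 * \<phi> 0 / real (Suc d)) (at_right 0)"
    proof (rule lhopital_right_0)
      have "continuous_on {0..1} (I \<phi>)" unfolding I_def[abs_def] by (rule indefinite_integral_continuous_1[OF integrand_integrable[OF \<phi>(1)]])
      then have "(I \<phi> \<longlongrightarrow> I \<phi> 0) (at 0 within {0..1})" by (auto simp: continuous_on_def)
      then have "(I \<phi> \<longlongrightarrow> I \<phi> 0) (at_right 0)" by (simp add: at_within_Icc_at_right)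
      then show "(I \<phi> \<longlongrightarrow> 0) (at_right 0)" by (simp add: I_def)
      have "((\<lambda>s::real. s ^ Suc d) \<longlongrightarrow> 0 ^ Suc d) (at_right 0)" by (intro tendsto_intros)
      then show "((\<lambda>s::real. s ^ Suc d) \<longlongrightarrow> 0) (at_right 0)" by simp
      have pos: "\<forall>\<^sub>F x in at_right 0. (0::real) < x" by (simp add: eventually_at_filter)
      show "\<forall>\<^sub>F x in at_right 0. x ^ Suc d \<noteq> (0::real)" using pos by eventually_elim simp
      show "\<forall>\<^sub>F x in at_right 0. real (Suc d) * x ^ d \<noteq> (0::real)" using pos by eventually_elim simp
      show "\<forall>\<^sub>F x in at_right 0. (I \<phi> has_real_derivative x ^ d * q x * \<phi> x) (at x)" using pos by eventually_elim (rule I_deriv[OF \<phi>(1)])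
      show "\<forall>\<^sub>F x in at_right 0. ((\<lambda>s. s ^ Suc d) has_real_derivative real (Suc d) * x ^ d) (at x)"
        using DERIV_pow[of "Suc d"] by (intro always_eventually) simp
      have "((\<lambda>x. q x * \<phi> x) \<longlongrightarrow> q 0 * \<phi> 0) (at 0 within {0..})"
        using q(1) \<phi>(1) by (intro tendsto_mult) (auto simp: continuous_on_def)
      then have "((\<lambda>x. q x * \<phi> x) \<longlongrightarrow> q 0 * \<phi> 0) (at_right 0)" by (rule tendsto_within_subset) auto
      then have "((\<lambda>x. q x * \<phi> x / real (Suc d)) \<longlongrightarrow> q 0 * \<phi> 0 / real (Suc d)) (at_right 0)"
        by (rule tendsto_divide[OF _ tendsto_const]) simp
      then show "((\<lambda>x. x ^ d * q x * \<phi> x / (real (Suc d) * x ^ d)) \<longlongrightarrow> q 0 * \<phi> 0 / real (Suc d)) (at_right 0)"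
        by (rule Lim_transform_eventually) (use pos in \<open>eventually_elim, simp\<close>)
    qed
    then have "((\<lambda>s. I \<phi> s / s ^ Suc d) \<longlongrightarrow> m 0) (at_right 0)" by (simp add: m_def phi0)
    then have "(m \<longlongrightarrow> m 0) (at_right 0)"
      by (rule Lim_transform_eventually) (auto simp: eventually_at_filter m_def)
    moreover have "at 0 within {0..} = at_right (0::real)" by (rule at_within_Ici_at_right)
    ultimately show ?thesis unfolding True continuous_within by simp
  qed
qed

lemma hess_cont: "continuous_on {0..} hess"
  unfolding hess_def[abs_def] by (intro continuous_intros q \<phi> m_cont)

lemma hess0: "hess 0 = 0" by (simp add: hess_def m_def phi0)

definition Phi :: "real^'n \<Rightarrow> real" where "Phi x = \<phi> (norm x)"
definition Pi :: "'n \<Rightarrow> real^'n \<Rightarrow> real" where "Pi i x = x $ i * m (norm x)"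
definition Qi :: "'n \<Rightarrow> real^'n \<Rightarrow> real" where "Qi i x = m (norm x) + (x $ i / norm x)\<^sup>2 * hess (norm x)"

lemma cont_norm: "continuous_on {0..} h \<Longrightarrow> continuous_on UNIV (\<lambda>x::real^'n. h (norm x))"
  by (rule continuous_on_compose2[of "{0..}" h]) (auto intro: continuous_intros)

lemma Phi_cont: "continuous_on UNIV Phi" "continuous_on UNIV (Pi i)"
  unfolding Phi_def[abs_def] Pi_def[abs_def] by (intro continuous_intros cont_norm \<phi> m_cont)+

text \<open>At the origin x_i/|x| has no limit, but it is bounded by 1 and multiplies
  \<open>hess\<close>, which tends to 0 there.\<close>

lemma Qi_cont:
  fixes i :: "'n::finite"
  shows "continuous_on UNIV (Qi i)"
proof -
  have "continuous_on UNIV (\<lambda>x::real^'n. (x $ i / norm x)\<^sup>2 * hess (norm x))"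
    unfolding continuous_on_eq_continuous_at[OF open_UNIV]
  proof
    fix x :: "real^'n"
    have "continuous_on UNIV (\<lambda>x::real^'n. hess (norm x))" by (rule cont_norm[OF hess_cont])
    then have ck: "isCont (\<lambda>x::real^'n. hess (norm x)) x" by (simp add: continuous_on_eq_continuous_at)
    show "isCont (\<lambda>x. (x $ i / norm x)\<^sup>2 * hess (norm x)) x"
    proof (cases "x = 0")
      case False
      have "isCont (\<lambda>x. x $ i) x" by (intro continuous_intros)
      then show ?thesis using False by (intro continuous_mult continuous_power continuous_divide ck continuous_norm continuous_ident) auto
    next
      case True
      have "((\<lambda>x. (x $ i / norm x)\<^sup>2 * hess (norm x)) \<longlongrightarrow> 0) (at 0)"
      proof (rule Lim_null_comparison)
        show "\<forall>\<^sub>F x in at 0. norm ((x $ i / norm x)\<^sup>2 * hess (norm x)) \<le> \<bar>hess (norm (x::real^'n))\<bar>"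
        proof (intro always_eventually allI)
          fix x :: "real^'n"
          have "\<bar>x $ i / norm x\<bar> \<le> 1" using component_le_norm_cart[of x i] by (simp add: abs_divide divide_le_eq_1)
          then have "(x $ i / norm x)\<^sup>2 \<le> 1" by (simp add: abs_square_le_1)
          then show "norm ((x $ i / norm x)\<^sup>2 * hess (norm x)) \<le> \<bar>hess (norm x)\<bar>"
            unfolding real_norm_def abs_mult by (simp add: mult_left_le_one_le)
        qed
        have "((\<lambda>x::real^'n. \<bar>hess (norm x)\<bar>) \<longlongrightarrow> \<bar>hess (norm (0::real^'n))\<bar>) (at 0)"
          using ck unfolding True by (intro tendsto_rabs) (simp add: isCont_def)
        then show "((\<lambda>x::real^'n. \<bar>hess (norm x)\<bar>) \<longlongrightarrow> 0) (at 0)" by (simp add: hess0)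
      qed
      then show ?thesis unfolding True isCont_def by simp
    qed
  qed
  then show ?thesis unfolding Qi_def[abs_def] by (intro continuous_on_add cont_norm m_cont)
qed

lemma Phi_deriv: "((\<lambda>s. Phi (x + s *\<^sub>R axis i 1)) has_real_derivative Pi i x) (at 0)"
proof (cases "x = 0")
  case False
  then have n: "0 < norm x" by simp
  have "((\<lambda>s. \<phi> (norm (x + s *\<^sub>R axis i 1))) has_real_derivative J \<phi> (norm x) * (x $ i / norm x)) (at 0)"
    by (rule DERIV_chain_line[OF \<phi>_deriv[OF n] DERIV_norm_line[OF False]])
  moreover have "J \<phi> (norm x) * (x $ i / norm x) = Pi i x" using n by (simp add: Pi_def m_def J_def mult_ac)
  ultimately show ?thesis by (simp add: Phi_def)
next
  case True
  have "compact (\<phi> ` {0..1})" by (intro compact_continuous_image continuous_on_subset[OF \<phi>(1)]) auto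
  then obtain M where M: "\<And>\<sigma>. \<sigma> \<in> {0..1} \<Longrightarrow> \<phi> \<sigma> \<le> M"
    using compact_imp_bounded[of "\<phi> ` {0..1}"] by (metis abs_le_D1 bounded_real image_eqI)
  have M0: "0 \<le> M" using M[of 0] phi0 by simp
  \<comment> \<open>Quadratic closeness to 1 makes the derivative of \<phi>(|h|) vanish at h = 0,
    where the chain rule through the norm fails.\<close>
  have b: "\<bar>\<phi> r - 1\<bar> \<le> B * M * r * r" if r: "0 \<le> r" "r \<le> 1" for r
  proof -
    have "integral {0..r} (J \<phi>) \<le> integral {0..r} (\<lambda>s. B * M * r)"
    proof (rule integral_le[OF J_integrable[OF \<phi>(1) \<phi>_nonneg]])
      fix s assume s: "s \<in> {0..r}"
      have "J \<phi> s \<le> B * M * s" using s r M by (intro J_bounds(3)[OF \<phi>(1) \<phi>_nonneg]) auto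
      also have "\<dots> \<le> B * M * r" using s B M0 by (intro mult_left_mono) auto
      finally show "J \<phi> s \<le> B * M * r" .
    qed auto
    then show ?thesis using \<phi>(2,3)[of r] r by (simp add: mult_ac)
  qed
  have "((\<lambda>h. (\<phi> \<bar>0 + h\<bar> - \<phi> \<bar>0\<bar>) / h) \<longlongrightarrow> 0) (at 0)"
  proof (rule Lim_null_comparison)
    have "\<forall>\<^sub>F h in at (0::real). h \<in> {-1<..<1}" by (auto simp: eventually_at_filter eventually_nhds intro!: exI[of _ "{-1<..<1}"])
    then show "\<forall>\<^sub>F h in at 0. norm ((\<phi> \<bar>0 + h\<bar> - \<phi> \<bar>0\<bar>) / h) \<le> B * M * \<bar>h\<bar>"
    proof eventually_elim
      case (elim h)
      show ?case
      proof (cases "h = 0")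
        case False
        have "\<bar>\<phi> \<bar>h\<bar> - 1\<bar> \<le> B * M * \<bar>h\<bar> * \<bar>h\<bar>" using elim by (intro b) auto
        then show ?thesis using False by (simp add: phi0 abs_divide pos_divide_le_eq)
      qed (use B M0 in simp)
    qed
    have "((\<lambda>h. B * M * \<bar>h\<bar>) \<longlongrightarrow> B * M * \<bar>0\<bar>) (at 0)" by (intro tendsto_intros)
    then show "((\<lambda>h. B * M * \<bar>h\<bar>) \<longlongrightarrow> 0) (at 0)" by simp
  qed
  then have "((\<lambda>h. \<phi> \<bar>h\<bar>) has_real_derivative 0) (at 0)" by (simp add: DERIV_def)
  then show ?thesis unfolding True by (simp add: Phi_def Pi_def)
qed

lemma Pi_deriv: "((\<lambda>s. Pi i (x + s *\<^sub>R axis i 1)) has_real_derivative Qi i x) (at 0)"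
proof (cases "x = 0")
  case False
  then have n: "0 < norm x" by simp
  have 1: "((\<lambda>s. m (norm (x + s *\<^sub>R axis i 1))) has_real_derivative hess (norm x) / norm x * (x $ i / norm x)) (at 0)"
    by (rule DERIV_chain_line[OF m_deriv[OF n] DERIV_norm_line[OF False]])
  have 2: "((\<lambda>s. (x + s *\<^sub>R axis i 1) $ i) has_real_derivative 1) (at 0)"
    by (auto intro!: derivative_eq_intros)
  have "((\<lambda>s. (x + s *\<^sub>R axis i 1) $ i * m (norm (x + s *\<^sub>R axis i 1))) has_real_derivative
      1 * m (norm x) + x $ i * (hess (norm x) / norm x * (x $ i / norm x))) (at 0)"
    by (rule DERIV_mult_line[OF 2 1])
  moreover have "1 * m (norm x) + x $ i * (hess (norm x) / norm x * (x $ i / norm x)) = Qi i x"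
    by (simp add: Qi_def power2_eq_square)
  ultimately show ?thesis by (simp add: Pi_def)
next
  case True
  have "isCont (\<lambda>h. m (norm (h::real))) 0"
  proof -
    have "continuous_on UNIV (\<lambda>h::real. m (norm h))" by (rule continuous_on_compose2[OF m_cont]) (auto intro: continuous_intros)
    then show ?thesis by (simp add: continuous_on_eq_continuous_at)
  qed
  then have "((\<lambda>h. m \<bar>h\<bar>) \<longlongrightarrow> m 0) (at 0)" by (simp add: isCont_def)
  then have "((\<lambda>h. ((0 + h) * m \<bar>0 + h\<bar> - 0 * m \<bar>0\<bar>) / h) \<longlongrightarrow> m 0) (at 0)"
    by (rule Lim_transform_eventually) (auto simp: eventually_at_filter)
  then have "((\<lambda>h. h * m \<bar>h\<bar>) has_real_derivative m 0) (at 0)" by (simp add: DERIV_def)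
  then show ?thesis unfolding True by (simp add: Pi_def Qi_def)
qed

text \<open>The squares (x_i/|x|)^2 add up to 1, so the trace is (d+1) m + \<open>hess\<close>,
  which is q \<phi> by the definition of \<open>hess\<close>.\<close>

lemma Phi_laplace:
  fixes x :: "real^'n"
  assumes "CARD('n) = Suc d"
  shows "(\<Sum>i\<in>UNIV. Qi i x) = q (norm x) * Phi x"
proof (cases "x = 0")
  case True
  then show ?thesis using assms by (simp add: Qi_def Phi_def m_def phi0)
next
  case False
  have "(\<Sum>i\<in>UNIV. (x $ i / norm x)\<^sup>2) = (\<Sum>i\<in>UNIV. (x $ i)\<^sup>2) / (norm x)\<^sup>2"
    by (simp add: power_divide sum_divide_distrib)
  also have "(\<Sum>i\<in>UNIV. (x $ i)\<^sup>2) = (norm x)\<^sup>2"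
    by (simp add: norm_eq_sqrt_inner inner_vec_def power2_eq_square sum_nonneg)
  finally have "(\<Sum>i\<in>UNIV. (x $ i / norm x)\<^sup>2) = 1" using False by simp
  then have "(\<Sum>i\<in>UNIV. Qi i x) = real (Suc d) * m (norm x) + hess (norm x)"
    using assms by (simp add: Qi_def sum.distrib sum_distrib_right[symmetric])
  then show ?thesis by (simp add: hess_def Phi_def)
qed

end

end

text \<open>Applied later with q = 1 + damping. Both bounds matter: \<Phi> >= 1 keeps the pairing
  with \<open>g\<close> positive, and the factor (1 + |x|)^(-(n-1)/2) determines the power of R in
  the lower bound.\<close>

theorem elliptic_solution:
  fixes q :: "real \<Rightarrow> real"
  assumes n: "2 \<le> CARD('n)" and q: "continuous_on {0..} q" "\<And>r. 0 \<le> r \<Longrightarrow> 0 \<le> q r" "\<And>r. 0 \<le> r \<Longrightarrow> q r \<le> B"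
    and A: "0 \<le> A" "\<And>r. 1 \<le> r \<Longrightarrow> q r \<le> 1 + A / r\<^sup>2"
  obtains \<Phi> :: "real^'n \<Rightarrow> real" and P Q :: "'n \<Rightarrow> real^'n \<Rightarrow> real" and C :: real where
    "continuous_on UNIV \<Phi>" "\<And>i. continuous_on UNIV (P i)" "\<And>i. continuous_on UNIV (Q i)"
    "\<And>i x. ((\<lambda>s. \<Phi> (x + s *\<^sub>R axis i 1)) has_real_derivative P i x) (at 0)"
    "\<And>i x. ((\<lambda>s. P i (x + s *\<^sub>R axis i 1)) has_real_derivative Q i x) (at 0)"
    "\<And>x. (\<Sum>i\<in>UNIV. Q i x) = q (norm x) * \<Phi> x" "\<And>x. 1 \<le> \<Phi> x" "0 < C"
    "\<And>x. \<Phi> x \<le> C * exp (norm x) * (1 + norm x) powr - ((real CARD('n) - 1) / 2)"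
proof -
  define d where "d = CARD('n) - 1"
  have d: "CARD('n) = Suc d" "real d = real CARD('n) - 1" using n by (auto simp: d_def)
  interpret radial d q B by unfold_locales (use q in auto)
  obtain \<phi> where \<phi>: "continuous_on {0..} \<phi>" "\<And>r. 0 \<le> r \<Longrightarrow> 1 \<le> \<phi> r"
    "\<And>r. 0 \<le> r \<Longrightarrow> \<phi> r = 1 + integral {0..r} (J \<phi>)" by (rule solution) blast
  obtain C where C: "0 < C" "\<And>r. 0 \<le> r \<Longrightarrow> \<phi> r \<le> C * exp r * (1 + r) powr - (real d / 2)"
    using growth[OF \<phi> A] by metis
  show thesis
  proof (rule that[of "Phi \<phi>" "Pi \<phi>" "Qi \<phi>" C])
    show "continuous_on UNIV (Phi \<phi>)" by (rule Phi_cont(1)[OF \<phi>])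
    show "continuous_on UNIV (Pi \<phi> i)" for i by (rule Phi_cont(2)[OF \<phi>])
    show "continuous_on UNIV (Qi \<phi> i)" for i by (rule Qi_cont[OF \<phi>])
    show "((\<lambda>s. Phi \<phi> (x + s *\<^sub>R axis i 1)) has_real_derivative Pi \<phi> i x) (at 0)" for i and x :: "real^'n" by (rule Phi_deriv[OF \<phi>])
    show "((\<lambda>s. Pi \<phi> i (x + s *\<^sub>R axis i 1)) has_real_derivative Qi \<phi> i x) (at 0)" for i and x :: "real^'n" by (rule Pi_deriv[OF \<phi>])
    show "(\<Sum>i\<in>UNIV. Qi \<phi> i x) = q (norm x) * Phi \<phi> x" for x :: "real^'n" by (rule Phi_laplace[OF \<phi> d(1)])
    show "1 \<le> Phi \<phi> x" for x :: "real^'n" using \<phi>(2)[of "norm x"] by (simp only: Phi_def[OF \<phi>] norm_ge_zero)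
    show "Phi \<phi> x \<le> C * exp (norm x) * (1 + norm x) powr - ((real CARD('n) - 1) / 2)" for x :: "real^'n"
      using C(2)[OF norm_ge_zero[of x]] by (simp only: Phi_def[OF \<phi>] d(2)[symmetric])
  qed (rule C)
qed

section \<open>Integrals over the cone\<close>

text \<open>On a half line \<open>{..a}\<close> both sides give the volume of the ball of radius
  \<open>a\<close>, and these half lines form an intersection-stable generator of the Borel
  sets.\<close>

lemma distr_norm_lborel:
  "distr (lborel :: (real^'n) measure) borel norm =
    density lborel (\<lambda>r. ennreal (real CARD('n) * unit_ball_vol (real CARD('n)) * r ^ (CARD('n) - 1)) * indicator {0..} r)"
    (is "?M = ?N")
proof (rule measure_eqI_generator_eq[where E="range (\<lambda>a::real. {..a})" and \<Omega>=UNIV and A="\<lambda>i. {..real i}"])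
  let ?n = "CARD('n)" and ?u = "unit_ball_vol (real CARD('n))"
  have n: "0 < ?n" by simp
  have u: "0 \<le> ?u" by simp
  show "Int_stable (range (\<lambda>a::real. {..a}))"
    by (auto simp: Int_stable_def)
  show "emeasure ?M X = emeasure ?N X" if "X \<in> range (\<lambda>a::real. {..a})" for X
  proof -
    obtain a where X: "X = {..a}" by (rule rangeE[OF \<open>X \<in> range _\<close>])
    have m: "emeasure ?M {..a} = emeasure lborel (cball (0::real^'n) a)"
      by (subst emeasure_distr) (auto intro!: arg_cong[where f="emeasure lborel"])
    have nn: "emeasure ?N {..a} = (\<integral>\<^sup>+r. ennreal (real ?n * ?u * r ^ (?n - 1)) * indicator {0..a} r \<partial>lborel)"
      by (subst emeasure_density) (auto intro!: nn_integral_cong simp: indicator_def)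
    show ?thesis
    proof (cases "0 \<le> a")
      case True
      have 1: "(\<integral>\<^sup>+r. ennreal (real ?n * ?u * r ^ (?n - 1)) * indicator {0..a} r \<partial>lborel) = ennreal (?u * a ^ ?n - ?u * 0 ^ ?n)"
        using True u by (intro nn_integral_FTC_Icc)
          (auto intro!: derivative_eq_intros mult_nonneg_nonneg simp: mult_ac)
      have 2: "?u * a ^ ?n - ?u * 0 ^ ?n = ?u * a ^ ?n" using n by (simp add: power_0_left)
      have 3: "emeasure lborel (cball (0::real^'n) a) = ennreal (?u * a ^ ?n)" using True by (simp add: emeasure_cball)
      show ?thesis unfolding X m nn 1 2 3 ..
    next
      case False
      then have "cball (0::real^'n) a = {}" "{0..a} = {}" by auto
      then show ?thesis unfolding X m nn by simp
    qed
  qed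
  show "sets ?M = sigma_sets UNIV (range (\<lambda>a::real. {..a}))" "sets ?N = sigma_sets UNIV (range (\<lambda>a::real. {..a}))"
    by (simp_all add: borel_eq_atMost)
  show "range (\<lambda>i. {..real i}) \<subseteq> range (\<lambda>a. {..a})" by auto
  show "(\<Union>i. {..real i}) = UNIV" using real_arch_simple by auto
  show "emeasure ?M {..real i} \<noteq> \<infinity>" for i
  proof -
    have "emeasure ?M {..real i} = emeasure lborel (cball (0::real^'n) (real i))"
      by (subst emeasure_distr) (auto intro!: arg_cong[where f="emeasure lborel"])
    then show ?thesis by (simp add: emeasure_cball)
  qed
qed auto

lemma nn_integral_radial:
  fixes h :: "real \<Rightarrow> ennreal"
  assumes [measurable]: "h \<in> borel_measurable borel"
  shows "(\<integral>\<^sup>+x. h (norm (x::real^'n)) \<partial>lborel) =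
    (\<integral>\<^sup>+r. ennreal (real CARD('n) * unit_ball_vol (real CARD('n)) * r ^ (CARD('n) - 1)) * indicator {0..} r * h r \<partial>lborel)"
proof -
  have "(\<integral>\<^sup>+x. h (norm (x::real^'n)) \<partial>lborel) = (\<integral>\<^sup>+r. h r \<partial>distr (lborel :: (real^'n) measure) borel norm)"
    by (subst nn_integral_distr) auto
  then show ?thesis unfolding distr_norm_lborel by (subst (asm) nn_integral_density) auto
qed

text \<open>Polar coordinates on every time slice reduce a radial weight on the cone to a
  one-dimensional integral, which is all that has to be estimated for each t.\<close>

lemma cone_integral_le:
  fixes h :: "real \<Rightarrow> real \<Rightarrow> real" and H :: "real \<Rightarrow> real"
  assumes h: "(\<lambda>(t, r). h t r) \<in> borel_measurable (borel \<Otimes>\<^sub>M borel)" and S: "S \<in> sets borel"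
    and H: "H \<in> borel_measurable borel"
    and le: "\<And>t. t \<in> S \<Longrightarrow> (\<integral>\<^sup>+r. ennreal (r ^ (CARD('n) - 1) * h t r) * indicator {0..t+1} r \<partial>lborel) \<le> ennreal (H t)"
  shows "(\<integral>\<^sup>+z. ennreal (h (fst z) (norm (snd z))) * indicator {z. fst z \<in> S \<and> norm (snd z) \<le> fst z + 1} z \<partial>(lborel :: (real \<times> (real^'n)) measure))
    \<le> ennreal (real CARD('n) * unit_ball_vol (real CARD('n))) * (\<integral>\<^sup>+t. ennreal (H t) * indicator S t \<partial>lborel)"
proof -
  note [measurable] = h S H
  let ?c = "real CARD('n) * unit_ball_vol (real CARD('n))"
  have c: "0 \<le> ?c" by simp
  have [measurable]: "(\<lambda>z::real \<times> (real^'n). h (fst z) (norm (snd z))) \<in> borel_measurable (borel \<Otimes>\<^sub>M borel)"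
    by measurable
  have [measurable]: "{z::real \<times> (real^'n). fst z \<in> S \<and> norm (snd z) \<le> fst z + 1} \<in> sets (borel \<Otimes>\<^sub>M borel)"
  proof -
    have "{z \<in> space (borel \<Otimes>\<^sub>M borel). fst z \<in> S \<and> norm (snd z) \<le> fst z + 1} \<in> sets (borel \<Otimes>\<^sub>M (borel :: (real^'n) measure))"
      by measurable
    then show ?thesis by (simp add: space_pair_measure)
  qed
  have "(\<integral>\<^sup>+z. ennreal (h (fst z) (norm (snd z))) * indicator {z. fst z \<in> S \<and> norm (snd z) \<le> fst z + 1} z \<partial>(lborel :: (real \<times> (real^'n)) measure))
    = (\<integral>\<^sup>+t. \<integral>\<^sup>+x. ennreal (h t (norm x)) * indicator {z. fst z \<in> S \<and> norm (snd z) \<le> fst z + 1} (t, x :: real^'n) \<partial>lborel \<partial>lborel)"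
    unfolding lborel_prod[symmetric] by (subst lborel.nn_integral_fst[symmetric]) simp_all
  also have "\<dots> \<le> (\<integral>\<^sup>+t. ennreal ?c * (ennreal (H t) * indicator S t) \<partial>lborel)"
  proof (rule nn_integral_mono)
    fix t :: real
    have "(\<integral>\<^sup>+x. ennreal (h t (norm x)) * indicator {z. fst z \<in> S \<and> norm (snd z) \<le> fst z + 1} (t, x :: real^'n) \<partial>lborel)
      = indicator S t * (\<integral>\<^sup>+x. ennreal (h t (norm (x :: real^'n))) * indicator {..t+1} (norm x) \<partial>lborel)"
      by (subst nn_integral_cmult[symmetric]) (auto intro!: nn_integral_cong simp: indicator_def)
    also have "(\<integral>\<^sup>+x. ennreal (h t (norm (x :: real^'n))) * indicator {..t+1} (norm x) \<partial>lborel)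
      = (\<integral>\<^sup>+r. ennreal (?c * r ^ (CARD('n) - 1)) * indicator {0..} r * (ennreal (h t r) * indicator {..t+1} r) \<partial>lborel)"
      by (rule nn_integral_radial[where h="\<lambda>r. ennreal (h t r) * indicator {..t+1} r"]) measurable
    also have "\<dots> = ennreal ?c * (\<integral>\<^sup>+r. ennreal (r ^ (CARD('n) - 1) * h t r) * indicator {0..t+1} r \<partial>lborel)"
    proof (subst nn_integral_cmult[symmetric])
      have gen: "ennreal (c * x) * ennreal y = ennreal c * ennreal (x * y)" if "0 \<le> c" "0 \<le> x" for c x y :: real
        using that by (simp add: ennreal_mult' mult.assoc)
      have "ennreal (?c * r ^ (CARD('n) - 1)) * indicator {0..} r * (ennreal (h t r) * indicator {..t + 1} r) =
        ennreal ?c * (ennreal (r ^ (CARD('n) - 1) * h t r) * indicator {0..t + 1} r)" for r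
      proof (cases "0 \<le> r")
        case True
        then have "ennreal (?c * r ^ (CARD('n) - 1)) * ennreal (h t r) = ennreal ?c * ennreal (r ^ (CARD('n) - 1) * h t r)"
          using gen[OF c, of "r ^ (CARD('n) - 1)"] by simp
        then show ?thesis using True by (simp only: indicator_def mem_Collect_eq atLeast_iff atMost_iff atLeastAtMost_iff) simp
      qed simp
      then show "(\<integral>\<^sup>+r. ennreal (?c * r ^ (CARD('n) - 1)) * indicator {0..} r * (ennreal (h t r) * indicator {..t+1} r) \<partial>lborel) =
        (\<integral>\<^sup>+r. ennreal ?c * (ennreal (r ^ (CARD('n) - 1) * h t r) * indicator {0..t + 1} r) \<partial>lborel)" by simp
    qed measurable
    finally show "(\<integral>\<^sup>+x. ennreal (h t (norm x)) * indicator {z. fst z \<in> S \<and> norm (snd z) \<le> fst z + 1} (t, x :: real^'n) \<partial>lborel)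
      \<le> ennreal ?c * (ennreal (H t) * indicator S t)"
      using le[of t] by (auto simp: indicator_def intro!: mult_left_mono)
  qed
  also have "\<dots> = ennreal ?c * (\<integral>\<^sup>+t. ennreal (H t) * indicator S t \<partial>lborel)"
    by (rule nn_integral_cmult) measurable
  finally show ?thesis .
qed

lemma nn_integral_Icc_le:
  fixes F h :: "real \<Rightarrow> real"
  assumes "a \<le> b" "h \<in> borel_measurable borel" "\<And>x. a \<le> x \<Longrightarrow> x \<le> b \<Longrightarrow> (F has_real_derivative h x) (at x)"
    "\<And>x. a \<le> x \<Longrightarrow> x \<le> b \<Longrightarrow> 0 \<le> h x" "F b - F a \<le> c"
  shows "(\<integral>\<^sup>+x. ennreal (h x) * indicator {a..b} x \<partial>lborel) \<le> ennreal c"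
proof -
  have "(\<integral>\<^sup>+x. ennreal (h x) * indicator {a..b} x \<partial>lborel) = ennreal (F b - F a)"
    by (rule nn_integral_FTC_Icc) (use assms in auto)
  then show ?thesis using assms by (simp add: ennreal_leI)
qed

lemma nn_integral_cmult_le:
  fixes h g :: "real \<Rightarrow> real"
  assumes "\<And>x. a \<le> x \<Longrightarrow> x \<le> b \<Longrightarrow> h x \<le> C * g x" "0 \<le> C" "g \<in> borel_measurable borel"
    "(\<integral>\<^sup>+x. ennreal (g x) * indicator {a..b} x \<partial>lborel) \<le> ennreal c"
  shows "(\<integral>\<^sup>+x. ennreal (h x) * indicator {a..b} x \<partial>lborel) \<le> ennreal (C * c)"
proof -
  note [measurable] = assms(3)
  have "(\<integral>\<^sup>+x. ennreal (h x) * indicator {a..b} x \<partial>lborel) \<le> (\<integral>\<^sup>+x. ennreal C * (ennreal (g x) * indicator {a..b} x) \<partial>lborel)"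
    using assms(1,2) by (intro nn_integral_mono) (auto simp: indicator_def ennreal_mult'[symmetric] intro!: ennreal_leI)
  also have "\<dots> = ennreal C * (\<integral>\<^sup>+x. ennreal (g x) * indicator {a..b} x \<partial>lborel)" by (rule nn_integral_cmult) measurable
  also have "\<dots> \<le> ennreal C * ennreal c" by (intro mult_left_mono assms) auto
  finally show ?thesis using assms(2) by (simp add: ennreal_mult')
qed

text \<open>Young's inequality after dividing \<open>F\<close> and \<open>G\<close> by A^(1/p) and
  B^(1/p'). Working with positive upper bounds instead of the norms avoids the cases where a norm is
  0 or infinite.\<close>

lemma nn_holder:
  fixes F G :: "'a \<Rightarrow> real"
  assumes p: "1 < p" "1 < p'" "1 / p + 1 / p' = 1"
    and [measurable]: "F \<in> borel_measurable M" "G \<in> borel_measurable M" and nn: "\<And>x. 0 \<le> F x" "\<And>x. 0 \<le> G x"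
    and A: "0 < A" "(\<integral>\<^sup>+x. ennreal (F x powr p) \<partial>M) \<le> ennreal A"
    and B: "0 < B" "(\<integral>\<^sup>+x. ennreal (G x powr p') \<partial>M) \<le> ennreal B"
  shows "(\<integral>\<^sup>+x. ennreal (F x * G x) \<partial>M) \<le> ennreal (A powr (1 / p) * B powr (1 / p'))"
proof -
  define K where "K = A powr (1 / p) * B powr (1 / p')"
  have K: "0 < K" using A B by (simp add: K_def)
  have pw: "F x * G x \<le> K / (p * A) * F x powr p + K / (p' * B) * G x powr p'" for x
  proof -
    have "(F x / A powr (1 / p)) * (G x / B powr (1 / p')) \<le> (F x / A powr (1 / p)) powr p / p + (G x / B powr (1 / p')) powr p' / p'"
      by (rule Youngs_inequality[OF p]) (use nn in auto)
    also have "\<dots> = F x powr p / (p * A) + G x powr p' / (p' * B)"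
      using nn[of x] A B p by (simp add: powr_divide powr_powr mult.commute)
    finally have "K * ((F x / A powr (1 / p)) * (G x / B powr (1 / p'))) \<le> K * (F x powr p / (p * A) + G x powr p' / (p' * B))"
      using K by (intro mult_left_mono) auto
    moreover have "K * ((F x / A powr (1 / p)) * (G x / B powr (1 / p'))) = F x * G x" using A B by (simp add: K_def)
    ultimately show ?thesis by (simp add: algebra_simps)
  qed
  have c: "0 \<le> K / (p * A)" "0 \<le> K / (p' * B)" using K p A B by auto
  have "(\<integral>\<^sup>+x. ennreal (F x * G x) \<partial>M) \<le> (\<integral>\<^sup>+x. ennreal (K / (p * A)) * ennreal (F x powr p) + ennreal (K / (p' * B)) * ennreal (G x powr p') \<partial>M)"
  proof (rule nn_integral_mono)
    fix x
    have "ennreal (K / (p * A) * F x powr p + K / (p' * B) * G x powr p') =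
        ennreal (K / (p * A)) * ennreal (F x powr p) + ennreal (K / (p' * B)) * ennreal (G x powr p')"
      using c by (simp only: ennreal_plus ennreal_mult' mult_nonneg_nonneg powr_ge_zero)
    then show "ennreal (F x * G x) \<le> ennreal (K / (p * A)) * ennreal (F x powr p) + ennreal (K / (p' * B)) * ennreal (G x powr p')"
      using ennreal_leI[OF pw[of x]] by simp
  qed
  also have "\<dots> = ennreal (K / (p * A)) * (\<integral>\<^sup>+x. ennreal (F x powr p) \<partial>M) + ennreal (K / (p' * B)) * (\<integral>\<^sup>+x. ennreal (G x powr p') \<partial>M)"
    by (simp add: nn_integral_add nn_integral_cmult)
  also have "\<dots> \<le> ennreal (K / (p * A)) * ennreal A + ennreal (K / (p' * B)) * ennreal B"
    by (intro add_mono mult_left_mono A B) auto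
  also have "\<dots> = ennreal (K / (p * A) * A + K / (p' * B) * B)" by (simp only: ennreal_plus ennreal_mult' mult_nonneg_nonneg less_imp_le[OF A(1)] less_imp_le[OF B(1)] c)
  also have "K / (p * A) * A + K / (p' * B) * B = K * (1 / p + 1 / p')" using A B p by (simp add: field_simps)
  finally show ?thesis using p by (simp add: K_def)
qed

text \<open>\<open>inc\<close> is the integrated form of y' >= \<kappa> y^p with y frozen at the
  left end, so neither differentiability nor continuity is required. From a value >= 2^k S, y gains
  2^k S within time (2^k S)^(1-p)/\<kappa>. These times form a convergent geometric series, so on a
  longer interval y(e) would exceed every bound.\<close>

lemma doubling_blowup:
  fixes y :: "real \<Rightarrow> real"
  assumes "0 < \<kappa>" "1 < p" "0 < S" "a \<le> e" "S \<le> y a"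
    and inc: "\<And>\<tau>1 \<tau>2. a \<le> \<tau>1 \<Longrightarrow> \<tau>1 \<le> \<tau>2 \<Longrightarrow> \<tau>2 \<le> e \<Longrightarrow> (\<tau>2 - \<tau>1) * \<kappa> * y \<tau>1 powr p \<le> y \<tau>2 - y \<tau>1"
  shows "e - a \<le> S powr (1 - p) / \<kappa> * (1 / (1 - 2 powr (1 - p)))"
proof (rule ccontr)
  assume neg: "\<not> ?thesis"
  define q where "q = (2::real) powr (1 - p)"
  \<comment> \<open>The time after which y has reached 2^k S.\<close>
  define D where "D k = S powr (1 - p) / \<kappa> * (\<Sum>i<k. q ^ i)" for k :: nat
  have q: "0 < q" "q < 1" using assms(2) by (auto simp: q_def powr_less_one)
  have c: "0 \<le> S powr (1 - p) / \<kappa>" using assms by simp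
  have D0: "0 \<le> D k" for k unfolding D_def using c q by (intro mult_nonneg_nonneg sum_nonneg) auto
  have De: "a + D k \<le> e" for k
  proof -
    have "(\<Sum>i<k. q ^ i) = (1 - q ^ k) / (1 - q)" using q by (simp add: sum_gp_strict)
    also have "\<dots> \<le> 1 / (1 - q)" using q by (intro divide_right_mono) auto
    finally have "D k \<le> S powr (1 - p) / \<kappa> * (1 / (1 - q))" unfolding D_def by (rule mult_left_mono[OF _ c])
    then show ?thesis using neg by (simp add: q_def)
  qed
  have y: "2 ^ k * S \<le> y (a + D k)" for k
  proof (induction k)
    case 0
    then show ?case using assms by (simp add: D_def)
  next
    case (Suc k)
    have s: "D (Suc k) - D k = (2 ^ k * S) powr (1 - p) / \<kappa>"
    proof -
      have "(2 ^ k * S) powr (1 - p) = (2 powr real k) powr (1 - p) * S powr (1 - p)"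
        using assms(3) by (subst powr_mult) (simp_all only: powr_realpow zero_less_numeral zero_le_power zero_le_numeral less_imp_le)
      also have "(2 powr real k) powr (1 - p) = q powr real k"
        unfolding q_def powr_powr by (simp only: mult.commute)
      also have "\<dots> = q ^ k" using q by (simp add: powr_realpow)
      finally show ?thesis by (simp add: D_def algebra_simps)
    qed
    then have s0: "D k \<le> D (Suc k)" using assms(1) by (smt (verit) divide_nonneg_pos powr_ge_zero)
    have "(a + D (Suc k) - (a + D k)) * \<kappa> * y (a + D k) powr p \<le> y (a + D (Suc k)) - y (a + D k)"
      using D0 De s0 by (intro inc) auto
    moreover have "(a + D (Suc k) - (a + D k)) * \<kappa> = (2 ^ k * S) powr (1 - p)" using s assms(1) by simp
    moreover have "(2 ^ k * S) powr (1 - p) * (2 ^ k * S) powr p \<le> (2 ^ k * S) powr (1 - p) * y (a + D k) powr p"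
      using Suc assms by (intro mult_left_mono powr_mono2) auto
    moreover have "(2 ^ k * S) powr (1 - p) * (2 ^ k * S) powr p = 2 ^ k * S"
      using assms(3) by (simp add: powr_add[symmetric])
    ultimately have "2 ^ k * S \<le> y (a + D (Suc k)) - y (a + D k)" by simp
    then show ?case using Suc by simp
  qed
  have "2 ^ k * S \<le> y e" for k
  proof -
    have "(e - (a + D k)) * \<kappa> * y (a + D k) powr p \<le> y e - y (a + D k)"
      using D0 De by (intro inc) auto
    moreover have "0 \<le> (e - (a + D k)) * \<kappa> * y (a + D k) powr p" using De[of k] assms by simp
    ultimately show ?thesis using y[of k] by linarith
  qed
  moreover obtain k where "y e / S < 2 ^ k" using real_arch_pow[of 2 "y e / S"] by auto
  ultimately show False using assms(3) by (meson not_le pos_divide_less_eq)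
qed

section \<open>Self-similar solutions of the wave equation\<close>

text \<open>
  With these coefficients $\sum_j c_j s^{-b-2j}|x|^{2j}$ is a formal solution of the free wave equation
  in $n$ space dimensions, where $s$ is a translate of the time.
\<close>

primrec cf :: "real \<Rightarrow> real \<Rightarrow> nat \<Rightarrow> real" where
  "cf b n 0 = 1"
| "cf b n (Suc j) = cf b n j * ((b + 2 * real j) * (b + 2 * real j + 1)) / ((2 * real j + 2) * (2 * real j + n))"

lemma cf_pos: "0 < b \<Longrightarrow> 0 < n \<Longrightarrow> 0 < cf b n j"
  by (induction j) (auto intro!: divide_pos_pos mult_pos_pos add_nonneg_pos add_pos_nonneg)

text \<open>These are the Taylor coefficients of the hypergeometric function 2F1(b/2, (b+1)/2; n/2;
  z), with z = |x|^2/s^2 in the application.\<close>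

lemma cf_pochhammer:
  assumes "0 < n"
  shows "cf b n j = pochhammer (b / 2) j * pochhammer ((b + 1) / 2) j / (pochhammer (n / 2) j * fact j)"
proof (induction j)
  case (Suc j)
  have p: "pochhammer (n / 2) j \<noteq> 0" using pochhammer_pos[of "n / 2" j] assms by simp
  have e: "pochhammer (b / 2) (Suc j) * pochhammer ((b + 1) / 2) (Suc j) / (pochhammer (n / 2) (Suc j) * fact (Suc j))
    = (pochhammer (b / 2) j * pochhammer ((b + 1) / 2) j / (pochhammer (n / 2) j * fact j)) *
      (((b / 2 + real j) * ((b + 1) / 2 + real j)) / ((n / 2 + real j) * (real j + 1)))"
    by (simp add: pochhammer_Suc mult_ac add_ac)
  have "((b / 2 + real j) * ((b + 1) / 2 + real j)) / ((n / 2 + real j) * (real j + 1))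
    = (4 * ((b / 2 + real j) * ((b + 1) / 2 + real j))) / (4 * ((n / 2 + real j) * (real j + 1)))" by simp
  also have "4 * ((b / 2 + real j) * ((b + 1) / 2 + real j)) = (b + 2 * real j) * (b + 2 * real j + 1)" by (simp add: field_simps)
  also have "4 * ((n / 2 + real j) * (real j + 1)) = (2 * real j + 2) * (2 * real j + n)" by (simp add: field_simps)
  finally show ?case unfolding e by (simp add: Suc)
qed simp

text \<open>Each Pochhammer symbol is, up to a factorial and a power of j, the inverse of a term of
  the Gamma limit \<open>Gamma_series'\<close>. The powers of j combine to b/2 + (b+1)/2 - n/2 - 1 =
  -(1 + \<theta>); the rest converges and is therefore bounded.\<close>

lemma cf_decay:
  fixes b n \<theta> :: real
  assumes b: "0 < b" "0 < n" "b = (n - 1) / 2 - \<theta>"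
  obtains C where "0 < C" "\<And>j. 1 \<le> j \<Longrightarrow> cf b n j \<le> C * real j powr - (1 + \<theta>)"
proof -
  let ?G = "Gamma_series' :: real \<Rightarrow> nat \<Rightarrow> real"
  have nz: "z \<notin> \<int>\<^sub>\<le>\<^sub>0" if "0 < z" for z :: real using that by (auto elim!: nonpos_Ints_cases)
  have lim: "(\<lambda>j. ?G (n / 2) j / (?G (b / 2) j * ?G ((b + 1) / 2) j)) \<longlonglongrightarrow> Gamma (n / 2) / (Gamma (b / 2) * Gamma ((b + 1) / 2))"
  proof (intro tendsto_intros Gamma_series'_LIMSEQ)
    show "Gamma (b / 2) * Gamma ((b + 1) / 2) \<noteq> 0"
      using nz[of "b / 2"] nz[of "(b + 1) / 2"] b(1) by (simp add: Gamma_eq_zero_iff)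
  qed
  have eq: "cf b n j * real j powr (1 + \<theta>) = ?G (n / 2) j / (?G (b / 2) j * ?G ((b + 1) / 2) j)" if j: "1 \<le> j" for j
  proof -
    have j0: "0 < real j" using j by simp
    have pz: "pochhammer (b / 2) j \<noteq> 0" "pochhammer ((b + 1) / 2) j \<noteq> 0" "pochhammer (n / 2) j \<noteq> 0"
      using pochhammer_pos[of "b / 2" j] pochhammer_pos[of "(b + 1) / 2" j] pochhammer_pos[of "n / 2" j] b by auto
    have G: "?G z j = fact (j - 1) * real j powr z / pochhammer z j" for z
      using j0 by (simp add: Gamma_series'_def powr_def)
    have f: "(fact j :: real) = real j * fact (j - 1)" using j by (simp add: fact_reduce)
    have pw: "real j powr (n / 2) = real j powr (b / 2) * real j powr ((b + 1) / 2) * real j powr \<theta>"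
    proof -
      have "n / 2 = b / 2 + (b + 1) / 2 + \<theta>" using b(3) by (simp add: field_simps)
      then show ?thesis by (simp only: powr_add)
    qed
    have "?G (n / 2) j / (?G (b / 2) j * ?G ((b + 1) / 2) j) =
      pochhammer (b / 2) j * pochhammer ((b + 1) / 2) j / (pochhammer (n / 2) j * fact (j - 1)) * real j powr \<theta>"
      unfolding G pw using j0 pz by (simp add: field_simps)
    moreover have "cf b n j * real j powr (1 + \<theta>) = pochhammer (b / 2) j * pochhammer ((b + 1) / 2) j / (pochhammer (n / 2) j * fact (j - 1)) * real j powr \<theta>"
      unfolding cf_pochhammer[OF b(2)] f powr_add using j0 by simp
    ultimately show ?thesis by simp
  qed
  have "Bseq (\<lambda>j. ?G (n / 2) j / (?G (b / 2) j * ?G ((b + 1) / 2) j))" using lim by (intro convergent_imp_Bseq convergentI)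
  then obtain C where C: "0 < C" "\<And>j. norm (?G (n / 2) j / (?G (b / 2) j * ?G ((b + 1) / 2) j)) \<le> C" by (auto elim: BseqE)
  show thesis
  proof (rule that[OF C(1)])
    fix j :: nat assume j: "1 \<le> j"
    have "cf b n j * real j powr (1 + \<theta>) \<le> C" using order_trans[OF abs_ge_self C(2)[of j, unfolded real_norm_def]] eq[OF j] by simp
    then have "cf b n j * real j powr (1 + \<theta>) * real j powr - (1 + \<theta>) \<le> C * real j powr - (1 + \<theta>)" by (intro mult_right_mono) auto
    moreover have "real j powr (1 + \<theta>) * real j powr - (1 + \<theta>) = 1" using j by (simp add: powr_add[symmetric])
    ultimately show "cf b n j \<le> C * real j powr - (1 + \<theta>)" by (simp add: mult.assoc)
  qed
qed

text \<open>Young's inequality gives m^(1-\<theta>) <= (m+1)^(1-\<theta>) - (1-\<theta>)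
  (m+1)^(-\<theta>), which telescopes.\<close>

lemma sum_powr_neg_le:
  fixes \<theta> :: real
  assumes "0 < \<theta>" "\<theta> < 1"
  shows "(\<Sum>j=1..m. real j powr - \<theta>) \<le> real m powr (1 - \<theta>) / (1 - \<theta>)"
proof (induction m)
  case 0
  then show ?case by simp
next
  case (Suc m)
  have "real m powr (1 - \<theta>) \<le> real (Suc m) powr (1 - \<theta>) - (1 - \<theta>) * real (Suc m) powr - \<theta>"
  proof (cases "m = 0")
    case True
    then show ?thesis using assms by simp
  next
    case False
    have "(real m / real (Suc m)) powr (1 - \<theta>) * 1 powr \<theta> \<le> (1 - \<theta>) * (real m / real (Suc m)) + \<theta> * 1"
      by (rule Youngs_inequality_0) (use assms False in auto)
    also have "\<dots> = 1 - (1 - \<theta>) / real (Suc m)" by (simp add: field_simps)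
    finally have "real (Suc m) powr (1 - \<theta>) * (real m / real (Suc m)) powr (1 - \<theta>) \<le> real (Suc m) powr (1 - \<theta>) * (1 - (1 - \<theta>) / real (Suc m))"
      by (intro mult_left_mono) auto
    moreover have "real (Suc m) powr (1 - \<theta>) * (real m / real (Suc m)) powr (1 - \<theta>) = real m powr (1 - \<theta>)"
      by (simp add: powr_divide)
    moreover have "real (Suc m) powr (1 - \<theta>) / real (Suc m) = real (Suc m) powr - \<theta>"
      using powr_diff[of "real (Suc m)" "1 - \<theta>" 1] by simp
    moreover have "X * (1 - c / S) = X - c * (X / S)" for X c S :: real
      by (simp add: right_diff_distrib)
    from this[of "real (Suc m) powr (1 - \<theta>)" "1 - \<theta>" "real (Suc m)"]
    have "real (Suc m) powr (1 - \<theta>) * (1 - (1 - \<theta>) / real (Suc m)) = real (Suc m) powr (1 - \<theta>) - (1 - \<theta>) * (real (Suc m) powr (1 - \<theta>) / real (Suc m))" .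
    ultimately show ?thesis by (simp only:)
  qed
  then have "real m powr (1 - \<theta>) / (1 - \<theta>) \<le> (real (Suc m) powr (1 - \<theta>) - (1 - \<theta>) * real (Suc m) powr - \<theta>) / (1 - \<theta>)"
    using assms by (intro divide_right_mono) auto
  also have "\<dots> = real (Suc m) powr (1 - \<theta>) / (1 - \<theta>) - real (Suc m) powr - \<theta>" using assms by (simp add: diff_divide_distrib)
  finally show ?case using Suc by simp
qed

text \<open>Split at j = 1/(1 - z). Below it z^j is dropped and \<open>sum_powr_neg_le\<close>
  applies; above it j^(-\<theta>) <= (1 - z)^\<theta> comes out of a geometric series. Both parts
  are of order (1 - z)^(\<theta>-1).\<close>

lemma power_series_powr_le:
  fixes \<theta> z :: real
  assumes \<theta>: "0 < \<theta>" "\<theta> < 1" and z: "0 \<le> z" "z < 1"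
  shows "(\<Sum>j=1..N. real j powr - \<theta> * z ^ j) \<le> (1 + 1 / (1 - \<theta>)) * (1 - z) powr (\<theta> - 1)"
proof -
  define y where "y = 1 - z"
  have y: "0 < y" "y \<le> 1" using z by (auto simp: y_def)
  define m where "m = nat \<lfloor>1 / y\<rfloor>"
  have m: "real m \<le> 1 / y" "1 / y < real m + 1" using y by (auto simp: m_def)
  have t: "real j powr - \<theta> * z ^ j \<le> y powr \<theta> * z ^ j + (if j \<le> m then real j powr - \<theta> else 0)" if "j \<in> {1..N}" for j
  proof (cases "j \<le> m")
    case True
    have "real j powr - \<theta> * z ^ j \<le> real j powr - \<theta> * 1" using z by (intro mult_left_mono power_le_one) auto
    moreover have "0 \<le> y powr \<theta> * z ^ j" using z by simp
    ultimately show ?thesis using True by simp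
  next
    case False
    then have "1 / y \<le> real j" using m by linarith
    then have "real j powr - \<theta> \<le> (1 / y) powr - \<theta>" using y \<theta> by (intro powr_mono2') auto
    also have "\<dots> = y powr \<theta>" using y by (simp add: powr_divide powr_minus)
    finally show ?thesis using False z by (simp add: mult_right_mono)
  qed
  have "(\<Sum>j=1..N. real j powr - \<theta> * z ^ j) \<le> (\<Sum>j=1..N. y powr \<theta> * z ^ j + (if j \<le> m then real j powr - \<theta> else 0))"
    by (rule sum_mono[OF t])
  also have "\<dots> = y powr \<theta> * (\<Sum>j=1..N. z ^ j) + (\<Sum>j\<in>{1..N} \<inter> {..m}. real j powr - \<theta>)"
    by (simp only: sum.distrib sum_distrib_left sum.inter_restrict finite_atLeastAtMost atMost_iff)
  also have "\<dots> \<le> y powr \<theta> * (1 / y) + (1 / y) powr (1 - \<theta>) / (1 - \<theta>)"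
  proof (intro add_mono mult_left_mono)
    have "(\<Sum>j=1..N. z ^ j) \<le> (\<Sum>j<Suc N. z ^ j)" using z by (intro sum_mono2) auto
    also have "\<dots> = (1 - z ^ Suc N) / (1 - z)" using z by (subst sum_gp_strict) auto
    also have "\<dots> \<le> 1 / y" unfolding y_def using z by (intro divide_right_mono) auto
    finally show "(\<Sum>j=1..N. z ^ j) \<le> 1 / y" .
    have "(\<Sum>j\<in>{1..N} \<inter> {..m}. real j powr - \<theta>) \<le> (\<Sum>j=1..m. real j powr - \<theta>)" by (intro sum_mono2) auto
    also have "\<dots> \<le> real m powr (1 - \<theta>) / (1 - \<theta>)" by (rule sum_powr_neg_le[OF \<theta>])
    also have "\<dots> \<le> (1 / y) powr (1 - \<theta>) / (1 - \<theta>)" using m \<theta> by (intro divide_right_mono powr_mono2) auto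
    finally show "(\<Sum>j\<in>{1..N} \<inter> {..m}. real j powr - \<theta>) \<le> (1 / y) powr (1 - \<theta>) / (1 - \<theta>)" .
  qed simp
  also have "y powr \<theta> * (1 / y) = y powr (\<theta> - 1)" using y by (simp add: powr_diff)
  also have "(1 / y) powr (1 - \<theta>) = y powr (\<theta> - 1)"
  proof -
    have "(1 / y) powr (1 - \<theta>) = y powr - (1 - \<theta>)" using y by (simp only: powr_minus_divide powr_divide powr_one_eq_one less_imp_le zero_le_one)
    then show ?thesis by simp
  qed
  finally show ?thesis by (simp add: y_def algebra_simps)
qed

text \<open>The coefficients are bounded by a multiple of j^(-1-\<theta>), which is summable, so the
  sums stay bounded up to z = 1. The factor b + 2j of the time derivative costs one power of j and
  leads to \<open>power_series_powr_le\<close>. All bounds are uniform in \<open>N\<close>; the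
  later choice is \<theta> = 1/p.\<close>

lemma cf_bounds:
  fixes b n \<theta> :: real
  assumes b: "0 < b" "0 < n" "b = (n - 1) / 2 - \<theta>" and \<theta>: "0 < \<theta>" "\<theta> < 1"
  obtains C where "0 < C" "\<And>j. cf b n j \<le> C"
    "\<And>N z. 0 \<le> z \<Longrightarrow> z < 1 \<Longrightarrow> (\<Sum>j\<le>N. cf b n j * z ^ j) \<le> C"
    "\<And>N z. 0 \<le> z \<Longrightarrow> z < 1 \<Longrightarrow> (\<Sum>j\<le>N. (b + 2 * real j) * cf b n j * z ^ j) \<le> C * (1 - z) powr (\<theta> - 1)"
proof -
  obtain C0 where C0: "0 < C0" "\<And>j. 1 \<le> j \<Longrightarrow> cf b n j \<le> C0 * real j powr - (1 + \<theta>)"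
    using cf_decay[OF b] by metis
  have pos: "0 < cf b n j" for j by (rule cf_pos[OF b(1,2)])
  have sm: "summable (\<lambda>j. real j powr - (1 + \<theta>))" using \<theta> by (subst summable_real_powr_iff) simp
  define \<Sigma> where "\<Sigma> = (\<Sum>j. real j powr - (1 + \<theta>))"
  have S0: "0 \<le> \<Sigma>" unfolding \<Sigma>_def by (intro suminf_nonneg sm) simp
  define C1 where "C1 = 1 + C0 * \<Sigma>"
  define C2 where "C2 = b + (b + 2) * C0 * (1 + 1 / (1 - \<theta>))"
  define C where "C = C0 + C1 + C2"
  have nn: "0 \<le> C0" "1 \<le> C1" "0 \<le> C2" using C0 S0 b \<theta> by (auto simp: C1_def C2_def)
  have split: "(\<Sum>j\<le>N. h j) = h 0 + (\<Sum>j=1..N. h j)" for N and h :: "nat \<Rightarrow> real"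
    by (simp add: atMost_atLeast0 sum.atLeast_Suc_atMost)
  show thesis
  proof (rule that[of C])
    show "0 < C" using nn by (simp add: C_def)
    show "cf b n j \<le> C" for j
    proof (cases "j = 0")
      case True
      then show ?thesis using nn by (simp add: C_def)
    next
      case False
      then have "cf b n j \<le> C0 * real j powr - (1 + \<theta>)" by (intro C0) simp
      also have "\<dots> \<le> C0 * 1"
      proof (rule mult_left_mono[OF _ less_imp_le[OF C0(1)]])
        have "real j powr - (1 + \<theta>) \<le> 1 powr - (1 + \<theta>)" using False \<theta> by (intro powr_mono2') auto
        then show "real j powr - (1 + \<theta>) \<le> 1" by simp
      qed
      finally show ?thesis using nn by (simp add: C_def)
    qed
    fix N and z :: real assume z: "0 \<le> z" "z < 1"
    have "(\<Sum>j=1..N. cf b n j * z ^ j) \<le> (\<Sum>j=1..N. C0 * real j powr - (1 + \<theta>))"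
    proof (rule sum_mono)
      fix j assume j: "j \<in> {1..N}"
      have "cf b n j * z ^ j \<le> cf b n j * 1" using pos[of j] z by (intro mult_left_mono power_le_one) auto
      also have "\<dots> \<le> C0 * real j powr - (1 + \<theta>)" using C0(2)[of j] j by simp
      finally show "cf b n j * z ^ j \<le> C0 * real j powr - (1 + \<theta>)" .
    qed
    also have "\<dots> = C0 * (\<Sum>j=1..N. real j powr - (1 + \<theta>))" by (simp add: sum_distrib_left)
    also have "\<dots> \<le> C0 * \<Sigma>" unfolding \<Sigma>_def using C0 by (intro mult_left_mono sum_le_suminf sm) auto
    finally show "(\<Sum>j\<le>N. cf b n j * z ^ j) \<le> C" unfolding split[of _ N] using nn by (simp add: C_def C1_def)
    have "(\<Sum>j=1..N. (b + 2 * real j) * cf b n j * z ^ j) \<le> (\<Sum>j=1..N. ((b + 2) * C0) * (real j powr - \<theta> * z ^ j))"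
    proof (rule sum_mono)
      fix j assume j: "j \<in> {1..N}"
      then have j0: "1 \<le> real j" by simp
      have "(b + 2 * real j) * cf b n j \<le> ((b + 2) * real j) * (C0 * real j powr - (1 + \<theta>))"
      proof (rule mult_mono)
        have "b * 1 \<le> b * real j" using j0 b by (intro mult_left_mono) auto
        then show "b + 2 * real j \<le> (b + 2) * real j" by (simp add: algebra_simps)
      qed (use C0(2)[of j] j pos[of j] b in auto)
      also have "\<dots> = ((b + 2) * C0) * real j powr - \<theta>"
      proof -
        have "real j * real j powr - (1 + \<theta>) = real j powr (1 + - (1 + \<theta>))" using j0 by (subst powr_add) simp
        then have "real j * real j powr - (1 + \<theta>) = real j powr - \<theta>" by simp
        then show ?thesis by (simp add: mult_ac)
      qed
      finally show "(b + 2 * real j) * cf b n j * z ^ j \<le> ((b + 2) * C0) * (real j powr - \<theta> * z ^ j)"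
        using z by (simp add: mult.assoc[symmetric] mult_right_mono)
    qed
    also have "\<dots> = ((b + 2) * C0) * (\<Sum>j=1..N. real j powr - \<theta> * z ^ j)" by (simp add: sum_distrib_left)
    also have "\<dots> \<le> ((b + 2) * C0) * ((1 + 1 / (1 - \<theta>)) * (1 - z) powr (\<theta> - 1))"
      using b C0 by (intro mult_left_mono power_series_powr_le \<theta> z) auto
    finally have 1: "(\<Sum>j=1..N. (b + 2 * real j) * cf b n j * z ^ j) \<le> ((b + 2) * C0 * (1 + 1 / (1 - \<theta>))) * (1 - z) powr (\<theta> - 1)" by (simp add: mult.assoc)
    have "1 powr (\<theta> - 1) \<le> (1 - z) powr (\<theta> - 1)" 
    proof -
      have "1 powr - (1 - \<theta>) \<le> (1 - z) powr - (1 - \<theta>)" using z \<theta> by (intro powr_mono2') auto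
      then show ?thesis by simp
    qed
    then have "b * 1 \<le> b * (1 - z) powr (\<theta> - 1)" using b by (intro mult_left_mono) auto
    then have "(\<Sum>j\<le>N. (b + 2 * real j) * cf b n j * z ^ j) \<le> C2 * (1 - z) powr (\<theta> - 1)"
      unfolding split[of _ N] using 1 by (simp add: C2_def distrib_right)
    also have "\<dots> \<le> C * (1 - z) powr (\<theta> - 1)" using nn by (intro mult_right_mono) (auto simp: C_def)
    finally show "(\<Sum>j\<le>N. (b + 2 * real j) * cf b n j * z ^ j) \<le> C * (1 - z) powr (\<theta> - 1)" .
  qed
qed

section \<open>Weights integrated over the cone\<close>

text \<open>For R/2 <= t <= R the range covers both 1 + t, if R >= 1, and t + t0, if 0 <= t0 <= R.
  The absolute value in the constant serves both signs of the exponent.\<close>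

lemma powr_comparable:
  fixes x R e :: real
  assumes "0 < R" "R / 2 \<le> x" "x \<le> 3 * R"
  shows "x powr e \<le> 3 powr \<bar>e\<bar> * R powr e"
proof -
  have x: "0 < x" using assms by linarith
  define y where "y = x / R"
  have y: "1 / 3 \<le> y" "y \<le> 3" "0 < y" using assms x by (auto simp: y_def field_simps)
  have "y powr e \<le> 3 powr \<bar>e\<bar>"
  proof (cases "0 \<le> e")
    case True
    then show ?thesis using y powr_mono2[of e y 3] by simp
  next
    case False
    have "y powr - (- e) \<le> (1 / 3) powr - (- e)" using y False by (intro powr_mono2') auto
    also have "\<dots> = 3 powr \<bar>e\<bar>" using False by (simp add: powr_divide powr_minus_divide[symmetric])
    finally show ?thesis by simp
  qed
  then have "y powr e * R powr e \<le> 3 powr \<bar>e\<bar> * R powr e" by (intro mult_right_mono) auto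
  moreover have "x powr e = y powr e * R powr e" using assms x y by (simp add: y_def powr_mult[symmetric])
  ultimately show ?thesis by simp
qed

lemma nn_integral_const_interval:
  fixes c R :: real
  assumes "0 \<le> c" "0 \<le> R"
  shows "(\<integral>\<^sup>+t. ennreal c * indicator {R / 2..R} t \<partial>lborel) = ennreal (c * (R / 2))"
  using assms by (simp add: nn_integral_cmult_indicator ennreal_mult'[symmetric])

text \<open>Half of the exponential decay in y = t - r is traded for replacing (1 + r)^(-k) by (1 +
  t)^(-k): one has 1 + t <= (1 + r)(2 + y), and (2 + y)^k is at most a constant times exp((2 +
  y)/2).\<close>

lemma exp_weight_bound:
  fixes k t r :: real
  assumes "0 < k" "0 \<le> r" "r \<le> t + 1" "0 \<le> t"
  shows "exp (r - t) * (1 + r) powr - k \<le> (2 * k) powr k * exp 1 * (1 + t) powr - k * exp ((r - t) / 2)"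
proof -
  define y where "y = t - r"
  have y: "-1 \<le> y" using assms by (simp add: y_def)
  have "1 + t \<le> (1 + r) * (2 + y)"
  proof -
    have "0 \<le> r * (1 + y)" using y assms by simp
    then show ?thesis by (simp add: y_def algebra_simps)
  qed
  then have "(1 + t) powr k \<le> ((1 + r) * (2 + y)) powr k" using assms by (intro powr_mono2) auto
  also have "\<dots> = (1 + r) powr k * (2 + y) powr k" using assms y by (simp add: powr_mult)
  also have "(2 + y) powr k \<le> (2 * k) powr k * exp ((2 + y) / 2)"
  proof -
    have "(2 + y) / (2 * k) \<le> exp ((2 + y) / (2 * k))" using exp_ge_add_one_self[of "(2 + y) / (2 * k)"] by linarith
    then have "2 + y \<le> (2 * k) * exp ((2 + y) / (2 * k))" using assms(1) by (simp add: field_simps)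
    then have "(2 + y) powr k \<le> ((2 * k) * exp ((2 + y) / (2 * k))) powr k" using y assms by (intro powr_mono2) auto
    also have "\<dots> = (2 * k) powr k * exp ((2 + y) / 2)" using assms(1) by (simp add: powr_mult exp_powr_real)
    finally show ?thesis .
  qed
  finally have "(1 + t) powr k \<le> (1 + r) powr k * ((2 * k) powr k * exp ((2 + y) / 2))"
    by (simp add: mult_left_mono)
  then have "(1 + t) powr k * ((1 + t) powr - k * (1 + r) powr - k * exp (r - t)) \<le> ((1 + r) powr k * ((2 * k) powr k * exp ((2 + y) / 2))) * ((1 + t) powr - k * (1 + r) powr - k * exp (r - t))"
    by (rule mult_right_mono) simp
  moreover have "(1 + t) powr k * (1 + t) powr - k = 1" "(1 + r) powr k * (1 + r) powr - k = 1"
    using assms by (simp_all add: powr_add[symmetric])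
  then have "(1 + t) powr k * ((1 + t) powr - k * (1 + r) powr - k * exp (r - t)) = exp (r - t) * (1 + r) powr - k"
    "((1 + r) powr k * ((2 * k) powr k * exp ((2 + y) / 2))) * ((1 + t) powr - k * (1 + r) powr - k * exp (r - t)) = (2 * k) powr k * (exp ((2 + y) / 2) * exp (r - t)) * (1 + t) powr - k"
    by algebra+
  ultimately have le: "exp (r - t) * (1 + r) powr - k \<le> (2 * k) powr k * (exp ((2 + y) / 2) * exp (r - t)) * (1 + t) powr - k"
    by (simp only:)
  have "exp ((2 + y) / 2) * exp (r - t) = exp 1 * exp ((r - t) / 2)"
    by (simp add: exp_add[symmetric] y_def field_simps)
  then have "(2 * k) powr k * (exp ((2 + y) / 2) * exp (r - t)) * (1 + t) powr - k = (2 * k) powr k * exp 1 * (1 + t) powr - k * exp ((r - t) / 2)"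
    by (simp only: mult_ac)
  then show ?thesis using le by (simp only:)
qed

text \<open>After \<open>exp_weight_bound\<close> the weight is concentrated in a layer of bounded
  width at the cone. A slice contributes of order (1 + t)^(n-1-kp'), and integration over t adds one
  power of R.\<close>

lemma cone_exp_integral:
  fixes k p' :: real
  assumes n: "2 \<le> CARD('n)" and k: "k = (real CARD('n) - 1) / 2" and p': "1 < p'"
  obtains C where "0 < C" "\<And>R. 1 \<le> R \<Longrightarrow>
    (\<integral>\<^sup>+z. ennreal ((exp (norm (snd z) - fst z) * (1 + norm (snd z)) powr - k) powr p') *
       indicator {z. fst z \<in> {R / 2..R} \<and> norm (snd z) \<le> fst z + 1} z \<partial>(lborel :: (real \<times> (real^'n)) measure))
    \<le> ennreal (C * R powr (real CARD('n) - k * p'))"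
proof -
  let ?n = "CARD('n)" and ?c = "real CARD('n) * unit_ball_vol (real CARD('n))"
  have k0: "0 < k" using n k by simp
  define C1 where "C1 = (2 * k) powr k * exp 1"
  have C1: "0 < C1" using k0 by (simp add: C1_def)
  define e where "e = real ?n - 1 - k * p'"
  define c where "c = p' / 2"
  have c: "0 < c" using p' by (simp add: c_def)
  define C2 where "C2 = C1 powr p' * 3 powr \<bar>e\<bar> * (exp c / c)"
  have C2: "0 < C2" using C1 c by (simp add: C2_def)
  have vol: "0 < ?c" using n by (simp add: unit_ball_vol_pos)
  show thesis
  proof (rule that[of "?c * C2 / 2"])
    show "0 < ?c * C2 / 2" using vol C2 by simp
    fix R :: real assume R: "1 \<le> R"
    let ?h = "\<lambda>t r. (exp (r - t) * (1 + r) powr - k) powr p'"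
    have "(\<integral>\<^sup>+z. ennreal (?h (fst z) (norm (snd z))) *
       indicator {z. fst z \<in> {R / 2..R} \<and> norm (snd z) \<le> fst z + 1} z \<partial>(lborel :: (real \<times> (real^'n)) measure))
      \<le> ennreal ?c * (\<integral>\<^sup>+t. ennreal (C2 * R powr e) * indicator {R / 2..R} t \<partial>lborel)"
    proof (rule cone_integral_le)
      show "(\<lambda>(t, r). ?h t r) \<in> borel_measurable (borel \<Otimes>\<^sub>M borel)" by measurable
      fix t assume t: "t \<in> {R / 2..R}"
      then have t0: "0 \<le> t" using R by auto
      define A where "A = (1 + t) powr (real ?n - 1) * (C1 * (1 + t) powr - k) powr p'"
      have A: "0 \<le> A" by (simp add: A_def)
      have "(\<integral>\<^sup>+r. ennreal (r ^ (?n - 1) * ?h t r) * indicator {0..t+1} r \<partial>lborel) \<le> ennreal (A * (exp c / c))"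
      proof (rule nn_integral_cmult_le[OF _ A])
        fix r assume r: "0 \<le> r" "r \<le> t + 1"
        have "?h t r \<le> (C1 * (1 + t) powr - k * exp ((r - t) / 2)) powr p'"
          using exp_weight_bound[OF k0 r t0] p' by (intro powr_mono2) (auto simp: C1_def)
        also have "\<dots> = (C1 * (1 + t) powr - k) powr p' * exp (c * (r - t))"
          using C1 by (simp add: powr_mult exp_powr_real c_def mult_ac)
        finally have 1: "?h t r \<le> (C1 * (1 + t) powr - k) powr p' * exp (c * (r - t))" .
        have "r ^ (?n - 1) \<le> (1 + t) ^ (?n - 1)" using r t0 by (intro power_mono) auto
        also have "\<dots> = (1 + t) powr (real ?n - 1)" using t0 n by (simp add: powr_realpow[symmetric] of_nat_diff)
        finally have "r ^ (?n - 1) \<le> (1 + t) powr (real ?n - 1)" .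
        from mult_mono[OF this 1] show "r ^ (?n - 1) * ?h t r \<le> A * exp (c * (r - t))"
          by (simp add: A_def mult.assoc)
      next
        show "(\<integral>\<^sup>+r. ennreal (exp (c * (r - t))) * indicator {0..t + 1} r \<partial>lborel) \<le> ennreal (exp c / c)"
          by (rule nn_integral_Icc_le[where F="\<lambda>r. exp (c * (r - t)) / c"])
            (use c t0 in \<open>auto intro!: derivative_eq_intros simp: field_simps\<close>)
      qed measurable
      also have "A * (exp c / c) \<le> C2 * R powr e"
      proof -
        have "A = C1 powr p' * (1 + t) powr e"
          using t0 C1 unfolding A_def e_def by (simp add: powr_mult powr_powr powr_add[symmetric] algebra_simps)
        also have "\<dots> \<le> C1 powr p' * (3 powr \<bar>e\<bar> * R powr e)"
          using t R by (intro mult_left_mono powr_comparable) auto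
        finally have "A * (exp c / c) \<le> C1 powr p' * (3 powr \<bar>e\<bar> * R powr e) * (exp c / c)" using c by (intro mult_right_mono) auto
        then show ?thesis by (simp add: C2_def mult_ac)
      qed
      finally show "(\<integral>\<^sup>+r. ennreal (r ^ (?n - 1) * ?h t r) * indicator {0..t+1} r \<partial>lborel) \<le> ennreal (C2 * R powr e)"
        by (simp add: ennreal_leI)
    qed auto
    also have "\<dots> = ennreal (?c * (C2 * R powr e * (R / 2)))"
      using C2 vol R by (subst nn_integral_const_interval) (auto simp: ennreal_mult'[symmetric])
    also have "?c * (C2 * R powr e * (R / 2)) = ?c * C2 / 2 * (R powr e * R)" by simp
    also have "R powr e * R = R powr (real ?n - k * p')" using R powr_add[of R e 1] by (simp add: e_def)
    finally show "(\<integral>\<^sup>+z. ennreal (?h (fst z) (norm (snd z))) *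
       indicator {z. fst z \<in> {R / 2..R} \<and> norm (snd z) \<le> fst z + 1} z \<partial>(lborel :: (real \<times> (real^'n)) measure))
      \<le> ennreal (?c * C2 / 2 * R powr (real ?n - k * p'))" .
  qed
qed

text \<open>The three summands stem from the second cutoff derivative, from the first one times
  \<Phi>_t, and from the damping times the first one. By \<open>rel\<close> each slice is of order
  at most (ln R)/R. Only the middle summand produces a logarithm, through the integral of 1/(t + t0
  - r); the others are absorbed using ln R >= ln 2.\<close>

lemma cone_main_integral:
  fixes k b p' :: real
  assumes n: "2 \<le> CARD('n)" and b: "0 < b" and p': "1 < p'"
    and rel: "real CARD('n) + 1 = 2 * p' + b" "k * p' = b * p' + p' - 1"
  obtains C where "0 < C" "\<And>R t0. 2 \<le> t0 \<Longrightarrow> t0 \<le> R \<Longrightarrow>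
    (\<integral>\<^sup>+z. ennreal (R powr - (2 * p' + b) + R powr (- p' - k * p' + b * (p' - 1)) * (1 / (fst z + t0 - norm (snd z)))
         + R powr (- p' - b) * (1 + norm (snd z)) powr (- 2 * p')) *
       indicator {z. fst z \<in> {R / 2..R} \<and> norm (snd z) \<le> fst z + 1} z \<partial>(lborel :: (real \<times> (real^'n)) measure))
    \<le> ennreal (C * ln R)"
proof -
  let ?n = "CARD('n)" and ?c = "real CARD('n) * unit_ball_vol (real CARD('n))"
  have vol: "0 < ?c" using n by (simp add: unit_ball_vol_pos)
  define C2 where "C2 = (2 * 2 ^ (?n - 1) + 3 powr b / b) / ln 2 + 2 * 2 ^ (?n - 1)"
  have ln2: "0 < ln (2::real)" by simp
  have C2: "0 < C2" unfolding C2_def using b ln2 by (intro add_pos_pos divide_pos_pos) auto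
  show thesis
  proof (rule that[of "?c * C2 / 2"])
    show "0 < ?c * C2 / 2" using vol C2 by simp
    fix R t0 :: real assume t0: "2 \<le> t0" and R: "t0 \<le> R"
    let ?h = "\<lambda>t r. R powr - (2 * p' + b) + R powr (- p' - k * p' + b * (p' - 1)) * (1 / (t + t0 - r)) + R powr (- p' - b) * (1 + r) powr (- 2 * p')"
    have lnR: "0 < ln R" "ln 2 \<le> ln R" using R t0 by auto
    have "(\<integral>\<^sup>+z. ennreal (?h (fst z) (norm (snd z))) *
       indicator {z. fst z \<in> {R / 2..R} \<and> norm (snd z) \<le> fst z + 1} z \<partial>(lborel :: (real \<times> (real^'n)) measure))
      \<le> ennreal ?c * (\<integral>\<^sup>+t. ennreal (C2 * ln R / R) * indicator {R / 2..R} t \<partial>lborel)"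
    proof (rule cone_integral_le)
      show "(\<lambda>(t, r). ?h t r) \<in> borel_measurable (borel \<Otimes>\<^sub>M borel)" by measurable
      fix t assume t: "t \<in> {R / 2..R}"
      then have t': "0 \<le> t" "1 \<le> t" using R t0 by auto
      define P where "P = (2 * R) ^ (?n - 1)"
      have P: "0 \<le> P" using R t0 by (simp add: P_def)
      define A1 where "A1 = P * R powr - (2 * p' + b)"
      define A2 where "A2 = P * R powr (- p' - k * p' + b * (p' - 1))"
      define A3 where "A3 = R powr (- p' - b)"
      have A: "0 \<le> A1" "0 \<le> A2" "0 \<le> A3" using P by (auto simp: A1_def A2_def A3_def)
      have Pp: "P = 2 ^ (?n - 1) * R powr (real ?n - 1)"
        using R t0 n by (simp add: P_def power_mult_distrib powr_realpow[symmetric] of_nat_diff)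
      have A1: "A1 = 2 ^ (?n - 1) * R powr - 2"
      proof -
        have "real ?n - 1 + - (2 * p' + b) = - 2" using rel(1) by simp
        then show ?thesis by (simp only: A1_def Pp mult.assoc powr_add[symmetric])
      qed
      have A2: "A2 = 2 ^ (?n - 1) * R powr - 1"
      proof -
        have "real ?n - 1 + (- p' - k * p' + b * (p' - 1)) = - 1" using rel by (simp add: algebra_simps)
        then show ?thesis by (simp only: A2_def Pp mult.assoc powr_add[symmetric])
      qed
      have "(\<integral>\<^sup>+r. ennreal (r ^ (?n - 1) * ?h t r) * indicator {0..t+1} r \<partial>lborel) \<le> ennreal (1 * (A1 * (t + 1) + A2 * ln (t + t0) + A3 * ((t + 2) powr b / b)))"
      proof (rule nn_integral_cmult_le)
        fix r assume r: "0 \<le> r" "r \<le> t + 1"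
        have "r \<le> 2 * R" using r t R t0 by auto
        then have rP: "r ^ (?n - 1) \<le> P" unfolding P_def using r by (intro power_mono) auto
        have s: "0 \<le> 1 / (t + t0 - r)" using r t0 by simp
        have "r ^ (?n - 1) * (1 + r) powr (- 2 * p') \<le> (1 + r) ^ (?n - 1) * (1 + r) powr (- 2 * p')"
          using r by (intro mult_right_mono power_mono) auto
        also have "\<dots> = (1 + r) powr (real ?n - 1 + - 2 * p')"
          unfolding powr_add using r n by (simp add: powr_realpow[symmetric] of_nat_diff)
        \<comment> \<open>The exponent equals b - 2 by \<open>rel\<close>. Raising it to b - 1 gives
          the antiderivative (1 + r)^b / b for every b > 0, and the loss is harmless since p' >
          1.\<close>
        also have "\<dots> \<le> (1 + r) powr (b - 1)" using r rel(1) by (intro powr_mono) auto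
        finally have 3: "r ^ (?n - 1) * (1 + r) powr (- 2 * p') \<le> (1 + r) powr (b - 1)" .
        have "r ^ (?n - 1) * ?h t r = r ^ (?n - 1) * R powr - (2 * p' + b) + r ^ (?n - 1) * (R powr (- p' - k * p' + b * (p' - 1)) * (1 / (t + t0 - r)))
            + R powr (- p' - b) * (r ^ (?n - 1) * (1 + r) powr (- 2 * p'))"
          by (simp only: distrib_left mult.left_commute)
        also have "\<dots> \<le> P * R powr - (2 * p' + b) + P * (R powr (- p' - k * p' + b * (p' - 1)) * (1 / (t + t0 - r)))
            + R powr (- p' - b) * (1 + r) powr (b - 1)"
          using rP s 3 by (intro add_mono mult_right_mono mult_left_mono mult_nonneg_nonneg) auto
        also have "\<dots> = A1 + A2 * (1 / (t + t0 - r)) + A3 * (1 + r) powr (b - 1)" by (simp only: A1_def A2_def A3_def mult.assoc)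
        finally show "r ^ (?n - 1) * ?h t r \<le> 1 * (A1 + A2 * (1 / (t + t0 - r)) + A3 * (1 + r) powr (b - 1))" by simp
      next
        show "(\<integral>\<^sup>+r. ennreal (A1 + A2 * (1 / (t + t0 - r)) + A3 * (1 + r) powr (b - 1)) * indicator {0..t + 1} r \<partial>lborel)
          \<le> ennreal (A1 * (t + 1) + A2 * ln (t + t0) + A3 * ((t + 2) powr b / b))"
        proof (rule nn_integral_Icc_le[where F="\<lambda>r. A1 * r - A2 * ln (t + t0 - r) + A3 * ((1 + r) powr b / b)"])
          fix r assume r: "0 \<le> r" "r \<le> t + 1"
          have 1: "((\<lambda>r. ln (t + t0 - r)) has_real_derivative - (1 / (t + t0 - r))) (at r)"
            using r t0 by (auto intro!: derivative_eq_intros simp: divide_simps)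
          have 2: "((\<lambda>r. (1 + r) powr b / b) has_real_derivative (1 + r) powr (b - 1)) (at r)"
            using r b by (auto intro!: derivative_eq_intros)
          have "((\<lambda>r. A1 * r - A2 * ln (t + t0 - r) + A3 * ((1 + r) powr b / b)) has_real_derivative
              A1 * 1 - A2 * - (1 / (t + t0 - r)) + A3 * (1 + r) powr (b - 1)) (at r)"
            by (intro DERIV_add DERIV_diff DERIV_cmult DERIV_ident 1 2)
          then show "((\<lambda>r. A1 * r - A2 * ln (t + t0 - r) + A3 * ((1 + r) powr b / b)) has_real_derivative
              A1 + A2 * (1 / (t + t0 - r)) + A3 * (1 + r) powr (b - 1)) (at r)" by simp
          show "0 \<le> A1 + A2 * (1 / (t + t0 - r)) + A3 * (1 + r) powr (b - 1)"
            using r t0 A by (intro add_nonneg_nonneg mult_nonneg_nonneg) auto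
        next
          have "0 \<le> A2 * ln (t + t0 - (t + 1))" using A t0 by simp
          moreover have "0 \<le> A3 * (1 / b)" using A b by simp
          moreover have e2: "1 + (t + 1) = t + 2" by simp
          ultimately show "A1 * (t + 1) - A2 * ln (t + t0 - (t + 1)) + A3 * ((1 + (t + 1)) powr b / b)
            - (A1 * 0 - A2 * ln (t + t0 - 0) + A3 * ((1 + 0) powr b / b)) \<le> A1 * (t + 1) + A2 * ln (t + t0) + A3 * ((t + 2) powr b / b)"
            unfolding e2 by simp
        qed (use t' in auto)
      qed (use t' in auto)
      also have "1 * (A1 * (t + 1) + A2 * ln (t + t0) + A3 * ((t + 2) powr b / b)) \<le> C2 * ln R / R"
      proof -
        have R0: "0 < R" using R t0 by simp
        have inv: "R powr - 2 * R = 1 / R" "R powr - 1 = 1 / R" using R0 by (auto simp: powr_minus_divide power2_eq_square)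
        have "A1 * (t + 1) \<le> A1 * (2 * R)" using A t R t0 by (intro mult_left_mono) auto
        also have "\<dots> = 2 * 2 ^ (?n - 1) * (R powr - 2 * R)" unfolding A1 by (simp only: mult_ac)
        finally have 1: "A1 * (t + 1) \<le> 2 * 2 ^ (?n - 1) * (1 / R)" unfolding inv .
        have "ln (t + t0) \<le> ln (R * R)"
        proof -
          have "t + t0 \<le> 2 * R" using t R by auto
          also have "\<dots> \<le> R * R" using R t0 by (intro mult_right_mono) auto
          finally show ?thesis using t' t0 by simp
        qed
        then have "ln (t + t0) \<le> 2 * ln R" using R0 by (simp add: ln_mult)
        then have "A2 * ln (t + t0) \<le> A2 * (2 * ln R)" using A by (intro mult_left_mono) auto
        also have "\<dots> = 2 * 2 ^ (?n - 1) * ln R * (1 / R)" unfolding A2 inv by (simp only: mult_ac)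
        finally have 2: "A2 * ln (t + t0) \<le> 2 * 2 ^ (?n - 1) * ln R * (1 / R)" .
        have "A3 * ((t + 2) powr b / b) \<le> A3 * ((3 * R) powr b / b)"
          using A b t R t0 by (intro mult_left_mono divide_right_mono powr_mono2) auto
        also have "\<dots> = (3 powr b / b) * (R powr (- p' - b) * R powr b)" using R0 by (simp add: A3_def powr_mult)
        also have "R powr (- p' - b) * R powr b = R powr - p'" by (simp add: powr_add[symmetric])
        also have "(3 powr b / b) * R powr - p' \<le> (3 powr b / b) * R powr - 1" using R t0 p' b by (intro mult_left_mono powr_mono) auto
        finally have 3: "A3 * ((t + 2) powr b / b) \<le> (3 powr b / b) * (1 / R)" unfolding inv .
        have "A1 * (t + 1) + A2 * ln (t + t0) + A3 * ((t + 2) powr b / b) \<le> ((2 * 2 ^ (?n - 1) + 3 powr b / b) * 1 + 2 * 2 ^ (?n - 1) * ln R) * (1 / R)"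
          using 1 2 3 by (simp add: algebra_simps)
        also have "\<dots> \<le> ((2 * 2 ^ (?n - 1) + 3 powr b / b) * (ln R / ln 2) + 2 * 2 ^ (?n - 1) * ln R) * (1 / R)"
          using lnR R0 b by (intro mult_right_mono add_mono mult_left_mono) (auto simp: field_simps)
        also have "\<dots> = C2 * ln R / R"
        proof -
          have "(A * (L / l) + B * L) * (1 / Q) = (A / l + B) * L / Q" for A B L l Q :: real by (simp add: distrib_right)
          then show ?thesis by (simp only: C2_def)
        qed
        finally show ?thesis by simp
      qed
      finally show "(\<integral>\<^sup>+r. ennreal (r ^ (?n - 1) * ?h t r) * indicator {0..t+1} r \<partial>lborel) \<le> ennreal (C2 * ln R / R)"
        by (simp add: ennreal_leI)
    qed auto
    also have "\<dots> = ennreal (?c * (C2 * ln R / R * (R / 2)))"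
      using C2 vol R lnR t0 by (subst nn_integral_const_interval) (auto simp: ennreal_mult'[symmetric])
    also have "?c * (C2 * ln R / R * (R / 2)) = ?c * C2 / 2 * ln R" using R t0 by simp
    finally show "(\<integral>\<^sup>+z. ennreal (?h (fst z) (norm (snd z))) *
       indicator {z. fst z \<in> {R / 2..R} \<and> norm (snd z) \<le> fst z + 1} z \<partial>(lborel :: (real \<times> (real^'n)) measure))
      \<le> ennreal (?c * C2 / 2 * ln R)" .
  qed
qed

text \<open>The weight of the error a \<Phi>_t, integrated over the whole future. It decays in
  \<open>t0\<close> because each slice is only of order s^(-p') ln s with s = t + t0.\<close>

lemma cone_error_integral:
  fixes b p' :: real
  assumes n: "2 \<le> CARD('n)" and b: "0 < b" and p': "1 < p'" and rel: "real CARD('n) + 1 = 2 * p' + b"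
  obtains C where "0 < C" "\<And>t0. 2 \<le> t0 \<Longrightarrow>
    (\<integral>\<^sup>+z. ennreal ((fst z + t0) powr (1 - p' - b) * (1 + norm (snd z)) powr (- 2 * p') * (1 / (fst z + t0 - norm (snd z)))) *
       indicator {z. fst z \<in> {0..} \<and> norm (snd z) \<le> fst z + 1} z \<partial>(lborel :: (real \<times> (real^'n)) measure))
    \<le> ennreal (C * t0 powr - ((p' - 1) / 2))"
proof -
  let ?n = "CARD('n)" and ?c = "real CARD('n) * unit_ball_vol (real CARD('n))"
  have vol: "0 < ?c" using n by (simp add: unit_ball_vol_pos)
  \<comment> \<open>Half of the surplus p' - 1 pays for the logarithm, the other half for
    integrability in time and the decay in \<open>t0\<close>.\<close>
  define \<delta> where "\<delta> = (p' - 1) / 2"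
  have \<delta>: "0 < \<delta>" "p' = 1 + 2 * \<delta>" using p' by (simp_all add: \<delta>_def field_simps)
  show thesis
  proof (rule that[of "?c * (2 / \<delta> / \<delta>)"])
    show "0 < ?c * (2 / \<delta> / \<delta>)" using vol \<delta> by simp
    fix t0 :: real assume t0: "2 \<le> t0"
    let ?h = "\<lambda>t r. (t + t0) powr (1 - p' - b) * (1 + r) powr (- 2 * p') * (1 / (t + t0 - r))"
    have "(\<integral>\<^sup>+z. ennreal (?h (fst z) (norm (snd z))) *
       indicator {z. fst z \<in> {0..} \<and> norm (snd z) \<le> fst z + 1} z \<partial>(lborel :: (real \<times> (real^'n)) measure))
      \<le> ennreal ?c * (\<integral>\<^sup>+t. ennreal (2 / \<delta> * (t + t0) powr (- 1 - \<delta>)) * indicator {0..} t \<partial>lborel)"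
    proof (rule cone_integral_le)
      show "(\<lambda>(t, r). ?h t r) \<in> borel_measurable (borel \<Otimes>\<^sub>M borel)" by measurable
      fix t :: real assume "t \<in> {0..}"
      then have t: "0 \<le> t" by simp
      define s where "s = t + t0"
      have s: "2 \<le> s" "t + 2 \<le> s" using t t0 by (auto simp: s_def)
      have "(\<integral>\<^sup>+r. ennreal (r ^ (?n - 1) * ?h t r) * indicator {0..t+1} r \<partial>lborel) \<le> ennreal (s powr - p' * (2 * ln s))"
      proof (rule nn_integral_cmult_le)
        fix r assume r: "0 \<le> r" "r \<le> t + 1"
        have s0: "0 < 1 / (s - r)" using r s by simp
        have "r ^ (?n - 1) * (1 + r) powr (- 2 * p') \<le> (1 + r) ^ (?n - 1) * (1 + r) powr (- 2 * p')"
          using r by (intro mult_right_mono power_mono) auto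
        also have "\<dots> = (1 + r) powr (real ?n - 1 + - 2 * p')"
          unfolding powr_add using r n by (simp add: powr_realpow[symmetric] of_nat_diff)
        also have "\<dots> \<le> (1 + r) powr (b - 1)" using r rel(1) by (intro powr_mono) auto
        also have "\<dots> = (1 + r) powr b * (1 / (1 + r))" using r by (simp add: powr_diff)
        also have "\<dots> \<le> s powr b * (1 / (1 + r))" using r s b by (intro mult_right_mono powr_mono2) auto
        finally have "r ^ (?n - 1) * (1 + r) powr (- 2 * p') * (1 / (s - r)) \<le> s powr b * (1 / (1 + r)) * (1 / (s - r))"
          using s0 by (intro mult_right_mono) auto
        also have "\<dots> = s powr b * ((1 / (1 + r)) * (1 / (s - r)))" by simp
        \<comment> \<open>Partial fractions separate the weight at the origin from the singularity
          at the shifted cone and gain a factor 1/(s + 1).\<close>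
        also have "(1 / (1 + r)) * (1 / (s - r)) = (1 / (s + 1)) * (1 / (1 + r) + 1 / (s - r))"
          using r s by (simp add: divide_simps)
        also have "s powr b * ((1 / (s + 1)) * (1 / (1 + r) + 1 / (s - r))) \<le> s powr b * ((1 / s) * (1 / (1 + r) + 1 / (s - r)))"
          using r s s0 by (intro mult_left_mono mult_right_mono divide_left_mono add_nonneg_nonneg) auto
        also have "\<dots> = s powr (b - 1) * (1 / (1 + r) + 1 / (s - r))" using s by (simp add: powr_diff)
        finally have "s powr (1 - p' - b) * (r ^ (?n - 1) * (1 + r) powr (- 2 * p') * (1 / (s - r))) \<le> s powr (1 - p' - b) * (s powr (b - 1) * (1 / (1 + r) + 1 / (s - r)))"
          by (intro mult_left_mono) auto
        also have "\<dots> = s powr - p' * (1 / (1 + r) + 1 / (s - r))" by (simp only: mult.assoc[symmetric] powr_add[symmetric]) simp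
        finally show "r ^ (?n - 1) * ?h t r \<le> s powr - p' * (1 / (1 + r) + 1 / (s - r))" by (simp only: s_def mult_ac)
      next
        show "(\<integral>\<^sup>+r. ennreal (1 / (1 + r) + 1 / (s - r)) * indicator {0..t + 1} r \<partial>lborel) \<le> ennreal (2 * ln s)"
        proof (rule nn_integral_Icc_le[where F="\<lambda>r. ln (1 + r) - ln (s - r)"])
          fix r assume r: "0 \<le> r" "r \<le> t + 1"
          show "((\<lambda>r. ln (1 + r) - ln (s - r)) has_real_derivative 1 / (1 + r) + 1 / (s - r)) (at r)"
            using r s by (auto intro!: derivative_eq_intros simp: divide_simps)
          show "0 \<le> 1 / (1 + r) + 1 / (s - r)" using r s by simp
        next
          have "ln (1 + (t + 1)) \<le> ln s" "0 \<le> ln (s - (t + 1))" using s t by auto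
          then show "ln (1 + (t + 1)) - ln (s - (t + 1)) - (ln (1 + 0) - ln (s - 0)) \<le> 2 * ln s" by simp
        qed (use t in auto)
      qed (use t in auto)
      also have "s powr - p' * (2 * ln s) \<le> 2 / \<delta> * s powr (- 1 - \<delta>)"
      proof -
        have "ln s \<le> s powr \<delta> / \<delta>" using s \<delta> by (intro ln_powr_bound) auto
        then have "s powr - p' * (2 * ln s) \<le> s powr - p' * (2 * (s powr \<delta> / \<delta>))" by (intro mult_left_mono) auto
        also have "\<dots> = 2 / \<delta> * (s powr - p' * s powr \<delta>)" by simp
        also have "s powr - p' * s powr \<delta> = s powr (- 1 - \<delta>)"
        proof -
          have "- p' + \<delta> = - 1 - \<delta>" using \<delta>(2) by simp
          then show ?thesis by (simp only: powr_add[symmetric])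
        qed
        finally show ?thesis .
      qed
      finally show "(\<integral>\<^sup>+r. ennreal (r ^ (?n - 1) * ?h t r) * indicator {0..t+1} r \<partial>lborel) \<le> ennreal (2 / \<delta> * (t + t0) powr (- 1 - \<delta>))"
        by (simp add: ennreal_leI s_def)
    qed auto
    also have "(\<integral>\<^sup>+t. ennreal (2 / \<delta> * (t + t0) powr (- 1 - \<delta>)) * indicator {0..} t \<partial>lborel) = ennreal (0 - (- (2 / \<delta> / \<delta>) * (0 + t0) powr - \<delta>))"
    proof (rule nn_integral_FTC_atLeast[where F="\<lambda>t. - (2 / \<delta> / \<delta>) * (t + t0) powr - \<delta>"])
      show "((\<lambda>t. - (2 / \<delta> / \<delta>) * (t + t0) powr - \<delta>) has_real_derivative 2 / \<delta> * (t + t0) powr (- 1 - \<delta>)) (at t)" if "0 \<le> t" for t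
      proof -
        have "((\<lambda>t. (t + t0) powr - \<delta>) has_real_derivative - \<delta> * (t + t0) powr (- \<delta> - 1)) (at t)"
          using that t0 by (auto intro!: derivative_eq_intros)
        then have "((\<lambda>t. - (2 / \<delta> / \<delta>) * (t + t0) powr - \<delta>) has_real_derivative - (2 / \<delta> / \<delta>) * (- \<delta> * (t + t0) powr (- \<delta> - 1))) (at t)"
          by (rule DERIV_cmult)
        moreover have "- \<delta> - 1 = - 1 - \<delta>" by simp
        moreover have "- (2 / \<delta> / \<delta>) * (- \<delta> * X) = 2 / \<delta> * X" for X :: real using \<delta>(1) by simp
        ultimately show ?thesis by (simp only:)
      qed
      have "((\<lambda>t. (t + t0) powr - \<delta>) \<longlongrightarrow> 0) at_top"
        by (rule tendsto_neg_powr) (use \<delta> in \<open>auto intro: filterlim_tendsto_add_at_top[OF tendsto_const filterlim_ident, of t0, simplified add.commute]\<close>)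
      then show "((\<lambda>t. - (2 / \<delta> / \<delta>) * (t + t0) powr - \<delta>) \<longlongrightarrow> 0) at_top" by (rule tendsto_mult_right_zero)
    qed (use \<delta> in auto)
    also have "ennreal ?c * ennreal (0 - (- (2 / \<delta> / \<delta>) * (0 + t0) powr - \<delta>)) = ennreal (?c * (2 / \<delta> / \<delta>) * t0 powr - \<delta>)"
      using vol \<delta> by (subst ennreal_mult'[symmetric]) (auto simp: mult_ac)
    finally show "(\<integral>\<^sup>+z. ennreal (?h (fst z) (norm (snd z))) *
       indicator {z. fst z \<in> {0..} \<and> norm (snd z) \<le> fst z + 1} z \<partial>(lborel :: (real \<times> (real^'n)) measure))
      \<le> ennreal (?c * (2 / \<delta> / \<delta>) * t0 powr - ((p' - 1) / 2))" by (simp add: \<delta>_def)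
  qed
qed

section \<open>The energy inequality\<close>

lemma cutoff_range: "0 \<le> cutoff m s" "cutoff m s \<le> 1"
  unfolding cutoff_def by (auto intro!: power_le_one)

lemma cutoff_antimono: "s \<le> t \<Longrightarrow> cutoff m t \<le> cutoff m s"
  unfolding cutoff_def by (intro power_mono max.mono diff_mono) auto

lemma cutoff_deriv_bounds:
  fixes p :: real
  assumes m: "3 \<le> m" "real m / p \<le> real m - 2" and p: "0 < p"
  shows "\<bar>cutoff' m s\<bar> \<le> 60 * (real m)\<^sup>2 * (indicator {1/2..1} s * cutoff m s powr (1 / p))"
    "\<bar>cutoff'' m s\<bar> \<le> 60 * (real m)\<^sup>2 * (indicator {1/2..1} s * cutoff m s powr (1 / p))"
proof -
  consider "s < 1 / 2" | "1 < s" | "1 / 2 \<le> s" "s \<le> 1" by linarith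
  then have "\<bar>cutoff' m s\<bar> \<le> 60 * (real m)\<^sup>2 * (indicator {1/2..1} s * cutoff m s powr (1 / p)) \<and>
    \<bar>cutoff'' m s\<bar> \<le> 60 * (real m)\<^sup>2 * (indicator {1/2..1} s * cutoff m s powr (1 / p))"
  proof cases
    case 1
    then show ?thesis by (simp add: cutoff_le_half)
  next
    case 2
    then show ?thesis using m by (simp add: cutoff_ge_1)
  next
    case 3
    define c where "c = max 0 (2 * s - 1)"
    define A where "A = max 0 (1 - c ^ 3)"
    have c: "0 \<le> c" "c \<le> 1" using 3 by (auto simp: c_def)
    have A: "0 \<le> A" "A \<le> 1" using c by (auto simp: A_def)
    have c2: "c ^ 2 \<le> 1" "c ^ 4 \<le> 1" using c by (auto intro: power_le_one)
    have key: "A ^ (m - 2) \<le> cutoff m s powr (1 / p)"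
    proof (cases "A = 0")
      case True
      then show ?thesis using m by (simp add: power_0_left)
    next
      case False
      then have A0: "0 < A" using A by simp
      have "A ^ (m - 2) = A powr (real m - 2)" using A0 m by (simp add: powr_realpow[symmetric] of_nat_diff)
      also have "\<dots> \<le> A powr (real m / p)" using A A0 m by (intro powr_mono') auto
      also have "\<dots> = (A powr real m) powr (1 / p)" by (simp add: powr_powr)
      also have "\<dots> = cutoff m s powr (1 / p)" using A0 by (simp add: cutoff_def A_def c_def powr_realpow)
      finally show ?thesis .
    qed
    have le: "A ^ (m - 1) \<le> A ^ (m - 2)" using A by (intro power_decreasing) auto
    have m1: "1 \<le> real m" using m by simp
    have msq: "real m \<le> (real m)\<^sup>2" using m1 by (simp add: power2_eq_square)
    have "real m * real (m - 1) \<le> real m * real m" by (intro mult_left_mono) auto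
    then have mm: "real m * real (m - 1) \<le> (real m)\<^sup>2" by (simp add: power2_eq_square)
    have "\<bar>cutoff' m s\<bar> = 6 * real m * (A ^ (m - 1) * c ^ 2)"
      using A by (simp add: cutoff'_def A_def[symmetric] c_def[symmetric] abs_mult)
    also have "\<dots> \<le> 60 * (real m)\<^sup>2 * (A ^ (m - 2) * 1)"
      using A c2 le msq by (intro mult_mono) auto
    finally have 1: "\<bar>cutoff' m s\<bar> \<le> 60 * (real m)\<^sup>2 * A ^ (m - 2)" by simp
    have "\<bar>cutoff'' m s\<bar> \<le> \<bar>36 * real m * real (m - 1) * A ^ (m - 2) * c ^ 4\<bar> + \<bar>24 * real m * A ^ (m - 1) * c\<bar>"
      unfolding cutoff''_def A_def c_def by (rule abs_triangle_ineq4)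
    also have "\<dots> = 36 * (real m * real (m - 1)) * (A ^ (m - 2) * c ^ 4) + 24 * real m * (A ^ (m - 1) * c)"
      using A c by (simp add: abs_mult)
    also have "\<dots> \<le> 36 * (real m)\<^sup>2 * (A ^ (m - 2) * 1) + 24 * (real m)\<^sup>2 * (A ^ (m - 2) * 1)"
      using A c c2 le msq mm by (intro add_mono mult_mono) auto
    finally have 2: "\<bar>cutoff'' m s\<bar> \<le> 60 * (real m)\<^sup>2 * A ^ (m - 2)" by simp
    have "60 * (real m)\<^sup>2 * A ^ (m - 2) \<le> 60 * (real m)\<^sup>2 * cutoff m s powr (1 / p)" using key by (intro mult_left_mono) auto
    then show ?thesis using 1 2 3 by simp
  qed
  then show "\<bar>cutoff' m s\<bar> \<le> 60 * (real m)\<^sup>2 * (indicator {1/2..1} s * cutoff m s powr (1 / p))"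
    "\<bar>cutoff'' m s\<bar> \<le> 60 * (real m)\<^sup>2 * (indicator {1/2..1} s * cutoff m s powr (1 / p))" by blast+
qed

lemma damping_le_inverse_square:
  assumes "0 \<le> \<mu>" "2 \<le> \<beta>"
  shows "damping \<mu> \<beta> x \<le> \<mu> * (1 + norm x) powr - 2"
proof -
  have "(1 + norm x) powr - \<beta> \<le> (1 + norm x) powr - 2" using assms by (intro powr_mono) auto
  then show ?thesis using assms by (simp add: damping_def powr_minus divide_inverse mult_left_mono)
qed

context energy_supp
begin

lemma continuous_cone_bounded:
  assumes "continuous_on UNIV \<omega>"
  obtains B where "\<And>z. 0 < fst z \<Longrightarrow> fst z \<le> T1 \<Longrightarrow> norm (snd z) \<le> fst z + 1 \<Longrightarrow> \<bar>\<omega> (z :: real \<times> (real^'n)) :: real\<bar> \<le> B"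
proof -
  have "compact (\<omega> ` ({0..T1} \<times> cball 0 (T1 + 1)))"
    by (intro compact_continuous_image continuous_on_subset[OF assms] compact_Times) auto
  then obtain B where "\<And>z. z \<in> {0..T1} \<times> cball 0 (T1 + 1) \<Longrightarrow> \<bar>\<omega> z\<bar> \<le> B"
    using compact_imp_bounded bounded_real by (metis image_eqI)
  then show thesis by (intro that[of B]) (auto simp: mem_Times_iff)
qed

text \<open>The data are nonnegative, \<Psi> >= 0 and its time derivative is <= 0 at t = 0, so all
  terms on the left of \<open>weak_identity\<close> are nonnegative and each is bounded by the
  residual integral. The first conclusion serves the lower bound, the second the upper
  bound.\<close>

lemma energy_bound:
  fixes \<Psi> Pt Ptt D :: "real \<times> (real^'n) \<Rightarrow> real" and P Q :: "'n \<Rightarrow> real \<times> (real^'n) \<Rightarrow> real"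
  assumes cont: "continuous_on UNIV \<Psi>" "continuous_on UNIV Pt" "continuous_on UNIV Ptt"
      "\<And>i. continuous_on UNIV (P i)" "\<And>i. continuous_on UNIV (Q i)"
    and dt: "\<And>z. ((\<lambda>s. \<Psi> (z + s *\<^sub>R (1, 0))) has_real_derivative Pt z) (at 0)"
      "\<And>z. ((\<lambda>s. Pt (z + s *\<^sub>R (1, 0))) has_real_derivative Ptt z) (at 0)"
    and dx: "\<And>i z. ((\<lambda>s. \<Psi> (z + s *\<^sub>R (0, axis i 1))) has_real_derivative P i z) (at 0)"
      "\<And>i z. ((\<lambda>s. P i (z + s *\<^sub>R (0, axis i 1))) has_real_derivative Q i z) (at 0)"
    and T1: "0 \<le> T1" "T1 < T" "\<And>z. T1 \<le> fst z \<Longrightarrow> \<Psi> z = 0"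
    and late: "\<And>z. T1 < fst z \<Longrightarrow> Pt z = 0 \<and> Ptt z = 0 \<and> (\<forall>i. Q i z = 0)"
    and sign: "0 \<le> \<epsilon>" "AE x in lborel. 0 \<le> f x" "AE x in lborel. 0 \<le> g x"
      "\<And>x. 0 \<le> \<Psi> (0, x)" "\<And>x. Pt (0, x) \<le> 0"
    and pos: "\<And>z. 0 < fst z \<Longrightarrow> fst z \<le> T1 \<Longrightarrow> norm (snd z) \<le> fst z + 1 \<Longrightarrow> 0 \<le> \<Psi> z"
    and D: "\<And>z. 0 < fst z \<Longrightarrow> fst z \<le> T1 \<Longrightarrow> norm (snd z) \<le> fst z + 1 \<Longrightarrow>
       \<bar>Ptt z - (\<Sum>i\<in>UNIV. Q i z) - a (snd z) * Pt z\<bar> \<le> D z"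
    and Dpos: "\<And>z. 0 \<le> D z"
  shows "ennreal (\<epsilon> * (LINT x|lborel. g x * \<Psi> (0, x))) \<le> (\<integral>\<^sup>+z. ennreal (\<bar>W z\<bar> * D z) \<partial>lborel)"
    "(\<integral>\<^sup>+z. ennreal (\<bar>W z\<bar> powr p * \<Psi> z) \<partial>lborel) \<le> (\<integral>\<^sup>+z. ennreal (\<bar>W z\<bar> * D z) \<partial>lborel)"
proof -
  let ?\<omega> = "\<lambda>z. Ptt z - (\<Sum>i\<in>UNIV. Q i z) - a (snd z) * Pt z"
  have [measurable]: "\<Psi> \<in> borel_measurable borel" "Pt \<in> borel_measurable borel" "Ptt \<in> borel_measurable borel"
    "Q i \<in> borel_measurable borel" for i
    using cont by (auto intro: borel_measurable_continuous_onI)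
  have [measurable]: "(\<lambda>z::real \<times> (real^'n). a (snd z)) \<in> borel_measurable borel" by (rule measurable_compose[OF borel_measurable_fst_snd(2) a_measurable])
  have ab: "\<bar>a x\<bar> \<le> \<mu>" "0 \<le> a x" for x using damping_bounds(1,2)[OF \<mu> \<beta>, of x] by auto
  have iW: "integrable lborel (\<lambda>z. W z * ?\<omega> z)"
  proof -
    have c: "continuous_on UNIV (\<lambda>z. Ptt z - (\<Sum>i\<in>UNIV. Q i z))" by (intro continuous_intros cont)
    obtain B1 where B1: "\<And>z. 0 < fst z \<Longrightarrow> fst z \<le> T1 \<Longrightarrow> norm (snd z) \<le> fst z + 1 \<Longrightarrow> \<bar>Ptt z - (\<Sum>i\<in>UNIV. Q i z)\<bar> \<le> B1"
      using continuous_cone_bounded[OF c] by metis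
    obtain B2 where B2: "\<And>z. 0 < fst z \<Longrightarrow> fst z \<le> T1 \<Longrightarrow> norm (snd z) \<le> fst z + 1 \<Longrightarrow> \<bar>Pt z\<bar> \<le> B2"
      using continuous_cone_bounded[OF cont(2)] by metis
    show ?thesis
    proof (rule W_integrable(1)[OF _ T1(1,2), where B="B1 + \<mu> * B2"])
      fix z :: "real \<times> (real^'n)" assume z: "0 < fst z" "fst z \<le> T1" "norm (snd z) \<le> fst z + 1"
      have "\<bar>a (snd z) * Pt z\<bar> \<le> \<mu> * B2" unfolding abs_mult by (intro mult_mono ab(1) B2 z abs_ge_zero \<mu>)
      then show "\<bar>?\<omega> z\<bar> \<le> B1 + \<mu> * B2" using B1[OF z] by linarith
    qed (use late in auto)
  qed
  have iP: "integrable lborel (\<lambda>z. \<bar>W z\<bar> powr p * \<Psi> z)"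
  proof -
    obtain B2 where B2: "\<And>z. 0 < fst z \<Longrightarrow> fst z \<le> T1 \<Longrightarrow> norm (snd z) \<le> fst z + 1 \<Longrightarrow> \<bar>\<Psi> z\<bar> \<le> B2"
      using continuous_cone_bounded[OF cont(1)] by metis
    show ?thesis by (rule W_integrable(2)[OF _ T1(1,2) B2]) (use T1 in auto)
  qed
  have nnP: "0 \<le> \<bar>W z\<bar> powr p * \<Psi> z" for z
  proof (cases "W z = 0 \<or> T1 < fst z")
    case True
    then show ?thesis using T1(3)[of z] p by auto
  next
    case False
    then show ?thesis using W_nonzeroD[of z] pos[of z] by auto
  qed
  have g0: "0 \<le> (LINT x|lborel. g x * \<Psi> (0, x))"
    by (rule integral_nonneg_AE) (use sign(3) in eventually_elim, use sign(4) in auto)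
  have f0: "0 \<le> (LINT x|lborel. a x * f x * \<Psi> (0, x))"
    by (rule integral_nonneg_AE) (use sign(2) in eventually_elim, use sign(4) ab in auto)
  have f1: "(LINT x|lborel. f x * Pt (0, x)) \<le> 0"
  proof -
    have "0 \<le> (LINT x|lborel. - (f x * Pt (0, x)))"
      by (rule integral_nonneg_AE) (use sign(2) in eventually_elim, use sign(5) in \<open>auto simp: mult_nonneg_nonpos\<close>)
    then show ?thesis by simp
  qed
  have id: "\<epsilon> * (LINT x|lborel. g x * \<Psi> (0, x)) + \<epsilon> * (LINT x|lborel. a x * f x * \<Psi> (0, x))
      - \<epsilon> * (LINT x|lborel. f x * Pt (0, x)) + (LINT z|lborel. \<bar>W z\<bar> powr p * \<Psi> z) = (LINT z|lborel. W z * ?\<omega> z)"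
    by (rule weak_identity[OF cont dt dx T1])
  have e0: "0 \<le> \<epsilon> * (LINT x|lborel. g x * \<Psi> (0, x))" "0 \<le> \<epsilon> * (LINT x|lborel. a x * f x * \<Psi> (0, x))"
    "\<epsilon> * (LINT x|lborel. f x * Pt (0, x)) \<le> 0"
    using g0 f0 f1 sign(1) by (auto intro: mult_nonneg_nonneg mult_nonneg_nonpos)
  have P0: "0 \<le> (LINT z|lborel. \<bar>W z\<bar> powr p * \<Psi> z)" by (rule Bochner_Integration.integral_nonneg[OF nnP])
  have up: "ennreal (LINT z|lborel. W z * ?\<omega> z) \<le> (\<integral>\<^sup>+z. ennreal (\<bar>W z\<bar> * D z) \<partial>lborel)"
  proof -
    have "(LINT z|lborel. W z * ?\<omega> z) \<le> (LINT z|lborel. \<bar>W z * ?\<omega> z\<bar>)"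
      by (rule order_trans[OF abs_ge_self integral_abs_bound])
    then have "ennreal (LINT z|lborel. W z * ?\<omega> z) \<le> ennreal (LINT z|lborel. \<bar>W z * ?\<omega> z\<bar>)" by (rule ennreal_leI)
    also have "\<dots> = (\<integral>\<^sup>+z. ennreal \<bar>W z * ?\<omega> z\<bar> \<partial>lborel)"
      by (rule nn_integral_eq_integral[symmetric]) (use integrable_abs[OF iW] in auto)
    also have "\<dots> \<le> (\<integral>\<^sup>+z. ennreal (\<bar>W z\<bar> * D z) \<partial>lborel)"
    proof (intro nn_integral_mono ennreal_leI)
      fix z
      show "\<bar>W z * ?\<omega> z\<bar> \<le> \<bar>W z\<bar> * D z"
      proof (cases "W z = 0")
        case False
        note Wz = W_nonzeroD[OF this]
        show ?thesis
        proof (cases "fst z \<le> T1")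
          case True
          then show ?thesis unfolding abs_mult using D[of z] Wz by (intro mult_left_mono) auto
        next
          case F: False
          then have "?\<omega> z = 0" using late[of z] by simp
          then show ?thesis using Dpos[of z] by simp
        qed
      qed simp
    qed
    finally show ?thesis .
  qed
  show "ennreal (\<epsilon> * (LINT x|lborel. g x * \<Psi> (0, x))) \<le> (\<integral>\<^sup>+z. ennreal (\<bar>W z\<bar> * D z) \<partial>lborel)"
    by (rule order_trans[OF ennreal_leI up]) (use id e0 P0 in linarith)
  have "(\<integral>\<^sup>+z. ennreal (\<bar>W z\<bar> powr p * \<Psi> z) \<partial>lborel) = ennreal (LINT z|lborel. \<bar>W z\<bar> powr p * \<Psi> z)"
    by (rule nn_integral_eq_integral[OF iP]) (use nnP in auto)
  also have "\<dots> \<le> (\<integral>\<^sup>+z. ennreal (\<bar>W z\<bar> * D z) \<partial>lborel)"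
    by (rule order_trans[OF ennreal_leI up]) (use id e0 in linarith)
  finally show "(\<integral>\<^sup>+z. ennreal (\<bar>W z\<bar> powr p * \<Psi> z) \<partial>lborel) \<le> (\<integral>\<^sup>+z. ennreal (\<bar>W z\<bar> * D z) \<partial>lborel)" .
qed

end

section \<open>Scaled cutoffs on space-time\<close>

lemma fst_snd_line:
  "fst (z + s *\<^sub>R (1, 0 :: real^'n)) = fst z + s" "snd (z + s *\<^sub>R (1 :: real, 0 :: real^'n)) = snd z"
  "fst (z + s *\<^sub>R (0 :: real, x :: real^'n)) = fst z" "snd (z + s *\<^sub>R (0 :: real, x :: real^'n)) = snd z + s *\<^sub>R x"
  by simp_all

lemma DERIV_time_line:
  assumes "(c has_real_derivative c') (at (fst z))"
  shows "((\<lambda>s. c (fst (z + s *\<^sub>R (1, 0 :: real^'n)))) has_real_derivative c') (at 0)"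
proof -
  have "((\<lambda>s. fst (z + s *\<^sub>R (1, 0 :: real^'n))) has_real_derivative 1) (at 0)"
    unfolding fst_snd_line by (auto intro!: derivative_eq_intros)
  from DERIV_chain_line[OF assms this] show ?thesis by simp
qed

lemma cutoff_scaled_deriv:
  assumes "3 \<le> m" "0 < R"
  shows "((\<lambda>t. cutoff m (t / R)) has_real_derivative cutoff' m (t / R) / R) (at t)"
    "((\<lambda>t. cutoff' m (t / R) / R) has_real_derivative cutoff'' m (t / R) / R\<^sup>2) (at t)"
proof -
  have d: "((\<lambda>t. t / R) has_real_derivative 1 / R) (at t)" by (rule DERIV_cdivide[OF DERIV_ident])
  show "((\<lambda>t. cutoff m (t / R)) has_real_derivative cutoff' m (t / R) / R) (at t)"
    using DERIV_chain2[where f="cutoff m" and g="\<lambda>t. t / R", OF cutoff_deriv[OF assms(1)] d] by simp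
  have "((\<lambda>t. cutoff' m (t / R) / R) has_real_derivative cutoff'' m (t / R) * (1 / R) / R) (at t)"
    by (rule DERIV_cdivide[OF DERIV_chain2[where f="cutoff' m" and g="\<lambda>t. t / R", OF cutoff'_deriv[OF assms(1)] d]])
  then show "((\<lambda>t. cutoff' m (t / R) / R) has_real_derivative cutoff'' m (t / R) / R\<^sup>2) (at t)"
    by (simp add: power2_eq_square)
qed

lemma continuous_time: "continuous_on UNIV c \<Longrightarrow> continuous_on UNIV (\<lambda>z::real \<times> (real^'n). c (fst z))"
  by (rule continuous_on_compose2[of UNIV c]) (auto intro!: continuous_intros)

lemma continuous_space: "continuous_on UNIV c \<Longrightarrow> continuous_on UNIV (\<lambda>z::real \<times> (real^'n). c (snd z))"
  by (rule continuous_on_compose2[of UNIV c]) (auto intro!: continuous_intros)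

lemma cutoff_scaled_continuous:
  fixes R :: real
  assumes "0 < R"
  shows "continuous_on UNIV (\<lambda>t. cutoff m (t / R))" "continuous_on UNIV (\<lambda>t. cutoff' m (t / R))" "continuous_on UNIV (\<lambda>t. cutoff'' m (t / R))"
  using assms
  by (auto intro!: continuous_intros continuous_on_compose2[OF cutoff_continuous(1)[of UNIV]]
    continuous_on_compose2[OF cutoff_continuous(2)[of UNIV]] continuous_on_compose2[OF cutoff_continuous(3)[of UNIV]])

text \<open>The cutoff restricted to R/2 <= t <= R, where its derivatives live. Both derivatives are
  at most a constant times \<open>late\<close> to the power 1/p, so after Hoelder only this part of
  the integral of |u|^p appears. It is not continuous and is never differentiated.\<close>

definition late :: "nat \<Rightarrow> real \<Rightarrow> real \<Rightarrow> real" where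
  "late m R t = indicator {1/2..1} (t / R) * cutoff m (t / R)"

lemma late_measurable[measurable]: "late m R \<in> borel_measurable borel"
proof -
  have [measurable]: "cutoff m \<in> borel_measurable borel" by (intro borel_measurable_continuous_onI cutoff_continuous)
  show ?thesis unfolding late_def[abs_def] by measurable
qed

lemma late_range: "0 \<le> late m R t" "late m R t \<le> 1" "late m R t \<le> cutoff m (t / R)"
  using cutoff_range[of m "t / R"] by (auto simp: late_def indicator_def)

lemma late_zero: "0 < R \<Longrightarrow> t \<notin> {R / 2..R} \<Longrightarrow> late m R t = 0"
  by (auto simp: late_def indicator_def field_simps)

lemma late_powr: "0 < p \<Longrightarrow> indicator {1/2..1} (t / R) * cutoff m (t / R) powr (1 / p) = late m R t powr (1 / p)"
  by (auto simp: late_def indicator_def)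

lemma cutoff_scaled_bounds:
  fixes p R :: real
  assumes m: "3 \<le> m" "real m / p \<le> real m - 2" and p: "0 < p"
  shows "\<bar>cutoff' m (t / R)\<bar> \<le> 60 * (real m)\<^sup>2 * late m R t powr (1 / p)"
    "\<bar>cutoff'' m (t / R)\<bar> \<le> 60 * (real m)\<^sup>2 * late m R t powr (1 / p)"
  using cutoff_deriv_bounds[OF assms, of "t / R"] unfolding late_powr[OF p] .

lemma damping_continuous_radial:
  fixes \<mu> \<beta> :: real
  assumes "0 \<le> \<mu>" "2 \<le> \<beta>"
  shows "continuous_on {0..} (\<lambda>r. 1 + \<mu> / (1 + r) powr \<beta>)"
    "\<And>r. 0 \<le> r \<Longrightarrow> 0 \<le> 1 + \<mu> / (1 + r) powr \<beta>" "\<And>r. 0 \<le> r \<Longrightarrow> 1 + \<mu> / (1 + r) powr \<beta> \<le> 1 + \<mu>"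
    "\<And>r. 1 \<le> r \<Longrightarrow> 1 + \<mu> / (1 + r) powr \<beta> \<le> 1 + \<mu> / r\<^sup>2"
proof -
  show "continuous_on {0..} (\<lambda>r. 1 + \<mu> / (1 + r) powr \<beta>)"
    by (auto intro!: continuous_intros)
  show "0 \<le> 1 + \<mu> / (1 + r) powr \<beta>" for r using assms by simp
  show "1 + \<mu> / (1 + r) powr \<beta> \<le> 1 + \<mu>" if r: "0 \<le> r" for r
  proof -
    have "1 \<le> (1 + r) powr \<beta>" using assms r by (intro ge_one_powr_ge_zero) auto
    then show ?thesis using assms mult_left_mono[of 1 "(1 + r) powr \<beta>" \<mu>] by (simp add: divide_le_eq)
  qed
  show "1 + \<mu> / (1 + r) powr \<beta> \<le> 1 + \<mu> / r\<^sup>2" if r: "1 \<le> r" for r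
  proof -
    have "r powr 2 \<le> (1 + r) powr 2" using r by (intro powr_mono2) auto
    also have "\<dots> \<le> (1 + r) powr \<beta>" using r assms by (intro powr_mono) auto
    finally have "r\<^sup>2 \<le> (1 + r) powr \<beta>" using r by simp
    then show ?thesis using assms r by (intro add_left_mono divide_left_mono) (auto intro: mult_pos_pos)
  qed
qed

section \<open>The lower bound\<close>

text \<open>Since exp(-t) \<Phi> solves the adjoint damped equation exactly, the residual contains
  cutoff derivatives only. The datum term \<epsilon> times the integral of g \<Phi> is therefore
  bounded by the late part of |u|, and Hoelder with \<open>cone_exp_integral\<close> turns this into
  a lower bound for the late integral of |u|^p.\<close>

lemma lower_bound:
  fixes \<mu> \<beta> p :: real and f g :: "real^'n \<Rightarrow> real"
  assumes n: "2 \<le> CARD('n)" and k: "k = (real CARD('n) - 1) / 2" and \<mu>: "0 \<le> \<mu>" and \<beta>: "2 \<le> \<beta>" and p: "1 < p"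
    and g: "L2 g" "AE x in lborel. 1 < norm x \<longrightarrow> g x = 0" "\<not> (AE x in lborel. g x = 0)"
    and f0: "AE x in lborel. 0 \<le> f x" and g0: "AE x in lborel. 0 \<le> g x"
    and m: "3 \<le> m" "real m / p \<le> real m - 2"
  obtains c0 where "0 < c0" "\<And>\<epsilon> T u v R A. energy_supp \<mu> \<beta> p \<epsilon> T f g u v \<Longrightarrow> 0 < \<epsilon> \<Longrightarrow> 1 \<le> R \<Longrightarrow> R < T \<Longrightarrow> 0 < A \<Longrightarrow>
     (\<integral>\<^sup>+z. ennreal (\<bar>energy_supp.W T u z\<bar> powr p * late m R (fst z)) \<partial>lborel) \<le> ennreal A \<Longrightarrow>
     c0 * \<epsilon> powr p * R powr (real CARD('n) - k * p) \<le> A"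
proof -
  let ?n = "real CARD('n)"
  define p' where "p' = p / (p - 1)"
  have p': "1 < p'" "1 / p + 1 / p' = 1" using p by (auto simp: p'_def field_simps)
  obtain \<Phi> :: "real^'n \<Rightarrow> real" and P Q :: "'n \<Rightarrow> real^'n \<Rightarrow> real" and C0 :: real where
    cont: "continuous_on UNIV \<Phi>" "\<And>i. continuous_on UNIV (P i)" "\<And>i. continuous_on UNIV (Q i)" and
    d1: "\<And>i x. ((\<lambda>s. \<Phi> (x + s *\<^sub>R axis i 1)) has_real_derivative P i x) (at 0)" and
    d2: "\<And>i x. ((\<lambda>s. P i (x + s *\<^sub>R axis i 1)) has_real_derivative Q i x) (at 0)" and
    lap: "\<And>x. (\<Sum>i\<in>UNIV. Q i x) = (1 + \<mu> / (1 + norm x) powr \<beta>) * \<Phi> x" and \<Phi>1: "\<And>x. 1 \<le> \<Phi> x" and C0: "0 < C0" and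
    up: "\<And>x. \<Phi> x \<le> C0 * exp (norm x) * (1 + norm x) powr - ((?n - 1) / 2)"
  proof -
    show ?thesis
    proof (rule elliptic_solution[where 'n='n and q="\<lambda>r. 1 + \<mu> / (1 + r) powr \<beta>" and B="1 + \<mu>" and A=\<mu>], goal_cases)
      case prems: 7 show ?case by (rule that[OF prems])
    qed (use n \<mu> damping_continuous_radial[OF \<mu> \<beta>] in simp_all)
  qed
  obtain C1 where C1: "0 < C1" "\<And>R. 1 \<le> R \<Longrightarrow>
    (\<integral>\<^sup>+z. ennreal ((exp (norm (snd z) - fst z) * (1 + norm (snd z)) powr - k) powr p') *
       indicator {z. fst z \<in> {R / 2..R} \<and> norm (snd z) \<le> fst z + 1} z \<partial>(lborel :: (real \<times> (real^'n)) measure))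
    \<le> ennreal (C1 * R powr (?n - k * p'))"
    by (rule cone_exp_integral[OF n k p'(1)]) blast
  define I where "I = (LINT x|lborel. g x * \<Phi> x)"
  have gm[measurable]: "g \<in> borel_measurable borel" using g(1) by (simp add: L2_def)
  have \<Phi>m[measurable]: "\<Phi> \<in> borel_measurable borel" using cont by (intro borel_measurable_continuous_onI)
  have intg: "integrable lborel (\<lambda>x. g x * \<Phi> x)"
  proof -
    have "compact (\<Phi> ` cball 0 1)" by (intro compact_continuous_image continuous_on_subset[OF cont(1)]) auto
    then obtain M where M: "\<And>x. x \<in> cball 0 1 \<Longrightarrow> \<bar>\<Phi> x\<bar> \<le> M" using compact_imp_bounded bounded_real by (metis image_eqI)
    have M0: "0 \<le> M" using M[of 0] by simp
    have "integrable lborel (\<lambda>x. g x * (\<Phi> x * indicator (cball 0 1) x))"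
    proof (rule L2_local(1)[OF g(1), where B=M and M=1])
      show "\<bar>\<Phi> x * indicator (cball 0 1) x\<bar> \<le> M * indicator (cball 0 1) x" for x using M[of x] by (auto simp: indicator_def)
      show "(\<lambda>x. \<Phi> x * indicator (cball 0 1) x) \<in> borel_measurable borel"
        by (intro borel_measurable_times borel_measurable_indicator \<Phi>m) auto
    qed (rule M0)
    then show ?thesis
    proof (rule Bochner_Integration.integrable_cong_AE_imp)
      show "AE x in lborel. g x * (\<Phi> x * indicator (cball 0 1) x) = g x * \<Phi> x"
        using g(2) by eventually_elim (auto simp: indicator_def)
    qed measurable
  qed
  have I: "0 < I"
  proof (rule ccontr)
    have nn: "AE x in lborel. 0 \<le> g x * \<Phi> x" using g0
    proof eventually_elim
      case (elim x)
      then show ?case using \<Phi>1[of x] by simp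
    qed
    assume "\<not> 0 < I"
    moreover have "0 \<le> I" unfolding I_def by (rule integral_nonneg_AE[OF nn])
    ultimately have "I = 0" by simp
    then have "AE x in lborel. g x * \<Phi> x = 0" unfolding I_def using integral_nonneg_eq_0_iff_AE[OF intg nn] by simp
    then have "AE x in lborel. g x = 0"
    proof eventually_elim
      case (elim x)
      then show ?case using \<Phi>1[of x] by simp
    qed
    then show False using g(3) by simp
  qed
  \<comment> \<open>The residual is \<eta>'' - 2 \<eta>' - a \<eta>' times exp(-t) \<Phi>, with 0 <=
    a <= \<mu>; this explains 3 + \<mu>.\<close>
  define K0 where "K0 = 60 * (real m)\<^sup>2 * (3 + \<mu>)"
  have K0: "0 < K0" using m \<mu> by (simp add: K0_def)
  define M where "M = C0 powr p' * C1"
  have M: "0 < M" using C0 C1 by (simp add: M_def)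
  \<comment> \<open>Obtained by solving \<epsilon> I <= (K0/R) A^(1/p) B^(1/p') for A, with B = M
    R^(n-kp').\<close>
  define c0 where "c0 = I powr p / (K0 powr p * M powr (p - 1))"
  show thesis
  proof (rule that[of c0])
    show "0 < c0" using I K0 M by (simp add: c0_def)
    fix \<epsilon> T R A :: real and u v :: "real \<Rightarrow> real^'n \<Rightarrow> real"
    assume es: "energy_supp \<mu> \<beta> p \<epsilon> T f g u v" and \<epsilon>: "0 < \<epsilon>" and R: "1 \<le> R" "R < T" and A: "0 < A"
      and le: "(\<integral>\<^sup>+z. ennreal (\<bar>energy_supp.W T u z\<bar> powr p * late m R (fst z)) \<partial>lborel) \<le> ennreal A"
    note p1 = p and Kb = C1(2)
    interpret energy_supp \<mu> \<beta> p \<epsilon> T f g u v by (rule es)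
    have R0: "0 < R" using R by simp
    define \<eta> where "\<eta> z = cutoff m (fst z / R)" for z :: "real \<times> (real^'n)"
    define \<eta>1 where "\<eta>1 z = cutoff' m (fst z / R) / R" for z :: "real \<times> (real^'n)"
    define \<eta>2 where "\<eta>2 z = cutoff'' m (fst z / R) / R\<^sup>2" for z :: "real \<times> (real^'n)"
    define E where "E z = exp (- fst z)" for z :: "real \<times> (real^'n)"
    define F where "F z = \<Phi> (snd z)" for z :: "real \<times> (real^'n)"
    have ceta: "continuous_on UNIV \<eta>" "continuous_on UNIV \<eta>1" "continuous_on UNIV \<eta>2" "continuous_on UNIV E" "continuous_on UNIV F"
      unfolding \<eta>_def[abs_def] \<eta>1_def[abs_def] \<eta>2_def[abs_def] E_def[abs_def] F_def[abs_def]
      using R0 by (auto intro!: continuous_intros continuous_time[OF cutoff_scaled_continuous(1)] continuous_time[OF cutoff_scaled_continuous(2)]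
        continuous_time[OF cutoff_scaled_continuous(3)] continuous_space cont)
    have d\<eta>: "((\<lambda>s. \<eta> (z + s *\<^sub>R (1, 0))) has_real_derivative \<eta>1 z) (at 0)" "((\<lambda>s. \<eta>1 (z + s *\<^sub>R (1, 0))) has_real_derivative \<eta>2 z) (at 0)" for z
      unfolding \<eta>_def \<eta>1_def \<eta>2_def by (intro DERIV_time_line cutoff_scaled_deriv m R0)+
    have dE: "((\<lambda>s. E (z + s *\<^sub>R (1, 0))) has_real_derivative - E z) (at 0)" for z
      unfolding E_def by (rule DERIV_time_line) (auto intro!: derivative_eq_intros)
    have F0: "F (z + s *\<^sub>R (1, 0)) = F z" "\<eta> (z + s *\<^sub>R (0, x)) = \<eta> z" "E (z + s *\<^sub>R (0, x)) = E z" for z s x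
      unfolding F_def \<eta>_def E_def fst_snd_line by simp_all
    let ?\<Psi> = "\<lambda>z. \<eta> z * E z * F z" and ?Pt = "\<lambda>z. (\<eta>1 z - \<eta> z) * E z * F z" and ?Ptt = "\<lambda>z. (\<eta>2 z - 2 * \<eta>1 z + \<eta> z) * E z * F z"
      and ?P = "\<lambda>i z. \<eta> z * E z * P i (snd z)" and ?Q = "\<lambda>i z. \<eta> z * E z * Q i (snd z)"
    let ?D = "\<lambda>z. K0 / R * late m R (fst z) powr (1 / p) * E z * F z"
    have ge: "1 \<le> F z" "0 < E z" for z by (auto simp: F_def E_def \<Phi>1)
    then have EF: "0 \<le> E z * F z" for z by (meson less_imp_le mult_nonneg_nonneg order_trans zero_le_one)
    have Dpos: "0 \<le> ?D z" for z
    proof -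
      have "?D z = (K0 / R * late m R (fst z) powr (1 / p)) * (E z * F z)" by simp
      also have "0 \<le> \<dots>" using K0 R0 by (intro mult_nonneg_nonneg EF) auto
      finally show ?thesis .
    qed
    have main: "ennreal (\<epsilon> * (LINT x|lborel. g x * ?\<Psi> (0, x))) \<le> (\<integral>\<^sup>+z. ennreal (\<bar>W z\<bar> * ?D z) \<partial>lborel)"
    proof (rule energy_bound(1)[where P="?P" and Q="?Q" and Pt="?Pt" and Ptt="?Ptt" and ?T1.0=R])
      show "continuous_on UNIV ?\<Psi>" "continuous_on UNIV ?Pt" "continuous_on UNIV ?Ptt" "continuous_on UNIV (?P i)" "continuous_on UNIV (?Q i)" for i
        by (intro continuous_intros ceta continuous_space cont)+
      show "((\<lambda>s. ?\<Psi> (z + s *\<^sub>R (1, 0))) has_real_derivative ?Pt z) (at 0)" for z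
        unfolding F0 by (rule DERIV_cong[OF DERIV_cmult_right[OF DERIV_mult_line[OF d\<eta>(1) dE]]]) (simp add: algebra_simps)
      show "((\<lambda>s. ?Pt (z + s *\<^sub>R (1, 0))) has_real_derivative ?Ptt z) (at 0)" for z
        unfolding F0 by (rule DERIV_cong[OF DERIV_cmult_right[OF DERIV_mult_line[where F="\<lambda>z. \<eta>1 z - \<eta> z", OF DERIV_diff[OF d\<eta>(2) d\<eta>(1)] dE]]]) (simp add: algebra_simps)
      show "((\<lambda>s. ?\<Psi> (z + s *\<^sub>R (0, axis i 1))) has_real_derivative ?P i z) (at 0)" for z i
        unfolding F0 F_def fst_snd_line by (intro DERIV_cmult d1)
      show "((\<lambda>s. ?P i (z + s *\<^sub>R (0, axis i 1))) has_real_derivative ?Q i z) (at 0)" for z i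
        unfolding F0 fst_snd_line by (intro DERIV_cmult d2)
      have l: "\<eta> z = 0" "\<eta>1 z = 0" "\<eta>2 z = 0" if "R \<le> fst z" for z
        using that R0 cutoff_ge_1[OF m(1), of "fst z / R"] by (auto simp: \<eta>_def \<eta>1_def \<eta>2_def)
      show "?\<Psi> z = 0" if "R \<le> fst z" for z using l[OF that] by simp
      show "?Pt z = 0 \<and> ?Ptt z = 0 \<and> (\<forall>i. ?Q i z = 0)" if "R < fst z" for z using l[of z] that by simp
      have nonneg: "0 \<le> ?\<Psi> z" for z
        using mult_nonneg_nonneg[OF cutoff_range(1)[of m "fst z / R"] EF[of z]] by (simp add: \<eta>_def mult.assoc)
      show "0 \<le> ?\<Psi> (0, x)" for x by (rule nonneg)
      show "0 \<le> ?\<Psi> z" for z by (rule nonneg)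
      show "?Pt (0, x) \<le> 0" for x
        using mult_nonneg_nonneg[OF cutoff_range(1)[of m 0] EF[of "(0, x)"]] by (simp add: \<eta>_def \<eta>1_def cutoff_le_half(2) mult.assoc)
      show "\<bar>?Ptt z - (\<Sum>i\<in>UNIV. ?Q i z) - a (snd z) * ?Pt z\<bar> \<le> ?D z" for z
      proof -
        let ?l = "late m R (fst z) powr (1 / p)"
        have S: "(\<Sum>i\<in>UNIV. ?Q i z) = \<eta> z * E z * ((1 + a (snd z)) * F z)"
          using lap[of "snd z"] by (simp add: sum_distrib_left[symmetric] F_def damping_def)
        \<comment> \<open>The undifferentiated cutoff terms cancel: 1 - (1 + a) + a = 0.\<close>
        have "?Ptt z - (\<Sum>i\<in>UNIV. ?Q i z) - a (snd z) * ?Pt z = (\<eta>2 z - 2 * \<eta>1 z - a (snd z) * \<eta>1 z) * (E z * F z)"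
          unfolding S by (simp add: algebra_simps)
        then have "\<bar>?Ptt z - (\<Sum>i\<in>UNIV. ?Q i z) - a (snd z) * ?Pt z\<bar> = \<bar>\<eta>2 z - 2 * \<eta>1 z - a (snd z) * \<eta>1 z\<bar> * (E z * F z)"
          using EF[of z] by (simp only: abs_mult[of _ "E z * F z"] abs_of_nonneg[OF EF])
        also have "\<dots> \<le> (K0 / R * ?l) * (E z * F z)"
        proof (rule mult_right_mono[OF _ EF])
          let ?c = "60 * (real m)\<^sup>2 * ?l / R"
          have p0: "0 < p" using p by simp
          have c0: "0 \<le> ?c" using R0 by simp
          have 1: "\<bar>\<eta>1 z\<bar> \<le> ?c" unfolding \<eta>1_def abs_divide using R0 cutoff_scaled_bounds(1)[OF m p0, of "fst z" R]
            by (simp add: divide_right_mono)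
          have 2: "\<bar>\<eta>2 z\<bar> \<le> ?c"
          proof -
            have "\<bar>\<eta>2 z\<bar> = \<bar>cutoff'' m (fst z / R)\<bar> / R\<^sup>2" by (simp add: \<eta>2_def)
            also have "\<dots> \<le> 60 * (real m)\<^sup>2 * ?l / R\<^sup>2" by (intro divide_right_mono cutoff_scaled_bounds[OF m p0]) auto
            also have "\<dots> \<le> ?c" using R R0 self_le_power[of R 2] by (intro divide_left_mono) auto
            finally show ?thesis .
          qed
          have 3: "\<bar>a (snd z) * \<eta>1 z\<bar> \<le> \<mu> * ?c" unfolding abs_mult
          proof (rule mult_mono[OF _ 1])
            show "\<bar>a (snd z)\<bar> \<le> \<mu>" using damping_bounds(1,2)[of \<mu> \<beta> "snd z"] \<mu> \<beta> by auto
          qed (use \<mu> in auto)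
          have "\<bar>\<eta>2 z - 2 * \<eta>1 z - a (snd z) * \<eta>1 z\<bar> \<le> ?c + 2 * ?c + \<mu> * ?c" using 1 2 3 by linarith
          also have "\<dots> = K0 / R * ?l" by (simp add: K0_def algebra_simps add_divide_distrib)
          finally show "\<bar>\<eta>2 z - 2 * \<eta>1 z - a (snd z) * \<eta>1 z\<bar> \<le> K0 / R * ?l" .
        qed
        finally show ?thesis by (simp add: mult.assoc)
      qed
    qed (use R \<epsilon> f0 g0 Dpos in auto)
    have "(LINT x|lborel. g x * ?\<Psi> (0, x)) = I" unfolding I_def
      by (simp add: \<eta>_def E_def F_def cutoff_le_half(1))
    then have main: "ennreal (\<epsilon> * I) \<le> (\<integral>\<^sup>+z. ennreal (\<bar>W z\<bar> * ?D z) \<partial>lborel)" using main by simp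
    let ?cone = "{z :: real \<times> (real^'n). fst z \<in> {R / 2..R} \<and> norm (snd z) \<le> fst z + 1}"
    let ?e = "\<lambda>z :: real \<times> (real^'n). exp (norm (snd z) - fst z) * (1 + norm (snd z)) powr - k"
    have "closed ?cone" by (auto intro!: closed_Collect_conj closed_Collect_le continuous_intros)
    then have [measurable]: "?cone \<in> sets borel" by (rule borel_closed)
    define F1 where "F1 z = \<bar>W z\<bar> * late m R (fst z) powr (1 / p)" for z
    define G1 where "G1 z = C0 * ?e z * indicator ?cone z" for z
    have [measurable]: "G1 \<in> borel_measurable borel" "F1 \<in> borel_measurable borel"
      unfolding G1_def[abs_def] F1_def[abs_def] by measurable
    define B where "B = M * R powr (?n - k * p')"
    have B: "0 < B" using M R0 by (simp add: B_def)
    have "(\<integral>\<^sup>+z. ennreal (\<bar>W z\<bar> * ?D z) \<partial>lborel) \<le> (\<integral>\<^sup>+z. ennreal (K0 / R) * ennreal (F1 z * G1 z) \<partial>lborel)"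
    proof (rule nn_integral_mono)
      fix z
      have "\<bar>W z\<bar> * ?D z \<le> K0 / R * (F1 z * G1 z)"
      proof (cases "W z = 0 \<or> late m R (fst z) = 0")
        case True
        then show ?thesis by (auto simp: F1_def)
      next
        case False
        then have c: "z \<in> ?cone" using W_nonzeroD[of z] late_zero[OF R0, of "fst z" m] by auto
        have "E z * F z \<le> E z * (C0 * exp (norm (snd z)) * (1 + norm (snd z)) powr - k)"
          using up[of "snd z"] ge(2)[of z] by (intro mult_left_mono) (auto simp: F_def k)
        also have "\<dots> = C0 * ?e z" by (simp add: E_def exp_diff exp_minus field_simps)
        finally have "E z * F z \<le> G1 z" using c by (simp add: G1_def)
        then have "(K0 / R * F1 z) * (E z * F z) \<le> (K0 / R * F1 z) * G1 z" using K0 R0 by (intro mult_left_mono) (auto simp: F1_def)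
        then show ?thesis by (simp add: F1_def mult_ac)
      qed
      then show "ennreal (\<bar>W z\<bar> * ?D z) \<le> ennreal (K0 / R) * ennreal (F1 z * G1 z)"
        using K0 R0 by (subst ennreal_mult'[symmetric]) (auto intro: ennreal_leI)
    qed
    also have "\<dots> = ennreal (K0 / R) * (\<integral>\<^sup>+z. ennreal (F1 z * G1 z) \<partial>lborel)" by (rule nn_integral_cmult) measurable
    also have "\<dots> \<le> ennreal (K0 / R) * ennreal (A powr (1 / p) * B powr (1 / p'))"
    proof (rule mult_left_mono)
      show "(\<integral>\<^sup>+z. ennreal (F1 z * G1 z) \<partial>lborel) \<le> ennreal (A powr (1 / p) * B powr (1 / p'))"
      proof (rule nn_holder[OF p1 p'])
        have "F1 z powr p = \<bar>W z\<bar> powr p * late m R (fst z)" for z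
          using p late_range(1)[of m R "fst z"] by (simp add: F1_def powr_mult powr_powr)
        then show "(\<integral>\<^sup>+z. ennreal (F1 z powr p) \<partial>lborel) \<le> ennreal A" using le by simp
        have "(\<integral>\<^sup>+z. ennreal (G1 z powr p') \<partial>lborel) = (\<integral>\<^sup>+z. ennreal (C0 powr p') * (ennreal (?e z powr p') * indicator ?cone z) \<partial>lborel)"
          using C0 by (intro nn_integral_cong) (auto simp: G1_def indicator_def powr_mult ennreal_mult')
        also have "\<dots> = ennreal (C0 powr p') * (\<integral>\<^sup>+z. (ennreal (?e z powr p') * indicator ?cone z) \<partial>lborel)" by (rule nn_integral_cmult) measurable
        also have "\<dots> \<le> ennreal (C0 powr p') * ennreal (C1 * R powr (?n - k * p'))" by (rule mult_left_mono[OF Kb[OF R(1)]]) simp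
        also have "\<dots> = ennreal B" by (simp add: ennreal_mult'[symmetric] B_def M_def mult.assoc)
        finally show "(\<integral>\<^sup>+z. ennreal (G1 z powr p') \<partial>lborel) \<le> ennreal B" .
      qed (use A B C0 in \<open>auto simp: F1_def G1_def\<close>)
    qed simp
    also have "\<dots> = ennreal (K0 / R * (A powr (1 / p) * B powr (1 / p')))" using K0 R0 by (simp add: ennreal_mult'[symmetric])
    finally have "ennreal (\<epsilon> * I) \<le> ennreal (K0 / R * (A powr (1 / p) * B powr (1 / p')))" using main by (rule order_trans[rotated])
    then have "\<epsilon> * I \<le> K0 / R * (A powr (1 / p) * B powr (1 / p'))" using K0 R0 A B by (subst (asm) ennreal_le_iff) auto
    then have "(\<epsilon> * I) powr p \<le> (K0 / R * (A powr (1 / p) * B powr (1 / p'))) powr p" using \<epsilon> I p1 by (intro powr_mono2) auto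
    also have "\<dots> = K0 powr p * R powr - p * (A * B powr (p - 1))"
    proof -
      have "p / p' = p - 1" using p1 by (simp add: p'_def)
      then show ?thesis using K0 R0 A B p1 by (simp add: powr_mult powr_divide powr_powr powr_minus_divide)
    qed
    also have "B powr (p - 1) = M powr (p - 1) * R powr ((?n - k * p') * (p - 1))" using M R0 by (simp add: B_def powr_mult powr_powr)
    also have "K0 powr p * R powr - p * (A * (M powr (p - 1) * R powr ((?n - k * p') * (p - 1)))) = K0 powr p * M powr (p - 1) * A * (R powr - p * R powr ((?n - k * p') * (p - 1)))"
      by (simp only: mult_ac)
    \<comment> \<open>The exponents collapse by p'(p - 1) = p and 2k = n - 1.\<close>
    also have "R powr - p * R powr ((?n - k * p') * (p - 1)) = R powr - (?n - k * p)"
    proof -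
      have "p' * (p - 1) = p" using p1 by (simp add: p'_def)
      then have "(?n - k * p') * (p - 1) = ?n * (p - 1) - k * p" by (simp add: left_diff_distrib mult.assoc)
      moreover have "2 * (k * p) = (?n - 1) * p" by (simp add: k)
      ultimately have "- p + (?n - k * p') * (p - 1) = - (?n - k * p)" by (simp add: algebra_simps)
      then show ?thesis by (simp only: powr_add[symmetric])
    qed
    finally have "\<epsilon> powr p * I powr p \<le> K0 powr p * M powr (p - 1) * A * R powr - (?n - k * p)" using \<epsilon> I by (simp add: powr_mult)
    then have "\<epsilon> powr p * I powr p * R powr (?n - k * p) \<le> K0 powr p * M powr (p - 1) * A * R powr - (?n - k * p) * R powr (?n - k * p)"
      by (intro mult_right_mono) auto
    also have "\<dots> = K0 powr p * M powr (p - 1) * A * (R powr - (?n - k * p) * R powr (?n - k * p))" by (simp only: mult.assoc)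
    also have "R powr - (?n - k * p) * R powr (?n - k * p) = 1" using R0 by (simp add: powr_add[symmetric])
    finally show "c0 * \<epsilon> powr p * R powr (?n - k * p) \<le> A"
      using K0 M by (simp add: c0_def pos_divide_le_eq mult_ac)
  qed
qed

section \<open>The upper bound\<close>

text \<open>
  Equal to $t + t_0$ for $t \ge 0$, but positive for all $t$, so that its powers are smooth enough on the
  whole line.
\<close>

definition shifted_time :: "real \<Rightarrow> real \<Rightarrow> real" where
  "shifted_time t0 t = t0 + t + max 0 (- t) ^ 3"

definition shifted_time' :: "real \<Rightarrow> real" where
  "shifted_time' t = 1 - 3 * max 0 (- t) ^ 2"

definition shifted_time'' :: "real \<Rightarrow> real" where
  "shifted_time'' t = 6 * max 0 (- t)"

lemma shifted_time_pos: "2 \<le> t0 \<Longrightarrow> 0 < shifted_time t0 t"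
proof -
  assume t0: "2 \<le> t0"
  define y where "y = max 0 (- t)"
  have y: "0 \<le> y" "- y \<le> t" by (auto simp: y_def)
  have "y \<le> 1 + y ^ 3"
  proof (cases "y \<le> 1")
    case True
    then show ?thesis using y zero_le_power[of y 3] by linarith
  next
    case False
    then show ?thesis using self_le_power[of y 3] by simp
  qed
  then show "0 < shifted_time t0 t" using t0 y by (simp add: shifted_time_def y_def[symmetric])
qed

lemma shifted_time_nonneg:
  assumes "0 \<le> t"
  shows "shifted_time t0 t = t + t0" "shifted_time' t = 1" "shifted_time'' t = 0"
  using assms by (simp_all add: shifted_time_def shifted_time'_def shifted_time''_def)

lemma shifted_time_deriv:
  "(shifted_time t0 has_real_derivative shifted_time' t) (at t)"
  "(shifted_time' has_real_derivative shifted_time'' t) (at t)"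
proof -
  have m: "((\<lambda>t. - t) has_real_derivative - 1) (at t)" by (auto intro!: derivative_eq_intros)
  have d: "((\<lambda>t. max 0 (- t) ^ 3) has_real_derivative - 3 * max 0 (- t) ^ 2) (at t)"
    by (rule DERIV_cong[OF DERIV_max0_power_chain[OF _ m, of 3]]) simp_all
  show "(shifted_time t0 has_real_derivative shifted_time' t) (at t)"
    unfolding shifted_time_def[abs_def] shifted_time'_def
    by (rule DERIV_cong[OF DERIV_add[OF DERIV_add[OF DERIV_const DERIV_ident] d]]) simp
  have d: "((\<lambda>t. max 0 (- t) ^ 2) has_real_derivative - 2 * max 0 (- t)) (at t)"
    by (rule DERIV_cong[OF DERIV_max0_power_chain[OF _ m, of 2]]) simp_all
  show "(shifted_time' has_real_derivative shifted_time'' t) (at t)"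
    unfolding shifted_time'_def[abs_def] shifted_time''_def
    by (rule DERIV_cong[OF DERIV_diff[OF DERIV_const DERIV_cmult[OF d]]]) simp
qed

lemma shifted_time_continuous:
  "continuous_on UNIV (shifted_time t0)" "continuous_on UNIV shifted_time'" "continuous_on UNIV shifted_time''"
  unfolding shifted_time_def[abs_def] shifted_time'_def[abs_def] shifted_time''_def[abs_def]
  by (intro continuous_intros)+

lemma square_norm_power_deriv:
  fixes z :: "real \<times> (real^'n)"
  shows "((\<lambda>s. (snd (z + s *\<^sub>R (0, axis i 1)) \<bullet> snd (z + s *\<^sub>R (0, axis i 1))) ^ j) has_real_derivative
      real j * (snd z \<bullet> snd z) ^ (j - 1) * (2 * snd z $ i)) (at 0)"
    "((\<lambda>s. real j * (snd (z + s *\<^sub>R (0, axis i 1)) \<bullet> snd (z + s *\<^sub>R (0, axis i 1))) ^ (j - 1) * (2 * snd (z + s *\<^sub>R (0, axis i 1)) $ i)) has_real_derivative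
      real j * (real (j - 1) * (snd z \<bullet> snd z) ^ (j - 2) * (4 * (snd z $ i)\<^sup>2) + 2 * (snd z \<bullet> snd z) ^ (j - 1))) (at 0)"
proof -
  have e: "snd (z + s *\<^sub>R (0, axis i 1)) \<bullet> snd (z + s *\<^sub>R (0, axis i 1)) = snd z \<bullet> snd z + 2 * s * (snd z $ i) + s * s"
    "snd (z + s *\<^sub>R (0, axis i 1)) $ i = snd z $ i + s" for s
    by (simp_all add: inner_add inner_axis inner_axis' algebra_simps)
  have d: "((\<lambda>s. (snd z \<bullet> snd z + 2 * s * (snd z $ i) + s * s) ^ j) has_real_derivative real j * (snd z \<bullet> snd z) ^ (j - 1) * (2 * snd z $ i)) (at 0)" for j
    by (auto intro!: derivative_eq_intros)
  show "((\<lambda>s. (snd (z + s *\<^sub>R (0, axis i 1)) \<bullet> snd (z + s *\<^sub>R (0, axis i 1))) ^ j) has_real_derivative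
      real j * (snd z \<bullet> snd z) ^ (j - 1) * (2 * snd z $ i)) (at 0)"
    unfolding e by (rule d)
  have l: "((\<lambda>s. 2 * (snd z $ i + s)) has_real_derivative 2) (at 0)" by (auto intro!: derivative_eq_intros)
  have j: "j - Suc (Suc 0) = j - 2" by simp
  show "((\<lambda>s. real j * (snd (z + s *\<^sub>R (0, axis i 1)) \<bullet> snd (z + s *\<^sub>R (0, axis i 1))) ^ (j - 1) * (2 * snd (z + s *\<^sub>R (0, axis i 1)) $ i)) has_real_derivative
      real j * (real (j - 1) * (snd z \<bullet> snd z) ^ (j - 2) * (4 * (snd z $ i)\<^sup>2) + 2 * (snd z \<bullet> snd z) ^ (j - 1))) (at 0)"
    unfolding e mult.assoc[of "real j"]
    by (rule DERIV_cong[OF DERIV_cmult[OF DERIV_mult[OF d l]]]) (simp add: j power2_eq_square algebra_simps)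
qed

text \<open>The recursion for \<open>cf\<close> makes the Laplacian of the term j + 1 cancel the
  second time derivative of the term j. Only the time derivative of the last term is left
  over.\<close>

lemma cf_wave_telescope:
  fixes b s \<rho> :: real and n :: nat
  assumes n: "0 < n" and b: "0 < b"
  shows "(\<Sum>j\<le>N. cf b n j * ((b + 2 * real j) * (b + 2 * real j + 1) * s powr (- b - 2 * real j - 2)) * \<rho> ^ j)
    - (\<Sum>j\<le>N. cf b n j * s powr (- b - 2 * real j) * (real j * (2 * (real n + 2 * real (j - 1)) * \<rho> ^ (j - 1))))
    = cf b n N * ((b + 2 * real N) * (b + 2 * real N + 1) * s powr (- b - 2 * real N - 2)) * \<rho> ^ N"
proof (induction N)
  case (Suc N)
  define X where "X = (b + 2 * real N) * (b + 2 * real N + 1)"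
  define Y where "Y = (2 * real N + 2) * (2 * real N + real n)"
  have Y: "Y \<noteq> 0" using n by (simp add: Y_def)
  have c: "cf b n (Suc N) = cf b n N * X / Y" by (simp add: X_def Y_def mult_ac)
  have e: "- b - 2 * real (Suc N) = - b - 2 * real N - 2" by simp
  have "cf b n (Suc N) * s powr (- b - 2 * real (Suc N)) * (real (Suc N) * (2 * (real n + 2 * real (Suc N - 1)) * \<rho> ^ (Suc N - 1)))
    = cf b n (Suc N) * Y * s powr (- b - 2 * real N - 2) * \<rho> ^ N"
    unfolding e by (simp add: Y_def algebra_simps)
  also have "cf b n (Suc N) * Y = cf b n N * X" unfolding c using Y by simp
  finally show ?case unfolding sum.atMost_Suc using Suc by (simp add: X_def algebra_simps del: cf.simps)
qed simp

text \<open>A partial sum needs no termwise differentiation of a series, at the price of a single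
  explicit residual term. For t < 0 the time is bent by \<open>shifted_time\<close>, so the function
  is defined on all of space-time; the explicit formulas are claimed for t >= 0 only.\<close>

lemma wave_test_function:
  fixes b t0 :: real
  assumes b: "0 < b" and t0: "2 \<le> t0"
  obtains \<Phi> Pt Ptt :: "real \<times> (real^'n) \<Rightarrow> real" and P Q :: "'n \<Rightarrow> real \<times> (real^'n) \<Rightarrow> real" where
    "continuous_on UNIV \<Phi>" "continuous_on UNIV Pt" "continuous_on UNIV Ptt" "\<And>i. continuous_on UNIV (P i)" "\<And>i. continuous_on UNIV (Q i)"
    "\<And>z. ((\<lambda>s. \<Phi> (z + s *\<^sub>R (1, 0))) has_real_derivative Pt z) (at 0)"
    "\<And>z. ((\<lambda>s. Pt (z + s *\<^sub>R (1, 0))) has_real_derivative Ptt z) (at 0)"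
    "\<And>i z. ((\<lambda>s. \<Phi> (z + s *\<^sub>R (0, axis i 1))) has_real_derivative P i z) (at 0)"
    "\<And>i z. ((\<lambda>s. P i (z + s *\<^sub>R (0, axis i 1))) has_real_derivative Q i z) (at 0)"
    "\<And>z. 0 \<le> \<Phi> z"
    "\<And>z. 0 \<le> fst z \<Longrightarrow> \<Phi> z = (\<Sum>j\<le>N. cf b CARD('n) j * (fst z + t0) powr (- b - 2 * real j) * (snd z \<bullet> snd z) ^ j)"
    "\<And>z. 0 \<le> fst z \<Longrightarrow> Pt z = - (\<Sum>j\<le>N. (b + 2 * real j) * cf b CARD('n) j * (fst z + t0) powr (- b - 2 * real j - 1) * (snd z \<bullet> snd z) ^ j)"
    "\<And>z. 0 \<le> fst z \<Longrightarrow> Ptt z - (\<Sum>i\<in>UNIV. Q i z) =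
       cf b CARD('n) N * ((b + 2 * real N) * (b + 2 * real N + 1) * (fst z + t0) powr (- b - 2 * real N - 2)) * (snd z \<bullet> snd z) ^ N"
proof -
  let ?n = "CARD('n)"
  define e where "e j = - b - 2 * real j" for j
  define A where "A j t = cf b ?n j * shifted_time t0 t powr e j" for j t
  define A1 where "A1 j t = cf b ?n j * (e j * shifted_time t0 t powr (e j - 1) * shifted_time' t)" for j t
  define A2 where "A2 j t = cf b ?n j * (e j * ((e j - 1) * shifted_time t0 t powr (e j - 2) * (shifted_time' t)\<^sup>2
    + shifted_time t0 t powr (e j - 1) * shifted_time'' t))" for j t
  note pos = shifted_time_pos[OF t0]
  have dp: "((\<lambda>t. shifted_time t0 t powr q) has_real_derivative q * shifted_time t0 t powr (q - 1) * shifted_time' t) (at t)" for q t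
    by (rule DERIV_cong[OF DERIV_chain2[where f="\<lambda>x. x powr q", OF has_real_derivative_powr[OF pos] shifted_time_deriv(1)]]) simp
  have dA: "(A j has_real_derivative A1 j t) (at t)" for j t
    unfolding A_def[abs_def] A1_def by (rule DERIV_cmult[OF dp])
  have e2: "e j - 1 - 1 = e j - 2" for j by simp
  have dA1: "(A1 j has_real_derivative A2 j t) (at t)" for j t
    unfolding A1_def[abs_def] A2_def mult.assoc[of "e j"]
    by (rule DERIV_cong[OF DERIV_cmult[OF DERIV_cmult[OF DERIV_mult[OF dp shifted_time_deriv(2)]]]]) (simp add: e2 power2_eq_square algebra_simps)
  have cp: "continuous_on UNIV (\<lambda>t. shifted_time t0 t powr q)" for q
    using pos by (intro continuous_on_powr' shifted_time_continuous continuous_on_const) (auto simp: less_imp_neq[OF pos, THEN not_sym] less_imp_le[OF pos])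
  have cA: "continuous_on UNIV (A j)" "continuous_on UNIV (A1 j)" "continuous_on UNIV (A2 j)" for j
    unfolding A_def[abs_def] A1_def[abs_def] A2_def[abs_def] by (intro continuous_intros cp shifted_time_continuous)+
  define \<rho> where "\<rho> z = snd z \<bullet> snd z" for z :: "real \<times> (real^'n)"
  define S1 where "S1 i j z = real j * \<rho> z ^ (j - 1) * (2 * snd z $ i)" for i j and z :: "real \<times> (real^'n)"
  define S2 where "S2 i j z = real j * (real (j - 1) * \<rho> z ^ (j - 2) * (4 * (snd z $ i)\<^sup>2) + 2 * \<rho> z ^ (j - 1))" for i j and z :: "real \<times> (real^'n)"
  have c\<rho>: "continuous_on UNIV \<rho>" unfolding \<rho>_def[abs_def] by (intro continuous_intros)
  have cS: "continuous_on UNIV (S1 i j)" "continuous_on UNIV (S2 i j)" for i j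
    unfolding S1_def[abs_def] S2_def[abs_def] by (intro continuous_intros c\<rho>)+
  have d\<rho>: "((\<lambda>s. \<rho> (z + s *\<^sub>R (0, axis i 1)) ^ j) has_real_derivative S1 i j z) (at 0)"
    and dS1: "((\<lambda>s. S1 i j (z + s *\<^sub>R (0, axis i 1))) has_real_derivative S2 i j z) (at 0)" for z i j
    unfolding \<rho>_def S1_def S2_def by (rule square_norm_power_deriv)+
  have inv: "fst (z + s *\<^sub>R (0, x)) = fst z" "\<rho> (z + s *\<^sub>R (1, 0)) = \<rho> z" for z s x
    unfolding \<rho>_def fst_snd_line by simp_all
  \<comment> \<open>The Laplacian of |x|^(2j) is 2j (n + 2(j - 1)) |x|^(2(j-1)).\<close>
  have sumQ: "(\<Sum>i\<in>UNIV. S2 i j z) = real j * (2 * (real ?n + 2 * real (j - 1)) * \<rho> z ^ (j - 1))" for j z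
  proof (cases "j \<le> 1")
    case True
    then consider "j = 0" | "j = 1" by linarith
    then show ?thesis by cases (simp_all add: S2_def)
  next
    case False
    then obtain l where l: "j = Suc (Suc l)" by (metis One_nat_def le_SucI not_less_eq_eq old.nat.exhaust zero_le)
    have "(\<Sum>i\<in>UNIV. (snd z $ i)\<^sup>2) = \<rho> z" by (simp add: \<rho>_def inner_vec_def power2_eq_square)
    then have "(\<Sum>i\<in>UNIV. S2 i j z) = real j * (real (j - 1) * \<rho> z ^ (j - 2) * (4 * \<rho> z) + real ?n * (2 * \<rho> z ^ (j - 1)))"
      by (simp add: S2_def sum.distrib sum_distrib_left[symmetric])
    also have "\<rho> z ^ (j - 2) * (4 * \<rho> z) = 4 * \<rho> z ^ (j - 1)" by (simp add: l)
    then have "real (j - 1) * \<rho> z ^ (j - 2) * (4 * \<rho> z) = real (j - 1) * (4 * \<rho> z ^ (j - 1))" by (simp only: mult.assoc)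
    finally show ?thesis by (simp add: algebra_simps)
  qed
  have st: "shifted_time t0 (fst z) = fst z + t0" "shifted_time' (fst z) = 1" "shifted_time'' (fst z) = 0" if "0 \<le> fst z" for z :: "real \<times> (real^'n)"
    by (rule shifted_time_nonneg[OF that])+
  show thesis
  proof (rule that[of "\<lambda>z. \<Sum>j\<le>N. A j (fst z) * \<rho> z ^ j" "\<lambda>z. \<Sum>j\<le>N. A1 j (fst z) * \<rho> z ^ j" "\<lambda>z. \<Sum>j\<le>N. A2 j (fst z) * \<rho> z ^ j"
      "\<lambda>i z. \<Sum>j\<le>N. A j (fst z) * S1 i j z" "\<lambda>i z. \<Sum>j\<le>N. A j (fst z) * S2 i j z"])
    show "continuous_on UNIV (\<lambda>z. \<Sum>j\<le>N. A j (fst z) * \<rho> z ^ j)" "continuous_on UNIV (\<lambda>z. \<Sum>j\<le>N. A1 j (fst z) * \<rho> z ^ j)"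
      "continuous_on UNIV (\<lambda>z. \<Sum>j\<le>N. A2 j (fst z) * \<rho> z ^ j)" "continuous_on UNIV (\<lambda>z. \<Sum>j\<le>N. A j (fst z) * S1 i j z)"
      "continuous_on UNIV (\<lambda>z. \<Sum>j\<le>N. A j (fst z) * S2 i j z)" for i
      by (intro continuous_on_sum continuous_on_mult continuous_on_power continuous_time cA cS c\<rho>)+
    show "((\<lambda>s. \<Sum>j\<le>N. A j (fst (z + s *\<^sub>R (1, 0))) * \<rho> (z + s *\<^sub>R (1, 0)) ^ j) has_real_derivative (\<Sum>j\<le>N. A1 j (fst z) * \<rho> z ^ j)) (at 0)" for z
      unfolding inv by (intro DERIV_sum DERIV_cmult_right DERIV_time_line dA)
    show "((\<lambda>s. \<Sum>j\<le>N. A1 j (fst (z + s *\<^sub>R (1, 0))) * \<rho> (z + s *\<^sub>R (1, 0)) ^ j) has_real_derivative (\<Sum>j\<le>N. A2 j (fst z) * \<rho> z ^ j)) (at 0)" for z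
      unfolding inv by (intro DERIV_sum DERIV_cmult_right DERIV_time_line dA1)
    show "((\<lambda>s. \<Sum>j\<le>N. A j (fst (z + s *\<^sub>R (0, axis i 1))) * \<rho> (z + s *\<^sub>R (0, axis i 1)) ^ j) has_real_derivative (\<Sum>j\<le>N. A j (fst z) * S1 i j z)) (at 0)" for i z
      unfolding inv by (intro DERIV_sum DERIV_cmult d\<rho>)
    show "((\<lambda>s. \<Sum>j\<le>N. A j (fst (z + s *\<^sub>R (0, axis i 1))) * S1 i j (z + s *\<^sub>R (0, axis i 1))) has_real_derivative (\<Sum>j\<le>N. A j (fst z) * S2 i j z)) (at 0)" for i z
      unfolding inv by (intro DERIV_sum DERIV_cmult dS1)
    have cf0: "0 < cf b ?n j" for j using b by (intro cf_pos) auto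
    then show "0 \<le> (\<Sum>j\<le>N. A j (fst z) * \<rho> z ^ j)" for z
      by (intro sum_nonneg mult_nonneg_nonneg zero_le_power) (auto simp: A_def \<rho>_def less_imp_le)
    fix z :: "real \<times> (real^'n)" assume z: "0 \<le> fst z"
    show "(\<Sum>j\<le>N. A j (fst z) * \<rho> z ^ j) = (\<Sum>j\<le>N. cf b ?n j * (fst z + t0) powr (- b - 2 * real j) * (snd z \<bullet> snd z) ^ j)"
      by (simp add: A_def e_def \<rho>_def st[OF z])
    show "(\<Sum>j\<le>N. A1 j (fst z) * \<rho> z ^ j) = - (\<Sum>j\<le>N. (b + 2 * real j) * cf b ?n j * (fst z + t0) powr (- b - 2 * real j - 1) * (snd z \<bullet> snd z) ^ j)"
      unfolding sum_negf[symmetric] by (intro sum.cong refl) (simp add: A1_def e_def \<rho>_def st[OF z] algebra_simps)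
    have "(\<Sum>i\<in>UNIV. \<Sum>j\<le>N. A j (fst z) * S2 i j z) = (\<Sum>j\<le>N. A j (fst z) * (real j * (2 * (real ?n + 2 * real (j - 1)) * \<rho> z ^ (j - 1))))"
      by (subst sum.swap) (simp add: sum_distrib_left[symmetric] sumQ)
    also have "\<dots> = (\<Sum>j\<le>N. cf b ?n j * (fst z + t0) powr (- b - 2 * real j) * (real j * (2 * (real ?n + 2 * real (j - 1)) * \<rho> z ^ (j - 1))))"
      by (simp add: A_def e_def st[OF z])
    finally have Q: "(\<Sum>i\<in>UNIV. \<Sum>j\<le>N. A j (fst z) * S2 i j z) = \<dots>" .
    have T: "(\<Sum>j\<le>N. A2 j (fst z) * \<rho> z ^ j) = (\<Sum>j\<le>N. cf b ?n j * ((b + 2 * real j) * (b + 2 * real j + 1) * (fst z + t0) powr (- b - 2 * real j - 2)) * \<rho> z ^ j)"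
      by (intro sum.cong refl) (simp add: A2_def e_def st[OF z] algebra_simps)
    show "(\<Sum>j\<le>N. A2 j (fst z) * \<rho> z ^ j) - (\<Sum>i\<in>UNIV. \<Sum>j\<le>N. A j (fst z) * S2 i j z) =
       cf b ?n N * ((b + 2 * real N) * (b + 2 * real N + 1) * (fst z + t0) powr (- b - 2 * real N - 2)) * (snd z \<bullet> snd z) ^ N"
      unfolding Q T unfolding \<rho>_def by (rule cf_wave_telescope) (use b in auto)
  qed
qed

text \<open>With z = (r/s)^2 every sum is a power of s times a polynomial in z, bounded uniformly in
  \<open>N\<close>. The singular factor (1 - z)^(\<theta>-1) becomes a power of s - r through 1 - z
  >= (s - r)/s. The last estimate controls the truncation residual: if r <= q s, it is at most a
  quadratic in \<open>N\<close> times q^(2N).\<close>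

lemma wave_sum_bounds:
  fixes b \<theta> s r C :: real and n :: nat
  assumes n: "0 < n" and b: "0 < b" and \<theta>: "\<theta> < 1" and s: "0 \<le> r" "r < s"
    and C: "\<And>j. cf b n j \<le> C" "\<And>N z. 0 \<le> z \<Longrightarrow> z < 1 \<Longrightarrow> (\<Sum>j\<le>N. cf b n j * z ^ j) \<le> C"
    "\<And>N z. 0 \<le> z \<Longrightarrow> z < 1 \<Longrightarrow> (\<Sum>j\<le>N. (b + 2 * real j) * cf b n j * z ^ j) \<le> C * (1 - z) powr (\<theta> - 1)"
  shows "s powr - b \<le> (\<Sum>j\<le>N. cf b n j * s powr (- b - 2 * real j) * (r\<^sup>2) ^ j)"
    "(\<Sum>j\<le>N. cf b n j * s powr (- b - 2 * real j) * (r\<^sup>2) ^ j) \<le> C * s powr - b"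
    "0 \<le> (\<Sum>j\<le>N. (b + 2 * real j) * cf b n j * s powr (- b - 2 * real j - 1) * (r\<^sup>2) ^ j)"
    "(\<Sum>j\<le>N. (b + 2 * real j) * cf b n j * s powr (- b - 2 * real j - 1) * (r\<^sup>2) ^ j) \<le> C * (s powr (- b - \<theta>) * (s - r) powr (\<theta> - 1))"
    "1 \<le> s \<Longrightarrow> r \<le> q * s \<Longrightarrow> 0 \<le> q \<Longrightarrow> cf b n N * ((b + 2 * real N) * (b + 2 * real N + 1) * s powr (- b - 2 * real N - 2)) * (r\<^sup>2) ^ N
      \<le> C * ((b + 2 * real N) * (b + 2 * real N + 1)) * (q\<^sup>2) ^ N"
proof -
  have s0: "0 < s" using s by linarith
  define z where "z = (r / s)\<^sup>2"
  have rs: "0 \<le> r / s" "r / s < 1" using s s0 by auto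
  have z: "0 \<le> z" "z < 1" using rs by (auto simp: z_def power_less_one_iff)
  have c0: "0 < cf b n j" for j using b n by (intro cf_pos) auto
  have pw: "s powr (- 2 * real j) * (r\<^sup>2) ^ j = z ^ j" for j
  proof -
    have "s powr (- 2 * real j) = inverse ((s\<^sup>2) ^ j)"
      using s0 powr_realpow[of s "2 * j"] by (simp add: powr_minus power_mult[symmetric])
    then show ?thesis unfolding z_def power_divide by (simp add: field_class.field_divide_inverse)
  qed
  have pw': "s powr (a - 2 * real j) * (r\<^sup>2) ^ j = s powr a * z ^ j" for a j
  proof -
    have "s powr (a - 2 * real j) = s powr a * s powr (- 2 * real j)" using s0 by (simp add: powr_add[symmetric])
    then show ?thesis using pw[of j] by (simp only: mult.assoc)
  qed
  have 1: "(\<Sum>j\<le>N. cf b n j * s powr (- b - 2 * real j) * (r\<^sup>2) ^ j) = s powr - b * (\<Sum>j\<le>N. cf b n j * z ^ j)"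
    unfolding sum_distrib_left by (intro sum.cong refl) (simp only: mult.assoc pw' mult.left_commute)
  have 2: "(\<Sum>j\<le>N. (b + 2 * real j) * cf b n j * s powr (- b - 2 * real j - 1) * (r\<^sup>2) ^ j) = s powr (- b - 1) * (\<Sum>j\<le>N. (b + 2 * real j) * cf b n j * z ^ j)"
  proof -
    have e: "- b - 2 * real j - 1 = (- b - 1) - 2 * real j" for j by simp
    show ?thesis unfolding sum_distrib_left e by (intro sum.cong refl) (simp only: mult.assoc pw' mult.left_commute)
  qed
  have "1 \<le> (\<Sum>j\<le>N. cf b n j * z ^ j)"
  proof -
    have "(\<Sum>j\<in>{0}. cf b n j * z ^ j) \<le> (\<Sum>j\<le>N. cf b n j * z ^ j)"
      using z by (intro sum_mono2 mult_nonneg_nonneg zero_le_power less_imp_le[OF c0]) auto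
    then show ?thesis by simp
  qed
  then show "s powr - b \<le> (\<Sum>j\<le>N. cf b n j * s powr (- b - 2 * real j) * (r\<^sup>2) ^ j)"
    unfolding 1 using mult_left_mono[of 1 _ "s powr - b"] by simp
  show "(\<Sum>j\<le>N. cf b n j * s powr (- b - 2 * real j) * (r\<^sup>2) ^ j) \<le> C * s powr - b"
    unfolding 1 using mult_left_mono[OF C(2)[OF z], of "s powr - b" N] by (simp add: mult.commute)
  show "0 \<le> (\<Sum>j\<le>N. (b + 2 * real j) * cf b n j * s powr (- b - 2 * real j - 1) * (r\<^sup>2) ^ j)"
    using c0 b by (intro sum_nonneg mult_nonneg_nonneg) (auto intro: less_imp_le)
  have zl: "(s - r) / s \<le> 1 - z"
  proof -
    have "z \<le> r / s" unfolding z_def power2_eq_square using rs mult_left_mono[of "r / s" 1 "r / s"] by simp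
    then show ?thesis using s0 by (simp add: diff_divide_distrib)
  qed
  have C0: "0 \<le> C" using C(1)[of 0] c0[of 0] by linarith
  have "(1 - z) powr (\<theta> - 1) \<le> ((s - r) / s) powr (\<theta> - 1)" using zl s s0 \<theta> by (intro powr_mono2') auto
  then have "C * (1 - z) powr (\<theta> - 1) \<le> C * ((s - r) / s) powr (\<theta> - 1)" using C0 by (rule mult_left_mono)
  then have "(\<Sum>j\<le>N. (b + 2 * real j) * cf b n j * z ^ j) \<le> C * ((s - r) / s) powr (\<theta> - 1)" using C(3)[OF z] by (rule order_trans[rotated])
  then have "s powr (- b - 1) * (\<Sum>j\<le>N. (b + 2 * real j) * cf b n j * z ^ j) \<le> s powr (- b - 1) * (C * ((s - r) / s) powr (\<theta> - 1))"
    by (rule mult_left_mono) simp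
  also have "\<dots> = C * (s powr (- b - 1) / s powr (\<theta> - 1) * (s - r) powr (\<theta> - 1))"
    using s s0 by (simp add: powr_divide)
  also have "s powr (- b - 1) / s powr (\<theta> - 1) = s powr (- b - \<theta>)" by (simp add: powr_diff[symmetric])
  finally show "(\<Sum>j\<le>N. (b + 2 * real j) * cf b n j * s powr (- b - 2 * real j - 1) * (r\<^sup>2) ^ j) \<le> C * (s powr (- b - \<theta>) * (s - r) powr (\<theta> - 1))"
    unfolding 2 .
  assume s1: "1 \<le> s" and q: "r \<le> q * s" "0 \<le> q"
  have "r / s \<le> q" using q s0 by (simp add: divide_le_eq)
  then have zq: "z \<le> q\<^sup>2" unfolding z_def using rs by (intro power_mono) auto
  have e: "- b - 2 * real N - 2 = (- b - 2) - 2 * real N" by simp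
  have "s powr (- b - 2 * real N - 2) * (r\<^sup>2) ^ N = s powr (- b - 2) * z ^ N" unfolding e by (rule pw')
  also have "\<dots> \<le> 1 * (q\<^sup>2) ^ N"
  proof (intro mult_mono power_mono zq z)
    have "s powr (- b - 2) \<le> s powr 0" using s1 b by (intro powr_mono) auto
    then show "s powr (- b - 2) \<le> 1" using s0 by simp
  qed (use z in auto)
  finally have fin: "s powr (- b - 2 * real N - 2) * (r\<^sup>2) ^ N \<le> 1 * (q\<^sup>2) ^ N" .
  have "cf b n N * ((b + 2 * real N) * (b + 2 * real N + 1)) * (s powr (- b - 2 * real N - 2) * (r\<^sup>2) ^ N)
      \<le> C * ((b + 2 * real N) * (b + 2 * real N + 1)) * (1 * (q\<^sup>2) ^ N)"
    by (rule mult_mono[OF mult_right_mono[OF C(1)] fin]) (use C0 b in auto)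
  then show "cf b n N * ((b + 2 * real N) * (b + 2 * real N + 1) * s powr (- b - 2 * real N - 2)) * (r\<^sup>2) ^ N
      \<le> C * ((b + 2 * real N) * (b + 2 * real N + 1)) * (q\<^sup>2) ^ N"
    by (simp only: mult.assoc mult_1)
qed

section \<open>Weights for Hoelder's inequality\<close>

lemma powr_sum3_le:
  fixes x y z q :: real
  assumes "0 \<le> x" "0 \<le> y" "0 \<le> z" "0 \<le> q"
  shows "(x + y + z) powr q \<le> 3 powr q * (x powr q + y powr q + z powr q)"
proof -
  define w where "w = max x (max y z)"
  have "(x + y + z) powr q \<le> (3 * w) powr q" using assms by (intro powr_mono2) (auto simp: w_def)
  also have "\<dots> = 3 powr q * w powr q" using assms by (intro powr_mult)
  also have "w powr q \<le> x powr q + y powr q + z powr q" by (auto simp: w_def max_def)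
  finally show ?thesis by simp
qed

lemma quadratic_geometric_tendsto_0:
  fixes b q :: real
  assumes q: "0 \<le> q" "q < 1"
  shows "(\<lambda>N. (b + 2 * real N) * (b + 2 * real N + 1) * q ^ N) \<longlonglongrightarrow> 0"
proof (cases "q = 0")
  case True
  have "\<forall>\<^sub>F N in sequentially. (b + 2 * real N) * (b + 2 * real N + 1) * q ^ N = 0"
    using eventually_gt_at_top[of "0::nat"] by eventually_elim (simp add: True)
  then show ?thesis by (rule tendsto_eventually)
next
  case False
  with q have "0 < q" by simp
  then show ?thesis using q by real_asymp
qed

text \<open>In Hoelder's inequality |u| carries s^(-b/p), so the remaining weight is multiplied by
  s^(b/p) before its p'-th power is taken. At late times s is comparable with R, and all powers of s
  turn into powers of R; only s - r has to be kept.\<close>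

lemma main_weight_bound:
  fixes s r R b k p p' \<mu> :: real
  assumes p: "1 < p" "p' = p / (p - 1)" and r: "0 \<le> r" "r < s" and R: "0 < R" "R / 2 \<le> s" "s \<le> 3 * R" and \<mu>: "0 \<le> \<mu>"
  shows "(s powr (b / p) * (s powr - b / R\<^sup>2 + 2 * (s powr - k * (s - r) powr (- 1 / p')) / R + \<mu> * (1 + r) powr -2 * s powr - b / R)) powr p'
    \<le> 3 powr p' * (3 powr \<bar>b\<bar> + 2 powr p' * 3 powr \<bar>b * (p' - 1) - k * p'\<bar> + \<mu> powr p' * 3 powr \<bar>b\<bar>) *
      (R powr - (2 * p' + b) + R powr (- p' - k * p' + b * (p' - 1)) * (1 / (s - r)) + R powr (- p' - b) * (1 + r) powr (- 2 * p'))"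
proof -
  have p': "1 < p'" "b / p * p' = b * (p' - 1)" "- 1 / p' * p' = - 1" using p(1) unfolding p(2) by (simp_all add: field_simps)
  have s0: "0 < s" "0 < s - r" "0 < 1 + r" using r by auto
  have e1: "(b / p - b) * p' = - b" using p'(2) by (simp add: algebra_simps)
  have e2: "(b / p - k) * p' = b * (p' - 1) - k * p'" using p'(2) by (simp add: algebra_simps)
  define x where "x = s powr (b / p - b) * R powr - 2"
  define y where "y = 2 * s powr (b / p - k) * (s - r) powr (- 1 / p') * R powr - 1"
  define w where "w = \<mu> * s powr (b / p - b) * (1 + r) powr - 2 * R powr - 1"
  have nn: "0 \<le> x" "0 \<le> y" "0 \<le> w" using \<mu> by (auto simp: x_def y_def w_def)
  have Rm: "R powr - 2 = 1 / R\<^sup>2" "R powr - 1 = 1 / R" using R by (auto simp: powr_minus_divide)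
  have sm: "s powr (b / p - b) = s powr (b / p) * s powr - b" "s powr (b / p - k) = s powr (b / p) * s powr - k"
    using s0 by (auto simp: powr_add[symmetric])
  have "s powr (b / p) * (s powr - b / R\<^sup>2 + 2 * (s powr - k * (s - r) powr (- 1 / p')) / R + \<mu> * (1 + r) powr -2 * s powr - b / R) = x + y + w"
    unfolding x_def y_def w_def Rm sm by (simp add: algebra_simps)
  moreover have "(x + y + w) powr p' \<le> 3 powr p' * (x powr p' + y powr p' + w powr p')"
    using p' by (intro powr_sum3_le nn) auto
  moreover have "x powr p' + y powr p' + w powr p' \<le> (3 powr \<bar>b\<bar> + 2 powr p' * 3 powr \<bar>b * (p' - 1) - k * p'\<bar> + \<mu> powr p' * 3 powr \<bar>b\<bar>) *
      (R powr - (2 * p' + b) + R powr (- p' - k * p' + b * (p' - 1)) * (1 / (s - r)) + R powr (- p' - b) * (1 + r) powr (- 2 * p'))"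
    (is "_ \<le> (?c1 + ?c2 + ?c3) * (?X + ?Y + ?Z)")
  proof -
    note cmp = powr_comparable[OF R]
    have x: "x powr p' \<le> ?c1 * ?X"
    proof -
      have "x powr p' = s powr - b * R powr (- 2 * p')" using s0 R by (simp add: x_def powr_mult powr_powr e1)
      also have "\<dots> \<le> (?c1 * R powr - b) * R powr (- 2 * p')" using cmp[of "- b"] by (intro mult_right_mono) auto
      also have "\<dots> = ?c1 * ?X" by (simp add: powr_add[symmetric] algebra_simps)
      finally show ?thesis .
    qed
    have y: "y powr p' \<le> ?c2 * ?Y"
    proof -
      have "y powr p' = 2 powr p' * s powr (b * (p' - 1) - k * p') * (s - r) powr - 1 * R powr - p'"
      proof -
        have "y powr p' = 2 powr p' * (s powr (b / p - k)) powr p' * ((s - r) powr (- 1 / p')) powr p' * (R powr - 1) powr p'"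
          by (simp only: y_def powr_mult powr_ge_zero mult_nonneg_nonneg zero_le_numeral)
        then show ?thesis by (simp only: powr_powr e2 p'(3) mult_minus1)
      qed
      also have "\<dots> \<le> 2 powr p' * (3 powr \<bar>b * (p' - 1) - k * p'\<bar> * R powr (b * (p' - 1) - k * p')) * (s - r) powr - 1 * R powr - p'"
        by (intro mult_right_mono mult_left_mono cmp) auto
      also have "\<dots> = ?c2 * (R powr (b * (p' - 1) - k * p') * R powr - p') * (s - r) powr - 1" by (simp only: mult_ac)
      also have "R powr (b * (p' - 1) - k * p') * R powr - p' = R powr (- p' - k * p' + b * (p' - 1))" by (simp add: powr_add[symmetric] algebra_simps)
      also have "(s - r) powr - 1 = 1 / (s - r)" using s0 by (simp add: powr_minus_divide)
      finally show ?thesis by (simp only: mult.assoc)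
    qed
    have z: "w powr p' \<le> ?c3 * ?Z"
    proof -
      have "w powr p' = \<mu> powr p' * s powr - b * (1 + r) powr (- 2 * p') * R powr - p'"
        by (simp only: w_def powr_mult powr_powr e1 powr_ge_zero mult_nonneg_nonneg \<mu> mult_minus1)
      also have "\<dots> \<le> \<mu> powr p' * (?c1 * R powr - b) * (1 + r) powr (- 2 * p') * R powr - p'"
        using cmp[of "- b"] by (intro mult_right_mono mult_left_mono) auto
      also have "\<dots> = ?c3 * (R powr - b * R powr - p') * (1 + r) powr (- 2 * p')" by (simp only: mult_ac)
      also have "R powr - b * R powr - p' = R powr (- p' - b)" unfolding powr_add[symmetric] by (rule arg_cong[where f="(powr) R"]) simp
      finally show ?thesis by (simp only: mult.assoc)
    qed
    have c: "0 \<le> ?c1" "0 \<le> ?c2" "0 \<le> ?c3" "0 \<le> ?X" "0 \<le> ?Y" "0 \<le> ?Z" using s0 by auto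
    have "?c1 * ?X + ?c2 * ?Y + ?c3 * ?Z \<le> (?c1 + ?c2 + ?c3) * ?X + (?c1 + ?c2 + ?c3) * ?Y + (?c1 + ?c2 + ?c3) * ?Z"
      using c by (intro add_mono mult_right_mono) linarith+
    then show ?thesis using x y z unfolding distrib_left by linarith
  qed
  ultimately have 3: "(s powr (b / p) * (s powr - b / R\<^sup>2 + 2 * (s powr - k * (s - r) powr (- 1 / p')) / R + \<mu> * (1 + r) powr -2 * s powr - b / R)) powr p'
      \<le> 3 powr p' * (x powr p' + y powr p' + w powr p')"
    and 4: "x powr p' + y powr p' + w powr p' \<le> (3 powr \<bar>b\<bar> + 2 powr p' * 3 powr \<bar>b * (p' - 1) - k * p'\<bar> + \<mu> powr p' * 3 powr \<bar>b\<bar>) *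
      (R powr - (2 * p' + b) + R powr (- p' - k * p' + b * (p' - 1)) * (1 / (s - r)) + R powr (- p' - b) * (1 + r) powr (- 2 * p'))"
    by (simp_all only:)
  from order_trans[OF 3 mult_left_mono[OF 4]] show ?thesis by (simp only: mult.assoc powr_ge_zero)
qed

text \<open>The three lines of the weight are the cutoff derivatives, supported at late times; the
  damping acting on \<Phi>_t; and the residual of the truncated series. Only the inverse square
  decay of the damping is used.\<close>

lemma (in energy_supp) wave_energy:
  fixes b k p' t0 R C :: real
  assumes p1: "1 < p" "p' = p / (p - 1)" and \<beta>2: "2 \<le> \<beta>" and sign: "0 \<le> \<epsilon>" "AE x in lborel. 0 \<le> f x" "AE x in lborel. 0 \<le> g x"
    and m: "3 \<le> m" "real m / p \<le> real m - 2" and b: "0 < b" "k = b + 1 / p" and t0: "2 \<le> t0" and R: "1 \<le> R" "R < T"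
    and C: "\<And>j. cf b CARD('n) j \<le> C" "\<And>N z. 0 \<le> z \<Longrightarrow> z < 1 \<Longrightarrow> (\<Sum>j\<le>N. cf b CARD('n) j * z ^ j) \<le> C"
    "\<And>N z. 0 \<le> z \<Longrightarrow> z < 1 \<Longrightarrow> (\<Sum>j\<le>N. (b + 2 * real j) * cf b CARD('n) j * z ^ j) \<le> C * (1 - z) powr (1 / p - 1)"
  defines "S \<equiv> \<lambda>z :: real \<times> (real^'n). fst z + t0" and "r \<equiv> \<lambda>z :: real \<times> (real^'n). norm (snd z)"
  shows "(\<integral>\<^sup>+z. ennreal (\<bar>W z\<bar> powr p * (S z powr - b * cutoff m (fst z / R))) \<partial>lborel) \<le>
    (\<integral>\<^sup>+z. ennreal (\<bar>W z\<bar> * (60 * (real m)\<^sup>2 * C * late m R (fst z) powr (1 / p) *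
         (S z powr - b / R\<^sup>2 + 2 * (S z powr - k * (S z - r z) powr (- 1 / p')) / R + \<mu> * (1 + r z) powr -2 * S z powr - b / R)
       + \<mu> * C * cutoff m (fst z / R) * ((1 + r z) powr -2 * (S z powr - k * (S z - r z) powr (- 1 / p')))
       + C * ((b + 2 * real N) * (b + 2 * real N + 1)) * (((R + 1) / (R + t0))\<^sup>2) ^ N * cutoff m (fst z / R))) \<partial>lborel)"
    (is "?X \<le> (\<integral>\<^sup>+z. ennreal (\<bar>W z\<bar> * ?D z) \<partial>lborel)")
proof -
  let ?n = "CARD('n)"
  have n: "0 < ?n" by simp
  have R0: "0 < R" using R by simp
  have p0: "0 < p" using p1 by simp
  have \<theta>: "1 / p < 1" "1 / p - 1 = - 1 / p'" "- b - 1 / p = - k" using p1(1) unfolding p1(2) b(2) by (simp_all add: field_simps)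
  obtain \<Phi> Pt Ptt :: "real \<times> (real^'n) \<Rightarrow> real" and P Q :: "'n \<Rightarrow> real \<times> (real^'n) \<Rightarrow> real" where
    cont: "continuous_on UNIV \<Phi>" "continuous_on UNIV Pt" "continuous_on UNIV Ptt" "\<And>i. continuous_on UNIV (P i)" "\<And>i. continuous_on UNIV (Q i)"
    and dt: "\<And>z. ((\<lambda>s. \<Phi> (z + s *\<^sub>R (1, 0))) has_real_derivative Pt z) (at 0)"
      "\<And>z. ((\<lambda>s. Pt (z + s *\<^sub>R (1, 0))) has_real_derivative Ptt z) (at 0)"
    and dx: "\<And>i z. ((\<lambda>s. \<Phi> (z + s *\<^sub>R (0, axis i 1))) has_real_derivative P i z) (at 0)"
      "\<And>i z. ((\<lambda>s. P i (z + s *\<^sub>R (0, axis i 1))) has_real_derivative Q i z) (at 0)"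
    and \<Phi>0: "\<And>z. 0 \<le> \<Phi> z"
    and eq: "\<And>z. 0 \<le> fst z \<Longrightarrow> \<Phi> z = (\<Sum>j\<le>N. cf b ?n j * (fst z + t0) powr (- b - 2 * real j) * (snd z \<bullet> snd z) ^ j)"
      "\<And>z. 0 \<le> fst z \<Longrightarrow> Pt z = - (\<Sum>j\<le>N. (b + 2 * real j) * cf b ?n j * (fst z + t0) powr (- b - 2 * real j - 1) * (snd z \<bullet> snd z) ^ j)"
      "\<And>z. 0 \<le> fst z \<Longrightarrow> Ptt z - (\<Sum>i\<in>UNIV. Q i z) =
       cf b ?n N * ((b + 2 * real N) * (b + 2 * real N + 1) * (fst z + t0) powr (- b - 2 * real N - 2)) * (snd z \<bullet> snd z) ^ N"
  proof -
    show ?thesis by (rule wave_test_function[OF b(1) t0, where 'n='n and N=N]) (rule that)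
  qed
  \<comment> \<open>The ratio (R + 1)/(R + t0) bounds r/s on the cone up to time R. It is below 1
    because t0 > 1, so the residual disappears as \<open>N\<close> grows.\<close>
  define EN where "EN = C * ((b + 2 * real N) * (b + 2 * real N + 1)) * (((R + 1) / (R + t0))\<^sup>2) ^ N"
  have C0: "0 \<le> C" using C(1)[of 0] by simp
  have est: "S z powr - b \<le> \<Phi> z" "\<Phi> z \<le> C * S z powr - b" "\<bar>Pt z\<bar> \<le> C * (S z powr - k * (S z - r z) powr (- 1 / p'))" "Pt z \<le> 0"
    "0 \<le> Ptt z - (\<Sum>i\<in>UNIV. Q i z)" "fst z \<le> R \<Longrightarrow> Ptt z - (\<Sum>i\<in>UNIV. Q i z) \<le> EN" if z: "0 \<le> fst z" "norm (snd z) \<le> fst z + 1" for z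
  proof -
    have rs: "0 \<le> r z" "r z < S z" using z t0 by (auto simp: r_def S_def)
    have rr: "snd z \<bullet> snd z = (r z)\<^sup>2" by (simp add: r_def power2_norm_eq_inner)
    note bd = wave_sum_bounds[OF n b(1) \<theta>(1) rs C, where N=N]
    have Sz: "fst z + t0 = S z" by (simp add: S_def)
    note eq' = eq[OF z(1), unfolded rr Sz]
    show "S z powr - b \<le> \<Phi> z" unfolding eq'(1) by (rule bd(1))
    show "\<Phi> z \<le> C * S z powr - b" unfolding eq'(1) by (rule bd(2))
    show "Pt z \<le> 0" unfolding eq'(2) using bd(3) by simp
    show "\<bar>Pt z\<bar> \<le> C * (S z powr - k * (S z - r z) powr (- 1 / p'))"
      unfolding eq'(2) using bd(3) bd(4)[unfolded \<theta>] by simp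
    have c0: "0 < cf b ?n N" using b by (intro cf_pos) auto
    show "0 \<le> Ptt z - (\<Sum>i\<in>UNIV. Q i z)" unfolding eq'(3) using c0 b rs(1) by (intro mult_nonneg_nonneg zero_le_power) auto
    show "Ptt z - (\<Sum>i\<in>UNIV. Q i z) \<le> EN" if "fst z \<le> R"
      unfolding eq'(3) EN_def
    proof (rule bd(5))
      show "1 \<le> S z" using z t0 by (simp add: S_def)
      show "0 \<le> (R + 1) / (R + t0)" using R t0 by simp
      \<comment> \<open>The quotient (t + 1)/(t + t0) increases in t as t0 >= 1, so t = R is the
        worst case.\<close>
      have "(fst z + 1) * (R + t0) \<le> (R + 1) * (fst z + t0)"
        using mult_nonneg_nonneg[of "R - fst z" "t0 - 1"] \<open>fst z \<le> R\<close> t0 by (simp add: algebra_simps)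
      then have "fst z + 1 \<le> (R + 1) / (R + t0) * S z" using R t0 by (simp add: S_def field_simps)
      then show "r z \<le> (R + 1) / (R + t0) * S z" using z by (simp add: r_def)
    qed
  qed
  define \<eta> where "\<eta> z = cutoff m (fst z / R)" for z :: "real \<times> (real^'n)"
  define \<eta>1 where "\<eta>1 z = cutoff' m (fst z / R) / R" for z :: "real \<times> (real^'n)"
  define \<eta>2 where "\<eta>2 z = cutoff'' m (fst z / R) / R\<^sup>2" for z :: "real \<times> (real^'n)"
  have \<eta>0: "0 \<le> \<eta> z" for z by (simp add: \<eta>_def cutoff_range)
  have ceta: "continuous_on UNIV \<eta>" "continuous_on UNIV \<eta>1" "continuous_on UNIV \<eta>2"
    unfolding \<eta>_def[abs_def] \<eta>1_def[abs_def] \<eta>2_def[abs_def]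
    using R0 by (auto intro!: continuous_intros continuous_time[OF cutoff_scaled_continuous(1)] continuous_time[OF cutoff_scaled_continuous(2)]
      continuous_time[OF cutoff_scaled_continuous(3)])
  have d\<eta>: "((\<lambda>s. \<eta> (z + s *\<^sub>R (1, 0))) has_real_derivative \<eta>1 z) (at 0)" "((\<lambda>s. \<eta>1 (z + s *\<^sub>R (1, 0))) has_real_derivative \<eta>2 z) (at 0)" for z
    unfolding \<eta>_def \<eta>1_def \<eta>2_def by (intro DERIV_time_line cutoff_scaled_deriv m R0)+
  have inv: "\<eta> (z + s *\<^sub>R (0, x)) = \<eta> z" for z s x unfolding \<eta>_def fst_snd_line by simp
  let ?\<Psi> = "\<lambda>z. \<eta> z * \<Phi> z" and ?Pt = "\<lambda>z. \<eta>1 z * \<Phi> z + \<eta> z * Pt z" and ?Ptt = "\<lambda>z. \<eta>2 z * \<Phi> z + 2 * \<eta>1 z * Pt z + \<eta> z * Ptt z"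
    and ?P = "\<lambda>i z. \<eta> z * P i z" and ?Q = "\<lambda>i z. \<eta> z * Q i z"
  have "?X \<le> (\<integral>\<^sup>+z. ennreal (\<bar>W z\<bar> powr p * ?\<Psi> z) \<partial>lborel)"
  proof (intro nn_integral_mono ennreal_leI)
    fix z
    show "\<bar>W z\<bar> powr p * (S z powr - b * cutoff m (fst z / R)) \<le> \<bar>W z\<bar> powr p * ?\<Psi> z"
    proof (cases "W z = 0")
      case True
      then show ?thesis using p0 by simp
    next
      case False
      then have "S z powr - b \<le> \<Phi> z" using W_nonzeroD[of z] by (intro est) auto
      then have "\<eta> z * S z powr - b \<le> \<eta> z * \<Phi> z" using \<eta>0 by (rule mult_left_mono)
      then show ?thesis by (intro mult_left_mono) (auto simp: \<eta>_def mult.commute)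
    qed
  qed
  also have "\<dots> \<le> (\<integral>\<^sup>+z. ennreal (\<bar>W z\<bar> * ?D z) \<partial>lborel)"
  proof (rule energy_bound(2)[where P="?P" and Q="?Q" and Pt="?Pt" and Ptt="?Ptt" and ?T1.0=R])
    show "continuous_on UNIV ?\<Psi>" "continuous_on UNIV ?Pt" "continuous_on UNIV ?Ptt" "continuous_on UNIV (?P i)" "continuous_on UNIV (?Q i)" for i
      by (intro continuous_intros ceta cont)+
    show "((\<lambda>s. ?\<Psi> (z + s *\<^sub>R (1, 0))) has_real_derivative ?Pt z) (at 0)" for z
      by (rule DERIV_mult_line[OF d\<eta>(1) dt(1)])
    show "((\<lambda>s. ?Pt (z + s *\<^sub>R (1, 0))) has_real_derivative ?Ptt z) (at 0)" for z
      by (rule DERIV_cong[OF DERIV_add[OF DERIV_mult_line[OF d\<eta>(2) dt(1)] DERIV_mult_line[OF d\<eta>(1) dt(2)]]]) simp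
    show "((\<lambda>s. ?\<Psi> (z + s *\<^sub>R (0, axis i 1))) has_real_derivative ?P i z) (at 0)" for z i
      unfolding inv by (intro DERIV_cmult dx)
    show "((\<lambda>s. ?P i (z + s *\<^sub>R (0, axis i 1))) has_real_derivative ?Q i z) (at 0)" for z i
      unfolding inv by (intro DERIV_cmult dx)
    have l: "\<eta> z = 0" "\<eta>1 z = 0" "\<eta>2 z = 0" if "R \<le> fst z" for z
      using that R0 cutoff_ge_1[OF m(1), of "fst z / R"] by (auto simp: \<eta>_def \<eta>1_def \<eta>2_def)
    show "?\<Psi> z = 0" if "R \<le> fst z" for z using l[OF that] by simp
    show "?Pt z = 0 \<and> ?Ptt z = 0 \<and> (\<forall>i. ?Q i z = 0)" if "R < fst z" for z using l[of z] that by simp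
    have nonneg: "0 \<le> ?\<Psi> z" for z using \<eta>0 \<Phi>0 by simp
    show "0 \<le> ?\<Psi> (0, x)" for x by (rule nonneg)
    show "0 \<le> ?\<Psi> z" for z by (rule nonneg)
    show "?Pt (0, x) \<le> 0" for x
    proof -
      have "Pt (0, x) \<le> 0" unfolding eq(2)[of "(0, x)", simplified] neg_le_0_iff_le
        using b cf_pos[OF b(1), of ?n] by (intro sum_nonneg mult_nonneg_nonneg zero_le_power less_imp_le[OF cf_pos]) auto
      then show ?thesis by (simp add: \<eta>_def \<eta>1_def cutoff_le_half)
    qed
    have D0: "0 \<le> 60 * (real m)\<^sup>2 * C * late m R (fst z) powr (1 / p) *
         (S z powr - b / R\<^sup>2 + 2 * (S z powr - k * (S z - r z) powr (- 1 / p')) / R + \<mu> * (1 + r z) powr -2 * S z powr - b / R)"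
       "0 \<le> \<mu> * C * cutoff m (fst z / R) * ((1 + r z) powr -2 * (S z powr - k * (S z - r z) powr (- 1 / p')))" "0 \<le> EN * cutoff m (fst z / R)" for z
      using C0 R0 \<mu> b t0 by (auto intro!: mult_nonneg_nonneg add_nonneg_nonneg divide_nonneg_nonneg simp: EN_def cutoff_range)
    show "0 \<le> ?D z" for z using D0[of z] unfolding EN_def by linarith
    fix z :: "real \<times> (real^'n)" assume z: "0 < fst z" "fst z \<le> R" "norm (snd z) \<le> fst z + 1"
    have z0: "0 \<le> fst z" using z by simp
    note e = est[OF z0 z(3)]
    let ?l = "60 * (real m)\<^sup>2 * late m R (fst z) powr (1 / p)" and ?V = "S z powr - k * (S z - r z) powr (- 1 / p')"
    have l0: "0 \<le> ?l" by simp
    have a: "0 \<le> a (snd z)" "a (snd z) \<le> \<mu> * (1 + r z) powr - 2"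
      using damping_le_inverse_square[OF \<mu> \<beta>2, of "snd z"] damping_bounds(1)[OF \<mu> \<beta>, of "snd z"] by (auto simp: r_def)
    have 1: "\<bar>\<eta>1 z\<bar> \<le> ?l / R" unfolding \<eta>1_def abs_divide using R0 cutoff_scaled_bounds(1)[OF m p0, of "fst z" R]
      by (simp add: divide_right_mono)
    have 2: "\<bar>\<eta>2 z\<bar> \<le> ?l / R\<^sup>2" unfolding \<eta>2_def abs_divide using cutoff_scaled_bounds(2)[OF m p0, of "fst z" R]
      by (simp add: divide_right_mono)
    have p0: "\<bar>\<Phi> z\<bar> \<le> C * S z powr - b" using e \<Phi>0[of z] by simp
    have A1: "\<bar>\<eta>2 z * \<Phi> z\<bar> \<le> ?l / R\<^sup>2 * (C * S z powr - b)" unfolding abs_mult by (intro mult_mono 2 p0) auto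
    have A2: "\<bar>\<eta>1 z * Pt z\<bar> \<le> ?l / R * (C * ?V)" unfolding abs_mult by (intro mult_mono 1 e) (use l0 R0 in auto)
    have A3: "\<bar>a (snd z) * (\<eta>1 z * \<Phi> z)\<bar> \<le> \<mu> * (1 + r z) powr - 2 * (?l / R * (C * S z powr - b))"
      unfolding abs_mult by (intro mult_mono 1 p0) (use l0 R0 a C0 in auto)
    have A4: "\<bar>a (snd z) * (\<eta> z * Pt z)\<bar> \<le> \<mu> * (1 + r z) powr - 2 * (\<eta> z * (C * ?V))"
      unfolding abs_mult by (intro mult_mono e) (use a C0 \<eta>0 in auto)
    have A5: "\<bar>\<eta> z * (Ptt z - (\<Sum>i\<in>UNIV. Q i z))\<bar> \<le> \<eta> z * EN"
      unfolding abs_mult using e(5) e(6)[OF z(2)] \<eta>0[of z] by (simp add: mult_left_mono)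
    \<comment> \<open>The only term with neither a cutoff derivative nor damping is the residual of
      \<Phi> as a solution of the free wave equation.\<close>
    have "?Ptt z - (\<Sum>i\<in>UNIV. ?Q i z) - a (snd z) * ?Pt z = \<eta>2 z * \<Phi> z + 2 * (\<eta>1 z * Pt z) - a (snd z) * (\<eta>1 z * \<Phi> z)
        - a (snd z) * (\<eta> z * Pt z) + \<eta> z * (Ptt z - (\<Sum>i\<in>UNIV. Q i z))"
      by (simp add: sum_distrib_left[symmetric] algebra_simps)
    then have "\<bar>?Ptt z - (\<Sum>i\<in>UNIV. ?Q i z) - a (snd z) * ?Pt z\<bar> \<le> ?l / R\<^sup>2 * (C * S z powr - b) + 2 * (?l / R * (C * ?V))
        + \<mu> * (1 + r z) powr - 2 * (?l / R * (C * S z powr - b)) + \<mu> * (1 + r z) powr - 2 * (\<eta> z * (C * ?V)) + \<eta> z * EN"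
      using A1 A2 A3 A4 A5 by linarith
    also have "\<dots> = ?D z" by (simp add: \<eta>_def EN_def algebra_simps)
    finally show "\<bar>?Ptt z - (\<Sum>i\<in>UNIV. ?Q i z) - a (snd z) * ?Pt z\<bar> \<le> ?D z" .
  qed (use R sign in auto)
  finally show ?thesis .
qed

text \<open>The p'-th power of (s - r)^(-1/p') is exactly 1/(s - r), and the relation for k p'
  simplifies the power of s.\<close>

lemma error_weight_bound:
  fixes s r b k p p' \<mu> C :: real
  assumes p: "1 < p" "p' = p / (p - 1)" and k: "k * p' = b * p' + p' - 1" and r: "0 \<le> r" "r < s" and \<mu>: "0 \<le> \<mu>" "0 \<le> C"
  shows "(s powr (b / p) * (\<mu> * C * ((1 + r) powr -2 * (s powr - k * (s - r) powr (- 1 / p'))))) powr p'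
    = (\<mu> * C) powr p' * (s powr (1 - p' - b) * (1 + r) powr (- 2 * p') * (1 / (s - r)))"
proof -
  have p': "1 < p'" "b / p * p' = b * (p' - 1)" "- 1 / p' * p' = - 1" using p(1) unfolding p(2) by (simp_all add: field_simps)
  have s0: "0 < s" "0 < s - r" using r by auto
  have e: "(b / p - k) * p' = 1 - p' - b" using p'(2) k by (simp add: algebra_simps)
  have "s powr (b / p) * (\<mu> * C * ((1 + r) powr -2 * (s powr - k * (s - r) powr (- 1 / p'))))
    = (\<mu> * C) * (s powr (b / p) * s powr - k) * (1 + r) powr -2 * (s - r) powr (- 1 / p')" by (simp only: mult_ac)
  also have "s powr (b / p) * s powr - k = s powr (b / p - k)" by (simp add: powr_add[symmetric])
  finally have "(s powr (b / p) * (\<mu> * C * ((1 + r) powr -2 * (s powr - k * (s - r) powr (- 1 / p'))))) powr p'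
    = (\<mu> * C) powr p' * s powr (1 - p' - b) * (1 + r) powr (- 2 * p') * (s - r) powr - 1"
    by (simp only: powr_mult powr_powr e p'(3) powr_ge_zero mult_nonneg_nonneg \<mu>)
  also have "(s - r) powr - 1 = 1 / (s - r)" using s0 by (simp add: powr_minus_divide)
  finally show ?thesis by (simp only: mult.assoc)
qed

text \<open>Hoelder on the three parts of \<open>wave_energy\<close>: the cutoff part against the
  late integral \<open>B\<close>, the damping part against \<open>X\<close> itself, and the
  truncation part by letting \<open>N\<close> tend to infinity for fixed \<open>R\<close>. The
  constant depends neither on \<open>R\<close> nor on \<open>t0\<close>, which leaves
  \<open>t0\<close> free for absorbing the damping.\<close>

lemma upper_bound:
  fixes \<mu> \<beta> p p' b k :: real and f g :: "real^'n \<Rightarrow> real"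
  assumes n: "2 \<le> CARD('n)" and \<mu>0: "0 < \<mu>" and \<beta>2: "2 \<le> \<beta>" and p1: "1 < p" "p' = p / (p - 1)"
    and b: "0 < b" "k = b + 1 / p" and rel: "k = (real CARD('n) - 1) / 2" "real CARD('n) + 1 = 2 * p' + b"
    and f0: "AE x in lborel. 0 \<le> f x" and g0: "AE x in lborel. 0 \<le> g x"
    and m: "3 \<le> m" "real m / p \<le> real m - 2"
  obtains C1 where "0 < C1" "\<And>\<epsilon> T u v t0 R B X. energy_supp \<mu> \<beta> p \<epsilon> T f g u v \<Longrightarrow> 0 < \<epsilon> \<Longrightarrow> 2 \<le> t0 \<Longrightarrow> t0 \<le> R \<Longrightarrow> R < T \<Longrightarrow> 0 < B \<Longrightarrow> 0 < X \<Longrightarrow>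
     (\<integral>\<^sup>+z. ennreal (\<bar>energy_supp.W T u z\<bar> powr p * ((fst z + t0) powr - b * late m R (fst z))) \<partial>lborel) \<le> ennreal B \<Longrightarrow>
     (\<integral>\<^sup>+z. ennreal (\<bar>energy_supp.W T u z\<bar> powr p * ((fst z + t0) powr - b * cutoff m (fst z / R))) \<partial>lborel) = ennreal X \<Longrightarrow>
     X \<le> C1 * ((ln R) powr (1 / p') * B powr (1 / p) + t0 powr - ((p' - 1) / (2 * p')) * X powr (1 / p))"
proof -
  let ?n = "CARD('n)"
  have p': "1 < p'" "1 / p + 1 / p' = 1" "1 / p * p' = p' - 1" using p1(1) unfolding p1(2) by (simp_all add: field_simps)
  have kp: "k * p' = b * p' + p' - 1" unfolding b(2) using p'(3) by (simp add: distrib_right)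
  have bb: "b = (real ?n - 1) / 2 - 1 / p" using b(2) rel(1) by linarith
  have n0: "0 < real ?n" by simp
  have th: "0 < 1 / p" "1 / p < 1" using p1 by auto
  obtain C where C: "0 < C" "\<And>j. cf b ?n j \<le> C" "\<And>N z. 0 \<le> z \<Longrightarrow> z < 1 \<Longrightarrow> (\<Sum>j\<le>N. cf b ?n j * z ^ j) \<le> C"
    "\<And>N z. 0 \<le> z \<Longrightarrow> z < 1 \<Longrightarrow> (\<Sum>j\<le>N. (b + 2 * real j) * cf b ?n j * z ^ j) \<le> C * (1 - z) powr (1 / p - 1)"
    by (rule cf_bounds[OF b(1) n0 bb th]) blast
  obtain Cm where Cm: "0 < Cm" "\<And>R t0. 2 \<le> t0 \<Longrightarrow> t0 \<le> R \<Longrightarrow>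
    (\<integral>\<^sup>+z. ennreal (R powr - (2 * p' + b) + R powr (- p' - k * p' + b * (p' - 1)) * (1 / (fst z + t0 - norm (snd z)))
         + R powr (- p' - b) * (1 + norm (snd z)) powr (- 2 * p')) *
       indicator {z. fst z \<in> {R / 2..R} \<and> norm (snd z) \<le> fst z + 1} z \<partial>(lborel :: (real \<times> (real^'n)) measure))
    \<le> ennreal (Cm * ln R)"
    by (rule cone_main_integral[OF n b(1) p'(1) rel(2) kp]) blast
  obtain Ce where Ce: "0 < Ce" "\<And>t0. 2 \<le> t0 \<Longrightarrow>
    (\<integral>\<^sup>+z. ennreal ((fst z + t0) powr (1 - p' - b) * (1 + norm (snd z)) powr (- 2 * p') * (1 / (fst z + t0 - norm (snd z)))) *
       indicator {z. fst z \<in> {0..} \<and> norm (snd z) \<le> fst z + 1} z \<partial>(lborel :: (real \<times> (real^'n)) measure))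
    \<le> ennreal (Ce * t0 powr - ((p' - 1) / 2))"
    by (rule cone_error_integral[OF n b(1) p'(1) rel(2)]) blast
  define c3 where "c3 = 3 powr p' * (3 powr \<bar>b\<bar> + 2 powr p' * 3 powr \<bar>b * (p' - 1) - k * p'\<bar> + \<mu> powr p' * 3 powr \<bar>b\<bar>)"
  have c3: "0 < c3" unfolding c3_def using \<mu>0 by (intro mult_pos_pos add_pos_pos) auto
  define K1 where "K1 = 60 * (real m)\<^sup>2 * C"
  have K1: "0 < K1" using m C by (simp add: K1_def)
  define V1 where "V1 = K1 * (c3 * Cm) powr (1 / p')"
  define V2 where "V2 = ((\<mu> * C) powr p' * Ce) powr (1 / p')"
  have V: "0 < V1" "0 < V2" using K1 c3 Cm Ce \<mu>0 C by (auto simp: V1_def V2_def)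
  show thesis
  proof (rule that[of "V1 + V2"])
    show "0 < V1 + V2" using V by simp
    fix \<epsilon> T t0 R B X :: real and u v :: "real \<Rightarrow> real^'n \<Rightarrow> real"
    assume es: "energy_supp \<mu> \<beta> p \<epsilon> T f g u v" and \<epsilon>: "0 < \<epsilon>" and R: "2 \<le> t0" "t0 \<le> R" "R < T" and B: "0 < B" and X: "0 < X"
      and leB: "(\<integral>\<^sup>+z. ennreal (\<bar>energy_supp.W T u z\<bar> powr p * ((fst z + t0) powr - b * late m R (fst z))) \<partial>lborel) \<le> ennreal B"
      and eqX: "(\<integral>\<^sup>+z. ennreal (\<bar>energy_supp.W T u z\<bar> powr p * ((fst z + t0) powr - b * cutoff m (fst z / R))) \<partial>lborel) = ennreal X"
    let ?W = "energy_supp.W T u"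
    have W0: "0 < fst z \<and> norm (snd z) \<le> fst z + 1" if "?W z \<noteq> 0" for z using energy_supp.W_nonzeroD[OF es that] by simp
    note Wm[measurable] = energy_supp.W_measurable[OF es]
    have R0: "0 < R" "1 \<le> R" "0 \<le> ln R" "0 < ln R" using R by auto
    define S where "S z = fst z + t0" for z :: "real \<times> (real^'n)"
    define r where "r z = norm (snd z)" for z :: "real \<times> (real^'n)"
    have [measurable]: "S \<in> borel_measurable borel" "r \<in> borel_measurable borel"
      unfolding S_def[abs_def] r_def[abs_def] by (auto intro!: borel_measurable_continuous_onI continuous_intros)
    have [measurable]: "(\<lambda>z :: real \<times> (real^'n). cutoff m (fst z / R)) \<in> borel_measurable borel"
      using R0 by (intro borel_measurable_continuous_onI continuous_time cutoff_scaled_continuous)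
    have [measurable]: "(\<lambda>z :: real \<times> (real^'n). late m R (fst z)) \<in> borel_measurable borel"
      by (rule measurable_compose[OF borel_measurable_fst_snd(1) late_measurable])
    define M where "M z = S z powr - b / R\<^sup>2 + 2 * (S z powr - k * (S z - r z) powr (- 1 / p')) / R + \<mu> * (1 + r z) powr -2 * S z powr - b / R" for z
    define Er where "Er z = \<mu> * C * ((1 + r z) powr -2 * (S z powr - k * (S z - r z) powr (- 1 / p')))" for z
    have M0: "0 \<le> M z" "0 \<le> Er z" for z using \<mu>0 C R0 by (auto simp: M_def Er_def intro!: add_nonneg_nonneg)
    have [measurable]: "M \<in> borel_measurable borel" "Er \<in> borel_measurable borel" unfolding M_def[abs_def] Er_def[abs_def] by measurable
    define \<eta> where "\<eta> z = cutoff m (fst z / R)" for z :: "real \<times> (real^'n)"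
    define L where "L z = late m R (fst z)" for z :: "real \<times> (real^'n)"
    have [measurable]: "\<eta> \<in> borel_measurable borel" "L \<in> borel_measurable borel" unfolding \<eta>_def[abs_def] L_def[abs_def] by measurable
    have \<eta>: "0 \<le> \<eta> z" "\<eta> z \<le> 1" "0 \<le> L z" for z by (auto simp: \<eta>_def L_def cutoff_range late_range)
    define eN where "eN N = C * ((b + 2 * real N) * (b + 2 * real N + 1)) * (((R + 1) / (R + t0))\<^sup>2) ^ N" for N
    have eN: "0 \<le> eN N" for N using C b by (simp add: eN_def)
    have en: "ennreal X \<le> (\<integral>\<^sup>+z. ennreal (\<bar>?W z\<bar> * (K1 * L z powr (1 / p) * M z + \<mu> * C * \<eta> z * ((1 + r z) powr -2 * (S z powr - k * (S z - r z) powr (- 1 / p')))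
       + eN N * \<eta> z)) \<partial>lborel)" for N
      using energy_supp.wave_energy[OF es p1 \<beta>2 less_imp_le[OF \<epsilon>] f0 g0 m b R(1) R0(2) R(3) C(2,3,4), of N]
      unfolding eqX by (simp only: K1_def L_def M_def S_def r_def \<eta>_def eN_def)
    define I1 where "I1 = (\<integral>\<^sup>+z. ennreal (\<bar>?W z\<bar> * (L z powr (1 / p) * M z)) \<partial>lborel)"
    define I2 where "I2 = (\<integral>\<^sup>+z. ennreal (\<bar>?W z\<bar> * (\<eta> z * Er z)) \<partial>lborel)"
    define I3 where "I3 = (\<integral>\<^sup>+z. ennreal (\<bar>?W z\<bar> * \<eta> z) \<partial>lborel)"
    have en': "ennreal X \<le> ennreal K1 * I1 + I2 + ennreal (eN N) * I3" for N
    proof -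
      have "(\<integral>\<^sup>+z. ennreal (\<bar>?W z\<bar> * (K1 * L z powr (1 / p) * M z + \<mu> * C * \<eta> z * ((1 + r z) powr -2 * (S z powr - k * (S z - r z) powr (- 1 / p')))
         + eN N * \<eta> z)) \<partial>lborel) = (\<integral>\<^sup>+z. ennreal K1 * ennreal (\<bar>?W z\<bar> * (L z powr (1 / p) * M z)) + ennreal (\<bar>?W z\<bar> * (\<eta> z * Er z))
         + ennreal (eN N) * ennreal (\<bar>?W z\<bar> * \<eta> z) \<partial>lborel)"
      proof (rule nn_integral_cong)
        fix z
        have "\<bar>?W z\<bar> * (K1 * L z powr (1 / p) * M z + \<mu> * C * \<eta> z * ((1 + r z) powr -2 * (S z powr - k * (S z - r z) powr (- 1 / p'))) + eN N * \<eta> z)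
          = K1 * (\<bar>?W z\<bar> * (L z powr (1 / p) * M z)) + \<bar>?W z\<bar> * (\<eta> z * Er z) + eN N * (\<bar>?W z\<bar> * \<eta> z)"
          by (simp add: Er_def algebra_simps)
        then show "ennreal (\<bar>?W z\<bar> * (K1 * L z powr (1 / p) * M z + \<mu> * C * \<eta> z * ((1 + r z) powr -2 * (S z powr - k * (S z - r z) powr (- 1 / p'))) + eN N * \<eta> z))
          = ennreal K1 * ennreal (\<bar>?W z\<bar> * (L z powr (1 / p) * M z)) + ennreal (\<bar>?W z\<bar> * (\<eta> z * Er z)) + ennreal (eN N) * ennreal (\<bar>?W z\<bar> * \<eta> z)"
          using K1 M0[of z] \<eta>[of z] eN[of N] by (simp add: ennreal_plus[symmetric] ennreal_mult'[symmetric] del: ennreal_plus)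
      qed
      also have "\<dots> = ennreal K1 * I1 + I2 + ennreal (eN N) * I3"
        unfolding I1_def I2_def I3_def by (simp add: nn_integral_add nn_integral_cmult)
      finally show ?thesis using en[of N] by simp
    qed
    let ?cone = "{z :: real \<times> (real^'n). fst z \<in> {R / 2..R} \<and> norm (snd z) \<le> fst z + 1}"
    let ?future = "{z :: real \<times> (real^'n). fst z \<in> {0..} \<and> norm (snd z) \<le> fst z + 1}"
    have "closed ?cone" "closed ?future" by (auto intro!: closed_Collect_conj closed_Collect_le continuous_intros)
    then have [measurable]: "?cone \<in> sets borel" "?future \<in> sets borel" by (auto intro: borel_closed)
    have pows: "S z powr (- b / p) * S z powr (b / p) = 1" if "0 < S z" for z using that by (simp add: powr_add[symmetric])
    have pw: "(\<bar>?W z\<bar> * (h powr (1 / p) * S z powr (- b / p))) powr p = \<bar>?W z\<bar> powr p * (S z powr - b * h)" if "0 \<le> h" for z and h :: real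
    proof -
      have "- b / p * p = - b" "1 / p * p = 1" using p1 by auto
      then show ?thesis using that by (simp only: powr_mult powr_powr powr_ge_zero abs_ge_zero mult_nonneg_nonneg powr_one mult_ac)
    qed
    have I1: "I1 \<le> ennreal (B powr (1 / p) * (c3 * (Cm * ln R)) powr (1 / p'))"
    proof -
      \<comment> \<open>The factor s^(-b/p) makes F^p the integrand of \<open>B\<close>; its inverse
        goes into \<open>G\<close>, which is handled by \<open>main_weight_bound\<close>.\<close>
      define F where "F z = \<bar>?W z\<bar> * (L z powr (1 / p) * S z powr (- b / p))" for z
      define G where "G z = S z powr (b / p) * M z * indicator ?cone z" for z
      have [measurable]: "F \<in> borel_measurable borel" "G \<in> borel_measurable borel" unfolding F_def[abs_def] G_def[abs_def] by measurable
      have "I1 \<le> (\<integral>\<^sup>+z. ennreal (F z * G z) \<partial>lborel)" unfolding I1_def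
      proof (intro nn_integral_mono ennreal_leI)
        fix z
        show "\<bar>?W z\<bar> * (L z powr (1 / p) * M z) \<le> F z * G z"
        proof (cases "?W z = 0 \<or> L z = 0")
          case False
          then have "z \<in> ?cone" using W0[of z] late_zero[OF R0(1), of "fst z" m] by (auto simp: L_def)
          moreover have "0 < S z" using W0[of z] False R by (simp add: S_def)
          ultimately have "F z * G z = \<bar>?W z\<bar> * (L z powr (1 / p) * (S z powr (- b / p) * S z powr (b / p)) * M z)"
            by (simp add: F_def G_def)
          then show ?thesis using pows[OF \<open>0 < S z\<close>] by simp
        qed (auto simp: F_def)
      qed
      also have "\<dots> \<le> ennreal (B powr (1 / p) * (c3 * (Cm * ln R)) powr (1 / p'))"
      proof (rule nn_holder[OF p1(1) p'(1,2)])
        show "(\<integral>\<^sup>+z. ennreal (F z powr p) \<partial>lborel) \<le> ennreal B" using leB unfolding F_def pw[OF \<eta>(3)] unfolding S_def L_def .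
        have "(\<integral>\<^sup>+z. ennreal (G z powr p') \<partial>lborel) \<le> (\<integral>\<^sup>+z. ennreal c3 * (ennreal (R powr - (2 * p' + b) + R powr (- p' - k * p' + b * (p' - 1)) * (1 / (fst z + t0 - norm (snd z)))
         + R powr (- p' - b) * (1 + norm (snd z)) powr (- 2 * p')) * indicator ?cone z) \<partial>lborel)"
        proof (rule nn_integral_mono)
          fix z
          show "ennreal (G z powr p') \<le> ennreal c3 * (ennreal (R powr - (2 * p' + b) + R powr (- p' - k * p' + b * (p' - 1)) * (1 / (fst z + t0 - norm (snd z)))
            + R powr (- p' - b) * (1 + norm (snd z)) powr (- 2 * p')) * indicator ?cone z)"
          proof (cases "z \<in> ?cone")
            case True
            have rs: "0 \<le> r z" "r z < S z" "R / 2 \<le> S z" "S z \<le> 3 * R" using True R by (auto simp: r_def S_def)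
            have "G z powr p' \<le> c3 * (R powr - (2 * p' + b) + R powr (- p' - k * p' + b * (p' - 1)) * (1 / (S z - r z)) + R powr (- p' - b) * (1 + r z) powr (- 2 * p'))"
              using main_weight_bound[OF p1 rs(1,2) R0(1) rs(3,4) less_imp_le[OF \<mu>0], of b k] True by (simp only: G_def M_def c3_def indicator_simps mult_1_right)
            then show ?thesis using True c3 by (simp add: ennreal_mult'[symmetric] S_def r_def ennreal_leI)
          qed (simp add: G_def)
        qed
        also have "\<dots> = ennreal c3 * (\<integral>\<^sup>+z. (ennreal (R powr - (2 * p' + b) + R powr (- p' - k * p' + b * (p' - 1)) * (1 / (fst z + t0 - norm (snd z)))
         + R powr (- p' - b) * (1 + norm (snd z)) powr (- 2 * p')) * indicator ?cone z) \<partial>lborel)" 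
          unfolding S_def[symmetric] r_def[symmetric] by (rule nn_integral_cmult) measurable
        also have "\<dots> \<le> ennreal c3 * ennreal (Cm * ln R)" by (rule mult_left_mono[OF Cm(2)[OF R(1,2)]]) simp
        also have "\<dots> = ennreal (c3 * (Cm * ln R))" using c3 by (simp add: ennreal_mult'[symmetric])
        finally show "(\<integral>\<^sup>+z. ennreal (G z powr p') \<partial>lborel) \<le> ennreal (c3 * (Cm * ln R))" .
      qed (use B c3 Cm R0 M0 in \<open>auto simp: F_def G_def\<close>)
      finally show ?thesis .
    qed
    have I2: "I2 \<le> ennreal (X powr (1 / p) * ((\<mu> * C) powr p' * (Ce * t0 powr - ((p' - 1) / 2))) powr (1 / p'))"
    proof -
      define F where "F z = \<bar>?W z\<bar> * (\<eta> z powr (1 / p) * S z powr (- b / p))" for z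
      define G where "G z = S z powr (b / p) * Er z * indicator ?future z" for z
      have [measurable]: "F \<in> borel_measurable borel" "G \<in> borel_measurable borel" unfolding F_def[abs_def] G_def[abs_def] by measurable
      have "I2 \<le> (\<integral>\<^sup>+z. ennreal (F z * G z) \<partial>lborel)" unfolding I2_def
      proof (intro nn_integral_mono ennreal_leI)
        fix z
        show "\<bar>?W z\<bar> * (\<eta> z * Er z) \<le> F z * G z"
        proof (cases "?W z = 0 \<or> \<eta> z = 0")
          case False
          then have "z \<in> ?future" using W0[of z] by auto
          moreover have "0 < S z" using W0[of z] False R by (simp add: S_def)
          ultimately have "F z * G z = \<bar>?W z\<bar> * (\<eta> z powr (1 / p) * (S z powr (- b / p) * S z powr (b / p)) * Er z)"
            by (simp add: F_def G_def)
          then have e: "F z * G z = \<bar>?W z\<bar> * (\<eta> z powr (1 / p) * Er z)" using pows[OF \<open>0 < S z\<close>] by simp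
          \<comment> \<open>Here the cutoff is undifferentiated, and 0 <= \<eta> <= 1 supplies the
            power 1/p that Hoelder needs.\<close>
          have "\<eta> z powr 1 \<le> \<eta> z powr (1 / p)" using th \<eta>[of z] by (intro powr_mono') auto
          then have "\<eta> z \<le> \<eta> z powr (1 / p)" using \<eta>[of z] by simp
          then show ?thesis unfolding e by (intro mult_left_mono mult_right_mono M0) auto
        qed (auto simp: F_def)
      qed
      also have "\<dots> \<le> ennreal (X powr (1 / p) * ((\<mu> * C) powr p' * (Ce * t0 powr - ((p' - 1) / 2))) powr (1 / p'))"
      proof (rule nn_holder[OF p1(1) p'(1,2)])
        show "(\<integral>\<^sup>+z. ennreal (F z powr p) \<partial>lborel) \<le> ennreal X" using eqX unfolding F_def pw[OF \<eta>(1)] unfolding S_def \<eta>_def by simp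
        have "(\<integral>\<^sup>+z. ennreal (G z powr p') \<partial>lborel) \<le> (\<integral>\<^sup>+z. ennreal ((\<mu> * C) powr p') * (ennreal ((fst z + t0) powr (1 - p' - b) * (1 + norm (snd z)) powr (- 2 * p') * (1 / (fst z + t0 - norm (snd z)))) *
          indicator ?future z) \<partial>lborel)"
        proof (rule nn_integral_mono)
          fix z
          show "ennreal (G z powr p') \<le> ennreal ((\<mu> * C) powr p') * (ennreal ((fst z + t0) powr (1 - p' - b) * (1 + norm (snd z)) powr (- 2 * p') * (1 / (fst z + t0 - norm (snd z)))) *
            indicator ?future z)"
          proof (cases "z \<in> ?future")
            case True
            have rs: "0 \<le> r z" "r z < S z" using True R by (auto simp: r_def S_def)
            have "G z powr p' = (\<mu> * C) powr p' * (S z powr (1 - p' - b) * (1 + r z) powr (- 2 * p') * (1 / (S z - r z)))"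
              using error_weight_bound[OF p1 kp rs less_imp_le[OF \<mu>0] less_imp_le[OF C(1)]] True by (simp only: G_def Er_def indicator_simps mult_1_right)
            then show ?thesis using True by (simp add: ennreal_mult'[symmetric] S_def r_def ennreal_leI)
          qed (simp add: G_def)
        qed
        also have "\<dots> = ennreal ((\<mu> * C) powr p') * (\<integral>\<^sup>+z. (ennreal ((fst z + t0) powr (1 - p' - b) * (1 + norm (snd z)) powr (- 2 * p') * (1 / (fst z + t0 - norm (snd z)))) *
          indicator ?future z) \<partial>lborel)"
          unfolding S_def[symmetric] r_def[symmetric] by (rule nn_integral_cmult) measurable
        also have "\<dots> \<le> ennreal ((\<mu> * C) powr p') * ennreal (Ce * t0 powr - ((p' - 1) / 2))" by (rule mult_left_mono[OF Ce(2)[OF R(1)]]) simp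
        also have "\<dots> = ennreal ((\<mu> * C) powr p' * (Ce * t0 powr - ((p' - 1) / 2)))" by (simp add: ennreal_mult'[symmetric])
        finally show "(\<integral>\<^sup>+z. ennreal (G z powr p') \<partial>lborel) \<le> ennreal ((\<mu> * C) powr p' * (Ce * t0 powr - ((p' - 1) / 2)))" .
      qed (use X C \<mu>0 Ce R M0 in \<open>auto simp: F_def G_def\<close>)
      finally show ?thesis .
    qed
    define J1 where "J1 = B powr (1 / p) * (c3 * (Cm * ln R)) powr (1 / p')"
    define J2 where "J2 = X powr (1 / p) * ((\<mu> * C) powr p' * (Ce * t0 powr - ((p' - 1) / 2))) powr (1 / p')"
    have J: "0 \<le> J1" "0 \<le> J2" by (auto simp: J1_def J2_def)
    \<comment> \<open>Its size is irrelevant: for fixed \<open>R\<close> it does not depend on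
      \<open>N\<close>, while \<open>eN N\<close> tends to 0.\<close>
    have "I3 < \<infinity>"
    proof -
      have "integrable lborel (\<lambda>z. ?W z * \<eta> z)"
      proof (rule energy_supp.W_integrable(1)[OF es, where B=1 and ?T1.0=R])
        show "\<eta> z = 0" if "R < fst z" for z using that R0 cutoff_ge_1[OF m(1), of "fst z / R"] by (simp add: \<eta>_def)
      qed (use R R0 \<eta> in auto)
      then have "(\<integral>\<^sup>+z. ennreal (norm (?W z * \<eta> z)) \<partial>lborel) < \<infinity>" unfolding integrable_iff_bounded by simp
      then show ?thesis using \<eta> by (simp add: I3_def abs_mult)
    qed
    then obtain J3 where J3: "0 \<le> J3" "I3 = ennreal J3" by (cases I3) auto
    have fin: "X \<le> K1 * J1 + J2 + eN N * J3" for N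
    proof -
      have "ennreal X \<le> ennreal K1 * ennreal J1 + ennreal J2 + ennreal (eN N) * ennreal J3"
        using en'[of N] I1 I2 unfolding J3(2) J1_def[symmetric] J2_def[symmetric]
        by (meson add_mono mult_left_mono order_refl order_trans zero_le)
      also have "\<dots> = ennreal (K1 * J1 + J2 + eN N * J3)"
        using K1 J J3(1) eN[of N] by (simp add: ennreal_mult'[symmetric])
      finally show ?thesis using K1 J J3(1) eN[of N] by (subst (asm) ennreal_le_iff) auto
    qed
    have "(\<lambda>N. K1 * J1 + J2 + eN N * J3) \<longlonglongrightarrow> K1 * J1 + J2 + C * 0 * J3"
    proof (intro tendsto_intros)
      have "0 \<le> (R + 1) / (R + t0)" "(R + 1) / (R + t0) < 1" using R by auto
      then have "0 \<le> ((R + 1) / (R + t0))\<^sup>2" "((R + 1) / (R + t0))\<^sup>2 < 1" by (auto simp: power_less_one_iff)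
      from tendsto_mult_left[OF quadratic_geometric_tendsto_0[OF this, of b], of C]
      show "eN \<longlonglongrightarrow> C * 0" unfolding eN_def[abs_def] by (simp add: mult.assoc)
    qed
    from LIMSEQ_le_const[OF this, of X] have "X \<le> K1 * J1 + J2" using fin by auto
    moreover have "K1 * J1 = V1 * ((ln R) powr (1 / p') * B powr (1 / p))"
      using c3 Cm R0 by (simp add: J1_def V1_def powr_mult)
    moreover have "J2 = V2 * (t0 powr - ((p' - 1) / (2 * p')) * X powr (1 / p))"
    proof -
      have "- ((p' - 1) / 2) * (1 / p') = - ((p' - 1) / (2 * p'))" by simp
      then show ?thesis using Ce C \<mu>0 R by (simp add: J2_def V2_def powr_mult powr_powr)
    qed
    moreover have "V1 * ((ln R) powr (1 / p') * B powr (1 / p)) + V2 * (t0 powr - ((p' - 1) / (2 * p')) * X powr (1 / p))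
      \<le> (V1 + V2) * ((ln R) powr (1 / p') * B powr (1 / p)) + (V1 + V2) * (t0 powr - ((p' - 1) / (2 * p')) * X powr (1 / p))"
      using V by (intro add_mono mult_right_mono mult_nonneg_nonneg) auto
    ultimately show "X \<le> (V1 + V2) * ((ln R) powr (1 / p') * B powr (1 / p) + t0 powr - ((p' - 1) / (2 * p')) * X powr (1 / p))"
      by (simp only: distrib_left)
  qed
qed

section \<open>Blow-up\<close>

text \<open>Exchange the integrals. For a fixed time t > 0, \<open>late m (exp \<sigma>) t\<close>
  is nonzero only for \<sigma> between ln t and ln t + ln 2, an interval of length ln 2, and there
  it is at most the cutoff at the larger scale exp \<tau>.\<close>

lemma log_averaging:
  fixes h :: "real \<times> (real^'n) \<Rightarrow> real"
  assumes [measurable]: "h \<in> borel_measurable borel" and h: "\<And>z. 0 \<le> h z" "\<And>z. h z \<noteq> 0 \<Longrightarrow> 0 < fst z"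
  shows "(\<lambda>\<sigma>. \<integral>\<^sup>+z. ennreal (h z * late m (exp \<sigma>) (fst z)) \<partial>lborel) \<in> borel_measurable borel"
    "(\<integral>\<^sup>+\<sigma>. (\<integral>\<^sup>+z. ennreal (h z * late m (exp \<sigma>) (fst z)) \<partial>lborel) * indicator {\<tau>0..\<tau>} \<sigma> \<partial>lborel)
      \<le> ennreal (ln 2) * (\<integral>\<^sup>+z. ennreal (h z * cutoff m (fst z / exp \<tau>)) \<partial>lborel)"
proof -
  note [measurable] = borel_measurable_fst_snd(1)
  have [measurable]: "cutoff m \<in> borel_measurable borel" by (intro borel_measurable_continuous_onI cutoff_continuous)
  have fm[measurable]: "(\<lambda>(\<sigma>, z). ennreal (h z * late m (exp \<sigma>) (fst z))) \<in> borel_measurable (borel \<Otimes>\<^sub>M borel)"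
    unfolding late_def by measurable
  have lb: "borel_measurable ((lborel :: real measure) \<Otimes>\<^sub>M (lborel :: (real \<times> (real^'n)) measure)) = borel_measurable (borel \<Otimes>\<^sub>M borel)"
    by (intro measurable_cong_sets sets_pair_measure_cong) auto
  have m1: "(\<lambda>\<sigma>. \<integral>\<^sup>+z. ennreal (h z * late m (exp \<sigma>) (fst z)) \<partial>lborel) \<in> borel_measurable lborel"
    using lborel.borel_measurable_nn_integral[of "\<lambda>\<sigma> z. ennreal (h z * late m (exp \<sigma>) (fst z))" lborel] fm lb by simp
  then show "(\<lambda>\<sigma>. \<integral>\<^sup>+z. ennreal (h z * late m (exp \<sigma>) (fst z)) \<partial>lborel) \<in> borel_measurable borel" by simp
  have "(\<integral>\<^sup>+\<sigma>. (\<integral>\<^sup>+z. ennreal (h z * late m (exp \<sigma>) (fst z)) \<partial>lborel) * indicator {\<tau>0..\<tau>} \<sigma> \<partial>lborel)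
    = (\<integral>\<^sup>+\<sigma>. (\<integral>\<^sup>+z. ennreal (h z * late m (exp \<sigma>) (fst z)) * indicator {\<tau>0..\<tau>} \<sigma> \<partial>lborel) \<partial>lborel)"
    by (intro nn_integral_cong nn_integral_multc[symmetric]) (simp add: late_def)
  also have "\<dots> = (\<integral>\<^sup>+z. (\<integral>\<^sup>+\<sigma>. ennreal (h z * late m (exp \<sigma>) (fst z)) * indicator {\<tau>0..\<tau>} \<sigma> \<partial>lborel) \<partial>lborel)"
  proof (rule lborel_pair.Fubini'[symmetric])
    show "(\<lambda>(\<sigma>, z). ennreal (h z * late m (exp \<sigma>) (fst z)) * indicator {\<tau>0..\<tau>} \<sigma>) \<in> borel_measurable (lborel \<Otimes>\<^sub>M lborel)"
      unfolding lb late_def by measurable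
  qed
  also have "\<dots> \<le> (\<integral>\<^sup>+z. ennreal (ln 2) * ennreal (h z * cutoff m (fst z / exp \<tau>)) \<partial>lborel)"
  proof (rule nn_integral_mono)
    fix z
    let ?t = "fst z" and ?c = "h z * cutoff m (fst z / exp \<tau>)"
    have c: "0 \<le> ?c" using h by (simp add: cutoff_range)
    show "(\<integral>\<^sup>+\<sigma>. ennreal (h z * late m (exp \<sigma>) ?t) * indicator {\<tau>0..\<tau>} \<sigma> \<partial>lborel) \<le> ennreal (ln 2) * ennreal ?c"
    proof (cases "h z = 0")
      case False
      then have t: "0 < ?t" by (rule h)
      have "(\<integral>\<^sup>+\<sigma>. ennreal (h z * late m (exp \<sigma>) ?t) * indicator {\<tau>0..\<tau>} \<sigma> \<partial>lborel) \<le> (\<integral>\<^sup>+\<sigma>. ennreal ?c * indicator {ln ?t..ln ?t + ln 2} \<sigma> \<partial>lborel)"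
      proof (rule nn_integral_mono)
        fix \<sigma> :: real
        show "ennreal (h z * late m (exp \<sigma>) ?t) * indicator {\<tau>0..\<tau>} \<sigma> \<le> ennreal ?c * indicator {ln ?t..ln ?t + ln 2} \<sigma>"
        proof (cases "late m (exp \<sigma>) ?t \<noteq> 0 \<and> \<sigma> \<in> {\<tau>0..\<tau>}")
          case True
          then have tt: "exp \<sigma> / 2 \<le> ?t" "?t \<le> exp \<sigma>" using late_zero[of "exp \<sigma>" ?t m] by force+
          then have "ln ?t \<le> \<sigma>" using t by (metis exp_gt_zero ln_exp ln_le_cancel_iff)
          moreover have "\<sigma> \<le> ln (2 * ?t)" using tt t by (subst ln_ge_iff) auto
          then have "\<sigma> \<le> ln ?t + ln 2" using t by (simp add: ln_mult)
          moreover have "late m (exp \<sigma>) ?t \<le> cutoff m (?t / exp \<tau>)"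
          proof (rule order_trans[OF late_range(3) cutoff_antimono])
            show "?t / exp \<tau> \<le> ?t / exp \<sigma>" using t True by (intro divide_left_mono) auto
          qed
          then have "h z * late m (exp \<sigma>) ?t \<le> ?c" using h(1) by (intro mult_left_mono)
          ultimately show ?thesis by (auto simp: indicator_def intro: ennreal_leI)
        qed auto
      qed
      also have "\<dots> = ennreal ?c * emeasure lborel {ln ?t..ln ?t + ln 2}" by (rule nn_integral_cmult_indicator) simp
      also have "\<dots> = ennreal (ln 2) * ennreal ?c" by (simp add: mult.commute)
      finally show ?thesis .
    qed simp
  qed
  also have "\<dots> = ennreal (ln 2) * (\<integral>\<^sup>+z. ennreal (h z * cutoff m (fst z / exp \<tau>)) \<partial>lborel)" by (rule nn_integral_cmult) measurable
  finally show "(\<integral>\<^sup>+\<sigma>. (\<integral>\<^sup>+z. ennreal (h z * late m (exp \<sigma>) (fst z)) \<partial>lborel) * indicator {\<tau>0..\<tau>} \<sigma> \<partial>lborel)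
      \<le> ennreal (ln 2) * (\<integral>\<^sup>+z. ennreal (h z * cutoff m (fst z / exp \<tau>)) \<partial>lborel)" .
qed

text \<open>Up to L/2 the constant lower bound makes the running integral y of \<open>Bf\<close>
  grow at least linearly, to c L/4. From L/2 to 3L/4 the relation y <= (ln 2) X gives y' >= \<kappa>
  (ln 2)^(-p) y^p in integrated form, and \<open>doubling_blowup\<close> bounds the length L/4 of
  that interval.\<close>

lemma log_blowup:
  fixes Bf :: "real \<Rightarrow> ennreal" and X :: "real \<Rightarrow> real" and L p c \<kappa> \<tau>0 :: real
  assumes p: "1 < p" and c: "0 < c" and \<kappa>: "0 < \<kappa>" and L: "0 < L" "\<tau>0 \<le> L / 4" and m[measurable]: "Bf \<in> borel_measurable borel"
    and Bc: "\<And>\<sigma>. \<tau>0 \<le> \<sigma> \<Longrightarrow> \<sigma> \<le> 3 * L / 4 \<Longrightarrow> ennreal c \<le> Bf \<sigma>"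
    and X0: "\<And>\<sigma>. \<tau>0 \<le> \<sigma> \<Longrightarrow> \<sigma> \<le> 3 * L / 4 \<Longrightarrow> 0 \<le> X \<sigma>"
    and BX: "\<And>\<sigma>. \<tau>0 \<le> \<sigma> \<Longrightarrow> \<sigma> \<le> 3 * L / 4 \<Longrightarrow> ennreal (\<kappa> * X \<sigma> powr p) \<le> Bf \<sigma>"
    and int: "\<And>\<tau>. \<tau>0 \<le> \<tau> \<Longrightarrow> \<tau> \<le> 3 * L / 4 \<Longrightarrow> (\<integral>\<^sup>+\<sigma>. Bf \<sigma> * indicator {\<tau>0..\<tau>} \<sigma> \<partial>lborel) \<le> ennreal (ln 2 * X \<tau>)"
  shows "L / 4 \<le> (c * L / 4) powr (1 - p) / (\<kappa> * ln 2 powr - p) * (1 / (1 - 2 powr (1 - p)))"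
proof -
  define Y where "Y \<tau> = (\<integral>\<^sup>+\<sigma>. Bf \<sigma> * indicator {\<tau>0..\<tau>} \<sigma> \<partial>lborel)" for \<tau>
  define y where "y \<tau> = enn2real (Y \<tau>)" for \<tau>
  have Yy: "Y \<tau> = ennreal (y \<tau>)" "y \<tau> \<le> ln 2 * X \<tau>" "0 \<le> y \<tau>" if "\<tau>0 \<le> \<tau>" "\<tau> \<le> 3 * L / 4" for \<tau>
  proof -
    have le: "Y \<tau> \<le> ennreal (ln 2 * X \<tau>)" unfolding Y_def by (rule int[OF that])
    then have "Y \<tau> < \<infinity>" by (rule order_le_less_trans) simp
    then show e: "Y \<tau> = ennreal (y \<tau>)" by (simp add: y_def)
    show "0 \<le> y \<tau>" by (simp add: y_def)
    show "y \<tau> \<le> ln 2 * X \<tau>" using le X0[OF that] unfolding e by (subst (asm) ennreal_le_iff) auto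
  qed
  \<comment> \<open>A lower bound \<open>d\<close> for \<open>Bf\<close> on an interval adds d times
    its length to y. This replaces differentiating y and, with d = 0, gives its
    monotonicity.\<close>
  have step: "y \<tau>1 + (\<tau>2 - \<tau>1) * d \<le> y \<tau>2"
    if \<tau>: "\<tau>0 \<le> \<tau>1" "\<tau>1 \<le> \<tau>2" "\<tau>2 \<le> 3 * L / 4" and d: "0 \<le> d" "\<And>\<sigma>. \<tau>1 \<le> \<sigma> \<Longrightarrow> \<sigma> \<le> \<tau>2 \<Longrightarrow> ennreal d \<le> Bf \<sigma>" for \<tau>1 \<tau>2 d
  proof -
    have "ennreal (y \<tau>1) + ennreal d * ennreal (\<tau>2 - \<tau>1) = Y \<tau>1 + (\<integral>\<^sup>+\<sigma>. ennreal d * indicator {\<tau>1<..\<tau>2} \<sigma> \<partial>lborel)"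
      using \<tau> Yy(1)[of \<tau>1] by (simp add: nn_integral_cmult_indicator)
    also have "\<dots> = (\<integral>\<^sup>+\<sigma>. Bf \<sigma> * indicator {\<tau>0..\<tau>1} \<sigma> + ennreal d * indicator {\<tau>1<..\<tau>2} \<sigma> \<partial>lborel)"
      unfolding Y_def by (rule nn_integral_add[symmetric]) auto
    also have "\<dots> \<le> Y \<tau>2" unfolding Y_def
    proof (rule nn_integral_mono)
      fix \<sigma>
      show "Bf \<sigma> * indicator {\<tau>0..\<tau>1} \<sigma> + ennreal d * indicator {\<tau>1<..\<tau>2} \<sigma> \<le> Bf \<sigma> * indicator {\<tau>0..\<tau>2} \<sigma>"
        using \<tau> d(2)[of \<sigma>] by (auto simp: indicator_def)
    qed
    also have "\<dots> = ennreal (y \<tau>2)" using \<tau> by (intro Yy) auto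
    finally have "ennreal (y \<tau>1 + d * (\<tau>2 - \<tau>1)) \<le> ennreal (y \<tau>2)"
      using \<tau> d Yy(3)[of \<tau>1] by (simp add: ennreal_mult'[symmetric] ennreal_plus[symmetric] del: ennreal_plus)
    then have "y \<tau>1 + d * (\<tau>2 - \<tau>1) \<le> y \<tau>2" using \<tau> Yy(3)[of \<tau>2] by (subst (asm) ennreal_le_iff) auto
    then show ?thesis by (simp add: mult.commute)
  qed
  have "3 * L / 4 - L / 2 \<le> (c * L / 4) powr (1 - p) / (\<kappa> * ln 2 powr - p) * (1 / (1 - 2 powr (1 - p)))"
  proof (rule doubling_blowup[where y=y])
    show "0 < \<kappa> * ln 2 powr - p" using \<kappa> by simp
    show "0 < c * L / 4" using c L by simp
    \<comment> \<open>Since \<tau>0 <= L/4, at least the length L/4 is available before L/2.\<close>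
    show "c * L / 4 \<le> y (L / 2)"
    proof -
      have "y \<tau>0 + (L / 2 - \<tau>0) * c \<le> y (L / 2)" using L c Bc by (intro step) auto
      moreover have "L / 4 * c \<le> (L / 2 - \<tau>0) * c" using L c by (intro mult_right_mono) auto
      moreover have "0 \<le> y \<tau>0" using L by (intro Yy) auto
      ultimately show ?thesis by (simp add: mult.commute)
    qed
    fix \<tau>1 \<tau>2 assume \<tau>: "L / 2 \<le> \<tau>1" "\<tau>1 \<le> \<tau>2" "\<tau>2 \<le> 3 * L / 4"
    have "y \<tau>1 + (\<tau>2 - \<tau>1) * (\<kappa> * ln 2 powr - p * y \<tau>1 powr p) \<le> y \<tau>2"
    proof (rule step)
      fix \<sigma> assume \<sigma>: "\<tau>1 \<le> \<sigma>" "\<sigma> \<le> \<tau>2"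
      have "\<kappa> * ln 2 powr - p * y \<tau>1 powr p \<le> \<kappa> * X \<sigma> powr p"
      proof -
        have "y \<tau>1 \<le> y \<sigma>" using step[of \<tau>1 \<sigma> 0] \<tau> \<sigma> L by simp
        also have "\<dots> \<le> ln 2 * X \<sigma>" using \<tau> \<sigma> L by (intro Yy) auto
        finally have "y \<tau>1 powr p \<le> (ln 2 * X \<sigma>) powr p" using p \<tau> L Yy(3)[of \<tau>1] by (intro powr_mono2) auto
        also have "\<dots> = ln 2 powr p * X \<sigma> powr p" by (rule powr_mult)
        finally have "ln 2 powr - p * y \<tau>1 powr p \<le> ln 2 powr - p * (ln 2 powr p * X \<sigma> powr p)" by (rule mult_left_mono) simp
        also have "\<dots> = X \<sigma> powr p" by (simp add: mult.assoc[symmetric] powr_add[symmetric])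
        finally show ?thesis using \<kappa> by (simp add: mult.assoc)
      qed
      then have "ennreal (\<kappa> * ln 2 powr - p * y \<tau>1 powr p) \<le> ennreal (\<kappa> * X \<sigma> powr p)" by (rule ennreal_leI)
      also have "\<dots> \<le> Bf \<sigma>" using \<tau> \<sigma> L by (intro BX) auto
      finally show "ennreal (\<kappa> * ln 2 powr - p * y \<tau>1 powr p) \<le> Bf \<sigma>" .
    qed (use \<tau> L \<kappa> in auto)
    then show "(\<tau>2 - \<tau>1) * (\<kappa> * ln 2 powr - p) * y \<tau>1 powr p \<le> y \<tau>2 - y \<tau>1" by (simp add: mult.assoc)
  qed (use p L in auto)
  then show ?thesis by simp
qed

text \<open>The quadratic equation for p in the forms used later, with b = k - 1/p. The relation n -
  k p = b makes the lower bound independent of R once the weight s^(-b) is included; n + 1 = 2p' + b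
  cancels the powers of R in the upper bound.\<close>

lemma strauss_exponent_facts:
  assumes n: "2 \<le> n" and p: "p = strauss_exponent n"
  defines "k \<equiv> (real n - 1) / 2"
  shows "1 < p" "0 < k - 1 / p" "real n - k * p = k - 1 / p" "real n + 1 = 2 * (p / (p - 1)) + (k - 1 / p)"
proof -
  define x where "x = real n"
  have x: "2 \<le> x" using n by (simp add: x_def)
  define s where "s = sqrt (x\<^sup>2 + 10 * x - 7)"
  have s2: "s\<^sup>2 = x\<^sup>2 + 10 * x - 7" unfolding s_def using x zero_le_power2[of x] by (intro real_sqrt_pow2) linarith
  have pe: "p = (x + 1 + s) / (2 * (x - 1))" unfolding p strauss_exponent_eq[OF n] s_def x_def ..
  have sl: "x + 1 < s" unfolding s_def by (rule real_less_rsqrt) (use x in \<open>simp add: power2_eq_square algebra_simps\<close>)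
  then show p1: "1 < p" unfolding pe using x by (simp add: field_simps)
  have e: "2 * (x - 1) * p - (x + 1) = s" unfolding pe using x by (simp add: field_simps)
  have "(2 * (x - 1) * p - (x + 1))\<^sup>2 - s\<^sup>2 = - 4 * (x - 1) * strauss_gamma p n"
    unfolding s2 strauss_gamma_def x_def[symmetric] by (simp add: power2_eq_square algebra_simps)
  then have "strauss_gamma p n = 0" unfolding e using x by simp
  then have g: "(x - 1) * (p * p) = 2 + (x + 1) * p" unfolding strauss_gamma_def x_def[symmetric] by (simp add: power2_eq_square)
  have "(x - 1) * p = (x - 1) * (p * p) / p" using p1 by simp
  also have "\<dots> = 2 / p + (x + 1)" unfolding g using p1 by (simp add: add_divide_distrib)
  finally have kp: "k * p = 1 / p + (x + 1) / 2" unfolding k_def x_def[symmetric] by simp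
  have "1 < (x + 1) / 2" using x by simp
  also have "\<dots> < k * p" unfolding kp using p1 by simp
  finally have "1 < k * p" .
  then show "0 < k - 1 / p" using p1 by (simp add: field_simps)
  show "real n - k * p = k - 1 / p" unfolding kp by (simp add: k_def x_def field_simps)
  show "real n + 1 = 2 * (p / (p - 1)) + (k - 1 / p)"
  proof -
    have "2 * (p / (p - 1)) = (x + 3) / 2 + 1 / p" using p1 g by (simp add: field_simps)
    then show ?thesis by (simp add: k_def x_def field_simps)
  qed
qed

text \<open>The lower bound gives X >= B >= c \<epsilon>^p, hence X^(1/p) = X X^(-1/p') is at most X
  times a negative power of \<epsilon>. A large enough t0 turns the damping error into at most X/2,
  which is absorbed on the left.\<close>

lemma absorbed_bounds:
  fixes \<mu> \<beta> p p' b k :: real and f g :: "real^'n \<Rightarrow> real"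
  assumes n: "2 \<le> CARD('n)" and \<mu>0: "0 < \<mu>" and \<beta>2: "2 \<le> \<beta>" and p1: "1 < p" "p' = p / (p - 1)"
    and b: "0 < b" "k = b + 1 / p" and rel: "k = (real CARD('n) - 1) / 2" "real CARD('n) + 1 = 2 * p' + b" "real CARD('n) - k * p = b"
    and f0: "AE x in lborel. 0 \<le> f x" and g0: "AE x in lborel. 0 \<le> g x"
    and g: "L2 g" "AE x in lborel. 1 < norm x \<longrightarrow> g x = 0" "\<not> (AE x in lborel. g x = 0)"
    and m: "3 \<le> m" "real m / p \<le> real m - 2"
  obtains c \<kappa> A M where "0 < c" "0 < \<kappa>" "2 \<le> A" "0 \<le> M"
    "\<And>\<epsilon> T u v R t0. energy_supp \<mu> \<beta> p \<epsilon> T f g u v \<Longrightarrow> 0 < \<epsilon> \<Longrightarrow> \<epsilon> \<le> 1 \<Longrightarrow> t0 = A * \<epsilon> powr - M \<Longrightarrow> t0 \<le> R \<Longrightarrow> R < T \<Longrightarrow>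
      \<exists>X B. (\<integral>\<^sup>+z. ennreal (\<bar>energy_supp.W T u z\<bar> powr p * (fst z + t0) powr - b * late m R (fst z)) \<partial>lborel) = ennreal B \<and>
        (\<integral>\<^sup>+z. ennreal (\<bar>energy_supp.W T u z\<bar> powr p * (fst z + t0) powr - b * cutoff m (fst z / R)) \<partial>lborel) = ennreal X \<and>
        0 \<le> X \<and> c * \<epsilon> powr p \<le> B \<and> \<kappa> * (ln R) powr (1 - p) * X powr p \<le> B"
proof -
  let ?n = "real CARD('n)"
  have p': "1 < p'" "p / p' = p - 1" "1 / p + 1 / p' = 1" using p1(1) unfolding p1(2) by (simp_all add: field_simps)
  obtain c0 where c0: "0 < c0" "\<And>\<epsilon> T u v R A. energy_supp \<mu> \<beta> p \<epsilon> T f g u v \<Longrightarrow> 0 < \<epsilon> \<Longrightarrow> 1 \<le> R \<Longrightarrow> R < T \<Longrightarrow> 0 < A \<Longrightarrow>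
     (\<integral>\<^sup>+z. ennreal (\<bar>energy_supp.W T u z\<bar> powr p * late m R (fst z)) \<partial>lborel) \<le> ennreal A \<Longrightarrow>
     c0 * \<epsilon> powr p * R powr (?n - k * p) \<le> A"
    by (rule lower_bound[OF n rel(1) less_imp_le[OF \<mu>0] \<beta>2 p1(1) g f0 g0 m]) blast
  obtain C1 where C1: "0 < C1" "\<And>\<epsilon> T u v t0 R B X. energy_supp \<mu> \<beta> p \<epsilon> T f g u v \<Longrightarrow> 0 < \<epsilon> \<Longrightarrow> 2 \<le> t0 \<Longrightarrow> t0 \<le> R \<Longrightarrow> R < T \<Longrightarrow> 0 < B \<Longrightarrow> 0 < X \<Longrightarrow>
     (\<integral>\<^sup>+z. ennreal (\<bar>energy_supp.W T u z\<bar> powr p * ((fst z + t0) powr - b * late m R (fst z))) \<partial>lborel) \<le> ennreal B \<Longrightarrow>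
     (\<integral>\<^sup>+z. ennreal (\<bar>energy_supp.W T u z\<bar> powr p * ((fst z + t0) powr - b * cutoff m (fst z / R))) \<partial>lborel) = ennreal X \<Longrightarrow>
     X \<le> C1 * ((ln R) powr (1 / p') * B powr (1 / p) + t0 powr - ((p' - 1) / (2 * p')) * X powr (1 / p))"
    by (rule upper_bound[OF n \<mu>0 \<beta>2 p1 b rel(1,2) f0 g0 m]) blast
  \<comment> \<open>For t <= R and t0 <= R one has t + t0 <= 2R, so the weight is at least
    (2R)^(-b); the R^b of the lower bound cancels.\<close>
  define c where "c = c0 * 2 powr - b"
  have c: "0 < c" using c0 by (simp add: c_def)
  define \<delta> where "\<delta> = (p' - 1) / (2 * p')"
  have \<delta>: "0 < \<delta>" using p' by (simp add: \<delta>_def)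
  \<comment> \<open>Makes t0^(-\<delta>) proportional to \<epsilon>^(p/p'), which compensates
    (\<epsilon>^p)^(-1/p') exactly.\<close>
  define M where "M = p / p' / \<delta>"
  have M: "0 \<le> M" "M * \<delta> = p / p'" using p1 p' \<delta> by (auto simp: M_def)
  \<comment> \<open>Large enough for the remaining constants to multiply to at most 1/2; at least 2,
    so that t0 >= 2 whenever \<epsilon> <= 1.\<close>
  define A where "A = max 2 ((2 * C1 * c powr - (1 / p')) powr (1 / \<delta>))"
  have A: "2 \<le> A" "2 * C1 * c powr - (1 / p') \<le> A powr \<delta>"
  proof -
    show "2 \<le> A" by (simp add: A_def)
    have "2 * C1 * c powr - (1 / p') = ((2 * C1 * c powr - (1 / p')) powr (1 / \<delta>)) powr \<delta>" using C1 c \<delta> by (simp add: powr_powr)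
    also have "\<dots> \<le> A powr \<delta>" using \<delta> by (intro powr_mono2) (auto simp: A_def)
    finally show "2 * C1 * c powr - (1 / p') \<le> A powr \<delta>" .
  qed
  define \<kappa> where "\<kappa> = (2 * C1) powr - p"
  show thesis
  proof (rule that[OF c _ A(1) M(1), of \<kappa>])
    show "0 < \<kappa>" using C1 by (simp add: \<kappa>_def)
    fix \<epsilon> T R t0 :: real and u v :: "real \<Rightarrow> real^'n \<Rightarrow> real"
    assume es: "energy_supp \<mu> \<beta> p \<epsilon> T f g u v" and \<epsilon>: "0 < \<epsilon>" "\<epsilon> \<le> 1" and t0: "t0 = A * \<epsilon> powr - M" and R: "t0 \<le> R" "R < T"
    let ?W = "energy_supp.W T u"
    note Wm[measurable] = energy_supp.W_measurable[OF es]
    have W0: "0 < fst z \<and> norm (snd z) \<le> fst z + 1" if "?W z \<noteq> 0" for z using energy_supp.W_nonzeroD[OF es that] by simp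
    have "1 \<le> \<epsilon> powr - M" using powr_mono2'[of "- M" \<epsilon> 1] \<epsilon> M by simp
    then have "A * 1 \<le> t0" unfolding t0 using A by (intro mult_left_mono) auto
    then have t02: "2 \<le> t0" using A by simp
    have R0: "2 \<le> R" "0 < R" "1 \<le> R" "0 \<le> R" "0 < ln R" using R t02 by auto
    have [measurable]: "(\<lambda>z :: real \<times> (real^'n). cutoff m (fst z / R)) \<in> borel_measurable borel"
      using R0 by (intro borel_measurable_continuous_onI continuous_time cutoff_scaled_continuous)
    have [measurable]: "(\<lambda>z :: real \<times> (real^'n). late m R (fst z)) \<in> borel_measurable borel"
      by (rule measurable_compose[OF borel_measurable_fst_snd(1) late_measurable])
    have [measurable]: "(\<lambda>z :: real \<times> (real^'n). fst z) \<in> borel_measurable borel" by (rule borel_measurable_fst_snd)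
    define XX where "XX = (\<integral>\<^sup>+z. ennreal (\<bar>?W z\<bar> powr p * ((fst z + t0) powr - b * cutoff m (fst z / R))) \<partial>lborel)"
    define BB where "BB = (\<integral>\<^sup>+z. ennreal (\<bar>?W z\<bar> powr p * ((fst z + t0) powr - b * late m R (fst z))) \<partial>lborel)"
    have BX: "BB \<le> XX" unfolding BB_def XX_def
      by (intro nn_integral_mono ennreal_leI mult_left_mono late_range) auto
    have "XX < \<infinity>"
    proof -
      have "integrable lborel (\<lambda>z. \<bar>?W z\<bar> powr p * ((fst z + t0) powr - b * cutoff m (fst z / R)))"
      proof (rule energy_supp.W_integrable(2)[OF es, where B=1 and ?T1.0=R])
        show "(fst z + t0) powr - b * cutoff m (fst z / R) = 0" if "R < fst z" for z :: "real \<times> (real^'n)"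
          using that R0 cutoff_ge_1[OF m(1), of "fst z / R"] by simp
        show "\<bar>(fst z + t0) powr - b * cutoff m (fst z / R)\<bar> \<le> 1" if "0 < fst z" for z :: "real \<times> (real^'n)"
        proof -
          have "(fst z + t0) powr - b \<le> 1" using powr_mono2'[of "- b" 1 "fst z + t0"] that t02 b by simp
          then have "(fst z + t0) powr - b * cutoff m (fst z / R) \<le> 1 * 1" by (intro mult_mono cutoff_range) auto
          then show ?thesis by (simp add: cutoff_range)
        qed
      qed (use R R0 in auto)
      then have "(\<integral>\<^sup>+z. ennreal (norm (\<bar>?W z\<bar> powr p * ((fst z + t0) powr - b * cutoff m (fst z / R)))) \<partial>lborel) < \<infinity>"
        unfolding integrable_iff_bounded by simp
      then show ?thesis by (simp add: XX_def cutoff_range abs_mult)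
    qed
    then obtain X where X: "0 \<le> X" "XX = ennreal X" by (cases XX) auto
    with BX obtain B where B: "0 \<le> B" "BB = ennreal B" by (cases BB) (auto simp: top_unique)
    have BleX: "B \<le> X" using BX X B by simp
    \<comment> \<open>\<open>c0(2)\<close> needs a positive bound and B may still be 0, hence the
      detour through B + e. Positivity of B then follows from this estimate.\<close>
    have low: "c * \<epsilon> powr p \<le> B"
    proof (rule field_le_epsilon)
      fix e :: real assume e: "0 < e"
      have "(\<integral>\<^sup>+z. ennreal (\<bar>?W z\<bar> powr p * late m R (fst z)) \<partial>lborel) \<le>
        (\<integral>\<^sup>+z. ennreal ((2 * R) powr b) * ennreal (\<bar>?W z\<bar> powr p * ((fst z + t0) powr - b * late m R (fst z))) \<partial>lborel)"
      proof (rule nn_integral_mono)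
        fix z
        have "\<bar>?W z\<bar> powr p * late m R (fst z) \<le> (2 * R) powr b * (\<bar>?W z\<bar> powr p * ((fst z + t0) powr - b * late m R (fst z)))"
        proof (cases "?W z = 0 \<or> late m R (fst z) = 0")
          case True
          then show ?thesis using p1 by auto
        next
          case False
          then have z: "0 < fst z" "fst z \<le> R" using W0[of z] late_zero[OF R0(2), of "fst z" m] by auto
          have "(2 * R) powr - b \<le> (fst z + t0) powr - b" using z t02 R b by (intro powr_mono2') auto
          then have "(2 * R) powr b * (2 * R) powr - b \<le> (2 * R) powr b * (fst z + t0) powr - b" by (rule mult_left_mono) simp
          moreover have "(2 * R) powr b * (2 * R) powr - b = 1" using R0 unfolding powr_add[symmetric] by simp
          ultimately have "1 \<le> (2 * R) powr b * (fst z + t0) powr - b" by simp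
          then have "\<bar>?W z\<bar> powr p * late m R (fst z) * 1 \<le> \<bar>?W z\<bar> powr p * late m R (fst z) * ((2 * R) powr b * (fst z + t0) powr - b)"
            by (rule mult_left_mono) (simp add: late_range)
          then show ?thesis by (simp only: mult_ac mult_1)
        qed
        then show "ennreal (\<bar>?W z\<bar> powr p * late m R (fst z)) \<le> ennreal ((2 * R) powr b) * ennreal (\<bar>?W z\<bar> powr p * ((fst z + t0) powr - b * late m R (fst z)))"
          by (simp add: ennreal_mult'[symmetric] ennreal_leI)
      qed
      also have "\<dots> = ennreal ((2 * R) powr b) * BB" unfolding BB_def by (rule nn_integral_cmult) measurable
      also have "\<dots> \<le> ennreal ((2 * R) powr b * (B + e))" unfolding B(2) using B e
        by (simp add: ennreal_mult'[symmetric] ennreal_leI mult_left_mono)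
      finally have "c0 * \<epsilon> powr p * R powr (?n - k * p) \<le> (2 * R) powr b * (B + e)"
        using R0 B e by (intro c0(2)[OF es \<epsilon>(1) R0(3) R(2)]) auto
      then have "c0 * \<epsilon> powr p * R powr b \<le> 2 powr b * (B + e) * R powr b" using R0 unfolding rel(3) by (simp add: powr_mult mult_ac)
      then have "c0 * \<epsilon> powr p \<le> 2 powr b * (B + e)" using R0 by simp
      then have "2 powr - b * (c0 * \<epsilon> powr p) \<le> 2 powr - b * (2 powr b * (B + e))" by (rule mult_left_mono) simp
      also have "\<dots> = B + e" unfolding mult.assoc[symmetric] powr_add[symmetric] by simp
      finally show "c * \<epsilon> powr p \<le> B + e" by (simp add: c_def mult_ac)
    qed
    have cp: "0 < c * \<epsilon> powr p" using c \<epsilon> by simp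
    have pos: "0 < B" "0 < X" using low cp BleX by linarith+
    have up: "X \<le> C1 * ((ln R) powr (1 / p') * B powr (1 / p) + t0 powr - \<delta> * X powr (1 / p))"
      unfolding \<delta>_def by (rule C1(2)[OF es \<epsilon>(1) t02 R pos]) (use B X in \<open>auto simp: BB_def XX_def\<close>)
    have "C1 * (t0 powr - \<delta> * X powr (1 / p)) \<le> X / 2"
    proof -
      have "X powr (1 / p) = X * X powr - (1 / p')"
      proof -
        have "1 / p = 1 + - (1 / p')" using p' by simp
        then show ?thesis using pos by (simp only: powr_add) simp
      qed
      moreover have "X powr - (1 / p') \<le> (c * \<epsilon> powr p) powr - (1 / p')"
        using low BleX cp p' by (intro powr_mono2') auto
      moreover have "(c * \<epsilon> powr p) powr - (1 / p') = c powr - (1 / p') * \<epsilon> powr - (p / p')"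
        by (simp add: powr_mult powr_powr)
      moreover have "t0 powr - \<delta> = A powr - \<delta> * \<epsilon> powr (p / p')"
        unfolding t0 powr_mult powr_powr using M(2) by simp
      ultimately have "C1 * (t0 powr - \<delta> * X powr (1 / p)) \<le> C1 * (A powr - \<delta> * \<epsilon> powr (p / p') * (X * (c powr - (1 / p') * \<epsilon> powr - (p / p'))))"
        using C1 pos by (auto intro!: mult_left_mono)
      also have "\<dots> = (2 * C1 * c powr - (1 / p')) * A powr - \<delta> * (\<epsilon> powr (p / p') * \<epsilon> powr - (p / p')) * X / 2" by simp
      also have "\<epsilon> powr (p / p') * \<epsilon> powr - (p / p') = 1" using \<epsilon> unfolding powr_add[symmetric] by simp
      also have "(2 * C1 * c powr - (1 / p')) * A powr - \<delta> * 1 * X / 2 \<le> A powr \<delta> * A powr - \<delta> * 1 * X / 2"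
        using A pos by (intro divide_right_mono mult_right_mono) auto
      also have "A powr \<delta> * A powr - \<delta> = 1" using A unfolding powr_add[symmetric] by simp
      finally show ?thesis by simp
    qed
    with up have "X \<le> 2 * C1 * ((ln R) powr (1 / p') * B powr (1 / p))" unfolding distrib_left by linarith
    then have "X powr p \<le> (2 * C1 * ((ln R) powr (1 / p') * B powr (1 / p))) powr p" using pos p1 by (intro powr_mono2) auto
    also have "\<dots> = (2 * C1) powr p * ((ln R) powr (p - 1) * B)"
    proof -
      have "1 / p' * p = p - 1" "1 / p * p = 1" using p' p1 by auto
      then show ?thesis using pos by (simp only: powr_mult powr_powr) simp
    qed
    finally have "\<kappa> * (ln R) powr (1 - p) * X powr p \<le> \<kappa> * (ln R) powr (1 - p) * ((2 * C1) powr p * ((ln R) powr (p - 1) * B))"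
      by (rule mult_left_mono) (simp add: \<kappa>_def)
    also have "\<dots> = ((2 * C1) powr - p * (2 * C1) powr p) * ((ln R) powr (1 - p) * (ln R) powr (p - 1)) * B"
      unfolding \<kappa>_def by (simp only: mult_ac)
    also have "\<dots> = B" using C1 R0 unfolding powr_add[symmetric] by simp
    finally have up': "\<kappa> * (ln R) powr (1 - p) * X powr p \<le> B" .
    show "\<exists>X B. (\<integral>\<^sup>+z. ennreal (\<bar>?W z\<bar> powr p * (fst z + t0) powr - b * late m R (fst z)) \<partial>lborel) = ennreal B \<and>
        (\<integral>\<^sup>+z. ennreal (\<bar>?W z\<bar> powr p * (fst z + t0) powr - b * cutoff m (fst z / R)) \<partial>lborel) = ennreal X \<and>
        0 \<le> X \<and> c * \<epsilon> powr p \<le> B \<and> \<kappa> * (ln R) powr (1 - p) * X powr p \<le> B"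
      using B(2) X low up' unfolding BB_def XX_def mult.assoc by blast
  qed
qed

text \<open>With L = ln T, either T < t0^4, and then L grows only like ln(1/\<epsilon>), or the
  scales between t0 and T^(3/4) are long enough for \<open>log_blowup\<close> in the variable
  \<sigma> = ln R.\<close>

lemma lifespan_bound:
  fixes \<mu> \<beta> p :: real and f g :: "real^'n \<Rightarrow> real"
  assumes n: "2 \<le> CARD('n)" and \<mu>: "0 < \<mu>" and \<beta>: "2 \<le> \<beta>" and p: "p = strauss_exponent CARD('n)"
    and f0: "AE x in lborel. 0 \<le> f x" and g0: "AE x in lborel. 0 \<le> g x"
    and g: "L2 g" "AE x in lborel. 1 < norm x \<longrightarrow> g x = 0" "\<not> (AE x in lborel. g x = 0)"
  obtains C where "0 < C" "\<And>\<epsilon> T u v. energy_supp \<mu> \<beta> p \<epsilon> T f g u v \<Longrightarrow> 0 < \<epsilon> \<Longrightarrow> \<epsilon> \<le> 1 \<Longrightarrow> T \<le> exp (C * \<epsilon> powr - (p * (p - 1)))"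
proof -
  let ?n = "real CARD('n)"
  define k where "k = (?n - 1) / 2"
  define b where "b = k - 1 / p"
  define p' where "p' = p / (p - 1)"
  note sf = strauss_exponent_facts[OF n p, folded k_def, folded b_def p'_def]
  have p1: "1 < p" by (rule sf)
  have p': "1 < p'" "1 / p + 1 / p' = 1" using p1 by (simp_all add: p'_def field_simps)
  have kb: "k = b + 1 / p" by (simp add: b_def)
  obtain m :: nat where "max 3 (2 * p') \<le> real m" using real_arch_simple by blast
  then have mm: "3 \<le> m" "2 * p' \<le> real m" by auto
  have m: "real m / p \<le> real m - 2"
  proof -
    have "2 \<le> real m * (1 / p')" using mm p' by (simp add: field_simps)
    also have "1 / p' = 1 - 1 / p" using p' by simp
    finally show ?thesis by (simp add: right_diff_distrib)
  qed
  obtain c \<kappa> A M where c: "0 < c" "0 < \<kappa>" "2 \<le> A" "0 \<le> M" and key: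
    "\<And>\<epsilon> T u v R t0. energy_supp \<mu> \<beta> p \<epsilon> T f g u v \<Longrightarrow> 0 < \<epsilon> \<Longrightarrow> \<epsilon> \<le> 1 \<Longrightarrow> t0 = A * \<epsilon> powr - M \<Longrightarrow> t0 \<le> R \<Longrightarrow> R < T \<Longrightarrow>
      \<exists>X B. (\<integral>\<^sup>+z. ennreal (\<bar>energy_supp.W T u z\<bar> powr p * (fst z + t0) powr - b * late m R (fst z)) \<partial>lborel) = ennreal B \<and>
        (\<integral>\<^sup>+z. ennreal (\<bar>energy_supp.W T u z\<bar> powr p * (fst z + t0) powr - b * cutoff m (fst z / R)) \<partial>lborel) = ennreal X \<and>
        0 \<le> X \<and> c * \<epsilon> powr p \<le> B \<and> \<kappa> * (ln R) powr (1 - p) * X powr p \<le> B"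
    by (rule absorbed_bounds[OF n \<mu> \<beta> p1 p'_def sf(2) kb k_def sf(4) sf(3) f0 g0 g mm(1) m]) blast
  define q where "q = p * (p - 1)"
  have q: "0 < q" using p1 by (simp add: q_def)
  define Q where "Q = 1 / (1 - 2 powr (1 - p))"
  have "2 powr (1 - p) < (1::real)" using p1 by (simp add: powr_less_one)
  then have Q: "0 < Q" by (simp add: Q_def)
  \<comment> \<open>Four times the bound of \<open>log_blowup\<close>, with the powers of \<epsilon>
    and L taken out.\<close>
  define V where "V = 4 * ((c / 4) powr (1 - p) / (\<kappa> * ln 2 powr - p) * Q)"
  have V: "0 < V" using c Q by (simp add: V_def)
  \<comment> \<open>V serves the blow-up case, the bracket the case L < 4 ln t0, where ln t0 = ln A
    + M ln(1/\<epsilon>) and ln(1/\<epsilon>) is at most \<epsilon>^(-q)/q.\<close>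
  define C where "C = V + (4 * ln A + 4 * M / q)"
  have lnA: "0 < ln A" using c by simp
  show thesis
  proof (rule that[of C])
    have "0 \<le> 4 * M / q" using c q by simp
    then show "0 < C" using V lnA by (simp add: C_def)
    fix \<epsilon> T :: real and u v :: "real \<Rightarrow> real^'n \<Rightarrow> real"
    assume es: "energy_supp \<mu> \<beta> p \<epsilon> T f g u v" and \<epsilon>: "0 < \<epsilon>" "\<epsilon> \<le> 1"
    define E where "E = \<epsilon> powr - q"
    have E: "1 \<le> E" using powr_mono2'[of "- q" \<epsilon> 1] \<epsilon> q by (simp add: E_def)
    have "T \<le> exp (C * E)"
    proof (cases "T \<le> 1")
      case True
      have "1 \<le> exp (C * E)" using \<open>0 < C\<close> E by simp
      then show ?thesis using True by linarith
    next
      case False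
      define L where "L = ln T"
      have T: "1 < T" using False by simp
      have L: "0 < L" using T by (simp add: L_def)
      define t0 where "t0 = A * \<epsilon> powr - M"
      have "1 \<le> \<epsilon> powr - M" using powr_mono2'[of "- M" \<epsilon> 1] \<epsilon> c by simp
      then have "A * 1 \<le> t0" unfolding t0_def using c by (intro mult_left_mono) auto
      then have t0: "2 \<le> t0" using c by simp
      have lt0: "0 < ln t0" using t0 by simp
      have "L \<le> C * E"
      proof (cases "L / 4 < ln t0")
        case True
        have "ln t0 = ln A + M * (- ln \<epsilon>)" using c \<epsilon> by (simp add: t0_def ln_mult ln_powr)
        moreover have "- ln \<epsilon> \<le> E / q"
        proof -
          have "q * (- ln \<epsilon>) = ln E" using \<epsilon> by (simp add: E_def ln_powr)
          also have "\<dots> \<le> E" using ln_le_minus_one[of E] E by simp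
          finally show ?thesis using q by (simp add: pos_le_divide_eq mult.commute)
        qed
        then have "M * (- ln \<epsilon>) \<le> M * (E / q)" using c by (intro mult_left_mono) auto
        moreover have "ln A \<le> ln A * E" using lnA E by simp
        moreover have "0 \<le> V * E" using V E by simp
        moreover have "C * E = V * E + 4 * (ln A * E) + 4 * (M * (E / q))" by (simp add: C_def algebra_simps)
        ultimately show ?thesis using True by linarith
      next
        case False
        let ?W = "energy_supp.W T u"
        note Wm[measurable] = energy_supp.W_measurable[OF es]
        have [measurable]: "(\<lambda>z :: real \<times> (real^'n). fst z) \<in> borel_measurable borel" by (rule borel_measurable_fst_snd)
        define h where "h z = \<bar>?W z\<bar> powr p * (fst z + t0) powr - b" for z
        define Bf where "Bf \<sigma> = (\<integral>\<^sup>+z. ennreal (h z * late m (exp \<sigma>) (fst z)) \<partial>lborel)" for \<sigma>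
        define X where "X \<sigma> = enn2real (\<integral>\<^sup>+z. ennreal (h z * cutoff m (fst z / exp \<sigma>)) \<partial>lborel)" for \<sigma>
        have hm: "h \<in> borel_measurable borel" unfolding h_def[abs_def] by measurable
        have h: "0 \<le> h z" "h z \<noteq> 0 \<Longrightarrow> 0 < fst z" for z
          using energy_supp.W_nonzeroD[OF es, of z] p1 by (auto simp: h_def)
        have R: "ennreal (c * \<epsilon> powr p) \<le> Bf \<sigma>" "ennreal (\<kappa> * L powr (1 - p) * X \<sigma> powr p) \<le> Bf \<sigma>"
          "(\<integral>\<^sup>+z. ennreal (h z * cutoff m (fst z / exp \<sigma>)) \<partial>lborel) = ennreal (X \<sigma>)" if \<sigma>: "ln t0 \<le> \<sigma>" "\<sigma> \<le> 3 * L / 4" for \<sigma>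
        proof -
          have "exp (ln t0) \<le> exp \<sigma>" using \<sigma> by simp
          then have 1: "t0 \<le> exp \<sigma>" using t0 by simp
          \<comment> \<open>Stopping at 3L/4 keeps the scale R = exp \<sigma> strictly below T, as
            the bounds require.\<close>
          have "exp \<sigma> < exp L" using \<sigma> L by simp
          then have 2: "exp \<sigma> < T" using T by (simp add: L_def)
          obtain Y B where YB: "Bf \<sigma> = ennreal B" "(\<integral>\<^sup>+z. ennreal (h z * cutoff m (fst z / exp \<sigma>)) \<partial>lborel) = ennreal Y" "0 \<le> Y"
            "c * \<epsilon> powr p \<le> B" "\<kappa> * \<sigma> powr (1 - p) * Y powr p \<le> B"
            using key[OF es \<epsilon> t0_def 1 2] unfolding Bf_def h_def ln_exp by blast
          have XY: "X \<sigma> = Y" using YB by (simp add: X_def)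
          show "(\<integral>\<^sup>+z. ennreal (h z * cutoff m (fst z / exp \<sigma>)) \<partial>lborel) = ennreal (X \<sigma>)" unfolding XY by (rule YB)
          show "ennreal (c * \<epsilon> powr p) \<le> Bf \<sigma>" unfolding YB(1) by (rule ennreal_leI[OF YB(4)])
          \<comment> \<open>As 1 - p < 0 and \<sigma> <= L, the factor \<sigma>^(1-p) may be
            replaced by the constant L^(1-p).\<close>
          have "L powr (1 - p) \<le> \<sigma> powr (1 - p)" using \<sigma> lt0 p1 L by (intro powr_mono2') auto
          then have "\<kappa> * L powr (1 - p) * Y powr p \<le> \<kappa> * \<sigma> powr (1 - p) * Y powr p" using c by (intro mult_right_mono mult_left_mono) auto
          then show "ennreal (\<kappa> * L powr (1 - p) * X \<sigma> powr p) \<le> Bf \<sigma>" unfolding YB(1) XY using YB(5) by (intro ennreal_leI) linarith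
        qed
        have "L / 4 \<le> (c * \<epsilon> powr p * L / 4) powr (1 - p) / (\<kappa> * L powr (1 - p) * ln 2 powr - p) * (1 / (1 - 2 powr (1 - p)))"
        proof (rule log_blowup[where ?\<tau>0.0="ln t0" and Bf=Bf and X=X])
          show "Bf \<in> borel_measurable borel" unfolding Bf_def[abs_def] by (rule log_averaging(1)[OF hm h])
          show "(\<integral>\<^sup>+\<sigma>. Bf \<sigma> * indicator {ln t0..\<tau>} \<sigma> \<partial>lborel) \<le> ennreal (ln 2 * X \<tau>)" if "ln t0 \<le> \<tau>" "\<tau> \<le> 3 * L / 4" for \<tau>
          proof -
            have "(\<integral>\<^sup>+\<sigma>. Bf \<sigma> * indicator {ln t0..\<tau>} \<sigma> \<partial>lborel) \<le> ennreal (ln 2) * ennreal (X \<tau>)"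
              unfolding Bf_def R(3)[OF that, symmetric] by (rule log_averaging(2)[OF hm h])
            also have "\<dots> = ennreal (ln 2 * X \<tau>)" by (simp add: ennreal_mult')
            finally show ?thesis .
          qed
          show "0 < c * \<epsilon> powr p" using c \<epsilon> by simp
          show "0 < \<kappa> * L powr (1 - p)" using c L by simp
          show "ln t0 \<le> L / 4" using False by simp
          show "0 \<le> X \<sigma>" for \<sigma> unfolding X_def by (rule enn2real_nonneg)
        qed (rule p1 L R; assumption)+
        \<comment> \<open>The power L^(1-p) from the initial size cancels the one in the rate,
          leaving a multiple of \<epsilon>^(-p(p-1)).\<close>
        also have "(c * \<epsilon> powr p * L / 4) powr (1 - p) = (c / 4) powr (1 - p) * E * L powr (1 - p)"
        proof -
          have "c * \<epsilon> powr p * L / 4 = c / 4 * \<epsilon> powr p * L" by simp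
          moreover have "p * (1 - p) = - q" by (simp add: q_def algebra_simps)
          ultimately show ?thesis by (simp only: powr_mult powr_powr E_def)
        qed
        also have "(c / 4) powr (1 - p) * E * L powr (1 - p) / (\<kappa> * L powr (1 - p) * ln 2 powr - p) * (1 / (1 - 2 powr (1 - p))) = V * E / 4"
          using L unfolding V_def Q_def by (simp add: divide_simps)
        finally have "L \<le> V * E" by simp
        moreover have "0 \<le> (4 * ln A + 4 * M / q) * E" using lnA c q E by (intro mult_nonneg_nonneg add_nonneg_nonneg) auto
        moreover have "C * E = V * E + (4 * ln A + 4 * M / q) * E" by (simp add: C_def distrib_right)
        ultimately show ?thesis by linarith
      qed
      then have "exp L \<le> exp (C * E)" by simp
      then show ?thesis using T by (simp add: L_def)
    qed
    then show "T \<le> exp (C * \<epsilon> powr - (p * (p - 1)))" by (simp add: E_def q_def)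
  qed
qed

theorem theorem2p2:
  fixes f g :: "real^'n \<Rightarrow> real" and \<mu> \<beta> p :: real
  assumes "2 \<le> CARD('n)" and "0 < \<mu>" and "2 < \<beta>"
    and "p = strauss_exponent CARD('n)"
    and "H1 f" and "L2 g"
    and "AE x in lborel. 0 \<le> f x" and "AE x in lborel. 0 \<le> g x"
    and "\<not> (AE x in lborel. f x = 0)" and "\<not> (AE x in lborel. g x = 0)"
    and "ess_supp UNIV f \<subseteq> {x. norm x \<le> 1}" and "ess_supp UNIV g \<subseteq> {x. norm x \<le> 1}"
  shows "\<exists>\<epsilon>\<^sub>0>0. \<exists>C>0. \<forall>\<epsilon>. 0 < \<epsilon> \<and> \<epsilon> \<le> \<epsilon>\<^sub>0 \<longrightarrow>
    (\<forall>(T::real) (u :: real \<Rightarrow> real^'n \<Rightarrow> real).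
       energy_solution \<mu> \<beta> p \<epsilon> f g T u \<and>
       ess_supp ({0..<T} \<times> UNIV) (\<lambda>(t, x). u t x) \<subseteq> {(t, x). t \<in> {0..<T} \<and> norm x \<le> t + 1} \<longrightarrow>
       T \<le> exp (C * \<epsilon> powr (- (p * (p - 1)))))"
proof -
  have supp: "AE x in lborel. 1 < norm x \<longrightarrow> f x = 0" "AE x in lborel. 1 < norm x \<longrightarrow> g x = 0"
    using ess_supp_AE[OF assms(11)] ess_supp_AE[OF assms(12)] by (auto simp: not_le)
  have "L2 f" using \<open>H1 f\<close> by (simp add: H1_def)
  have p: "1 < p" by (rule strauss_exponent_facts(1)[OF assms(1,4)])
  have "2 \<le> \<beta>" using assms(3) by simp
  obtain C where C: "0 < C" "\<And>\<epsilon> T u v. energy_supp \<mu> \<beta> p \<epsilon> T f g u v \<Longrightarrow> 0 < \<epsilon> \<Longrightarrow> \<epsilon> \<le> 1 \<Longrightarrow> T \<le> exp (C * \<epsilon> powr - (p * (p - 1)))"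
    by (rule lifespan_bound[OF assms(1,2) \<open>2 \<le> \<beta>\<close> assms(4,7,8,6) supp(2) assms(10)]) blast
  show ?thesis
  \<comment> \<open>The threshold 1 for \<epsilon> suffices, because the smallness required for
    absorption was put into t0 and not into \<epsilon>.\<close>
  proof (rule exI[of _ 1], intro conjI, simp, rule exI[of _ C], intro conjI allI impI)
    fix \<epsilon> T :: real and u :: "real \<Rightarrow> real^'n \<Rightarrow> real"
    assume \<epsilon>: "0 < \<epsilon> \<and> \<epsilon> \<le> 1" and u: "energy_solution \<mu> \<beta> p \<epsilon> f g T u \<and>
       ess_supp ({0..<T} \<times> UNIV) (\<lambda>(t, x). u t x) \<subseteq> {(t, x). t \<in> {0..<T} \<and> norm x \<le> t + 1}"
    have "AE z in lborel. spacetime T u z \<noteq> 0 \<longrightarrow> norm (snd z) \<le> fst z + 1"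
      using ess_supp_AE[OF conjunct2[OF u]]
    proof eventually_elim
      case (elim z)
      then show ?case by (cases z) (auto simp: spacetime_def indicator_def split: if_splits)
    qed
    moreover obtain v where "C1_L2 T u v" and "\<And>\<Psi>. test_function ({..<T} \<times> UNIV) \<Psi> \<Longrightarrow>
      st_convergent T (\<lambda>t x. \<bar>u t x\<bar> powr p * \<Psi> (t, x)) \<and>
      st_convergent T (\<lambda>t x. v t x * deriv (\<lambda>s. \<Psi> (s, x)) t) \<and>
      \<epsilon> * (LINT x|lborel. g x * \<Psi> (0, x))
        + \<epsilon> * (LINT x|lborel. damping \<mu> \<beta> x * f x * \<Psi> (0, x))
        + st_integral T (\<lambda>t x. \<bar>u t x\<bar> powr p * \<Psi> (t, x))
      = - st_integral T (\<lambda>t x. v t x * deriv (\<lambda>s. \<Psi> (s, x)) t)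
        + st_integral T (\<lambda>t x. weak_grad (u t) x \<bullet> grad (\<lambda>y. \<Psi> (t, y)) x)
        - st_integral T (\<lambda>t x. damping \<mu> \<beta> x * u t x * deriv (\<lambda>s. \<Psi> (s, x)) t)"
      using u unfolding energy_solution_def by blast
    ultimately have "energy_supp \<mu> \<beta> p \<epsilon> T f g u v"
      using u p assms \<open>L2 f\<close> supp unfolding energy_solution_def
      by (intro energy_supp.intro energy.intro energy_supp_axioms.intro) auto
    then show "T \<le> exp (C * \<epsilon> powr (- (p * (p - 1))))" using \<epsilon> by (intro C(2)) auto
  qed (use C in auto)
qed

end
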